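(* Let $n\ge1$. For any nonzero real $u\in\mathcal{H}_n$, $$\frac{2\pi}{j_0}\left(n+\frac12\right)<\mathfrak{h}^1(N_u)\leq2\pi n,$$ $$\arcsin\frac1n\leq\operatorname{inr}\left(\mathbb{S}^2\setminus N_u\right)\leq\theta_n<\frac{j_0}{n+\frac12}.$$ In the first line, the upper bound $2\pi n$ is attained if $u=\psi$; the upper bound $\theta_n$ for $\operatorname{inr}(\mathbb{S}^2\setminus N_u)$ in the second line is attained for $u=\phi$.
   Context: $\mathcal{H}_n$ is the space of complex-valued harmonic homogeneous polynomials of degree $n$ on $\mathbb{R}^3$, also viewed as functions on the unit sphere $\mathbb{S}^2\subset\mathbb{R}^3$; $u$ is real if it takes real values on $\mathbb{R}^3$. $N_u=\{x\in\mathbb{S}^2:u(x)=0\}$; $\mathfrak{h}^1$ is one-dimensional Hausdorff measure. $\psi(x)=\operatorname{Re}(x_1+ix_2)^n$. $\phi$ denotes a zonal spherical harmonic of degree $n$, i.e. $\phi(x)=P_n(\langle a,x\rangle)$ on $\mathbb{S}^2$ (up to a nonzero real constant factor) for some $a\in\mathbb{S}^2$, where $P_n$ is the $n$th Legendre polynomial. $\theta_n=\arccos t_n$, where $t_n$ is the greatest zero of $P_n$. $j_0\approx2.4048$ is the least positive zero of the Bessel function $J_0$. The inner radius is $$\operatorname{inr}(\mathbb{S}^2\setminus N_u)=\sup_{x\in\mathbb{S}^2}\ \inf_{y\in N_u}\rho(x,y),\qquad \rho(x,y)=\arccos\langle x,y\rangle .$$ *)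

theory Defs
  imports "HOL-Analysis.Analysis" "HOL-Computational_Algebra.Polynomial"
begin

definition homogeneous_polynomial :: "nat \<Rightarrow> (real ^ 3 \<Rightarrow> complex) \<Rightarrow> bool" where
  "homogeneous_polynomial n u \<longleftrightarrow>
     (\<exists>c :: nat \<Rightarrow> nat \<Rightarrow> complex. \<forall>x.
        u x = (\<Sum>i\<le>n. \<Sum>j\<le>n - i. c i j * of_real (x $ 1 ^ i * x $ 2 ^ j * x $ 3 ^ (n - i - j))))"

definition partial :: "3 \<Rightarrow> (real ^ 3 \<Rightarrow> complex) \<Rightarrow> real ^ 3 \<Rightarrow> complex" where
  "partial i u x = vector_derivative (\<lambda>t. u (x + t *\<^sub>R axis i 1)) (at 0)"

text \<open>The function \<open>vector_derivative\<close> is total, so the Laplacian is meaningful only for functions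
  that are twice differentiable; below it is applied to polynomials only.\<close>

definition laplacian :: "(real ^ 3 \<Rightarrow> complex) \<Rightarrow> real ^ 3 \<Rightarrow> complex" where
  "laplacian u x = (\<Sum>i\<in>UNIV. partial i (partial i u) x)"

definition harmonic_space :: "nat \<Rightarrow> (real ^ 3 \<Rightarrow> complex) set" where
  "harmonic_space n = {u. homogeneous_polynomial n u \<and> (\<forall>x. laplacian u x = 0)}"

definition real_valued :: "(real ^ 3 \<Rightarrow> complex) \<Rightarrow> bool" where
  "real_valued u \<longleftrightarrow> (\<forall>x. u x \<in> \<real>)"

definition nodal_set :: "(real ^ 3 \<Rightarrow> complex) \<Rightarrow> (real ^ 3) set" where
  "nodal_set u = {x \<in> sphere 0 1. u x = 0}"

text \<open>One-dimensional Hausdorff measure, normalised so that a segment has its length as measure.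
  On subsets of the sphere the Euclidean distance of the ambient space and the geodesic distance
  give the same measure. Boundedness of the covering sets is required because \<open>diameter\<close> is
  unspecified for unbounded sets.\<close>

definition hausdorff1_pre :: "real \<Rightarrow> 'a :: metric_space set \<Rightarrow> ennreal" where
  "hausdorff1_pre \<delta> A =
     (INF E \<in> {E :: nat \<Rightarrow> 'a set. A \<subseteq> (\<Union>k. E k) \<and> (\<forall>k. bounded (E k) \<and> diameter (E k) \<le> \<delta>)}.
        \<Sum>k. ennreal (diameter (E k)))"

definition hausdorff1 :: "'a :: metric_space set \<Rightarrow> ennreal" where
  "hausdorff1 A = (SUP \<delta> \<in> {0<..}. hausdorff1_pre \<delta> A)"

text \<open>\<open>inner_radius N\<close> is the inner radius of the complement of \<open>N\<close> in the unit sphere. Infima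
  and suprema are taken in the reals, which is meaningful for nonempty \<open>N \<subseteq> sphere 0 1\<close>, where
  all distances lie between \<open>0\<close> and \<open>pi\<close>.\<close>

definition sphere_dist :: "real ^ 3 \<Rightarrow> real ^ 3 \<Rightarrow> real" where
  "sphere_dist x y = arccos (x \<bullet> y)"

definition inner_radius :: "(real ^ 3) set \<Rightarrow> real" where
  "inner_radius N = (SUP x \<in> sphere 0 1. INF y \<in> N. sphere_dist x y)"

text \<open>Rodrigues' formula.\<close>

definition legendre :: "nat \<Rightarrow> real poly" where
  "legendre n = smult (1 / (2 ^ n * fact n)) ((pderiv ^^ n) ([:-1, 0, 1:] ^ n))"

definition theta :: "nat \<Rightarrow> real" where
  "theta n = arccos (Max {t. poly (legendre n) t = 0})"

definition bessel_J0 :: "real \<Rightarrow> real" where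
  "bessel_J0 x = (\<Sum>k. (-1) ^ k / (fact k)\<^sup>2 * (x / 2) ^ (2 * k))"

definition j0 :: real where
  "j0 = (LEAST x. x > 0 \<and> bessel_J0 x = 0)"

definition psi :: "nat \<Rightarrow> real ^ 3 \<Rightarrow> complex" where
  "psi n x = of_real (Re (Complex (x $ 1) (x $ 2) ^ n))"

definition zonal_harmonic :: "nat \<Rightarrow> (real ^ 3 \<Rightarrow> complex) \<Rightarrow> bool" where
  "zonal_harmonic n \<phi> \<longleftrightarrow>
     \<phi> \<in> harmonic_space n \<and>
     (\<exists>a \<in> sphere 0 1. \<exists>c :: real. c \<noteq> 0 \<and>
        (\<forall>x \<in> sphere 0 1. \<phi> x = of_real (c * poly (legendre n) (a \<bullet> x))))"

end

theory Submission
  imports Defs "HOL-Real_Asymp.Real_Asymp"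
begin

text \<open>Write \<open>u\<close> in cylindrical coordinates around an axis: \<open>u\<close> becomes \<open>\<Sum>d. r^d z^(n - d) T_d(\<phi>)\<close>, and Laplace's
  equation a recursion for the \<open>T_d\<close>. It shows that the mean of \<open>u\<close> over the circle of radius \<open>\<theta>\<close> around \<open>a\<close>
  is \<open>u(a) P_n(cos \<theta>)\<close>, so every circle of radius \<open>theta n\<close> meets the nodal set at least twice, and that
  the nodal set is a smooth curve outside finitely many points. By the kinematic formula, the length of a curve
  is proportional to the average number of its intersections with circles of a fixed radius: radius \<open>theta n\<close> gives
  the lower bound \<open>2 pi / sin (theta n)\<close> for the nodal length, and great circles, on which \<open>u\<close> is a
  trigonometric form with at most \<open>2 n\<close> zeros, give the upper bound \<open>2 pi n\<close>. Great circles also give the lower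
  bound for the inner radius: starting from a maximum of \<open>\<bar>u\<bar>\<close>, such a form has no zero within
  \<open>pi / (2 n)\<close>. Finally \<open>theta n < j0 / (n + 1/2)\<close> by Sturm comparison of the equations of Legendre and Bessel.\<close>

section \<open>Legendre polynomials\<close>

text \<open>Hausdorff measure is an infimum over arbitrary covers, so the kinematic formula is not
  applied to it as an identity but split into two one-sided estimates whose errors tend to zero.
  From below: the circles of a given radius that meet a short, nearly straight set of diameter d
  have centres of volume at most about 4/3 d times the sine of the radius; summed over a cover, this
  bounds the average number of hits. From above: the great circles separating the ends of a short
  arc have volume at least about 4/3 times its chord, and each of them meets the arc. Centres are
  averaged over the unit ball, of volume 4/3 pi, where Fubini is available in every orthonormal
  frame. Both estimates work at regular points of the nodal set only, which is why the singular
  points must be finitely many. Legendre polynomials enter through their differential equation: a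
  polynomial solution is fixed by its value at 1, and this identifies all zonal sums. The radius pi
  / (2 n) found on great circles is at least arcsin (1 / n), with equality for n = 1.\<close>

definition legendre_operator :: "nat \<Rightarrow> real poly \<Rightarrow> real poly" where
  "legendre_operator n p = pderiv ([:1, 0, -1:] * pderiv p) + smult (real n * (real n + 1)) p"

lemma higher_pderiv_pcompose_shift:
  "(pderiv ^^ m) (pcompose p [:c, 1:]) = pcompose ((pderiv ^^ m) p) [:c, 1 :: real:]"
  by (induction m) (auto simp: pderiv_pcompose pderiv_pCons)

text \<open>The expansion is taken at t = 1, where (t^2 - 1)^n = s^n (s + 2)^n with s = t - 1, so
  Rodrigues' formula differentiates each power of s separately. The coefficients are nonnegative,
  which excludes zeros in t \<ge> 1. Moreover 1 is a singular point of Legendre's equation, which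
  makes the recursion of the coefficients two-term.\<close>

lemma coeff_legendre_shift:
  assumes "k \<le> n"
  shows "coeff (pcompose (legendre n) [:1, 1:]) k =
    pochhammer (real (Suc k)) n * (real (n choose k) * 2 ^ (n - k)) / (2 ^ n * fact n)"
proof -
  have 1: "pcompose ([:-1, 0, 1:] ^ n) [:1, 1::real:] = monom 1 n * [:2, 1:] ^ n"
  proof -
    have "pcompose [:-1, 0, 1:] [:1, 1::real:] = [:0, 1:] * [:2, 1:]"
      by (simp add: pcompose_pCons)
    moreover have "pcompose (q ^ n) p = pcompose q p ^ n" for p q :: "real poly"
      by (induction n) (simp_all add: pcompose_mult pcompose_1)
    ultimately show ?thesis
      by (simp only: power_mult_distrib monom_altdef) simp
  qed
  have "coeff (pcompose (legendre n) [:1, 1:]) k =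
     1 / (2 ^ n * fact n) * coeff ((pderiv ^^ n) (monom 1 n * [:2, 1::real:] ^ n)) k"
    unfolding legendre_def by (simp add: pcompose_smult 1 flip: higher_pderiv_pcompose_shift)
  also have "\<dots> = 1 / (2 ^ n * fact n) * (pochhammer (real (Suc k)) n * coeff ([:2, 1::real:] ^ n) k)"
    by (subst coeff_higher_pderiv) (simp add: coeff_monom_mult add.commute)
  finally show ?thesis using assms by (simp add: coeff_linear_poly_power)
qed

lemma coeff_legendre_shift_0: "coeff (pcompose (legendre n) [:1, 1:]) 0 = 1"
  by (subst coeff_legendre_shift) (auto simp: pochhammer_fact [symmetric])

lemma degree_legendre_le: "degree (legendre n) \<le> n"
  unfolding legendre_def using degree_power_le[of "[:-1, 0, 1::real:]" n]
  by (auto simp: degree_higher_pderiv)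

lemma coeff_legendre_shift_nonneg: "coeff (pcompose (legendre n) [:1, 1:]) k \<ge> 0"
proof (cases "k \<le> n")
  case True
  then show ?thesis
    by (subst coeff_legendre_shift) (auto intro!: divide_nonneg_nonneg mult_nonneg_nonneg pochhammer_nonneg)
next
  case False
  have "degree (pcompose (legendre n) [:1, 1:]) \<le> n"
    using degree_legendre_le[of n] by (simp add: degree_pcompose)
  then show ?thesis using False by (simp add: coeff_eq_0)
qed

lemma coeff_legendre_shift_Suc:
  "2 * (real k + 1)\<^sup>2 * coeff (pcompose (legendre n) [:1, 1:]) (Suc k) =
   (real n * (real n + 1) - real k * (real k + 1)) * coeff (pcompose (legendre n) [:1, 1:]) k"
proof (cases "k < n")
  case True
  then have k: "k \<le> n" "Suc k \<le> n" by auto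
  obtain d where d: "n = Suc (k + d)" using True less_imp_Suc_add by blast
  have poch: "pochhammer (real (Suc (Suc k))) n * (real k + 1) = pochhammer (real (Suc k)) n * (real k + 1 + real n)"
    using pochhammer_rec[of "real (Suc k)" n] pochhammer_rec'[of "real (Suc k)" n]
    by (simp add: add_ac mult_ac)
  have ch: "real (n choose Suc k) * (real k + 1) = real (n choose k) * (real n - real k)"
  proof -
    have "Suc k * (n choose Suc k) = (n - k) * (n choose k)"
      by (metis binomial_absorb_comp binomial_absorption diff_Suc_Suc mult.commute d Suc_times_binomial_eq binomial_eq_0 Suc_times_binomial True less_imp_Suc_add)
    then have "real (Suc k) * real (n choose Suc k) = real (n - k) * real (n choose k)"
      by (metis of_nat_mult)
    then show ?thesis using k by (simp add: of_nat_diff algebra_simps)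
  qed
  have pw: "(2::real) ^ (n - k) = 2 * 2 ^ (n - Suc k)" using d by simp
  have "2 * (real k + 1)\<^sup>2 * (pochhammer (real (Suc (Suc k))) n * (real (n choose Suc k) * 2 ^ (n - Suc k)))
     = (pochhammer (real (Suc (Suc k))) n * (real k + 1)) * (real (n choose Suc k) * (real k + 1)) * (2 * 2 ^ (n - Suc k))"
    by (simp add: power2_eq_square algebra_simps)
  also have "\<dots> = (real n * (real n + 1) - real k * (real k + 1)) * (pochhammer (real (Suc k)) n * (real (n choose k) * 2 ^ (n - k)))"
    unfolding poch ch pw by (simp add: algebra_simps)
  finally show ?thesis using k by (simp add: coeff_legendre_shift del: of_nat_Suc)
next
  case False
  have "degree (pcompose (legendre n) [:1, 1:]) \<le> n" using degree_legendre_le[of n] by (simp add: degree_pcompose)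
  then have "coeff (pcompose (legendre n) [:1, 1:]) (Suc k) = 0"
    using False by (intro coeff_eq_0) linarith
  moreover have "k > n \<Longrightarrow> coeff (pcompose (legendre n) [:1, 1:]) k = 0"
    using degree_legendre_le[of n] by (intro coeff_eq_0) (simp add: degree_pcompose)
  ultimately show ?thesis using False by (cases "k = n") auto
qed

text \<open>With s = t - 1 the operator becomes (- (2 s + s^2) P')' + n (n + 1) P, and the recursion
  says that its coefficient of s^k vanishes. The factor 2 (k + 1)^2 is never zero, so a polynomial
  solution is determined by its value at t = 1.\<close>

lemma legendre_operator_eq_0_iff:
  "legendre_operator n p = 0 \<longleftrightarrow>
   (\<forall>k. 2 * (real k + 1)\<^sup>2 * coeff (pcompose p [:1, 1:]) (Suc k) =
     (real n * (real n + 1) - real k * (real k + 1)) * coeff (pcompose p [:1, 1:]) k)"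
proof -
  define P where "P = pcompose p [:1, 1::real:]"
  have P': "pcompose (pderiv p) [:1, 1:] = pderiv P"
    by (simp add: P_def pderiv_pcompose pderiv_pCons)
  have "pcompose (legendre_operator n p) [:1, 1:] =
      pderiv ([:0, -2, -1:] * pderiv P) + smult (real n * (real n + 1)) P"
  proof -
    have "pcompose (pderiv ([:1, 0, -1:] * pderiv p)) [:1, 1:] = pderiv (pcompose ([:1, 0, -1:] * pderiv p) [:1, 1:])"
      by (simp add: pderiv_pcompose pderiv_pCons)
    also have "pcompose ([:1, 0, -1:] * pderiv p) [:1, 1:] = [:0, -2, -1:] * pderiv P"
    proof -
      have "pcompose [:1, 0, -1:] [:1, 1::real:] = [:0, -2, -1:]" by (simp add: pcompose_pCons)
      then show ?thesis by (simp only: pcompose_mult P')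
    qed
    finally show ?thesis by (simp add: legendre_operator_def pcompose_add pcompose_smult P_def)
  qed
  moreover have "pcompose (legendre_operator n p) [:1, 1:] = 0 \<longleftrightarrow> legendre_operator n p = 0"
    by (simp add: pcompose_eq_0_iff)
  moreover have "coeff (pderiv ([:0, -2, -1:] * pderiv P) + smult (real n * (real n + 1)) P) k =
     (real n * (real n + 1) - real k * (real k + 1)) * coeff P k - 2 * (real k + 1)\<^sup>2 * coeff P (Suc k)" for k
    by (cases k) (auto simp: coeff_pderiv coeff_pCons power2_eq_square algebra_simps split: nat.splits)
  ultimately show ?thesis
    unfolding P_def [symmetric] poly_eq_iff by (metis coeff_0 right_minus_eq)
qed

lemma legendre_operator_legendre: "legendre_operator n (legendre n) = 0"
  using coeff_legendre_shift_Suc legendre_operator_eq_0_iff by blast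

lemma poly_shift_1: "poly (pcompose p [:1, 1:]) s = poly p (1 + s)" for p :: "real poly"
  by (simp add: poly_pcompose)

lemma legendre_operator_unique:
  assumes "legendre_operator n p = 0" "legendre_operator n q = 0" "poly p 1 = poly q 1"
  shows "p = q"
proof -
  have "coeff (pcompose p [:1, 1:]) k = coeff (pcompose q [:1, 1:]) k" for k
  proof (induction k)
    case 0
    then show ?case using assms(3) poly_shift_1[of p 0] poly_shift_1[of q 0]
      by (simp add: poly_0_coeff_0)
  next
    case (Suc k)
    have "2 * (real k + 1)\<^sup>2 * coeff (pcompose p [:1, 1:]) (Suc k) =
      2 * (real k + 1)\<^sup>2 * coeff (pcompose q [:1, 1:]) (Suc k)"
      using assms(1,2) Suc unfolding legendre_operator_eq_0_iff by simp
    then show ?case by (simp add: add_eq_0_iff)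
  qed
  then have "pcompose p [:1, 1:] = pcompose q [:1, 1:]" by (simp add: poly_eq_iff)
  then have "poly p x = poly q x" for x
    using poly_shift_1[of p "x - 1"] poly_shift_1[of q "x - 1"] by simp
  then show ?thesis by (simp add: poly_eq_poly_eq_iff[symmetric] fun_eq_iff)
qed

lemma legendre_1: "poly (legendre n) 1 = 1"
  using poly_shift_1[of "legendre n" 0] coeff_legendre_shift_0[of n] by (simp add: poly_0_coeff_0)

lemma legendre_pos:
  assumes "t \<ge> 1"
  shows "poly (legendre n) t > 0"
proof -
  let ?L = "pcompose (legendre n) [:1, 1:]"
  have "poly (legendre n) t = poly ?L (t - 1)" by (simp add: poly_shift_1)
  also have "\<dots> = (\<Sum>i\<le>degree ?L. coeff ?L i * (t - 1) ^ i)" by (rule poly_altdef)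
  also have "\<dots> \<ge> (\<Sum>i\<in>{0}. coeff ?L i * (t - 1) ^ i)"
    using assms coeff_legendre_shift_nonneg by (intro sum_mono2) auto
  finally show ?thesis by (simp add: coeff_legendre_shift_0 legendre_1)
qed

section \<open>Rotationally invariant polynomials on the sphere\<close>

definition zonal_monomial :: "nat \<Rightarrow> nat \<Rightarrow> real poly" where
  "zonal_monomial k m = [:1, 0, -1:] ^ k * [:0, 1:] ^ m"

lemma pderiv_zonal_monomial:
  "pderiv (zonal_monomial k m) =
   smult (- 2 * real k) (zonal_monomial (k - 1) (m + 1)) + smult (real m) (zonal_monomial k (m - 1))"
  unfolding zonal_monomial_def
  by (rule poly_eq_poly_eq_iff[THEN iffD1], rule ext)
     (auto simp: pderiv_mult pderiv_power pderiv_pCons algebra_simps)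

lemma mult_pderiv_zonal_monomial:
  "[:1, 0, -1:] * pderiv (zonal_monomial k m) =
   smult (- 2 * real k) (zonal_monomial k (m + 1)) + smult (real m) (zonal_monomial (k + 1) (m - 1))"
  unfolding pderiv_zonal_monomial unfolding zonal_monomial_def
  by (rule poly_eq_poly_eq_iff[THEN iffD1], rule ext, cases k) (auto simp: algebra_simps)

text \<open>(1 - t^2)^k t^m is the restriction to the unit sphere of \<rho>^k z^m with \<rho> =
  x_1^2 + x_2^2 and z = x_3. In total degree n the Legendre operator acts on it as the Euclidean
  Laplacian: the right side is 4 k^2 \<rho>^(k-1) z^m + m (m - 1) \<rho>^k z^(m-2), restricted. The
  truncated exponents at k = 0 and m < 2 come with the factor zero.\<close>

lemma legendre_operator_zonal_monomial:
  assumes "n = m + 2 * k"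
  shows "legendre_operator n (zonal_monomial k m) =
    smult (4 * (real k)\<^sup>2) (zonal_monomial (k - 1) m) + smult (real m * (real m - 1)) (zonal_monomial k (m - 2))"
proof -
  have eq: "poly (legendre_operator n (zonal_monomial k m)) t =
     4 * (real k)\<^sup>2 * poly (zonal_monomial (k - 1) (m + 2)) t - 2 * real k * (real m + 1) * poly (zonal_monomial k m) t
     - 2 * real m * (real k + 1) * poly (zonal_monomial k m) t * (if m = 0 then 0 else 1)
     + real m * (real m - 1) * poly (zonal_monomial (k + 1) (m - 2)) t
     + real n * (real n + 1) * poly (zonal_monomial k m) t" for t
    unfolding legendre_operator_def mult_pderiv_zonal_monomial unfolding pderiv_add pderiv_smult pderiv_zonal_monomial
    by (cases m; cases "m - 1") (auto simp: power2_eq_square algebra_simps)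
  have n: "real n = real m + 2 * real k" using assms by simp
  show ?thesis
  proof (rule poly_eq_poly_eq_iff[THEN iffD1], rule ext)
    fix t :: real
    have 1: "4 * (real k)\<^sup>2 * poly (zonal_monomial (k - 1) (m + 2)) t =
       4 * (real k)\<^sup>2 * (poly (zonal_monomial (k - 1) m) t - poly (zonal_monomial k m) t)"
      by (cases k) (auto simp: zonal_monomial_def algebra_simps power2_eq_square)
    have 2: "real m * (real m - 1) * poly (zonal_monomial (k + 1) (m - 2)) t =
       real m * (real m - 1) * (poly (zonal_monomial k (m - 2)) t - poly (zonal_monomial k m) t)"
    proof (cases "m < 2")
      case True then have "m = 0 \<or> m = 1" by auto
      then show ?thesis by auto
    next
      case False
      then obtain m' where "m = Suc (Suc m')" by (metis Suc_diff_Suc add_2_eq_Suc le_add_diff_inverse not_less)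
      then show ?thesis by (simp add: zonal_monomial_def algebra_simps power2_eq_square)
    qed
    have 3: "2 * real m * (real k + 1) * poly (zonal_monomial k m) t * (if m = 0 then 0 else 1) =
      2 * real m * (real k + 1) * poly (zonal_monomial k m) t" by simp
    show "poly (legendre_operator n (zonal_monomial k m)) t = poly (smult (4 * (real k)\<^sup>2) (zonal_monomial (k - 1) m) +
      smult (real m * (real m - 1)) (zonal_monomial k (m - 2))) t"
      unfolding eq 1 2 3 n by (simp add: power2_eq_square algebra_simps)
  qed
qed

text \<open>The second term of index k cancels the first term of index k + 1. The first term of
  index 0 carries the factor k^2, and the last second term vanishes because n - 2 k is 0 or 1 at k =
  n div 2. \<open>g\<close> is left arbitrary so that the cancellation serves the Legendre operator
  here and the Laplacian on all of space later.\<close>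

lemma zonal_telescope:
  fixes \<beta> :: "nat \<Rightarrow> real" and g :: "nat \<Rightarrow> nat \<Rightarrow> real"
  assumes rec: "\<And>k. 2 * k + 2 \<le> n \<Longrightarrow>
      4 * (real k + 1)\<^sup>2 * \<beta> (Suc k) = - (real (n - 2 * k) * (real (n - 2 * k) - 1) * \<beta> k)"
  shows "(\<Sum>k\<le>n div 2. \<beta> k * (4 * (real k)\<^sup>2 * g (k - 1) (n - 2 * k) +
    real (n - 2 * k) * (real (n - 2 * k) - 1) * g k (n - 2 * k - 2))) = 0"
proof -
  define M where "M = n div 2"
  have M: "2 * M = n \<or> 2 * M + 1 = n" unfolding M_def by linarith
  have "(\<Sum>k\<le>M. \<beta> k * (4 * (real k)\<^sup>2 * g (k - 1) (n - 2 * k) + real (n - 2 * k) * (real (n - 2 * k) - 1) * g k (n - 2 * k - 2))) =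
     (\<Sum>k\<le>M. 4 * (real k)\<^sup>2 * \<beta> k * g (k - 1) (n - 2 * k)) +
     (\<Sum>k\<le>M. real (n - 2 * k) * (real (n - 2 * k) - 1) * \<beta> k * g k (n - 2 * k - 2))"
    by (simp add: sum.distrib[symmetric] algebra_simps)
  also have "(\<Sum>k\<le>M. 4 * (real k)\<^sup>2 * \<beta> k * g (k - 1) (n - 2 * k)) =
     (\<Sum>k<M. 4 * (real (Suc k))\<^sup>2 * \<beta> (Suc k) * g k (n - 2 * k - 2))"
    by (simp add: lessThan_Suc_atMost[symmetric] sum.lessThan_Suc_shift del: sum.lessThan_Suc)
  also have "(\<Sum>k\<le>M. real (n - 2 * k) * (real (n - 2 * k) - 1) * \<beta> k * g k (n - 2 * k - 2))
     = (\<Sum>k<M. real (n - 2 * k) * (real (n - 2 * k) - 1) * \<beta> k * g k (n - 2 * k - 2))"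
  proof -
    have "real (n - 2 * M) * (real (n - 2 * M) - 1) = 0" using M by auto
    then show ?thesis by (simp add: lessThan_Suc_atMost[symmetric] del: mult_eq_0_iff)
  qed
  also have "(\<Sum>k<M. 4 * (real (Suc k))\<^sup>2 * \<beta> (Suc k) * g k (n - 2 * k - 2)) +
     (\<Sum>k<M. real (n - 2 * k) * (real (n - 2 * k) - 1) * \<beta> k * g k (n - 2 * k - 2)) = 0"
  proof -
    have "4 * (real (Suc k))\<^sup>2 * \<beta> (Suc k) + real (n - 2 * k) * (real (n - 2 * k) - 1) * \<beta> k = 0" if "k < M" for k
      using rec[of k] that M by (auto simp: add.commute)
    then show ?thesis by (simp add: sum.distrib[symmetric] distrib_right[symmetric])
  qed
  finally show ?thesis by (simp add: M_def)
qed

text \<open>Both sides are annihilated by the Legendre operator, and at t = 1 only the term k = 0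
  survives, so they have the same value there.\<close>

lemma zonal_sum_eq_legendre_poly:
  fixes \<beta> :: "nat \<Rightarrow> real"
  assumes rec: "\<And>k. 2 * k + 2 \<le> n \<Longrightarrow>
      4 * (real k + 1)\<^sup>2 * \<beta> (Suc k) = - (real (n - 2 * k) * (real (n - 2 * k) - 1) * \<beta> k)"
  shows "(\<Sum>k\<le>n div 2. smult (\<beta> k) (zonal_monomial k (n - 2 * k))) = smult (\<beta> 0) (legendre n)"
proof (rule legendre_operator_unique)
  define M where "M = n div 2"
  have M: "2 * M = n \<or> 2 * M + 1 = n" unfolding M_def by linarith
  let ?S = "\<Sum>k\<le>M. smult (\<beta> k) (zonal_monomial k (n - 2 * k))"
  have sm: "legendre_operator n (smult c p) = smult c (legendre_operator n p)" for c p
  proof -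
    have "pderiv (q * pderiv (smult c p)) = smult c (pderiv (q * pderiv p))" for q
      by (simp add: pderiv_smult)
    then show ?thesis unfolding legendre_operator_def by (simp only: smult_add_right smult_smult mult.commute[of c])
  qed
  have "legendre_operator n ?S = (\<Sum>k\<le>M. smult (\<beta> k) (legendre_operator n (zonal_monomial k (n - 2 * k))))"
  proof -
    have add: "legendre_operator n (p + q) = legendre_operator n p + legendre_operator n q" for p q
    proof -
      have "pderiv (r * pderiv (p + q)) = pderiv (r * pderiv p) + pderiv (r * pderiv q)" for r
        by (simp only: pderiv_add distrib_left)
      then show ?thesis unfolding legendre_operator_def by (simp only: smult_add_right add_ac)
    qed
    have "legendre_operator n (\<Sum>k\<in>A. f k) = (\<Sum>k\<in>A. legendre_operator n (f k))"
      if "finite A" for A :: "nat set" and f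
      using that(1)
    proof (induction A rule: finite_induct)
      case empty
      then show ?case by (simp add: legendre_operator_def)
    qed (simp add: add)
    then show ?thesis by (simp add: sm)
  qed
  also have "\<dots> = (\<Sum>k\<le>M. smult (\<beta> k) (smult (4 * (real k)\<^sup>2) (zonal_monomial (k - 1) (n - 2 * k)) +
       smult (real (n - 2 * k) * (real (n - 2 * k) - 1)) (zonal_monomial k (n - 2 * k - 2))))"
    using M by (intro sum.cong refl arg_cong2[of _ _ _ _ smult] legendre_operator_zonal_monomial) auto
  also have "\<dots> = 0"
    using zonal_telescope[of n \<beta> "\<lambda>k m. poly (zonal_monomial k m) t" for t, OF rec]
    by (intro poly_eq_poly_eq_iff[THEN iffD1] ext) (simp add: poly_sum M_def)
  finally show "legendre_operator n (\<Sum>k\<le>n div 2. smult (\<beta> k) (zonal_monomial k (n - 2 * k))) = 0"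
    by (simp add: M_def)
  show "legendre_operator n (smult (\<beta> 0) (legendre n)) = 0"
    by (simp add: sm legendre_operator_legendre)
  have "poly (zonal_monomial 0 m) 1 = 1" "k \<noteq> 0 \<Longrightarrow> poly (zonal_monomial k m) 1 = 0" for k m
    by (simp_all add: zonal_monomial_def poly_power)
  moreover have "(\<Sum>k\<le>n div 2. \<beta> k * poly (zonal_monomial k (n - 2 * k)) 1) =
      (\<Sum>k\<in>{0}. \<beta> k * poly (zonal_monomial k (n - 2 * k)) 1)"
    by (rule sum.mono_neutral_right) (auto simp: calculation)
  ultimately show "poly (\<Sum>k\<le>n div 2. smult (\<beta> k) (zonal_monomial k (n - 2 * k))) 1 = poly (smult (\<beta> 0) (legendre n)) 1"
    by (simp add: poly_sum legendre_1)
qed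

lemma zonal_sum_eq_legendre:
  fixes \<beta> :: "nat \<Rightarrow> real"
  assumes "\<And>k. 2 * k + 2 \<le> n \<Longrightarrow>
      4 * (real k + 1)\<^sup>2 * \<beta> (Suc k) = - (real (n - 2 * k) * (real (n - 2 * k) - 1) * \<beta> k)"
  shows "(\<Sum>k\<le>n div 2. \<beta> k * (1 - t\<^sup>2) ^ k * t ^ (n - 2 * k)) = \<beta> 0 * poly (legendre n) t"
proof -
  have "poly (zonal_monomial k m) t = (1 - t\<^sup>2) ^ k * t ^ m" for k m
    by (simp add: zonal_monomial_def poly_power power2_eq_square algebra_simps)
  then show ?thesis
    using arg_cong[OF zonal_sum_eq_legendre_poly[OF assms], of "\<lambda>p. poly p t"]
    by (simp add: poly_sum mult.assoc)
qed

text \<open>Made for circle means: \<open>B d\<close> will be the integral of the angular part of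
  degree d. The recursion with step two and \<open>B 1 = 0\<close> kills all odd indices; the even
  ones satisfy the recursion of the zonal sum, with s^2 = 1 - c^2.\<close>

lemma trig_sum_eq_legendre:
  fixes B :: "nat \<Rightarrow> real"
  assumes rec: "\<And>d. d + 2 \<le> n \<Longrightarrow> (real d + 2)\<^sup>2 * B (d + 2) = - (real (n - d) * (real (n - d) - 1) * B d)"
    and B1: "n \<ge> 1 \<Longrightarrow> B 1 = 0" and cs: "c\<^sup>2 + s\<^sup>2 = 1"
  shows "(\<Sum>d\<le>n. B d * s ^ d * c ^ (n - d)) = B 0 * poly (legendre n) c"
proof -
  have odd: "B d = 0" if "odd d" "d \<le> n" for d
    using that
  proof (induction d rule: less_induct)
    case (less d)
    show ?case
    proof (cases "d = 1")
      case False
      then obtain e where e: "d = e + 2" using less.prems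
        by (metis Suc_1 Suc_leI add.commute antisym_conv2 le_add_diff_inverse odd_pos One_nat_def less_antisym not_less linorder_le_less_linear less_Suc_eq)
      then have "B e = 0" using less by auto
      then have "(real e + 2)\<^sup>2 * B d = 0" using rec[of e] e less.prems by auto
      then show ?thesis by (auto simp: add_eq_0_iff)
    qed (use less.prems B1 in auto)
  qed
  have "(\<Sum>d\<le>n. B d * s ^ d * c ^ (n - d)) = (\<Sum>d\<in>(\<lambda>k. 2 * k) ` {..n div 2}. B d * s ^ d * c ^ (n - d))"
  proof (rule sum.mono_neutral_right)
    show "\<forall>i\<in>{..n} - (\<lambda>k. 2 * k) ` {..n div 2}. B i * s ^ i * c ^ (n - i) = 0"
    proof
      fix i assume i: "i \<in> {..n} - (\<lambda>k. 2 * k) ` {..n div 2}"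
      then have "odd i" by (auto elim!: evenE)
      then show "B i * s ^ i * c ^ (n - i) = 0" using i odd by auto
    qed
  qed auto
  also have "\<dots> = (\<Sum>k\<le>n div 2. B (2 * k) * (1 - c\<^sup>2) ^ k * c ^ (n - 2 * k))"
  proof -
    have "s ^ (2 * k) = (1 - c\<^sup>2) ^ k" for k
    proof -
      have "1 - c\<^sup>2 = s\<^sup>2" using cs by linarith
      then show ?thesis by (simp add: power_mult)
    qed
    then show ?thesis by (simp add: sum.reindex inj_on_def)
  qed
  also have "\<dots> = B (2 * 0) * poly (legendre n) c"
  proof (rule zonal_sum_eq_legendre)
    fix k assume k: "2 * k + 2 \<le> n"
    show "4 * (real k + 1)\<^sup>2 * B (2 * Suc k) = - (real (n - 2 * k) * (real (n - 2 * k) - 1) * B (2 * k))"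
      using rec[of "2 * k"] k by (simp add: power2_eq_square algebra_simps)
  qed
  finally show ?thesis by simp
qed

section \<open>The Bessel function and Sturm comparison\<close>

text \<open>\<open>bessel_J0\<close> is an entire function of y = x^2 / 4. In this variable the
  power series is differentiated termwise, and Bessel's equation reads y b'' + b' + b = 0.\<close>

definition bessel_series :: "real \<Rightarrow> real" where
  "bessel_series y = (\<Sum>k. (-1) ^ k / (fact k)\<^sup>2 * y ^ k)"

lemma bessel_J0_eq: "bessel_J0 x = bessel_series (x\<^sup>2 / 4)"
proof -
  have "(x / 2) ^ (2 * k) = (x\<^sup>2 / 4) ^ k" for k
    by (simp add: power_mult power_divide)
  then show ?thesis unfolding bessel_J0_def bessel_series_def by presburger
qed

lemma summable_bessel_series: "summable (\<lambda>k. (-1) ^ k / (fact k)\<^sup>2 * y ^ k :: real)"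
proof (rule summable_comparison_test')
  show "summable (\<lambda>k. inverse (fact k) * \<bar>y\<bar> ^ k)"
    using summable_exp[of "\<bar>y\<bar>"] by simp
  fix k :: nat
  have "1 / (fact k)\<^sup>2 \<le> (1 / fact k :: real)"
    by (simp add: power2_eq_square field_simps)
  then have "\<bar>y\<bar> ^ k * (1 / (fact k)\<^sup>2) \<le> \<bar>y\<bar> ^ k * (1 / fact k)"
    by (intro mult_left_mono) auto
  then show "norm ((-1) ^ k / (fact k)\<^sup>2 * y ^ k) \<le> inverse (fact k) * \<bar>y\<bar> ^ k"
    by (simp add: abs_mult power_abs field_simps)
qed

lemma bessel_J0_ode:
  "\<exists>J1 J2. (\<forall>x. (bessel_J0 has_real_derivative J1 x) (at x)) \<and>
    (\<forall>x. (J1 has_real_derivative J2 x) (at x)) \<and>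
    (\<forall>x. x * J2 x + J1 x + x * bessel_J0 x = 0)"
proof -
  define a :: "nat \<Rightarrow> real" where "a = (\<lambda>k. (-1) ^ k / (fact k)\<^sup>2)"
  have sa: "summable (\<lambda>k. a k * y ^ k)" for y
    using summable_bessel_series[of y] by (simp add: a_def)
  have sd: "summable (\<lambda>k. diffs a k * y ^ k)" for y
    using termdiff_converges_all sa by blast
  have sdd: "summable (\<lambda>k. diffs (diffs a) k * y ^ k)" for y
    using termdiff_converges_all sd by blast
  define b0 b1 b2 where "b0 = (\<lambda>y. \<Sum>k. a k * y ^ k)"
    and "b1 = (\<lambda>y. \<Sum>k. diffs a k * y ^ k)" and "b2 = (\<lambda>y. \<Sum>k. diffs (diffs a) k * y ^ k)"
  have J: "bessel_J0 x = b0 (x\<^sup>2 / 4)" for x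
    by (simp add: bessel_J0_eq bessel_series_def b0_def a_def)
  have d0: "(b0 has_real_derivative b1 y) (at y)" for y
    unfolding b0_def b1_def using termdiffs_strong_converges_everywhere[OF sa] .
  have d1: "(b1 has_real_derivative b2 y) (at y)" for y
    unfolding b1_def b2_def using termdiffs_strong_converges_everywhere[OF sd] .
  have ode: "y * b2 y + b1 y + b0 y = 0" for y
  proof -
    have s1: "(\<lambda>k. real k * diffs a k * y ^ k) sums (y * b2 y)"
    proof -
      have "(\<lambda>k. y * (diffs (diffs a) k * y ^ k)) sums (y * b2 y)"
        unfolding b2_def by (intro sums_mult summable_sums sdd)
      then have "(\<lambda>k. real (Suc k) * diffs a (Suc k) * y ^ Suc k) sums (y * b2 y)"
        by (simp add: diffs_def mult_ac)
      then show ?thesis by (subst (asm) sums_Suc_iff) simp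
    qed
    have "(\<lambda>k. real k * diffs a k * y ^ k + diffs a k * y ^ k + a k * y ^ k) sums (y * b2 y + b1 y + b0 y)"
      unfolding b1_def b0_def by (intro sums_add s1 summable_sums sd sa)
    moreover have "real k * diffs a k * y ^ k + diffs a k * y ^ k + a k * y ^ k = 0" for k
    proof -
      have "(real k + 1) * diffs a k = - a k"
      proof -
        have "c * (c * (- s / (c * f)\<^sup>2)) = - (s / f\<^sup>2)" if "c \<noteq> 0" "f \<noteq> 0" for c f s :: real
          using that by (simp add: field_simps power2_eq_square)
        from this[of "real k + 1" "fact k" "(-1) ^ k"] show ?thesis
          unfolding a_def diffs_def by (simp add: add.commute)
      qed
      then have "((real k + 1) * diffs a k + a k) * y ^ k = 0" by simp
      then show ?thesis by (simp add: algebra_simps)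
    qed
    ultimately have "(\<lambda>_. 0) sums (y * b2 y + b1 y + b0 y)" by simp
    from sums_unique2[OF this sums_zero] show ?thesis .
  qed
  have in': "((\<lambda>x. x\<^sup>2 / 4) has_real_derivative x / 2) (at x)" for x :: real
    by (auto intro!: derivative_eq_intros)
  show ?thesis
  proof (rule exI[of _ "\<lambda>x. x / 2 * b1 (x\<^sup>2 / 4)"], rule exI[of _ "\<lambda>x. b1 (x\<^sup>2 / 4) / 2 + x\<^sup>2 / 4 * b2 (x\<^sup>2 / 4)"],
      intro conjI allI)
    fix x :: real
    show "(bessel_J0 has_real_derivative (x / 2 * b1 (x\<^sup>2 / 4))) (at x)"
      using DERIV_chain2[OF d0 in'] by (simp add: J[abs_def] mult.commute)
    show "((\<lambda>x. x / 2 * b1 (x\<^sup>2 / 4)) has_real_derivative (b1 (x\<^sup>2 / 4) / 2 + x\<^sup>2 / 4 * b2 (x\<^sup>2 / 4))) (at x)"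
    proof -
      have h: "((\<lambda>x. x / 2) has_real_derivative 1 / 2) (at x)"
        using DERIV_cdivide[OF DERIV_ident] .
      show ?thesis
        by (rule DERIV_cong[OF DERIV_mult[OF h DERIV_chain2[OF d1 in']]]) (simp add: power2_eq_square)
    qed
    show "x * (b1 (x\<^sup>2 / 4) / 2 + x\<^sup>2 / 4 * b2 (x\<^sup>2 / 4)) + x / 2 * b1 (x\<^sup>2 / 4) + x * bessel_J0 x = 0"
    proof -
      have "x * (x\<^sup>2 / 4 * b2 (x\<^sup>2 / 4) + b1 (x\<^sup>2 / 4) + b0 (x\<^sup>2 / 4)) = 0" by (simp only: ode mult_zero_right)
      then show ?thesis by (simp add: J algebra_simps)
    qed
  qed
qed

text \<open>At x = sqrt 8 the variable of the series is y = 2, and the first terms 1 - 2 + 1 - 8/36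
  + 16/576 have a negative sum. The Leibniz bound is applied from index 2 on, where the terms
  decrease. The negative value yields a zero of \<open>bessel_J0\<close> and the bound
  \<open>j0 \<le> sqrt 8\<close>, which keeps \<open>j0 / (n + 1/2)\<close> below pi.\<close>

lemma bessel_J0_sqrt_8_neg: "bessel_J0 (sqrt 8) < 0"
proof -
  define b :: "nat \<Rightarrow> real" where "b = (\<lambda>i. 2 ^ (i + 2) / (fact (i + 2))\<^sup>2)"
  have s: "{..<2 * 1 + 1} = {0, 1, 2::nat}" "{..<2} = {0, 1::nat}" by auto
  have "bessel_J0 (sqrt 8) = (\<Sum>k. (-1) ^ k / (fact k)\<^sup>2 * 2 ^ k)"
    by (simp add: bessel_J0_eq bessel_series_def)
  also have "\<dots> = (\<Sum>i. (-1) ^ (i + 2) / (fact (i + 2))\<^sup>2 * 2 ^ (i + 2)) + (\<Sum>k<2. (-1) ^ k / (fact k)\<^sup>2 * 2 ^ k)"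
    by (rule suminf_split_initial_segment[OF summable_bessel_series])
  also have "(\<Sum>i. (-1) ^ (i + 2) / (fact (i + 2))\<^sup>2 * 2 ^ (i + 2)) = (\<Sum>i. (-1) ^ i * b i)"
    by (simp add: b_def)
  also have "(\<Sum>i. (-1) ^ i * b i) \<le> (\<Sum>i<2 * 1 + 1. (-1) ^ i * b i)"
  proof (rule summable_Leibniz'(4))
    have "summable (\<lambda>k. (-1) ^ k / (fact k)\<^sup>2 * (-2) ^ k :: real)" by (rule summable_bessel_series)
    then have "summable (\<lambda>k. 2 ^ k / (fact k)\<^sup>2 :: real)"
      by (simp add: power_mult_distrib[symmetric])
    then have "(\<lambda>k. 2 ^ k / (fact k)\<^sup>2 :: real) \<longlonglongrightarrow> 0" by (rule summable_LIMSEQ_zero)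
    then show "b \<longlonglongrightarrow> 0" unfolding b_def by (rule LIMSEQ_ignore_initial_segment)
    show "0 \<le> b i" for i by (simp add: b_def)
    show "b (Suc i) \<le> b i" for i
    proof -
      have "b (Suc i) = b i * (2 / (real i + 3)\<^sup>2)"
        unfolding b_def by (simp add: power2_eq_square field_simps)
      also have "\<dots> \<le> b i * 1"
      proof (rule mult_left_mono)
        have "2 \<le> (real i + 3)\<^sup>2" by (simp add: power2_eq_square algebra_simps)
        then show "2 / (real i + 3)\<^sup>2 \<le> 1" by simp
      qed (simp add: b_def)
      finally show ?thesis by simp
    qed
  qed
  finally have "bessel_J0 (sqrt 8) \<le> (\<Sum>i\<in>{0, 1, 2}. (-1) ^ i * b i) + (\<Sum>k\<in>{0, 1::nat}. (-1) ^ k / (fact k)\<^sup>2 * 2 ^ k)"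
    unfolding s by simp
  also have "\<dots> = 1 - 8 / 36 + 16 / 576 + (-1)"
    by (simp add: b_def fact_numeral)
  finally show ?thesis by simp
qed

lemma isCont_bessel_J0: "isCont bessel_J0 x"
proof -
  obtain J1 where "\<forall>x. (bessel_J0 has_real_derivative J1 x) (at x)"
    using bessel_J0_ode by blast
  then show ?thesis using DERIV_isCont by blast
qed

lemma bessel_J0_0: "bessel_J0 0 = 1"
proof -
  have "(\<Sum>k. (-1) ^ k / (fact k)\<^sup>2 * 0 ^ k :: real) = (-1) ^ 0 / (fact 0)\<^sup>2"
    by (rule powser_zero)
  then show ?thesis by (simp add: bessel_J0_eq bessel_series_def)
qed

text \<open>\<open>LEAST\<close> over the reals says something only if the minimum is attained: the
  zeros in [0, sqrt 8] form a nonempty compact set that avoids 0. Positivity before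
  \<open>j0\<close> follows from the value 1 at 0.\<close>

lemma j0_properties: "0 < j0" "bessel_J0 j0 = 0" "j0 \<le> sqrt 8" "\<And>x. 0 \<le> x \<Longrightarrow> x < j0 \<Longrightarrow> bessel_J0 x > 0"
proof -
  define A where "A = {x \<in> {0..sqrt 8}. bessel_J0 x = 0}"
  have cont: "continuous_on S bessel_J0" for S
    by (simp add: continuous_at_imp_continuous_on isCont_bessel_J0)
  have "closed A" unfolding A_def by (intro continuous_closed_preimage_constant cont) auto
  moreover have "bounded A" by (rule bounded_subset[of "{0..sqrt 8}"]) (auto simp: A_def)
  ultimately have "compact A" by (simp add: compact_eq_bounded_closed)
  moreover have "A \<noteq> {}"
  proof -
    obtain x where "0 \<le> x" "x \<le> sqrt 8" "bessel_J0 x = 0"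
      using IVT2'[OF _ _ _ cont, of "sqrt 8" 0 0] bessel_J0_sqrt_8_neg bessel_J0_0 by auto
    then show ?thesis by (auto simp: A_def)
  qed
  ultimately obtain m where m: "m \<in> A" "\<And>x. x \<in> A \<Longrightarrow> m \<le> x"
    using compact_attains_inf[of A] by metis
  have m0: "m > 0" using m(1) bessel_J0_0 by (auto simp: A_def order_le_less)
  have "j0 = m"
    unfolding j0_def
  proof (rule Least_equality)
    show "0 < m \<and> bessel_J0 m = 0" using m m0 by (simp add: A_def)
    fix y assume "0 < y \<and> bessel_J0 y = 0"
    then show "m \<le> y" using m by (cases "y \<le> sqrt 8") (auto simp: A_def)
  qed
  then show "0 < j0" "bessel_J0 j0 = 0" "j0 \<le> sqrt 8" using m m0 by (auto simp: A_def)
  fix x assume x: "0 \<le> x" "x < j0"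
  show "bessel_J0 x > 0"
  proof (rule ccontr)
    assume "\<not> bessel_J0 x > 0"
    then obtain y where "0 \<le> y" "y \<le> x" "bessel_J0 y = 0"
      using IVT2'[OF _ _ _ cont, of x 0 0] bessel_J0_0 x by auto
    then have "y \<in> A" using x \<open>j0 \<le> sqrt 8\<close> by (auto simp: A_def)
    then show False using m(2)[of y] \<open>j0 = m\<close> x \<open>y \<le> x\<close> by simp
  qed
qed

lemma legendre_ode:
  "(1 - t\<^sup>2) * poly (pderiv (pderiv (legendre n))) t - 2 * t * poly (pderiv (legendre n)) t
    + real n * (real n + 1) * poly (legendre n) t = 0"
proof -
  have "pderiv ([:1, 0, -1:] * p) = [:0, -2:] * p + [:1, 0, -1:] * pderiv p" for p :: "real poly"
    by (simp only: pderiv_mult) (simp add: pderiv_pCons)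
  then have "poly ([:0, -2:] * pderiv (legendre n) + [:1, 0, -1:] * pderiv (pderiv (legendre n))
     + smult (real n * (real n + 1)) (legendre n)) t = 0"
    using legendre_operator_legendre[of n] unfolding legendre_operator_def by (metis poly_0)
  then show ?thesis by (simp add: power2_eq_square algebra_simps)
qed

text \<open>Liouville's normal form: \<open>sqrt (sin x) * P x\<close> and \<open>sqrt x * Q x\<close> solve \<open>y'' + (N^2 + 1 / (4 sin^2 x)) y = 0\<close>
  and \<open>y'' + (N^2 + 1 / (4 x^2)) y = 0\<close>. Their Wronskian \<open>W\<close> would decrease from \<open>0\<close> to a nonnegative value if
  \<open>P\<close> were positive on \<open>(0, \<tau>)\<close>.\<close>

lemma legendre_zero_before_bessel_zero:
  assumes "n \<ge> 1"
  shows "\<exists>\<theta>. 0 < \<theta> \<and> \<theta> < j0 / (real n + 1 / 2) \<and> poly (legendre n) (cos \<theta>) = 0"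
proof (rule ccontr)
  assume no: "\<not> ?thesis"
  define N where "N = real n + 1 / 2"
  define \<tau> where "\<tau> = j0 / N"
  have N: "N \<ge> 3 / 2" using assms by (simp add: N_def)
  have \<tau>0: "\<tau> > 0" using N j0_properties(1) by (simp add: \<tau>_def)
  have N\<tau>: "N * \<tau> = j0" using N by (simp add: \<tau>_def)
  have \<tau>pi: "\<tau> < pi"
  proof -
    have "j0 \<le> 3" using j0_properties(3) real_le_lsqrt[of 3 8] by simp
    then have "\<tau> \<le> 2" using N by (simp add: \<tau>_def divide_le_eq)
    then show ?thesis using pi_gt3 by linarith
  qed
  define p where "p = legendre n"
  define P P1 P2 where "P = (\<lambda>x. poly p (cos x))"
    and "P1 = (\<lambda>x. - sin x * poly (pderiv p) (cos x))"
    and "P2 = (\<lambda>x. - cos x * poly (pderiv p) (cos x) + (sin x)\<^sup>2 * poly (pderiv (pderiv p)) (cos x))"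
  have dpoly: "((\<lambda>x. poly q (cos x)) has_real_derivative (- sin x * poly (pderiv q) (cos x))) (at x)" for q x
    using DERIV_chain2[OF poly_DERIV DERIV_cos, of q] by (simp add: mult.commute)
  have dP: "(P has_real_derivative P1 x) (at x)" for x
    unfolding P_def P1_def by (rule dpoly)
  have dP1: "(P1 has_real_derivative P2 x) (at x)" for x
    unfolding P1_def P2_def
    by (rule derivative_eq_intros dpoly refl | simp add: power2_eq_square)+
  have odeP: "sin x * P2 x + cos x * P1 x + real n * (real n + 1) * sin x * P x = 0" for x
  proof -
    have "sin x * ((1 - (cos x)\<^sup>2) * poly (pderiv (pderiv p)) (cos x) - 2 * cos x * poly (pderiv p) (cos x)
       + real n * (real n + 1) * poly p (cos x)) = 0"
      unfolding p_def legendre_ode by simp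
    moreover have "1 - (cos x)\<^sup>2 = (sin x)\<^sup>2" by (simp add: sin_squared_eq)
    ultimately show ?thesis by (simp add: P_def P1_def P2_def algebra_simps)
  qed
  obtain J1 J2 where J: "\<And>x. (bessel_J0 has_real_derivative J1 x) (at x)"
    "\<And>x. (J1 has_real_derivative J2 x) (at x)"
    "\<And>x. x * J2 x + J1 x + x * bessel_J0 x = 0"
    using bessel_J0_ode by auto
  define Q Q1 Q2 where "Q = (\<lambda>x. bessel_J0 (N * x))" and "Q1 = (\<lambda>x. N * J1 (N * x))"
    and "Q2 = (\<lambda>x. N\<^sup>2 * J2 (N * x))"
  have dQ: "(Q has_real_derivative Q1 x) (at x)" for x
    unfolding Q_def Q1_def by (rule DERIV_cong[OF DERIV_chain2[OF J(1) DERIV_cmult_Id[of N]]]) simp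
  have dQ1: "(Q1 has_real_derivative Q2 x) (at x)" for x
    unfolding Q1_def Q2_def by (rule DERIV_cong[OF DERIV_cmult[OF DERIV_chain2[OF J(2) DERIV_cmult_Id[of N]]]])
      (simp add: power2_eq_square)
  have odeQ: "x * Q2 x + Q1 x + N\<^sup>2 * x * Q x = 0" for x
  proof -
    have "N * (N * x * J2 (N * x) + J1 (N * x) + N * x * bessel_J0 (N * x)) = 0" by (simp only: J(3) mult_zero_right)
    then show ?thesis by (simp add: Q_def Q1_def Q2_def power2_eq_square algebra_simps)
  qed
  have Pnz: "P x \<noteq> 0" if "0 < x" "x < \<tau>" for x
    using no that by (auto simp: P_def p_def \<tau>_def N_def)
  have contP: "continuous_on S P" for S
    using dP by (meson DERIV_isCont continuous_at_imp_continuous_on)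
  have Ppos: "P x > 0" if x: "0 \<le> x" "x < \<tau>" for x
  proof (rule ccontr)
    assume "\<not> P x > 0"
    moreover have "P 0 = 1" by (simp add: P_def p_def legendre_1)
    ultimately obtain y where "0 \<le> y" "y \<le> x" "P y = 0"
      using IVT2'[OF _ _ _ contP, of x 0 0] x by auto
    then show False using Pnz[of y] x \<open>P 0 = 1\<close> by (cases "y = 0") auto
  qed
  have P\<tau>: "P \<tau> \<ge> 0"
  proof (rule ccontr)
    assume "\<not> P \<tau> \<ge> 0"
    then obtain y where "\<tau> / 2 \<le> y" "y \<le> \<tau>" "P y = 0"
      using IVT2'[OF _ _ _ contP, of \<tau> 0 "\<tau> / 2"] \<tau>0 Ppos[of "\<tau> / 2"] by auto
    then show False using Ppos[of y] \<tau>0 \<open>\<not> P \<tau> \<ge> 0\<close> by (cases "y = \<tau>") auto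
  qed
  have Qpos: "Q x > 0" if "0 \<le> x" "x < \<tau>" for x
    unfolding Q_def using that N N\<tau> by (intro j0_properties(4)) (auto simp flip: N\<tau>)
  have Q\<tau>: "Q \<tau> = 0" by (simp add: Q_def N\<tau> j0_properties)
  have Q1\<tau>: "Q1 \<tau> \<le> 0"
  proof (rule ccontr)
    assume "\<not> Q1 \<tau> \<le> 0"
    then obtain d where d: "d > 0" "\<And>h. 0 < h \<Longrightarrow> h < d \<Longrightarrow> Q (\<tau> - h) < Q \<tau>"
      using DERIV_pos_inc_left[OF dQ[of \<tau>]] by auto
    define h where "h = min (d / 2) \<tau>"
    have "0 < h" "h < d" "h \<le> \<tau>" using d(1) \<tau>0 by (auto simp: h_def)
    then show False using d(2)[of h] Qpos[of "\<tau> - h"] Q\<tau> by auto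
  qed
  \<comment> \<open>\<open>K\<close> is half the logarithmic derivative of sin x / x, so that
    \<open>W\<close> is the Wronskian (sqrt (sin x) P)' sqrt x Q - sqrt (sin x) P (sqrt x
    Q)'.\<close>
  define K where "K = (\<lambda>x::real. (cos x / sin x - 1 / x) / 2)"
  define w where "w = (\<lambda>x. P1 x * Q x - P x * Q1 x + K x * (P x * Q x))"
  define W where "W = (\<lambda>x. sqrt (x * sin x) * w x)"
  have dW: "(W has_real_derivative sqrt (x * sin x) * (1 / (4 * x\<^sup>2) - 1 / (4 * (sin x)\<^sup>2)) * (P x * Q x)) (at x)"
    if x: "0 < x" "x < pi" for x
  proof -
    have s: "sin x > 0" using x by (rule sin_gt_zero)
    define S where "S = sqrt (x * sin x)"
    have S: "S > 0" "S\<^sup>2 = x * sin x" using s x by (auto simp: S_def)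
    have dS: "((\<lambda>x. sqrt (x * sin x)) has_real_derivative S * ((1 / x + cos x / sin x) / 2)) (at x)"
    proof -
      have "((\<lambda>x. sqrt (x * sin x)) has_real_derivative (sin x + x * cos x) / (2 * S)) (at x)"
      proof -
        have m: "((\<lambda>x. x * sin x) has_real_derivative (sin x + x * cos x)) (at x)"
          by (rule DERIV_cong[OF DERIV_mult[OF DERIV_ident DERIV_sin]]) simp
        have pos: "x * sin x > 0" using s x by simp
        show ?thesis
          by (rule DERIV_cong[OF DERIV_chain2[where f = sqrt and g = "\<lambda>x. x * sin x", OF DERIV_real_sqrt[OF pos] m]]) (simp add: S_def inverse_eq_divide)
      qed
      moreover have "(sin x + x * cos x) / (2 * S) = S * ((1 / x + cos x / sin x) / 2)"
      proof -
        have "1 / x + cos x / sin x = (sin x + x * cos x) / S\<^sup>2"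
          unfolding S(2) using s x by (simp add: add_divide_distrib)
        then show ?thesis using S(1) by (simp add: power2_eq_square)
      qed
      ultimately show ?thesis by simp
    qed
    have dK: "(K has_real_derivative (1 / x\<^sup>2 - 1 / (sin x)\<^sup>2) / 2) (at x)"
    proof -
      have dc: "((\<lambda>x. cos x / sin x) has_real_derivative - (1 / (sin x)\<^sup>2)) (at x)"
      proof -
        have "- sin x * sin x - cos x * cos x = -1"
          using sin_cos_squared_add[of x] by (simp add: power2_eq_square)
        then show ?thesis
          using s by (auto intro!: derivative_eq_intros simp: power2_eq_square divide_simps)
      qed
      have di: "((\<lambda>x. 1 / x) has_real_derivative - (1 / x\<^sup>2)) (at x)"
        using DERIV_inverse[of x] x by (simp add: inverse_eq_divide power2_eq_square)
      show ?thesis unfolding K_def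
        by (rule DERIV_cong[OF DERIV_cdivide[OF DERIV_diff[OF dc di]]]) simp
    qed
    define w' where "w' = P2 x * Q x + P1 x * Q1 x - (P1 x * Q1 x + P x * Q2 x)
      + ((1 / x\<^sup>2 - 1 / (sin x)\<^sup>2) / 2 * (P x * Q x) + K x * (P1 x * Q x + P x * Q1 x))"
    have dw: "(w has_real_derivative w') (at x)"
      unfolding w_def w'_def by (rule derivative_eq_intros dP dP1 dQ dQ1 dK refl | simp)+
    have "(W has_real_derivative S * ((1 / x + cos x / sin x) / 2) * w x + w' * S) (at x)"
      unfolding W_def using DERIV_mult[OF dS dw] by (simp add: S_def)
    moreover have "S * ((1 / x + cos x / sin x) / 2) * w x + w' * S = S * (((1 / x + cos x / sin x) / 2) * w x + w')"
      by (simp add: algebra_simps)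
    moreover have "((1 / x + cos x / sin x) / 2) * w x + w' = (1 / (4 * x\<^sup>2) - 1 / (4 * (sin x)\<^sup>2)) * (P x * Q x)"
    proof -
      have P2: "P2 x = - (cos x / sin x) * P1 x - real n * (real n + 1) * P x"
        using odeP[of x] s by (simp add: field_simps)
      have Q2: "Q2 x = - (1 / x) * Q1 x - N\<^sup>2 * Q x"
        using odeQ[of x] x by (simp add: field_simps)
      have ct: "(cos x / sin x)\<^sup>2 = 1 / (sin x)\<^sup>2 - 1"
        using s by (simp add: power_divide cos_squared_eq field_simps)
      \<comment> \<open>The shift by 1/2 completes the square: both normal forms have the same
        constant N^2, and their potentials differ by 1 / (4 sin^2 x) - 1 / (4 x^2) only.\<close>
      have NN: "N\<^sup>2 = real n * (real n + 1) + 1 / 4" by (simp add: N_def power2_eq_square algebra_simps)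
      define c u r where "c = cos x / sin x" and "u = 1 / x" and "r = 1 / (sin x)\<^sup>2"
      have K': "K x = (c - u) / 2" by (simp add: K_def c_def u_def)
      have u2: "1 / x\<^sup>2 = u\<^sup>2" by (simp add: u_def power_divide)
      have r4: "1 / (4 * x\<^sup>2) = u\<^sup>2 / 4" "1 / (4 * (sin x)\<^sup>2) = r / 4" by (simp_all add: u_def r_def power_divide)
      have c2: "r = c\<^sup>2 + 1" using ct by (simp add: c_def r_def)
      show ?thesis
        unfolding w_def w'_def P2 Q2 u2 K' r4
        unfolding c_def[symmetric] u_def[symmetric] r_def[symmetric] c2 NN
        by (simp add: field_simps power2_eq_square)
    qed
    ultimately show ?thesis by (simp add: S_def mult.assoc)
  qed
  have neg: "sqrt (x * sin x) * (1 / (4 * x\<^sup>2) - 1 / (4 * (sin x)\<^sup>2)) * (P x * Q x) < 0"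
    if x: "0 < x" "x < \<tau>" for x
  proof -
    have s: "sin x > 0" using x \<tau>pi by (intro sin_gt_zero) auto
    have "sin x < x"
    proof -
      have "cos (x / 2) < 1" using x \<tau>pi cos_monotone_0_pi[of 0 "x / 2"] by simp
      moreover have "sin (x / 2) > 0" using x \<tau>pi by (intro sin_gt_zero) auto
      ultimately have "2 * sin (x / 2) * cos (x / 2) < 2 * sin (x / 2)" by simp
      moreover have "sin x = 2 * sin (x / 2) * cos (x / 2)" using sin_double[of "x / 2"] by simp
      moreover have "sin (x / 2) \<le> x / 2" using x by (intro sin_x_le_x) auto
      ultimately show ?thesis by linarith
    qed
    then have "(sin x)\<^sup>2 < x\<^sup>2" using s by (intro power_strict_mono) auto
    then have "1 / (4 * x\<^sup>2) < 1 / (4 * (sin x)\<^sup>2)" using s x by (simp add: frac_less2)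
    moreover have "P x * Q x > 0" "sqrt (x * sin x) > 0" using Ppos Qpos x s by auto
    ultimately show ?thesis by (simp add: mult_pos_neg mult_neg_pos)
  qed
  have dec: "W b < W a" if ab: "0 < a" "a < b" "b \<le> \<tau>" for a b
  proof (rule DERIV_neg_imp_decreasing_open[OF ab(2)])
    show "\<exists>y. (W has_real_derivative y) (at x) \<and> y < 0" if "a < x" "x < b" for x
      using dW[of x] neg[of x] that ab \<tau>pi by (intro exI conjI) auto
    show "continuous_on {a..b} W"
    proof (rule continuous_at_imp_continuous_on, rule ballI)
      fix x assume "x \<in> {a..b}"
      then show "isCont W x" using dW[of x] ab \<tau>pi by (auto intro: DERIV_isCont)
    qed
  qed
  have lim: "(W \<longlongrightarrow> 0) (at_right 0)"
  proof -
    have K: "(K \<longlongrightarrow> 0) (at_right 0)" unfolding K_def by real_asymp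
    have S: "((\<lambda>x. sqrt (x * sin x)) \<longlongrightarrow> 0) (at_right 0)" by real_asymp
    have c: "(f \<longlongrightarrow> f 0) (at_right 0)" if "\<And>x. (f has_real_derivative f' x) (at x)" for f f' :: "real \<Rightarrow> real"
      using DERIV_isCont[OF that[of 0]] by (metis isCont_def filterlim_at_split)
    have "(W \<longlongrightarrow> 0 * (P1 0 * Q 0 - P 0 * Q1 0 + 0 * (P 0 * Q 0))) (at_right 0)"
      unfolding W_def w_def
      by (intro tendsto_intros S K c[of P P1] c[of Q Q1] c[of P1 P2] c[of Q1 Q2] dP dP1 dQ dQ1)
    then show ?thesis by simp
  qed
  have "W (\<tau> / 2) \<le> 0"
  proof (rule tendsto_lowerbound[OF lim])
    show "\<forall>\<^sub>F i in at_right 0. W (\<tau> / 2) \<le> W i"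
      unfolding eventually_at_right_field
      using dec[of _ "\<tau> / 2"] \<tau>0 by (intro exI[of _ "\<tau> / 2"]) (auto intro: less_imp_le)
  qed simp
  moreover have "W \<tau> < W (\<tau> / 2)" using dec[of "\<tau> / 2" \<tau>] \<tau>0 by simp
  \<comment> \<open>Only - P Q' is left at \<tau>, because Q vanishes there; P is nonnegative, and Q
    arrives at its first zero from above.\<close>
  moreover have "W \<tau> \<ge> 0"
  proof -
    have "sin \<tau> > 0" using \<tau>0 \<tau>pi by (rule sin_gt_zero)
    moreover have "P \<tau> * Q1 \<tau> \<le> 0" using P\<tau> Q1\<tau> by (rule mult_nonneg_nonpos)
    ultimately show ?thesis unfolding W_def w_def using Q\<tau> \<tau>0 by (simp add: mult_nonneg_nonpos)
  qed
  ultimately show False by linarith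
qed

text \<open>\<open>theta\<close> is defined by \<open>Max\<close>, so the set of zeros must be
  finite and nonempty; the zero found by Sturm comparison is one of them. There is no zero at t
  \<ge> 1 and that zero exceeds -1, so \<open>arccos\<close> is applied strictly inside (-1, 1),
  where it turns the greatest zero into the least angle.\<close>

lemma theta_properties:
  assumes "n \<ge> 1"
  shows "0 < theta n" "theta n < j0 / (real n + 1 / 2)" "theta n < pi" "poly (legendre n) (cos (theta n)) = 0"
    "\<And>t. poly (legendre n) t = 0 \<Longrightarrow> t \<le> cos (theta n)"
proof -
  define A where "A = {t. poly (legendre n) t = 0}"
  obtain \<theta> where \<theta>: "0 < \<theta>" "\<theta> < j0 / (real n + 1 / 2)" "poly (legendre n) (cos \<theta>) = 0"
    using legendre_zero_before_bessel_zero[OF assms] by blast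
  have \<theta>pi: "\<theta> < pi"
  proof -
    have "j0 \<le> 3" using j0_properties(3) real_le_lsqrt[of 3 8] by simp
    then have "j0 / (real n + 1 / 2) \<le> 2" using assms by (simp add: divide_le_eq)
    then show ?thesis using pi_gt3 \<theta> by linarith
  qed
  have "legendre n \<noteq> 0" using legendre_1[of n] by auto
  then have fin: "finite A" unfolding A_def by (rule poly_roots_finite)
  have ne: "cos \<theta> \<in> A" using \<theta> by (simp add: A_def)
  have mx: "Max A \<in> A" using fin ne Max_in by blast
  have M1: "Max A < 1" using mx legendre_pos[of "Max A" n] by (force simp: A_def)
  have Mc: "cos \<theta> \<le> Max A" using fin ne by simp
  have M2: "-1 < Max A" using Mc cos_monotone_0_pi[of \<theta> pi] \<theta> \<theta>pi by simp
  have th: "theta n = arccos (Max A)" by (simp add: theta_def A_def)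
  have cth: "cos (theta n) = Max A" using M1 M2 by (simp add: th)
  show "0 < theta n" "theta n < pi" using M1 M2 arccos_lt_bounded[of "Max A"] by (auto simp: th)
  have "arccos (Max A) \<le> arccos (cos \<theta>)" using M1 Mc by (intro arccos_le_arccos) auto
  then show "theta n < j0 / (real n + 1 / 2)" using \<theta> \<theta>pi by (simp add: th arccos_cos)
  show "poly (legendre n) (cos (theta n)) = 0" using mx by (simp add: cth A_def)
  show "t \<le> cos (theta n)" if "poly (legendre n) t = 0" for t
    using that fin by (simp add: cth A_def)
qed

section \<open>Binary trigonometric forms\<close>

text \<open>The restriction of a binary form of degree n to the unit circle. A shift of t by pi
  multiplies it by (-1)^n, so its zeros are counted in half a period.\<close>

definition trig_form :: "nat \<Rightarrow> (nat \<Rightarrow> real) \<Rightarrow> real \<Rightarrow> real" where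
  "trig_form n D t = (\<Sum>i\<le>n. D i * cos t ^ i * sin t ^ (n - i))"

lemma continuous_on_trig_form: "continuous_on S (trig_form n D)"
  unfolding trig_form_def by (intro continuous_intros)

lemma cis_double_eq_imp_eq:
  assumes "cis (2 * s) = cis (2 * t)" "\<bar>s - t\<bar> < pi"
  shows "s = t"
proof -
  have "cis (2 * (s - t)) = 1"
    using assms(1) by (simp add: right_diff_distrib flip: cis_divide)
  then have "cos (2 * (s - t)) = 1" by (metis cis.simps(1) one_complex.simps(1))
  then obtain k :: int where k: "2 * (s - t) = real_of_int k * 2 * pi"
    using cos_one_2pi_int by auto
  then have "s - t = real_of_int k * pi" by simp
  then have "\<bar>real_of_int k\<bar> * pi < 1 * pi" using assms(2) by (simp add: abs_mult)
  then have "\<bar>real_of_int k\<bar> < 1" by (simp only: mult_less_cancel_right) (use pi_gt_zero in auto)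
  then have "k = 0" by linarith
  then show ?thesis using k by simp
qed

text \<open>A form of degree \<open>n\<close> is, up to the unimodular factor \<open>cis (n t)\<close>, a polynomial of degree \<open>n\<close>
  in \<open>cis (2 t)\<close>.\<close>

lemma trig_form_zeros:
  assumes nz: "trig_form n D t0 \<noteq> 0"
  shows "finite {t \<in> {\<alpha>..<\<alpha> + pi}. trig_form n D t = 0}"
    and "card {t \<in> {\<alpha>..<\<alpha> + pi}. trig_form n D t = 0} \<le> n"
proof -
  \<comment> \<open>With z = cis t one has cos t = (z^2 + 1) / (2 z) and sin t = (z^2 - 1) / (2 i
    z); \<open>p\<close> is the resulting numerator, as a polynomial in z^2.\<close>
  define p :: "complex poly" where
    "p = (\<Sum>i\<le>n. smult (of_real (D i) / (2 ^ i * (2 * \<i>) ^ (n - i))) ([:1, 1:] ^ i * [:-1, 1:] ^ (n - i)))"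
  have p_eq: "poly p (cis (2 * t)) = cis t ^ n * of_real (trig_form n D t)" for t
  proof -
    define z where "z = cis t"
    have z2: "cis (2 * t) = z * z" by (simp add: z_def cis_mult)
    have zm: "z * cnj z = 1" by (simp add: z_def complex_eq_iff power2_eq_square[symmetric])
    have c: "1 + z * z = z * (2 * of_real (cos t))"
    proof -
      have "2 * of_real (cos t) = z + cnj z" by (simp add: z_def complex_eq_iff)
      then show ?thesis using zm by (simp add: distrib_left mult.commute)
    qed
    have s: "z * z - 1 = z * (2 * \<i> * of_real (sin t))"
    proof -
      have "2 * \<i> * of_real (sin t) = z - cnj z" by (simp add: z_def complex_eq_iff)
      then show ?thesis using zm by (simp add: right_diff_distrib mult.commute)
    qed
    have "poly p (cis (2 * t)) = (\<Sum>i\<le>n. of_real (D i) / (2 ^ i * (2 * \<i>) ^ (n - i)) * ((1 + z * z) ^ i * (z * z - 1) ^ (n - i)))"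
      unfolding p_def z2 by (simp add: poly_sum poly_power)
    also have "\<dots> = (\<Sum>i\<le>n. z ^ n * of_real (D i * cos t ^ i * sin t ^ (n - i)))"
    proof (rule sum.cong, rule refl)
      fix i assume i: "i \<in> {..n}"
      have "z ^ n = z ^ i * z ^ (n - i)" using i by (simp flip: power_add)
      then show "of_real (D i) / (2 ^ i * (2 * \<i>) ^ (n - i)) * ((1 + z * z) ^ i * (z * z - 1) ^ (n - i)) =
        z ^ n * of_real (D i * cos t ^ i * sin t ^ (n - i))"
        unfolding c s by (simp add: power_mult_distrib)
    qed
    finally show ?thesis unfolding trig_form_def z_def by (simp add: sum_distrib_left)
  qed
  have "p \<noteq> 0" using p_eq[of t0] nz by auto
  have deg: "degree p \<le> n"
    unfolding p_def
  proof (rule degree_sum_le)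
    fix i assume i: "i \<in> {..n}"
    have "degree ([:1, 1::complex:] ^ i * [:-1, 1:] ^ (n - i)) \<le> i + (n - i)"
      by (rule order_trans[OF degree_mult_le])
         (intro add_mono order_trans[OF degree_power_le], simp_all)
    then show "degree (smult (of_real (D i) / (2 ^ i * (2 * \<i>) ^ (n - i))) ([:1, 1:] ^ i * [:-1, 1::complex:] ^ (n - i))) \<le> n"
      using i by (intro order_trans[OF degree_smult_le]) simp
  qed simp
  let ?Z = "{t \<in> {\<alpha>..<\<alpha> + pi}. trig_form n D t = 0}"
  have inj: "inj_on (\<lambda>t. cis (2 * t)) ?Z"
    by (intro inj_onI cis_double_eq_imp_eq) auto
  have sub: "(\<lambda>t. cis (2 * t)) ` ?Z \<subseteq> {w. poly p w = 0}" by (auto simp: p_eq)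
  have fin: "finite {w. poly p w = 0}" using \<open>p \<noteq> 0\<close> by (rule poly_roots_finite)
  show "finite ?Z" using finite_subset[OF sub fin] inj by (rule finite_imageD)
  have "card ?Z = card ((\<lambda>t. cis (2 * t)) ` ?Z)" using inj by (simp add: card_image)
  also have "\<dots> \<le> card {w. poly p w = 0}" using sub fin by (rule card_mono[rotated])
  also have "\<dots> \<le> degree p" using \<open>p \<noteq> 0\<close> by (rule card_poly_roots_bound)
  finally show "card ?Z \<le> n" using deg by linarith
qed

text \<open>Expansion of Re (cis (- n s) (cos t + i sin t)^n). A shifted cosine of frequency n is
  thus a form of degree n, and its difference with any other such form obeys the same bound on
  zeros.\<close>

lemma cos_trig_form: "\<exists>D. \<forall>t. cos (real n * (t - s)) = trig_form n D t"
proof -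
  define D where "D = (\<lambda>i. Re (cis (- (real n * s)) * of_nat (n choose i) * \<i> ^ (n - i)))"
  have "cos (real n * (t - s)) = trig_form n D t" for t
  proof -
    have "cos (real n * (t - s)) = Re (cis (- (real n * s)) * cis t ^ n)"
      by (simp add: Complex.DeMoivre cis_mult algebra_simps)
    also have "cis t ^ n = (of_real (cos t) + \<i> * of_real (sin t)) ^ n"
      by (simp add: cis_conv_exp exp_Euler cos_of_real sin_of_real)
    also have "\<dots> = (\<Sum>i\<le>n. of_nat (n choose i) * of_real (cos t) ^ i * (\<i> * of_real (sin t)) ^ (n - i))"
      by (rule binomial_ring)
    also have "Re (cis (- (real n * s)) * \<dots>) = (\<Sum>i\<le>n. Re (cis (- (real n * s)) * (of_nat (n choose i) * of_real (cos t) ^ i * (\<i> * of_real (sin t)) ^ (n - i))))"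
      by (simp only: sum_distrib_left Re_sum)
    also have "\<dots> = (\<Sum>i\<le>n. D i * cos t ^ i * sin t ^ (n - i))"
    proof (rule sum.cong, rule refl)
      fix i
      have "cis (- (real n * s)) * (of_nat (n choose i) * of_real (cos t) ^ i * (\<i> * of_real (sin t)) ^ (n - i))
         = of_real (cos t ^ i * sin t ^ (n - i)) * (cis (- (real n * s)) * of_nat (n choose i) * \<i> ^ (n - i))"
        by (simp add: power_mult_distrib mult_ac)
      then show "Re (cis (- (real n * s)) * (of_nat (n choose i) * of_real (cos t) ^ i * (\<i> * of_real (sin t)) ^ (n - i)))
         = D i * cos t ^ i * sin t ^ (n - i)"
        unfolding D_def by (simp only: Re_complex_of_real Im_complex_of_real times_complex.sel mult_zero_left diff_zero) (simp add: mult_ac)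
    qed
    finally show ?thesis by (simp add: trig_form_def)
  qed
  then show ?thesis by blast
qed

section \<open>Comparison of a form with a cosine of the same frequency\<close>

lemma alternating_zeros:
  fixes G :: "real \<Rightarrow> real"
  assumes cont: "continuous_on UNIV G"
    and mono: "\<And>i. i < m \<Longrightarrow> p i < p (Suc i)"
    and sgn: "\<And>i. i \<le> m \<Longrightarrow> (-1) ^ Suc i * G (p i) > 0"
    and fin: "finite {t \<in> {p 0..<p m}. G t = 0}"
  shows "m \<le> card {t \<in> {p 0..<p m}. G t = 0}"
proof -
  have "\<exists>z. p i < z \<and> z < p (Suc i) \<and> G z = 0" if i: "i < m" for i
  proof -
    have s: "(-1) ^ Suc i * G (p i) > 0" "(-1) ^ Suc i * G (p (Suc i)) < 0"
      using sgn[of i] sgn[of "Suc i"] i by auto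
    have "\<exists>z. p i \<le> z \<and> z \<le> p (Suc i) \<and> (-1) ^ Suc i * G z = 0"
    proof (rule IVT2')
      show "continuous_on {p i..p (Suc i)} (\<lambda>z. (-1) ^ Suc i * G z)"
        by (intro continuous_intros continuous_on_subset[OF cont]) auto
    qed (use s mono[OF i] in auto)
    then obtain z where z: "p i \<le> z" "z \<le> p (Suc i)" "G z = 0" by auto
    then have "z \<noteq> p i" "z \<noteq> p (Suc i)" using s by auto
    then show ?thesis using z by (intro exI[of _ z]) auto
  qed
  then obtain z where z: "\<And>i. i < m \<Longrightarrow> p i < z i \<and> z i < p (Suc i) \<and> G (z i) = 0" by metis
  have pm: "p i \<le> p j" if "i \<le> j" "j \<le> m" for i j
    using that
  proof (induction j rule: dec_induct)
    case (step k)
    then show ?case using mono[of k] by simp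
  qed simp
  have inj: "inj_on z {..<m}"
  proof (rule linorder_inj_onI)
    fix i j assume "i < j" "i \<in> {..<m}" "j \<in> {..<m}"
    then have "z i < p (Suc i)" "p j < z j" "p (Suc i) \<le> p j" using z pm[of "Suc i" j] by auto
    then show "z i \<noteq> z j" by linarith
  qed auto
  have "z ` {..<m} \<subseteq> {t \<in> {p 0..<p m}. G t = 0}"
  proof
    fix x assume "x \<in> z ` {..<m}"
    then obtain i where i: "i < m" "x = z i" by auto
    then show "x \<in> {t \<in> {p 0..<p m}. G t = 0}"
      using z[of i] pm[of 0 i] pm[of "Suc i" m] by auto
  qed
  from card_mono[OF fin this] show ?thesis using inj by (simp add: card_image)
qed

text \<open>M. Riesz: \<open>trig_form n D\<close> lies above the cosine of frequency \<open>n\<close> near a maximum. Otherwise its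
  difference with a slightly shifted cosine would have \<open>n + 2\<close> zeros in a half period.\<close>

lemma trig_form_pos_left:
  assumes n: "n \<ge> 1" and F0: "trig_form n D 0 = 1" and bd: "\<And>t. \<bar>trig_form n D t\<bar> \<le> 1"
    and \<tau>: "- (pi / (2 * real n)) < \<tau>" "\<tau> < 0"
  shows "trig_form n D \<tau> > 0"
proof (rule ccontr)
  assume neg: "\<not> trig_form n D \<tau> > 0"
  \<comment> \<open>Half of the slack left by \<tau>: the cosine with peak at s > 0 is still
    positive at \<tau>, because s - \<tau> stays below a quarter period.\<close>
  define s where "s = (pi / (2 * real n) + \<tau>) / 2"
  have s: "s > 0" "s - \<tau> < pi / (2 * real n)" "s < pi / (2 * real n)" using \<tau> by (auto simp: s_def field_simps)
  have hn: "pi / real n = 2 * (pi / (2 * real n))" using n by (simp add: field_simps)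
  have nx: "\<bar>real n * x\<bar> < pi / 2" if "\<bar>x\<bar> < pi / (2 * real n)" for x
  proof -
    have "real n * \<bar>x\<bar> < real n * (pi / (2 * real n))" using that n by (intro mult_strict_left_mono) auto
    then show ?thesis using n by (simp add: abs_mult)
  qed
  have ns: "0 < real n * s" "real n * s < pi / 2" using nx[of s] s n by (auto simp: abs_less_iff)
  have cos1: "cos (real n * s) < 1" using cos_monotone_0_pi[of 0 "real n * s"] ns by simp
  have cos0: "cos (real n * s) > 0" using ns by (intro cos_gt_zero_pi) auto
  \<comment> \<open>Any value strictly in between serves: \<mu> < 1 lets the cosine dominate at its
    own extrema, \<mu> > cos (n s) makes the difference negative at 0.\<close>
  define \<mu> where "\<mu> = (1 + cos (real n * s)) / 2"
  have \<mu>: "cos (real n * s) < \<mu>" "\<mu> < 1" "\<mu> > 0" using cos1 cos0 by (auto simp: \<mu>_def)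
  obtain C where C: "\<And>t. cos (real n * (t - s)) = trig_form n C t" using cos_trig_form[of n s] by blast
  define E where "E = (\<lambda>i. C i - \<mu> * D i)"
  have E: "trig_form n E t = cos (real n * (t - s)) - \<mu> * trig_form n D t" for t
    unfolding C E_def trig_form_def by (simp add: sum_subtractf sum_distrib_left algebra_simps)
  \<comment> \<open>The nodes; the signs of the difference alternate, beginning with minus at i = 0.
    The nodes are a minimum of the cosine, then \<tau>, where the cosine is positive and the form is
    not, then 0, then n successive extrema of the cosine starting with the peak s. These n + 3 nodes
    span exactly pi.\<close>
  define p where "p = (\<lambda>i::nat. if i = 0 then s - pi / real n else if i = 1 then \<tau> else if i = 2 then 0
     else s + (real i - 3) * (pi / real n))"
  have mono: "p i < p (Suc i)" if "i < n + 2" for i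
  proof -
    consider "i = 0" | "i = 1" | "i = 2" | "i \<ge> 3" by linarith
    then show ?thesis
    proof cases
      case 1
      have "s - pi / real n < \<tau>" using s \<tau> unfolding hn by linarith
      then show ?thesis using 1 by (simp add: p_def)
    next
      case 4
      then show ?thesis using n by (simp add: p_def algebra_simps)
    qed (use s \<tau> in \<open>auto simp: p_def\<close>)
  qed
  have node: "(-1) ^ k * trig_form n E (s + real k * (pi / real n)) > 0" for k
  proof -
    have "real n * (s + real k * (pi / real n) - s) = pi * real k" using n by simp
    then have "(-1) ^ k * trig_form n E (s + real k * (pi / real n))
       = 1 - (-1) ^ k * (\<mu> * trig_form n D (s + real k * (pi / real n)))"
      unfolding E by (simp add: cos_npi2 right_diff_distrib flip: power_mult_distrib)
    moreover have "\<bar>(-1) ^ k * (\<mu> * trig_form n D (s + real k * (pi / real n)))\<bar> < 1"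
    proof -
      have "\<mu> * \<bar>trig_form n D (s + real k * (pi / real n))\<bar> \<le> \<mu> * 1"
        using bd \<mu> by (intro mult_left_mono) auto
      moreover have "\<bar>(-1) ^ k * (\<mu> * trig_form n D (s + real k * (pi / real n)))\<bar> =
          \<mu> * \<bar>trig_form n D (s + real k * (pi / real n))\<bar>"
        using \<mu> by (simp add: abs_mult power_abs)
      ultimately show ?thesis using \<mu> by linarith
    qed
    ultimately show ?thesis by linarith
  qed
  have sgn: "(-1) ^ Suc i * trig_form n E (p i) > 0" if "i \<le> n + 2" for i
  proof -
    consider "i = 0" | "i = 1" | "i = 2" | "i \<ge> 3" by linarith
    then show ?thesis
    proof cases
      case 1
      have "real n * (s - pi / real n - s) = - pi" using n by simp
      then have "trig_form n E (p i) = -1 - \<mu> * trig_form n D (p i)" using 1 unfolding E by (simp add: p_def)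
      moreover have "\<bar>\<mu> * trig_form n D (p i)\<bar> \<le> \<mu> * 1"
        using bd \<mu> unfolding abs_mult by (intro mult_mono) auto
      ultimately show ?thesis using 1 \<mu> by simp
    next
      case 2
      have "cos (real n * (\<tau> - s)) > 0"
        using nx[of "\<tau> - s"] s \<tau> by (intro cos_gt_zero_pi) (auto simp: abs_less_iff)
      moreover have "\<mu> * trig_form n D \<tau> \<le> 0" using neg \<mu> by (simp add: mult_nonneg_nonpos)
      ultimately show ?thesis using 2 by (simp add: p_def E)
    next
      case 3
      have "trig_form n E 0 = cos (real n * s) - \<mu>" unfolding E F0 by simp
      then show ?thesis using 3 \<mu> by (simp add: p_def)
    next
      case 4
      then obtain k where k: "i = k + 3" by (metis add.commute le_Suc_ex)
      have "(-1 :: real) ^ Suc i = (-1) ^ k" unfolding k by (simp add: power_add)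
      then show ?thesis using node[of k] k by (simp add: p_def)
    qed
  qed
  have "trig_form n E 0 \<noteq> 0" unfolding E F0 using \<mu> by simp
  note zeros = trig_form_zeros[OF this, of "p 0"]
  have p_end: "p (n + 2) = p 0 + pi"
  proof -
    have "real (n + 2) - 3 = real n - 1" by simp
    then have "p (n + 2) = s + (real n - 1) * (pi / real n)" using n unfolding p_def by auto
    also have "\<dots> = s - pi / real n + pi" using n by (simp add: field_simps)
    finally show ?thesis by (simp add: p_def)
  qed
  have "n + 2 \<le> card {t \<in> {p 0..<p (n + 2)}. trig_form n E t = 0}"
    by (rule alternating_zeros[OF continuous_on_trig_form mono sgn]) (use zeros(1) p_end in auto)
  then show False using zeros(2) p_end by simp
qed

lemma trig_form_pos:
  assumes n: "n \<ge> 1" and F0: "trig_form n D 0 = 1" and bd: "\<And>t. \<bar>trig_form n D t\<bar> \<le> 1"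
    and \<tau>: "\<bar>\<tau>\<bar> < pi / (2 * real n)"
  shows "trig_form n D \<tau> > 0"
proof -
  consider "\<tau> = 0" | "\<tau> < 0" | "\<tau> > 0" by linarith
  then show ?thesis
  proof cases
    case 1
    then show ?thesis using F0 by simp
  next
    case 2
    then show ?thesis using trig_form_pos_left[OF n F0 bd] \<tau> by auto
  next
    case 3
    define E where "E = (\<lambda>i. D i * (-1) ^ (n - i))"
    have E: "trig_form n E t = trig_form n D (- t)" for t
      unfolding trig_form_def E_def by (simp add: power_minus[of "sin t"] mult_ac)
    have "trig_form n E (- \<tau>) > 0"
    proof (rule trig_form_pos_left[OF n])
      show "trig_form n E 0 = 1" "\<bar>trig_form n E t\<bar> \<le> 1" for t using F0 bd by (simp_all add: E)
    qed (use 3 \<tau> in auto)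
    then show ?thesis by (simp add: E)
  qed
qed

text \<open>The claim is sin x \<ge> 2 x / pi at x = pi / (2 n). For n \<ge> 2 one has x \<le> pi /
  4, and the mean value theorem gives sin x = x cos z with cos z \<ge> sqrt 2 / 2 \<ge> 2 / pi; for
  n = 1 both sides are pi / 2.\<close>

lemma arcsin_inverse_le:
  assumes "n \<ge> 1"
  shows "arcsin (1 / real n) \<le> pi / (2 * real n)"
proof (cases "n = 1")
  case True
  then show ?thesis by simp
next
  case False
  then have n: "real n \<ge> 2" using assms by simp
  define x where "x = pi / (2 * real n)"
  have x: "0 < x" "x \<le> pi / 4" using n by (auto simp: x_def field_simps)
  have "\<exists>z. 0 < z \<and> z < x \<and> sin x - sin 0 = (x - 0) * cos z"
    using x by (intro MVT2) (auto intro!: derivative_eq_intros)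
  then obtain z where z: "0 < z" "z < x" "sin x = x * cos z" by auto
  have "cos z \<ge> cos (pi / 4)" using z x by (intro cos_monotone_0_pi_le) auto
  then have "cos z \<ge> 2 / pi"
  proof -
    have "2 \<le> pi * (sqrt 2 / 2)"
    proof -
      have "(14 / 10 :: real) \<le> sqrt 2" by (rule real_le_rsqrt) (simp add: power2_eq_square)
      then have "3 * (14 / 10 / 2) \<le> pi * (sqrt 2 / 2)" using pi_gt3 by (intro mult_mono) auto
      then show ?thesis by simp
    qed
    then have "2 / pi \<le> sqrt 2 / 2" by (simp add: divide_le_eq mult.commute)
    then show ?thesis using \<open>cos z \<ge> cos (pi / 4)\<close> by (simp add: cos_45)
  qed
  then have "x * (2 / pi) \<le> sin x" unfolding z(3) using x by (intro mult_left_mono) auto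
  then have "1 / real n \<le> sin x" using n by (simp add: x_def)
  then have "arcsin (1 / real n) \<le> arcsin (sin x)" using n order_trans[of "-1" 0 "1 / real n"] by (intro arcsin_le_arcsin) auto
  also have "\<dots> = x" using x pi_gt_zero by (intro arcsin_sin) auto
  finally show ?thesis by (simp add: x_def)
qed

section \<open>Real homogeneous polynomials\<close>

definition hompoly :: "nat \<Rightarrow> (real ^ 3 \<Rightarrow> real) \<Rightarrow> bool" where
  "hompoly n U \<longleftrightarrow>
     (\<exists>c. \<forall>x. U x = (\<Sum>i\<le>n. \<Sum>j\<le>n - i. c i j * (x $ 1 ^ i * x $ 2 ^ j * x $ 3 ^ (n - i - j))))"

lemma hompoly_add:
  assumes "hompoly n U" "hompoly n V"
  shows "hompoly n (\<lambda>x. U x + V x)"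
proof -
  obtain c d where
    "\<forall>x. U x = (\<Sum>i\<le>n. \<Sum>j\<le>n - i. c i j * (x $ 1 ^ i * x $ 2 ^ j * x $ 3 ^ (n - i - j)))"
    "\<forall>x. V x = (\<Sum>i\<le>n. \<Sum>j\<le>n - i. d i j * (x $ 1 ^ i * x $ 2 ^ j * x $ 3 ^ (n - i - j)))"
    using assms unfolding hompoly_def by blast
  then show ?thesis unfolding hompoly_def
    by (intro exI[of _ "\<lambda>i j. c i j + d i j"]) (simp add: sum.distrib algebra_simps)
qed

lemma hompoly_cmul:
  assumes "hompoly n U"
  shows "hompoly n (\<lambda>x. a * U x)"
proof -
  obtain c where "\<forall>x. U x = (\<Sum>i\<le>n. \<Sum>j\<le>n - i. c i j * (x $ 1 ^ i * x $ 2 ^ j * x $ 3 ^ (n - i - j)))"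
    using assms unfolding hompoly_def by blast
  then show ?thesis unfolding hompoly_def
    by (intro exI[of _ "\<lambda>i j. a * c i j"]) (simp add: sum_distrib_left mult_ac)
qed

lemma hompoly_zero: "hompoly n (\<lambda>x. 0)"
  unfolding hompoly_def by (rule exI[of _ "\<lambda>i j. 0"]) simp

lemma hompoly_sum:
  assumes "\<And>i. i \<in> A \<Longrightarrow> hompoly n (f i)"
  shows "hompoly n (\<lambda>x. \<Sum>i\<in>A. f i x)"
  using assms by (induction A rule: infinite_finite_induct) (auto intro: hompoly_zero hompoly_add)

lemma sum_delta_mult:
  fixes f :: "'a \<Rightarrow> real"
  assumes "finite A" "i \<in> A"
  shows "(\<Sum>k\<in>A. (if k = i then c else 0) * f k) = c * f i"
proof -
  have "(\<Sum>k\<in>A. (if k = i then c else 0) * f k) = (\<Sum>k\<in>{i}. (if k = i then c else 0) * f k)"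
    using assms by (intro sum.mono_neutral_right) auto
  then show ?thesis by simp
qed

lemma hompoly_monomial:
  assumes "i + j + k = n"
  shows "hompoly n (\<lambda>x. x $ 1 ^ i * x $ 2 ^ j * x $ 3 ^ k)"
  unfolding hompoly_def
proof (intro exI[of _ "\<lambda>i' j'. (if i' = i then 1 else 0) * (if j' = j then 1 else 0)"] allI)
  fix x :: "real ^ 3"
  have k: "k = n - i - j" "i \<in> {..n}" "j \<in> {..n - i}" using assms by auto
  have "(\<Sum>i'\<le>n. \<Sum>j'\<le>n - i'. (if i' = i then 1 else 0) * (if j' = j then 1 else 0) * (x $ 1 ^ i' * x $ 2 ^ j' * x $ 3 ^ (n - i' - j')))
    = (\<Sum>i'\<le>n. (if i' = i then 1 else 0) * (\<Sum>j'\<le>n - i'. (if j' = j then 1 else 0) * (x $ 1 ^ i' * x $ 2 ^ j' * x $ 3 ^ (n - i' - j'))))"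
    by (simp only: sum_distrib_left mult.assoc)
  also have "\<dots> = x $ 1 ^ i * x $ 2 ^ j * x $ 3 ^ k"
    using k by (simp only: sum_delta_mult finite_atMost)
  finally show "x $ 1 ^ i * x $ 2 ^ j * x $ 3 ^ k =
    (\<Sum>i'\<le>n. \<Sum>j'\<le>n - i'. (if i' = i then 1 else 0) * (if j' = j then 1 else 0) * (x $ 1 ^ i' * x $ 2 ^ j' * x $ 3 ^ (n - i' - j')))"
    by (rule sym)
qed

text \<open>Homogeneous polynomials as the linear span of the monomials of degree n; this keeps the
  double sum out of the later proofs.\<close>

lemma hompoly_induct [consumes 1, case_names monomial add cmul]:
  assumes "hompoly n U"
    and "\<And>i j k. i + j + k = n \<Longrightarrow> P (\<lambda>x. x $ 1 ^ i * x $ 2 ^ j * x $ 3 ^ k)"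
    and "\<And>U V. P U \<Longrightarrow> P V \<Longrightarrow> P (\<lambda>x. U x + V x)" and "\<And>a U. P U \<Longrightarrow> P (\<lambda>x. a * U x)"
  shows "P U"
proof -
  obtain c where c: "U = (\<lambda>x. \<Sum>i\<le>n. \<Sum>j\<le>n - i. c i j * (x $ 1 ^ i * x $ 2 ^ j * x $ 3 ^ (n - i - j)))"
    using assms(1) unfolding hompoly_def by blast
  have P0: "P (\<lambda>x. 0)" using assms(4)[OF assms(2)[of n 0 0], of 0] by simp
  have Ps: "P (\<lambda>x. \<Sum>i\<in>A. f i x)" if "\<And>i. i \<in> A \<Longrightarrow> P (f i)" for A :: "nat set" and f
    using that by (induction A rule: infinite_finite_induct) (auto intro: P0 assms(3))
  show ?thesis unfolding c by (intro Ps assms(4) assms(2)) auto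
qed

lemma hompoly_inner_mult:
  assumes "hompoly n U"
  shows "hompoly (Suc n) (\<lambda>x. (a \<bullet> x) * U x)"
  using assms
proof (induction rule: hompoly_induct)
  case (monomial i j k)
  have "hompoly (Suc n) (\<lambda>x. a $ 1 * (x $ 1 ^ Suc i * x $ 2 ^ j * x $ 3 ^ k) +
     (a $ 2 * (x $ 1 ^ i * x $ 2 ^ Suc j * x $ 3 ^ k) + a $ 3 * (x $ 1 ^ i * x $ 2 ^ j * x $ 3 ^ Suc k)))"
    using monomial by (intro hompoly_add hompoly_cmul hompoly_monomial) auto
  then show ?case by (simp add: inner_vec_def sum_3 algebra_simps)
next
  case (add U V)
  then show ?case using hompoly_add by (simp add: distrib_left)
next
  case (cmul b U)
  then show ?case using hompoly_cmul[of "Suc n" "\<lambda>x. (a \<bullet> x) * U x" b] by (simp add: mult_ac)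
qed

lemma hompoly_1: "hompoly 0 (\<lambda>x. 1)"
  using hompoly_monomial[of 0 0 0 0] by simp

lemma hompoly_inner_powers:
  "hompoly (i + j + k) (\<lambda>x. (a \<bullet> x) ^ i * (b \<bullet> x) ^ j * (c \<bullet> x) ^ k)"
proof -
  have 1: "hompoly m (\<lambda>x. (c \<bullet> x) ^ m)" for m
    by (induction m) (auto intro: hompoly_1 hompoly_inner_mult)
  have 2: "hompoly (m + k) (\<lambda>x. (b \<bullet> x) ^ m * (c \<bullet> x) ^ k)" for m
    by (induction m) (auto intro: 1 hompoly_inner_mult simp: mult.assoc)
  have "hompoly (m + (j + k)) (\<lambda>x. (a \<bullet> x) ^ m * ((b \<bullet> x) ^ j * (c \<bullet> x) ^ k))" for m
    by (induction m) (auto intro: 2 hompoly_inner_mult simp: mult.assoc)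
  then show ?thesis by (simp add: mult.assoc add.assoc)
qed

lemma hompoly_homogeneous:
  assumes "hompoly n U"
  shows "U (t *\<^sub>R x) = t ^ n * U x"
  using assms
proof (induction rule: hompoly_induct)
  case (monomial i j k)
  have "t ^ n = t ^ i * t ^ j * t ^ k" using monomial by (simp flip: power_add)
  then show ?case by (simp add: power_mult_distrib)
qed (simp_all add: algebra_simps)

text \<open>Replacing the coordinate axes by a frame allows every point of the sphere to be taken as
  the pole of cylindrical coordinates.\<close>

lemma hompoly_compose_linear:
  assumes "hompoly n U"
  shows "hompoly n (\<lambda>x. U (x $ 1 *\<^sub>R e1 + x $ 2 *\<^sub>R e2 + x $ 3 *\<^sub>R e3))"
  using assms
proof (induction rule: hompoly_induct)
  case (monomial i j k)
  define v :: "3 \<Rightarrow> real ^ 3" where "v = (\<lambda>l. vector [e1 $ l, e2 $ l, e3 $ l])"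
  have "(x $ 1 *\<^sub>R e1 + x $ 2 *\<^sub>R e2 + x $ 3 *\<^sub>R e3) $ l = v l \<bullet> x" for x l
    by (simp add: v_def inner_vec_def sum_3 mult.commute)
  then show ?case using hompoly_inner_powers[of i j k "v 1" "v 2" "v 3"] monomial by simp
qed (auto intro: hompoly_add hompoly_cmul)

lemma hompoly_polynomial:
  assumes "hompoly n U"
  shows "real_polynomial_function U"
  using assms
proof (induction rule: hompoly_induct)
  case (monomial i j k)
  have "real_polynomial_function (\<lambda>x :: real ^ 3. x $ l)" for l
    by (intro real_polynomial_function.intros(1) bounded_linear_vec_nth)
  then show ?case by (intro real_polynomial_function.intros(4) real_polynomial_function_power)
qed (auto intro: real_polynomial_function.intros)

section \<open>Gradients of polynomials\<close>

text \<open>Hadamard's lemma: the factor is jointly continuous, which replaces mean value estimates below.\<close>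

lemma polynomial_difference:
  fixes f :: "'a::euclidean_space \<Rightarrow> real"
  assumes "real_polynomial_function f"
  shows "\<exists>\<Phi> :: 'a \<times> 'a \<Rightarrow> 'a. polynomial_function \<Phi> \<and> (\<forall>x y. f x - f y = \<Phi> (x, y) \<bullet> (x - y))"
  using assms
proof (induction rule: real_polynomial_function.induct)
  case (linear f)
  then have l: "linear f" by (simp add: bounded_linear.linear)
  have "f h = adjoint f 1 \<bullet> h" for h
    using adjoint_works[OF l, of h 1] by (simp add: inner_commute)
  then show ?case
    by (intro exI[of _ "\<lambda>_. adjoint f 1"]) (simp add: inner_diff_right)
next
  case (const c)
  show ?case by (intro exI[of _ "\<lambda>_. 0"]) simp
next
  case (add f g)
  then obtain F G where "polynomial_function F" "\<forall>x y. f x - f y = F (x, y) \<bullet> (x - y)"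
    "polynomial_function G" "\<forall>x y. g x - g y = G (x, y) \<bullet> (x - y)" by blast
  then show ?case
    by (intro exI[of _ "\<lambda>z. F z + G z"]) (auto simp: inner_add_left add_diff_add)
next
  case (mult f g)
  then obtain F G where F: "polynomial_function F" "\<forall>x y. f x - f y = F (x, y) \<bullet> (x - y)"
    and G: "polynomial_function G" "\<forall>x y. g x - g y = G (x, y) \<bullet> (x - y)" by blast
  have "polynomial_function (\<lambda>z :: 'a \<times> 'a. fst z)" "polynomial_function (\<lambda>z :: 'a \<times> 'a. snd z)"
    by (auto intro!: polynomial_function_bounded_linear bounded_linear_fst bounded_linear_snd)
  then have "real_polynomial_function (g \<circ> (\<lambda>z :: 'a \<times> 'a. fst z))" "real_polynomial_function (f \<circ> (\<lambda>z :: 'a \<times> 'a. snd z))"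
    using mult by (auto intro!: real_polynomial_function_compose)
  then have p: "polynomial_function (\<lambda>z :: 'a \<times> 'a. g (fst z))" "polynomial_function (\<lambda>z :: 'a \<times> 'a. f (snd z))"
    by (simp_all add: o_def real_polynomial_function_eq)
  have "polynomial_function (\<lambda>z. g (fst z) *\<^sub>R F z + f (snd z) *\<^sub>R G z)"
    using F(1) G(1) p by (intro polynomial_function_add polynomial_function_mult)
  moreover have "f x * g x - f y * g y = (g (fst (x, y)) *\<^sub>R F (x, y) + f (snd (x, y)) *\<^sub>R G (x, y)) \<bullet> (x - y)" for x y
  proof -
    have "f x * g x - f y * g y = g x * (f x - f y) + f y * (g x - g y)" by (simp add: algebra_simps)
    then show ?thesis using F(2) G(2) by (simp add: inner_add_left)
  qed
  ultimately show ?case by blast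
qed

lemma has_derivative_polynomial_difference:
  fixes f :: "'a::euclidean_space \<Rightarrow> real"
  assumes "polynomial_function \<Phi>" "\<And>x y. f x - f y = \<Phi> (x, y) \<bullet> (x - y)"
  shows "(f has_derivative (\<lambda>h. \<Phi> (x, x) \<bullet> h)) (at x)"
proof (rule has_derivativeI_sandwich[of 1 _ _ _ _ "\<lambda>y. norm (\<Phi> (y, x) - \<Phi> (x, x))"])
  show "bounded_linear (\<lambda>h. \<Phi> (x, x) \<bullet> h)" by (rule bounded_linear_inner_right)
  have c1: "isCont \<Phi> (x, x)" using assms(1) by (rule continuous_polymonial_function)
  have c2: "isCont (\<lambda>y. (y, x)) x" by (intro continuous_intros)
  have "isCont (\<lambda>y. \<Phi> (y, x)) x" using isCont_o2[OF c2 c1] .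
  then have "((\<lambda>y. \<Phi> (y, x) - \<Phi> (x, x)) \<longlongrightarrow> \<Phi> (x, x) - \<Phi> (x, x)) (at x)"
    unfolding isCont_def by (intro tendsto_diff tendsto_const)
  then show "((\<lambda>y. norm (\<Phi> (y, x) - \<Phi> (x, x))) \<longlongrightarrow> 0) (at x)"
    by (simp add: tendsto_norm_zero)
  fix y assume "y \<noteq> x"
  have "f y - f x - \<Phi> (x, x) \<bullet> (y - x) = (\<Phi> (y, x) - \<Phi> (x, x)) \<bullet> (y - x)"
    using assms(2)[of y x] by (simp add: inner_diff_left)
  then have "norm (f y - f x - \<Phi> (x, x) \<bullet> (y - x)) \<le> norm (\<Phi> (y, x) - \<Phi> (x, x)) * norm (y - x)"
    using Cauchy_Schwarz_ineq2 by simp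
  then show "norm (f y - f x - \<Phi> (x, x) \<bullet> (y - x)) / norm (y - x) \<le> norm (\<Phi> (y, x) - \<Phi> (x, x))"
    using \<open>y \<noteq> x\<close> by (simp add: divide_le_eq)
qed simp

definition gradient :: "('a::euclidean_space \<Rightarrow> real) \<Rightarrow> 'a \<Rightarrow> 'a" where
  "gradient f x = (SOME g. (f has_derivative (\<lambda>h. g \<bullet> h)) (at x))"

lemma gradient_eq:
  assumes "(f has_derivative (\<lambda>h. g \<bullet> h)) (at x)"
  shows "gradient f x = g"
proof -
  have "(f has_derivative (\<lambda>h. gradient f x \<bullet> h)) (at x)"
    unfolding gradient_def using assms by (rule someI)
  then have "(\<lambda>h. gradient f x \<bullet> h) = (\<lambda>h. g \<bullet> h)" using assms by (rule has_derivative_unique)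
  then show ?thesis by (metis inner_eq_zero_iff inner_diff_left right_minus_eq)
qed

lemma polynomial_difference_gradient:
  fixes f :: "'a::euclidean_space \<Rightarrow> real"
  assumes "real_polynomial_function f"
  shows "\<exists>\<Phi> :: 'a \<times> 'a \<Rightarrow> 'a. polynomial_function \<Phi> \<and>
    (\<forall>x y. f x - f y = \<Phi> (x, y) \<bullet> (x - y)) \<and> (\<forall>x. \<Phi> (x, x) = gradient f x)"
  using polynomial_difference[OF assms] has_derivative_polynomial_difference gradient_eq by metis

lemma has_derivative_gradient:
  fixes f :: "'a::euclidean_space \<Rightarrow> real"
  assumes "real_polynomial_function f"
  shows "(f has_derivative (\<lambda>h. gradient f x \<bullet> h)) (at x)"
  using polynomial_difference_gradient[OF assms] has_derivative_polynomial_difference by metis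

lemma polynomial_function_gradient:
  fixes f :: "'a::euclidean_space \<Rightarrow> real"
  assumes "real_polynomial_function f"
  shows "polynomial_function (gradient f)"
proof -
  obtain \<Phi> :: "'a \<times> 'a \<Rightarrow> 'a" where P: "polynomial_function \<Phi>" "\<forall>x. \<Phi> (x, x) = gradient f x"
    using polynomial_difference_gradient[OF assms] by blast
  have "polynomial_function (\<lambda>x :: 'a. (x, x))"
    by (intro polynomial_function_bounded_linear bounded_linear_Pair bounded_linear_ident)
  then have "polynomial_function (\<Phi> \<circ> (\<lambda>x. (x, x)))"
    using P(1) by (rule polynomial_function_compose)
  then show ?thesis using P(2) by (simp add: o_def)
qed

definition hessian :: "('a::euclidean_space \<Rightarrow> real) \<Rightarrow> 'a \<Rightarrow> 'a \<Rightarrow> 'a" where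
  "hessian f x = frechet_derivative (gradient f) (at x)"

lemma has_derivative_hessian:
  fixes f :: "'a::euclidean_space \<Rightarrow> real"
  assumes "real_polynomial_function f"
  shows "(gradient f has_derivative hessian f x) (at x)"
  unfolding hessian_def
  using differentiable_at_polynomial_function[OF polynomial_function_gradient[OF assms]]
  by (simp add: frechet_derivative_works)

lemma linear_hessian:
  fixes f :: "'a::euclidean_space \<Rightarrow> real"
  assumes "real_polynomial_function f"
  shows "linear (hessian f x)"
  using has_derivative_hessian[OF assms] by (rule has_derivative_linear)

lemma DERIV_along_path:
  fixes f :: "'a::euclidean_space \<Rightarrow> real"
  assumes "real_polynomial_function f" "(\<gamma> has_vector_derivative v) (at t)"
  shows "((\<lambda>t. f (\<gamma> t)) has_real_derivative gradient f (\<gamma> t) \<bullet> v) (at t)"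
proof -
  have "((f \<circ> \<gamma>) has_derivative (\<lambda>h. gradient f (\<gamma> t) \<bullet> (h *\<^sub>R v))) (at t)"
    using diff_chain_at[OF assms(2)[unfolded has_vector_derivative_def] has_derivative_gradient[OF assms(1)]]
    by (simp add: o_def)
  then show ?thesis by (simp add: has_field_derivative_def o_def mult_commute_abs)
qed

lemma DERIV_gradient_along_path:
  fixes f :: "'a::euclidean_space \<Rightarrow> real"
  assumes "real_polynomial_function f" "(\<gamma> has_vector_derivative v) (at t)"
    "(w has_vector_derivative w') (at t)"
  shows "((\<lambda>t. gradient f (\<gamma> t) \<bullet> w t) has_real_derivative
    hessian f (\<gamma> t) v \<bullet> w t + gradient f (\<gamma> t) \<bullet> w') (at t)"
proof -
  have "((gradient f \<circ> \<gamma>) has_derivative (\<lambda>h. hessian f (\<gamma> t) (h *\<^sub>R v))) (at t)"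
    using diff_chain_at[OF assms(2)[unfolded has_vector_derivative_def] has_derivative_hessian[OF assms(1)]]
    by (simp add: o_def)
  then have "((\<lambda>t. gradient f (\<gamma> t)) has_derivative (\<lambda>h. h *\<^sub>R hessian f (\<gamma> t) v)) (at t)"
    by (simp add: o_def linear_scale[OF linear_hessian[OF assms(1)]])
  from has_derivative_inner[OF this assms(3)[unfolded has_vector_derivative_def]]
  show ?thesis unfolding has_field_derivative_def
    by (rule has_derivative_eq_rhs) (auto simp: algebra_simps)
qed

lemma DERIV_line:
  fixes f :: "'a::euclidean_space \<Rightarrow> real"
  assumes "real_polynomial_function f"
  shows "((\<lambda>t. f (p + t *\<^sub>R e)) has_real_derivative gradient f (p + t *\<^sub>R e) \<bullet> e) (at t)"
    "((\<lambda>t. gradient f (p + t *\<^sub>R e) \<bullet> e) has_real_derivative hessian f (p + t *\<^sub>R e) e \<bullet> e) (at t)"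
proof -
  have d: "((\<lambda>t. p + t *\<^sub>R e) has_vector_derivative e) (at t)"
    by (auto intro!: derivative_eq_intros)
  show "((\<lambda>t. f (p + t *\<^sub>R e)) has_real_derivative gradient f (p + t *\<^sub>R e) \<bullet> e) (at t)"
    by (rule DERIV_along_path[OF assms d])
  show "((\<lambda>t. gradient f (p + t *\<^sub>R e) \<bullet> e) has_real_derivative hessian f (p + t *\<^sub>R e) e \<bullet> e) (at t)"
    using DERIV_gradient_along_path[OF assms d has_vector_derivative_const[of e]] by simp
qed

section \<open>Orthonormal frames\<close>

definition frame :: "(3 \<Rightarrow> real ^ 3) \<Rightarrow> bool" where
  "frame E \<longleftrightarrow> (\<forall>i j. E i \<bullet> E j = (if i = j then 1 else 0))"

definition frame_point :: "(3 \<Rightarrow> real ^ 3) \<Rightarrow> real \<Rightarrow> real \<Rightarrow> real \<Rightarrow> real ^ 3" where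
  "frame_point E x y z = x *\<^sub>R E 1 + y *\<^sub>R E 2 + z *\<^sub>R E 3"

lemma frame_coordinates:
  assumes "frame E"
  shows "frame_point E x y z \<bullet> E 1 = x" "frame_point E x y z \<bullet> E 2 = y" "frame_point E x y z \<bullet> E 3 = z"
  using assms by (auto simp: frame_def frame_point_def inner_add_left)

lemma frame_inner:
  assumes "frame E"
  shows "frame_point E x y z \<bullet> frame_point E x' y' z' = x * x' + y * y' + z * z'"
  using assms by (auto simp: frame_def frame_point_def inner_add_left inner_add_right)

lemma frame_norm:
  assumes "frame E"
  shows "(norm (frame_point E x y z))\<^sup>2 = x\<^sup>2 + y\<^sup>2 + z\<^sup>2"
  by (simp add: power2_norm_eq_inner frame_inner[OF assms]) (simp add: power2_eq_square)

lemma frame_transpose: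
  assumes "frame E"
  shows "(\<Sum>l\<in>UNIV. E l $ i * E l $ j) = (if i = j then 1 else 0)"
proof -
  define A :: "real ^ 3 ^ 3" where "A = (\<chi> l. E l)"
  have "(A ** transpose A) $ l $ m = E l \<bullet> E m" for l m
    by (simp add: A_def matrix_matrix_mult_def transpose_def inner_vec_def)
  then have "A ** transpose A = mat 1"
    using assms by (simp add: vec_eq_iff mat_def frame_def)
  then have "transpose A ** A = mat 1" by (rule matrix_left_right_inverse[THEN iffD1])
  then have "(transpose A ** A) $ i $ j = mat 1 $ i $ j" by simp
  then show ?thesis by (simp add: A_def matrix_matrix_mult_def transpose_def mat_def)
qed

lemma frame_expand:
  assumes "frame E"
  shows "x = frame_point E (x \<bullet> E 1) (x \<bullet> E 2) (x \<bullet> E 3)"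
proof -
  have "(\<Sum>l\<in>UNIV. (x \<bullet> E l) *\<^sub>R E l) $ i = x $ i" for i
  proof -
    have "(\<Sum>l\<in>UNIV. (x \<bullet> E l) *\<^sub>R E l) $ i = (\<Sum>l\<in>UNIV. \<Sum>j\<in>UNIV. x $ j * (E l $ j * E l $ i))"
      by (simp add: inner_vec_def sum_distrib_right mult.assoc)
    also have "\<dots> = (\<Sum>j\<in>UNIV. x $ j * (\<Sum>l\<in>UNIV. E l $ j * E l $ i))"
      by (subst sum.swap) (simp add: sum_distrib_left)
    also have "\<dots> = x $ i" by (simp add: frame_transpose[OF assms] if_distrib sum.delta cong: if_cong)
    finally show ?thesis .
  qed
  then have "x = (\<Sum>l\<in>UNIV. (x \<bullet> E l) *\<^sub>R E l)" by (simp add: vec_eq_iff)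
  then show ?thesis by (simp add: frame_point_def sum_3)
qed

text \<open>The trace of a linear map is the same in all orthonormal frames.
  \<open>laplacian\<close> differentiates along the coordinate axes, whereas the cylindrical
  expansion needs the frame of radial, angular and axial directions.\<close>

lemma frame_trace:
  assumes "frame E" "linear H"
  shows "(\<Sum>l\<in>UNIV. H (E l) \<bullet> E l) = (\<Sum>i\<in>UNIV. H (axis i 1) \<bullet> axis i 1)"
proof -
  have H: "H x = (\<Sum>j\<in>UNIV. x $ j *\<^sub>R H (axis j 1))" for x
  proof -
    have "x = (\<Sum>j\<in>UNIV. x $ j *\<^sub>R axis j 1)" using basis_expansion[of x] by (simp add: scalar_mult_eq_scaleR)
    then have "H x = H (\<Sum>j\<in>UNIV. x $ j *\<^sub>R axis j 1)" by simp
    also have "\<dots> = (\<Sum>j\<in>UNIV. x $ j *\<^sub>R H (axis j 1))" using assms(2) by (simp add: linear_sum linear_scale)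
    finally show ?thesis .
  qed
  have "(\<Sum>l\<in>UNIV. H (E l) \<bullet> E l) = (\<Sum>l\<in>UNIV. \<Sum>i\<in>UNIV. \<Sum>j\<in>UNIV. H (axis j 1) $ i * (E l $ j * E l $ i))"
    by (subst H) (simp add: inner_vec_def sum_distrib_left sum_distrib_right mult_ac)
  also have "\<dots> = (\<Sum>i\<in>UNIV. \<Sum>j\<in>UNIV. H (axis j 1) $ i * (\<Sum>l\<in>UNIV. E l $ j * E l $ i))"
    by (subst sum.swap, rule sum.cong[OF refl], subst sum.swap) (simp add: sum_distrib_left)
  also have "\<dots> = (\<Sum>j\<in>UNIV. H (axis j 1) \<bullet> axis j 1)"
    by (simp add: frame_transpose[OF assms(1)] inner_axis if_distrib sum.delta cong: if_cong)
  finally show ?thesis .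
qed

lemma frame_exists2:
  assumes "norm a = 1" "norm v = 1" "a \<bullet> v = 0"
  shows "\<exists>E. frame E \<and> E 3 = a \<and> E 1 = v"
proof -
  define E :: "3 \<Rightarrow> real ^ 3" where "E = (\<lambda>i. if i = 1 then v else if i = 2 then cross3 a v else a)"
  have aa: "a \<bullet> a = 1" "v \<bullet> v = 1" using assms by (simp_all add: dot_square_norm)
  have cc: "cross3 a v \<bullet> cross3 a v = 1"
    using norm_cross_dot[of a v] assms by (simp add: power2_norm_eq_inner)
  have "frame E" unfolding frame_def
    using aa cc assms by (auto simp: E_def forall_3 dot_cross_self inner_commute)
  then show ?thesis by (intro exI[of _ E]) (auto simp: E_def)
qed

lemma frame_exists:
  assumes "norm a = 1"
  shows "\<exists>E. frame E \<and> E 3 = a"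
proof -
  obtain y where y: "y \<noteq> 0" "orthogonal a y"
    using orthogonal_to_vector_exists[of a] by auto
  then have "norm (y /\<^sub>R norm y) = 1" "a \<bullet> (y /\<^sub>R norm y) = 0" by (auto simp: orthogonal_def)
  then show ?thesis using frame_exists2[OF assms] by blast
qed

section \<open>Cylindrical expansion of a harmonic polynomial\<close>

text \<open>The monomials are collected by their degree d in the two horizontal coordinates: the
  radius then enters as r^d, and the angle through a binary form of degree d.\<close>

lemma hompoly_cylindrical:
  assumes "hompoly n U"
  shows "\<exists>C. \<forall>r \<phi> z. U (frame_point E (r * cos \<phi>) (r * sin \<phi>) z) =
    (\<Sum>d\<le>n. r ^ d * z ^ (n - d) * trig_form d (C d) \<phi>)"
proof -
  obtain c where c: "\<forall>x :: real ^ 3. U (x $ 1 *\<^sub>R E 1 + x $ 2 *\<^sub>R E 2 + x $ 3 *\<^sub>R E 3) =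
      (\<Sum>i\<le>n. \<Sum>j\<le>n - i. c i j * (x $ 1 ^ i * x $ 2 ^ j * x $ 3 ^ (n - i - j)))"
    using hompoly_compose_linear[OF assms, of "E 1" "E 2" "E 3"] unfolding hompoly_def by blast
  have "U (frame_point E (r * cos \<phi>) (r * sin \<phi>) z) =
    (\<Sum>d\<le>n. r ^ d * z ^ (n - d) * trig_form d (\<lambda>i. c i (d - i)) \<phi>)" for r \<phi> z
  proof -
    define g where "g = (\<lambda>i j. c i j * ((r * cos \<phi>) ^ i * (r * sin \<phi>) ^ j * z ^ (n - i - j)))"
    have "U (frame_point E (r * cos \<phi>) (r * sin \<phi>) z) = (\<Sum>i\<le>n. \<Sum>j\<le>n - i. g i j)"
      using c[rule_format, of "vector [r * cos \<phi>, r * sin \<phi>, z]"]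
      by (simp add: frame_point_def g_def vector_3)
    also have "\<dots> = (\<Sum>(i, j)\<in>(SIGMA i:{..n}. {..n - i}). g i j)" by (simp add: sum.Sigma)
    also have "(SIGMA i:{..n}. {..n - i}) = {(i, j). i + j \<le> n}" by auto
    also have "(\<Sum>(i, j)\<in>{(i, j). i + j \<le> n}. g i j) = (\<Sum>d\<le>n. \<Sum>i\<le>d. g i (d - i))"
      by (rule sum.triangle_reindex_eq)
    also have "\<dots> = (\<Sum>d\<le>n. r ^ d * z ^ (n - d) * trig_form d (\<lambda>i. c i (d - i)) \<phi>)"
    proof (intro sum.cong refl)
      fix d assume d: "d \<in> {..n}"
      have "g i (d - i) = r ^ d * z ^ (n - d) * (c i (d - i) * cos \<phi> ^ i * sin \<phi> ^ (d - i))" if "i \<le> d" for i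
      proof -
        have "r ^ d = r ^ i * r ^ (d - i)" "n - i - (d - i) = n - d" using that d by (auto simp flip: power_add)
        then show ?thesis by (simp add: g_def power_mult_distrib mult_ac)
      qed
      then show "(\<Sum>i\<le>d. g i (d - i)) = r ^ d * z ^ (n - d) * trig_form d (\<lambda>i. c i (d - i)) \<phi>"
        by (simp add: trig_form_def sum_distrib_left)
    qed
    finally show ?thesis .
  qed
  then show ?thesis by (intro exI[of _ "\<lambda>d i. c i (d - i)"]) simp
qed

lemma DERIV_power_ident: "((\<lambda>x. x ^ k) has_real_derivative real k * x ^ (k - 1)) (at (x :: real))"
  using DERIV_pow[of k x UNIV] by simp

text \<open>Differentiation sends cos^i sin^(d - i) to its two neighbours of the same total degree;
  \<open>m i k\<close> are the matrix entries. Derivatives of the angular parts are therefore forms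
  again, hence continuous, bounded and periodic.\<close>

lemma trig_form_DERIV:
  "\<exists>D'. \<forall>t. (trig_form d D has_real_derivative trig_form d D' t) (at t)"
proof -
  define m where "m = (\<lambda>i k. (if Suc k = i then - real i else 0) + (if k = Suc i then real (d - i) else 0))"
  have pw: "sin t ^ (d - k) = sin t * sin t ^ (d - Suc k)" if "Suc k \<le> d" for k and t :: real
    using that by (metis Suc_diff_le diff_Suc_Suc power_Suc)
  have mono: "((\<lambda>t. cos t ^ i * sin t ^ (d - i)) has_real_derivative (\<Sum>k\<le>d. m i k * cos t ^ k * sin t ^ (d - k))) (at t)"
    if i: "i \<le> d" for i t
  proof -
    have "((\<lambda>t. cos t ^ i * sin t ^ (d - i)) has_real_derivative
       - (real i * cos t ^ (i - 1) * sin t ^ (d - i + 1)) + real (d - i) * cos t ^ (i + 1) * sin t ^ (d - i - 1)) (at t)"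
      by (rule DERIV_cong[OF DERIV_mult[OF DERIV_power[OF DERIV_cos] DERIV_power[OF DERIV_sin]]])
         (simp add: mult_ac)
    also have "(- (real i * cos t ^ (i - 1) * sin t ^ (d - i + 1)) + real (d - i) * cos t ^ (i + 1) * sin t ^ (d - i - 1))
       = (\<Sum>k\<le>d. m i k * cos t ^ k * sin t ^ (d - k))"
    proof -
      have "(\<Sum>k\<le>d. m i k * cos t ^ k * sin t ^ (d - k)) =
         (\<Sum>k\<le>d. (if Suc k = i then - real i * cos t ^ (i - 1) * sin t ^ (d - i + 1) else 0)) +
         (\<Sum>k\<le>d. (if k = Suc i then real (d - i) * cos t ^ (i + 1) * sin t ^ (d - i - 1) else 0))"
        unfolding sum.distrib[symmetric] using i
        by (intro sum.cong refl) (auto simp: m_def algebra_simps pw)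
      also have "(\<Sum>k\<le>d. (if Suc k = i then - real i * cos t ^ (i - 1) * sin t ^ (d - i + 1) else 0))
         = - (real i * cos t ^ (i - 1) * sin t ^ (d - i + 1))"
        using i by (cases i) (simp_all add: sum.delta algebra_simps)
      also have "(\<Sum>k\<le>d. (if k = Suc i then real (d - i) * cos t ^ (i + 1) * sin t ^ (d - i - 1) else 0))
         = real (d - i) * cos t ^ (i + 1) * sin t ^ (d - i - 1)"
        using i by (auto simp: sum.delta)
      finally show ?thesis by simp
    qed
    finally show ?thesis .
  qed
  have "(trig_form d D has_real_derivative trig_form d (\<lambda>k. \<Sum>i\<le>d. D i * m i k) t) (at t)" for t
  proof -
    have "((\<lambda>t. \<Sum>i\<le>d. D i * (cos t ^ i * sin t ^ (d - i))) has_real_derivative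
       (\<Sum>i\<le>d. D i * (\<Sum>k\<le>d. m i k * cos t ^ k * sin t ^ (d - k)))) (at t)"
      by (intro DERIV_sum DERIV_cmult mono) auto
    moreover have "(\<Sum>i\<le>d. D i * (\<Sum>k\<le>d. m i k * cos t ^ k * sin t ^ (d - k))) = trig_form d (\<lambda>k. \<Sum>i\<le>d. D i * m i k) t"
      unfolding trig_form_def sum_distrib_left sum_distrib_right
      by (subst sum.swap) (simp add: mult_ac)
    ultimately show ?thesis by (simp add: trig_form_def[abs_def] mult.assoc)
  qed
  then show ?thesis by blast
qed

definition harmonic_poly :: "nat \<Rightarrow> (real ^ 3 \<Rightarrow> real) \<Rightarrow> bool" where
  "harmonic_poly n U \<longleftrightarrow> hompoly n U \<and> (\<forall>x. (\<Sum>i\<in>UNIV. hessian U x (axis i 1) \<bullet> axis i 1) = 0)"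

text \<open>The angular parts \<open>T d\<close> of a harmonic polynomial in cylindrical coordinates, with their first
  and second derivatives; the last clause is Laplace's equation.\<close>

definition cylindrical ::
  "nat \<Rightarrow> (real ^ 3 \<Rightarrow> real) \<Rightarrow> (3 \<Rightarrow> real ^ 3) \<Rightarrow> (nat \<Rightarrow> real \<Rightarrow> real) \<Rightarrow> (nat \<Rightarrow> real \<Rightarrow> real) \<Rightarrow>
    (nat \<Rightarrow> real \<Rightarrow> real) \<Rightarrow> bool" where
  "cylindrical n U E T T1 T2 \<longleftrightarrow>
     (\<forall>r \<phi> z. U (frame_point E (r * cos \<phi>) (r * sin \<phi>) z) = (\<Sum>d\<le>n. r ^ d * z ^ (n - d) * T d \<phi>)) \<and>
     (\<forall>d. \<exists>D. T d = trig_form d D) \<and> (\<forall>d. \<exists>D. T1 d = trig_form d D) \<and> (\<forall>d. \<exists>D. T2 d = trig_form d D) \<and>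
     (\<forall>d \<phi>. (T d has_real_derivative T1 d \<phi>) (at \<phi>)) \<and> (\<forall>d \<phi>. (T1 d has_real_derivative T2 d \<phi>) (at \<phi>)) \<and>
     (\<forall>d \<phi>. d \<le> n \<longrightarrow> (real d)\<^sup>2 * T d \<phi> + T2 d \<phi> +
        (if 2 \<le> d then real (n - (d - 2)) * (real (n - (d - 2)) - 1) * T (d - 2) \<phi> else 0) = 0)"

text \<open>In cylindrical coordinates r^2 times the Laplacian is r^2 U_rr + r U_r + U_\<phi>\<phi>
  + r^2 U_zz. At height z = 1 this is a polynomial in r that vanishes identically, and its
  coefficient of r^d is the last clause of \<open>cylindrical\<close>; U_zz contributes the shift
  from d - 2 to d.\<close>

lemma cylindrical_exists:
  assumes U: "harmonic_poly n U" and E: "frame E"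
  shows "\<exists>T T1 T2. cylindrical n U E T T1 T2"
proof -
  have hU: "hompoly n U" and lap: "\<And>x. (\<Sum>i\<in>UNIV. hessian U x (axis i 1) \<bullet> axis i 1) = 0"
    using U by (auto simp: harmonic_poly_def)
  have pU: "real_polynomial_function U" using hU by (rule hompoly_polynomial)
  obtain C where C: "\<And>r \<phi> z. U (frame_point E (r * cos \<phi>) (r * sin \<phi>) z) =
    (\<Sum>d\<le>n. r ^ d * z ^ (n - d) * trig_form d (C d) \<phi>)"
    using hompoly_cylindrical[OF hU, of E] by blast
  obtain D1 where D1: "\<And>d D t. (trig_form d D has_real_derivative trig_form d (D1 d D) t) (at t)"
    using trig_form_DERIV by metis
  define T T1 T2 where "T = (\<lambda>d. trig_form d (C d))" and "T1 = (\<lambda>d. trig_form d (D1 d (C d)))"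
    and "T2 = (\<lambda>d. trig_form d (D1 d (D1 d (C d))))"
  have dT: "(T d has_real_derivative T1 d \<phi>) (at \<phi>)" "(T1 d has_real_derivative T2 d \<phi>) (at \<phi>)" for d \<phi>
    unfolding T_def T1_def T2_def by (rule D1)+
  have ode: "(real d)\<^sup>2 * T d \<phi> + T2 d \<phi> +
        (if 2 \<le> d then real (n - (d - 2)) * (real (n - (d - 2)) - 1) * T (d - 2) \<phi> else 0) = 0"
    if "d \<le> n" for d \<phi>
  proof -
    define \<nu> \<tau> where "\<nu> = cos \<phi> *\<^sub>R E 1 + sin \<phi> *\<^sub>R E 2" and "\<tau> = - sin \<phi> *\<^sub>R E 1 + cos \<phi> *\<^sub>R E 2"
    have key: "(\<Sum>d\<le>n. r ^ d * ((real d)\<^sup>2 * T d \<phi> + T2 d \<phi>)) +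
       (\<Sum>d\<le>n. r ^ (d + 2) * (real (n - d) * (real (n - d) - 1) * T d \<phi>)) = 0" for r
    proof -
      define q where "q = frame_point E (r * cos \<phi>) (r * sin \<phi>) 1"
      have S: "U (frame_point E (r * cos \<phi>) (r * sin \<phi>) z) = (\<Sum>d\<le>n. r ^ d * z ^ (n - d) * T d \<phi>)" for r \<phi> z
        unfolding C T_def ..
      define \<gamma> w where "\<gamma> = (\<lambda>\<phi>. frame_point E (r * cos \<phi>) (r * sin \<phi>) 1)"
        and "w = (\<lambda>\<phi>. frame_point E (- r * sin \<phi>) (r * cos \<phi>) 0)"
      have d\<gamma>: "(\<gamma> has_vector_derivative w s) (at s)" for s
        unfolding \<gamma>_def w_def frame_point_def by (auto intro!: derivative_eq_intros simp: mult.commute)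
      have dw: "(w has_vector_derivative frame_point E (- r * cos s) (- r * sin s) 0) (at s)" for s
        unfolding w_def frame_point_def by (auto intro!: derivative_eq_intros simp: mult.commute)
      have g\<phi>: "gradient U (\<gamma> s) \<bullet> w s = (\<Sum>d\<le>n. r ^ d * T1 d s)" for s
      proof (rule DERIV_unique[OF DERIV_along_path[OF pU d\<gamma>]])
        show "((\<lambda>t. U (\<gamma> t)) has_real_derivative (\<Sum>d\<le>n. r ^ d * T1 d s)) (at s)"
          unfolding \<gamma>_def S by (auto intro!: DERIV_sum DERIV_cmult dT)
      qed
      \<comment> \<open>Second derivative along the circle of radius r: its acceleration is - r
        \<nu>, which accounts for the first order term.\<close>
      have h\<phi>: "hessian U q (r *\<^sub>R \<tau>) \<bullet> (r *\<^sub>R \<tau>) - r * (gradient U q \<bullet> \<nu>) = (\<Sum>d\<le>n. r ^ d * T2 d \<phi>)"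
      proof -
        have "hessian U (\<gamma> \<phi>) (w \<phi>) \<bullet> w \<phi> + gradient U (\<gamma> \<phi>) \<bullet> frame_point E (- r * cos \<phi>) (- r * sin \<phi>) 0
            = (\<Sum>d\<le>n. r ^ d * T2 d \<phi>)"
        proof (rule DERIV_unique[OF DERIV_gradient_along_path[OF pU d\<gamma> dw]])
          show "((\<lambda>t. gradient U (\<gamma> t) \<bullet> w t) has_real_derivative (\<Sum>d\<le>n. r ^ d * T2 d \<phi>)) (at \<phi>)"
            unfolding g\<phi> by (auto intro!: DERIV_sum DERIV_cmult dT)
        qed
        moreover have "w \<phi> = r *\<^sub>R \<tau>" "frame_point E (- r * cos \<phi>) (- r * sin \<phi>) 0 = (- r) *\<^sub>R \<nu>" "\<gamma> \<phi> = q"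
          by (simp_all add: w_def \<tau>_def \<nu>_def \<gamma>_def q_def frame_point_def algebra_simps)
        ultimately show ?thesis by simp
      qed
      have line: "frame_point E (s * cos \<phi>) (s * sin \<phi>) 1 = E 3 + s *\<^sub>R \<nu>" for s
        by (simp add: frame_point_def \<nu>_def algebra_simps)
      have gr: "gradient U (E 3 + s *\<^sub>R \<nu>) \<bullet> \<nu> = (\<Sum>d\<le>n. (real d * s ^ (d - 1)) * T d \<phi>)" for s
      proof (rule DERIV_unique[OF DERIV_line(1)[OF pU]])
        show "((\<lambda>t. U (E 3 + t *\<^sub>R \<nu>)) has_real_derivative (\<Sum>d\<le>n. (real d * s ^ (d - 1)) * T d \<phi>)) (at s)"
          unfolding line[symmetric] S
          by (auto intro!: DERIV_sum DERIV_cmult_right DERIV_pow[of _ s UNIV, simplified])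
      qed
      have hr: "hessian U (E 3 + r *\<^sub>R \<nu>) \<nu> \<bullet> \<nu> = (\<Sum>d\<le>n. (real d * (real (d - 1) * r ^ (d - 1 - 1))) * T d \<phi>)"
      proof (rule DERIV_unique[OF DERIV_line(2)[OF pU]])
        show "((\<lambda>t. gradient U (E 3 + t *\<^sub>R \<nu>) \<bullet> \<nu>) has_real_derivative
            (\<Sum>d\<le>n. (real d * (real (d - 1) * r ^ (d - 1 - 1))) * T d \<phi>)) (at r)"
          unfolding gr
          by (intro DERIV_sum DERIV_cmult_right DERIV_cmult DERIV_power_ident)
      qed
      have linez: "frame_point E (r * cos \<phi>) (r * sin \<phi>) z = r *\<^sub>R \<nu> + z *\<^sub>R E 3" for z
        by (simp add: frame_point_def \<nu>_def algebra_simps)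
      have gz: "gradient U (r *\<^sub>R \<nu> + z *\<^sub>R E 3) \<bullet> E 3 = (\<Sum>d\<le>n. r ^ d * (real (n - d) * z ^ (n - d - 1)) * T d \<phi>)" for z
      proof (rule DERIV_unique[OF DERIV_line(1)[OF pU]])
        show "((\<lambda>t. U (r *\<^sub>R \<nu> + t *\<^sub>R E 3)) has_real_derivative (\<Sum>d\<le>n. r ^ d * (real (n - d) * z ^ (n - d - 1)) * T d \<phi>)) (at z)"
          unfolding linez[symmetric] S
          by (intro DERIV_sum DERIV_cmult_right DERIV_cmult DERIV_power_ident)
      qed
      have hz: "hessian U (r *\<^sub>R \<nu> + 1 *\<^sub>R E 3) (E 3) \<bullet> E 3 =
         (\<Sum>d\<le>n. r ^ d * (real (n - d) * (real (n - d - 1) * 1 ^ (n - d - 1 - 1))) * T d \<phi>)"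
      proof (rule DERIV_unique[OF DERIV_line(2)[OF pU]])
        show "((\<lambda>t. gradient U (r *\<^sub>R \<nu> + t *\<^sub>R E 3) \<bullet> E 3) has_real_derivative
          (\<Sum>d\<le>n. r ^ d * (real (n - d) * (real (n - d - 1) * 1 ^ (n - d - 1 - 1))) * T d \<phi>)) (at 1)"
          unfolding gz
          by (intro DERIV_sum DERIV_cmult_right DERIV_cmult DERIV_power_ident)
      qed
      have qr: "E 3 + r *\<^sub>R \<nu> = q" "r *\<^sub>R \<nu> + 1 *\<^sub>R E 3 = q"
        by (simp_all add: q_def frame_point_def \<nu>_def algebra_simps)
      define F :: "3 \<Rightarrow> real ^ 3" where "F = (\<lambda>i. if i = 1 then \<nu> else if i = 2 then \<tau> else E 3)"
      have "frame F"
      proof -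
        have "E i \<bullet> E j = (if i = j then 1 else 0)" for i j using E by (simp add: frame_def)
        moreover have "cos \<phi> * cos \<phi> + sin \<phi> * sin \<phi> = 1" "sin \<phi> * sin \<phi> + cos \<phi> * cos \<phi> = 1"
          using sin_cos_squared_add[of \<phi>] by (simp_all add: power2_eq_square)
        ultimately show ?thesis
          by (auto simp: frame_def F_def \<nu>_def \<tau>_def forall_3 inner_add_left inner_add_right algebra_simps)
      qed
      from frame_trace[OF this linear_hessian[OF pU, of q]] lap[of q]
      have tr: "hessian U q \<nu> \<bullet> \<nu> + hessian U q \<tau> \<bullet> \<tau> + hessian U q (E 3) \<bullet> E 3 = 0"
        by (simp add: sum_3 F_def)
      have e0: "r\<^sup>2 * (hessian U q \<nu> \<bullet> \<nu>) + hessian U q (r *\<^sub>R \<tau>) \<bullet> (r *\<^sub>R \<tau>) + r\<^sup>2 * (hessian U q (E 3) \<bullet> E 3) = 0"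
      proof -
        have "r\<^sup>2 * (hessian U q \<nu> \<bullet> \<nu> + hessian U q \<tau> \<bullet> \<tau> + hessian U q (E 3) \<bullet> E 3) = 0" by (simp add: tr)
        then show ?thesis
          by (simp add: linear_scale[OF linear_hessian[OF pU]] algebra_simps power2_eq_square)
      qed
      have e1: "r\<^sup>2 * (hessian U q \<nu> \<bullet> \<nu>) = (\<Sum>d\<le>n. r ^ d * (real d * (real d - 1) * T d \<phi>))"
      proof -
        have "r\<^sup>2 * ((real d * (real (d - 1) * r ^ (d - 1 - 1))) * T d \<phi>) = r ^ d * (real d * (real d - 1) * T d \<phi>)" for d
          by (cases d; cases "d - 1") (auto simp: power2_eq_square)
        then show ?thesis using hr unfolding qr by (simp only: sum_distrib_left)
      qed
      have e2: "r * (gradient U q \<bullet> \<nu>) = (\<Sum>d\<le>n. r ^ d * (real d * T d \<phi>))"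
      proof -
        have "r * ((real d * r ^ (d - 1)) * T d \<phi>) = r ^ d * (real d * T d \<phi>)" for d
          by (cases d) auto
        then show ?thesis using gr[of r] unfolding qr by (simp only: sum_distrib_left)
      qed
      have e3: "r\<^sup>2 * (hessian U q (E 3) \<bullet> E 3) = (\<Sum>d\<le>n. r ^ (d + 2) * (real (n - d) * (real (n - d) - 1) * T d \<phi>))"
      proof -
        have "r\<^sup>2 * (r ^ d * (real (n - d) * (real (n - d - 1) * 1 ^ (n - d - 1 - 1))) * T d \<phi>) =
           r ^ (d + 2) * (real (n - d) * (real (n - d) - 1) * T d \<phi>)" for d
          by (cases "n - d") (auto simp: power_add power2_eq_square)
        then show ?thesis using hz unfolding qr by (simp only: sum_distrib_left)
      qed
      have "(\<Sum>d\<le>n. r ^ d * (real d * (real d - 1) * T d \<phi>)) + (\<Sum>d\<le>n. r ^ d * (real d * T d \<phi>)) +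
         (\<Sum>d\<le>n. r ^ d * T2 d \<phi>) = (\<Sum>d\<le>n. r ^ d * ((real d)\<^sup>2 * T d \<phi> + T2 d \<phi>))"
        by (simp add: sum.distrib[symmetric] power2_eq_square algebra_simps)
      with e0 e1 e2 e3 h\<phi> show ?thesis by linarith
    qed
    \<comment> \<open>The coefficient of r^d. Degrees run up to n + 2 because of the factor r^2 at
      U_zz, while the first part stops at n.\<close>
    define K where "K = (\<lambda>d. (if d \<le> n then (real d)\<^sup>2 * T d \<phi> + T2 d \<phi> else 0) +
        (if 2 \<le> d then real (n - (d - 2)) * (real (n - (d - 2)) - 1) * T (d - 2) \<phi> else 0))"
    have "(\<Sum>d\<le>n + 2. K d * r ^ d) = 0" for r
    proof -
      have "(\<Sum>d\<le>n. r ^ d * ((real d)\<^sup>2 * T d \<phi> + T2 d \<phi>)) =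
        (\<Sum>d\<le>n + 2. (if d \<le> n then (real d)\<^sup>2 * T d \<phi> + T2 d \<phi> else 0) * r ^ d)"
        by (rule sum.mono_neutral_cong_left) (auto simp: mult.commute)
      moreover have "(\<Sum>d\<le>n. r ^ (d + 2) * (real (n - d) * (real (n - d) - 1) * T d \<phi>)) =
        (\<Sum>d\<le>n + 2. (if 2 \<le> d then real (n - (d - 2)) * (real (n - (d - 2)) - 1) * T (d - 2) \<phi> else 0) * r ^ d)"
      proof -
        have "(\<Sum>d\<le>n. r ^ (d + 2) * (real (n - d) * (real (n - d) - 1) * T d \<phi>)) =
          (\<Sum>d\<in>(\<lambda>d. d + 2) ` {..n}. (if 2 \<le> d then real (n - (d - 2)) * (real (n - (d - 2)) - 1) * T (d - 2) \<phi> else 0) * r ^ d)"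
        proof -
          have "inj_on (\<lambda>d. d + 2 :: nat) {..n}" by (simp add: inj_on_def)
          note eq = sum.reindex[OF this, unfolded o_def]
          show ?thesis unfolding eq by (simp add: mult.commute)
        qed
        also have "\<dots> = (\<Sum>d\<le>n + 2. (if 2 \<le> d then real (n - (d - 2)) * (real (n - (d - 2)) - 1) * T (d - 2) \<phi> else 0) * r ^ d)"
        proof (rule sum.mono_neutral_left)
          show "\<forall>i\<in>{..n + 2} - (\<lambda>d. d + 2) ` {..n}.
            (if 2 \<le> i then real (n - (i - 2)) * (real (n - (i - 2)) - 1) * T (i - 2) \<phi> else 0) * r ^ i = 0"
          proof
            fix i assume i: "i \<in> {..n + 2} - (\<lambda>d. d + 2) ` {..n}"
            have "\<not> 2 \<le> i"
            proof
              assume "2 \<le> i"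
              then have "i = (i - 2) + 2" "i - 2 \<in> {..n}" using i by auto
              then show False using i by blast
            qed
            then show "(if 2 \<le> i then real (n - (i - 2)) * (real (n - (i - 2)) - 1) * T (i - 2) \<phi> else 0) * r ^ i = 0"
              by simp
          qed
        qed auto
        finally show ?thesis .
      qed
      ultimately show ?thesis using key[of r] unfolding K_def by (simp add: distrib_right sum.distrib)
    qed
    then have "K d = 0" using polyfun_eq_0[of K "n + 2"] that by auto
    then show ?thesis using that by (simp add: K_def)
  qed
  have "cylindrical n U E T T1 T2"
    unfolding cylindrical_def using dT ode by (auto simp: C T_def T1_def T2_def)
  then show ?thesis by blast
qed

section \<open>Harmonic functions as real polynomials\<close>

lemma partial_of_real:
  assumes "((\<lambda>t. f (x + t *\<^sub>R axis i 1)) has_real_derivative D) (at 0)"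
  shows "partial i (\<lambda>x. of_real (f x)) x = of_real D"
proof -
  have "((\<lambda>t. of_real (f (x + t *\<^sub>R axis i 1)) :: complex) has_vector_derivative of_real D) (at 0)"
    using assms by (intro has_vector_derivative_of_real) (simp add: has_real_derivative_iff_has_vector_derivative)
  then show ?thesis unfolding partial_def by (rule vector_derivative_at)
qed

text \<open>\<open>partial\<close> is total and can be computed only from derivatives known to
  exist. They are supplied as \<open>D\<close> and \<open>D2\<close>: for general polynomials by
  gradient and hessian, for \<open>psi\<close> and the zonal polynomial by explicit
  formulas.\<close>

lemma laplacian_of_real:
  assumes "\<And>i x. ((\<lambda>t. f (x + t *\<^sub>R axis i 1)) has_real_derivative D i x) (at 0)"
    and "\<And>i x. ((\<lambda>t. D i (x + t *\<^sub>R axis i 1)) has_real_derivative D2 i x) (at 0)"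
  shows "laplacian (\<lambda>x. of_real (f x)) x = of_real (\<Sum>i\<in>UNIV. D2 i x)"
proof -
  have "partial i (\<lambda>x. of_real (f x)) = (\<lambda>x. of_real (D i x))" for i
    by (rule ext, rule partial_of_real, rule assms)
  then show ?thesis unfolding laplacian_def by (simp add: partial_of_real[OF assms(2)])
qed

lemma laplacian_hessian:
  assumes "real_polynomial_function U"
  shows "laplacian (\<lambda>x. of_real (U x)) x = of_real (\<Sum>i\<in>UNIV. hessian U x (axis i 1) \<bullet> axis i 1)"
proof (rule laplacian_of_real[where D = "\<lambda>i x. gradient U x \<bullet> axis i 1"])
  show "((\<lambda>t. U (x + t *\<^sub>R axis i 1)) has_real_derivative gradient U x \<bullet> axis i 1) (at 0)" for i x
    using DERIV_line(1)[OF assms, of x "axis i 1" 0] by simp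
  show "((\<lambda>t. gradient U (x + t *\<^sub>R axis i 1) \<bullet> axis i 1) has_real_derivative
      hessian U x (axis i 1) \<bullet> axis i 1) (at 0)" for i x
    using DERIV_line(2)[OF assms, of x "axis i 1" 0] by simp
qed

text \<open>The monomials are real, so taking real parts of the coefficients represents the real
  part of \<open>u\<close>, which is \<open>u\<close> itself.\<close>

lemma harmonic_space_real:
  assumes "u \<in> harmonic_space n" "real_valued u"
  shows "\<exists>U. harmonic_poly n U \<and> u = (\<lambda>x. of_real (U x))"
proof -
  define U where "U = (\<lambda>x. Re (u x))"
  have u: "u = (\<lambda>x. of_real (U x))"
    using assms(2) by (auto simp: real_valued_def U_def of_real_Re)
  obtain c where c: "\<forall>x. u x = (\<Sum>i\<le>n. \<Sum>j\<le>n - i. c i j * of_real (x $ 1 ^ i * x $ 2 ^ j * x $ 3 ^ (n - i - j)))"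
    using assms(1) unfolding harmonic_space_def homogeneous_polynomial_def by blast
  have "hompoly n U" unfolding hompoly_def
  proof (intro exI[of _ "\<lambda>i j. Re (c i j)"] allI)
    fix x :: "real ^ 3"
    show "U x = (\<Sum>i\<le>n. \<Sum>j\<le>n - i. Re (c i j) * (x $ 1 ^ i * x $ 2 ^ j * x $ 3 ^ (n - i - j)))"
      unfolding U_def c[rule_format] Re_sum by (intro sum.cong refl) (simp del: of_real_mult of_real_power)
  qed
  moreover have "(\<Sum>i\<in>UNIV. hessian U x (axis i 1) \<bullet> axis i 1) = 0" for x
  proof -
    have "laplacian u x = of_real (\<Sum>i\<in>UNIV. hessian U x (axis i 1) \<bullet> axis i 1)"
      by (subst u) (rule laplacian_hessian[OF hompoly_polynomial[OF \<open>hompoly n U\<close>]])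
    moreover have "laplacian u x = 0" using assms(1) by (simp add: harmonic_space_def)
    ultimately show ?thesis by (metis of_real_eq_0_iff)
  qed
  ultimately show ?thesis using u by (auto simp: harmonic_poly_def)
qed

lemma hompoly_imp_homogeneous_polynomial:
  assumes "hompoly n U"
  shows "homogeneous_polynomial n (\<lambda>x. of_real (U x))"
proof -
  obtain c where c: "\<forall>x. U x = (\<Sum>i\<le>n. \<Sum>j\<le>n - i. c i j * (x $ 1 ^ i * x $ 2 ^ j * x $ 3 ^ (n - i - j)))"
    using assms unfolding hompoly_def by blast
  show ?thesis unfolding homogeneous_polynomial_def
    by (intro exI[of _ "\<lambda>i j. of_real (c i j)"] allI) (simp add: c)
qed

section \<open>Mean values over circles\<close>

text \<open>Integrating Laplace's recursion over the angle removes \<open>T2\<close>, the derivative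
  of a periodic function. The integrals of the \<open>T d\<close> then satisfy the recursion of the
  Legendre sum; that of index 1 vanishes by the clause for d = 1, and \<open>T 0\<close> is the
  constant value of \<open>U\<close> at the pole.\<close>

lemma cylindrical_integral:
  assumes cyl: "cylindrical n U E T T1 T2" and cs: "c\<^sup>2 + s\<^sup>2 = 1"
  shows "((\<lambda>\<phi>. U (frame_point E (s * cos \<phi>) (s * sin \<phi>) c)) has_integral
     2 * pi * U (E 3) * poly (legendre n) c) {0..2 * pi}"
proof -
  define B where "B = (\<lambda>d. integral {0..2 * pi} (T d))"
  have cont: "continuous_on S (T d)" for S d
    using cyl continuous_on_trig_form unfolding cylindrical_def by metis
  have B: "(T d has_integral B d) {0..2 * pi}" for d
    unfolding B_def by (intro integrable_integral integrable_continuous_interval cont)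
  have T2: "(T2 d has_integral 0) {0..2 * pi}" for d
  proof -
    have "(T2 d has_integral T1 d (2 * pi) - T1 d 0) {0..2 * pi}"
      using cyl by (intro fundamental_theorem_of_calculus)
        (auto simp: cylindrical_def has_real_derivative_iff_has_vector_derivative[symmetric] intro: has_field_derivative_at_within)
    moreover have "T1 d (2 * pi) = T1 d 0"
    proof -
      obtain D where "T1 d = trig_form d D" using cyl unfolding cylindrical_def by blast
      then show ?thesis by (simp add: trig_form_def)
    qed
    ultimately show ?thesis by simp
  qed
  have ode: "(real d)\<^sup>2 * B d + (if 2 \<le> d then real (n - (d - 2)) * (real (n - (d - 2)) - 1) * B (d - 2) else 0) = 0"
    if "d \<le> n" for d
  proof -
    have "((\<lambda>\<phi>. (real d)\<^sup>2 * T d \<phi> + T2 d \<phi> + (if 2 \<le> d then real (n - (d - 2)) * (real (n - (d - 2)) - 1) else 0) * T (d - 2) \<phi>)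
      has_integral (real d)\<^sup>2 * B d + 0 + (if 2 \<le> d then real (n - (d - 2)) * (real (n - (d - 2)) - 1) else 0) * B (d - 2)) {0..2 * pi}"
      by (intro has_integral_add has_integral_mult_right B T2)
    moreover have "(\<lambda>\<phi>. (real d)\<^sup>2 * T d \<phi> + T2 d \<phi> + (if 2 \<le> d then real (n - (d - 2)) * (real (n - (d - 2)) - 1) else 0) * T (d - 2) \<phi>) = (\<lambda>_. 0)"
    proof
      fix \<phi>
      have "(real d)\<^sup>2 * T d \<phi> + T2 d \<phi> + (if 2 \<le> d then real (n - (d - 2)) * (real (n - (d - 2)) - 1) * T (d - 2) \<phi> else 0) = 0"
        using cyl that unfolding cylindrical_def by blast
      then show "(real d)\<^sup>2 * T d \<phi> + T2 d \<phi> + (if 2 \<le> d then real (n - (d - 2)) * (real (n - (d - 2)) - 1) else 0) * T (d - 2) \<phi> = 0"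
        by (cases "2 \<le> d") simp_all
    qed
    ultimately have "((\<lambda>_. 0) has_integral (real d)\<^sup>2 * B d + 0 + (if 2 \<le> d then real (n - (d - 2)) * (real (n - (d - 2)) - 1) else 0) * B (d - 2)) {0..2 * pi}"
      by (simp only:)
    from has_integral_unique[OF this has_integral_0] show ?thesis by (cases "2 \<le> d") simp_all
  qed
  have S: "U (frame_point E (r * cos \<phi>) (r * sin \<phi>) z) = (\<Sum>d\<le>n. r ^ d * z ^ (n - d) * T d \<phi>)" for r \<phi> z
    using cyl unfolding cylindrical_def by blast
  have T0: "T 0 \<phi> = U (E 3)" for \<phi>
  proof -
    have "U (E 3) = (\<Sum>d\<le>n. 0 ^ d * 1 ^ (n - d) * T d \<phi>)" using S[of 0 \<phi> 1] by (simp add: frame_point_def)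
    also have "\<dots> = (\<Sum>d\<in>{0}. 0 ^ d * 1 ^ (n - d) * T d \<phi>)"
      by (intro sum.mono_neutral_right) auto
    finally show ?thesis by simp
  qed
  have "B 0 = 2 * pi * U (E 3)"
  proof -
    have "T 0 = (\<lambda>_. U (E 3))" using T0 by auto
    then show ?thesis unfolding B_def by simp
  qed
  moreover have "(\<Sum>d\<le>n. B d * s ^ d * c ^ (n - d)) = B 0 * poly (legendre n) c"
  proof (rule trig_sum_eq_legendre[OF _ _ cs])
    show "(real d + 2)\<^sup>2 * B (d + 2) = - (real (n - d) * (real (n - d) - 1) * B d)" if "d + 2 \<le> n" for d
      using ode[OF that] by (simp add: add.commute)
    show "B 1 = 0" if "1 \<le> n" using ode[OF that] by simp
  qed
  moreover have "((\<lambda>\<phi>. \<Sum>d\<le>n. s ^ d * c ^ (n - d) * T d \<phi>) has_integral (\<Sum>d\<le>n. s ^ d * c ^ (n - d) * B d)) {0..2 * pi}"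
    by (intro has_integral_sum has_integral_mult_right B) auto
  ultimately show ?thesis unfolding S by (simp add: mult_ac)
qed

lemma integral_zero_sign_change:
  fixes f :: "real \<Rightarrow> real"
  assumes cont: "continuous_on {a..b} f" and int: "(f has_integral 0) {a..b}" and ab: "a < b"
    and nz: "x \<in> {a..b}" "f x \<noteq> 0"
  shows "\<exists>y\<in>{a..b}. f y > 0"
proof (rule ccontr)
  assume "\<not> ?thesis"
  then have le: "\<And>y. y \<in> {a..b} \<Longrightarrow> f y \<le> 0" by force
  have "((\<lambda>y. - f y) has_integral 0) (cbox a b)" using has_integral_neg[OF int] by simp
  then have "- f x = 0"
    using has_integral_0_cbox_imp_0[of a b "\<lambda>y. - f y" x] cont le ab nz
    by (auto intro!: continuous_on_minus simp: box_real cbox_interval)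
  then show False using nz by simp
qed

text \<open>A continuous function with mean zero vanishes identically or takes both signs; in the
  second case each of the two arcs between a positive and a negative point contains a zero. The
  strict inequality y < x + 2 pi makes the zeros different points of the circle.\<close>

lemma periodic_mean_zero_two_zeros:
  fixes f :: "real \<Rightarrow> real"
  assumes cont: "continuous_on UNIV f" and int: "(f has_integral 0) {0..2 * pi}"
    and per: "\<And>x. f (x + 2 * pi) = f x"
  shows "\<exists>x y. x < y \<and> y < x + 2 * pi \<and> f x = 0 \<and> f y = 0"
proof (cases "\<exists>x\<in>{0..2 * pi}. f x \<noteq> 0")
  case False
  then show ?thesis by (intro exI[of _ 0] exI[of _ 1]) (use pi_gt3 in auto)
next
  case True
  then obtain x where x: "x \<in> {0..2 * pi}" "f x \<noteq> 0" by blast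
  have c: "continuous_on S f" for S using cont continuous_on_subset by blast
  obtain p where p: "p \<in> {0..2 * pi}" "f p > 0"
    using integral_zero_sign_change[OF c int _ x] by auto
  have "\<exists>y\<in>{0..2 * pi}. - f y > 0"
    by (rule integral_zero_sign_change[OF _ _ _ x(1)])
      (use has_integral_neg[OF int] x c in \<open>auto intro!: continuous_on_minus\<close>)
  then obtain q where q: "q \<in> {0..2 * pi}" "f q < 0" by auto
  \<comment> \<open>The negative point is moved by one period if necessary, so that it follows p
    within one turn.\<close>
  define q' where "q' = (if p < q then q else q + 2 * pi)"
  have q': "f q' < 0" "p < q'" "q' < p + 2 * pi"
  proof -
    show "f q' < 0" using q per by (simp add: q'_def)
    have "p \<noteq> q" using p q by auto
    moreover have "\<not> (p = 2 * pi \<and> q = 0)" "\<not> (p = 0 \<and> q = 2 * pi)" using per[of 0] p q by auto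
    ultimately show "p < q'" "q' < p + 2 * pi" using p q by (auto simp: q'_def)
  qed
  obtain z1 where z1: "p \<le> z1" "z1 \<le> q'" "f z1 = 0"
    using IVT2'[OF _ _ _ c, of q' 0 p] p q' by auto
  obtain z2 where z2: "q' \<le> z2" "z2 \<le> p + 2 * pi" "f z2 = 0"
    using IVT'[OF _ _ _ c, of q' 0 "p + 2 * pi"] p q' per by auto
  have "z1 \<noteq> p" "z1 \<noteq> q'" "z2 \<noteq> q'" "z2 \<noteq> p + 2 * pi" using z1 z2 p q' per[of p] by auto
  then show ?thesis using z1 z2 by (intro exI[of _ z1] exI[of _ z2]) auto
qed

lemma circle_two_zeros:
  assumes U: "harmonic_poly n U" and a: "norm a = 1" and s: "s > 0" and cs: "c\<^sup>2 + s\<^sup>2 = 1"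
    and P: "poly (legendre n) c = 0"
  shows "\<exists>x y. x \<noteq> y \<and> norm x = 1 \<and> norm y = 1 \<and> U x = 0 \<and> U y = 0 \<and> a \<bullet> x = c \<and> a \<bullet> y = c"
proof -
  obtain E where E: "frame E" "E 3 = a" using frame_exists[OF a] by blast
  obtain T T1 T2 where cyl: "cylindrical n U E T T1 T2" using cylindrical_exists[OF U E(1)] by blast
  define g where "g = (\<lambda>\<phi>. frame_point E (s * cos \<phi>) (s * sin \<phi>) c)"
  have "real_polynomial_function U" using U by (auto simp: harmonic_poly_def intro: hompoly_polynomial)
  then have "continuous_on S U" for S
    by (simp add: real_polynomial_function_eq continuous_on_polymonial_function)
  then have "continuous_on UNIV (\<lambda>\<phi>. U (g \<phi>))"
    unfolding g_def frame_point_def by (rule continuous_on_compose2) (auto intro!: continuous_intros)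
  moreover have "((\<lambda>\<phi>. U (g \<phi>)) has_integral 0) {0..2 * pi}"
    using cylindrical_integral[OF cyl cs] P by (simp add: g_def)
  ultimately obtain x y where xy: "x < y" "y < x + 2 * pi" "U (g x) = 0" "U (g y) = 0"
    using periodic_mean_zero_two_zeros[of "\<lambda>\<phi>. U (g \<phi>)"] by (auto simp: g_def)
  have nrm: "norm (g \<phi>) = 1" for \<phi>
  proof -
    have "(norm (g \<phi>))\<^sup>2 = s\<^sup>2 * ((cos \<phi>)\<^sup>2 + (sin \<phi>)\<^sup>2) + c\<^sup>2"
      unfolding g_def frame_norm[OF E(1)] by (simp only: power_mult_distrib distrib_left)
    then have "(norm (g \<phi>))\<^sup>2 = 1\<^sup>2" using cs by simp
    then show ?thesis by (rule power2_eq_imp_eq) simp_all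
  qed
  have inn: "a \<bullet> g \<phi> = c" for \<phi>
    using frame_coordinates(3)[OF E(1)] E(2) by (simp add: g_def inner_commute)
  have "g x \<noteq> g y"
  proof
    assume "g x = g y"
    then have "s * cos x = s * cos y" "s * sin x = s * sin y"
      using frame_coordinates(1,2)[OF E(1)] by (metis g_def)+
    then have "cos (y - x) = 1"
      using s sin_cos_squared_add[of x] by (simp add: cos_diff power2_eq_square)
    then obtain k :: int where k: "y - x = real_of_int k * 2 * pi" using cos_one_2pi_int by blast
    then have e: "real_of_int k * (2 * pi) = y - x" by simp
    have "0 < real_of_int k * (2 * pi)" "real_of_int k * (2 * pi) < 1 * (2 * pi)"
      unfolding e using xy by simp_all
    then have "0 < real_of_int k" "real_of_int k < 1"
      using zero_less_mult_pos2[of "real_of_int k" "2 * pi"] mult_right_less_imp_less[of "real_of_int k" "2 * pi" 1]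
      by simp_all
    then show False by simp
  qed
  then show ?thesis using xy nrm inn by blast
qed

section \<open>Singular points of the nodal set\<close>

lemma trig_form_bound: "\<bar>trig_form d D t\<bar> \<le> (\<Sum>i\<le>d. \<bar>D i\<bar>)"
  unfolding trig_form_def
proof (rule order_trans[OF sum_abs], rule sum_mono)
  fix i
  have "\<bar>cos t\<bar> ^ i * \<bar>sin t\<bar> ^ (d - i) \<le> 1 * 1"
    by (intro mult_mono power_le_one) auto
  then have "\<bar>D i\<bar> * (\<bar>cos t\<bar> ^ i * \<bar>sin t\<bar> ^ (d - i)) \<le> \<bar>D i\<bar> * 1"
    by (intro mult_left_mono) auto
  then show "\<bar>D i * cos t ^ i * sin t ^ (d - i)\<bar> \<le> \<bar>D i\<bar>"
    by (simp add: abs_mult power_abs mult.assoc)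
qed

text \<open>Dividing the sum by r^k leaves z^(n - k) A_k plus r times a bounded remainder. The bound
  z \<ge> 1/2 is the source of 2^n.\<close>

lemma leading_coefficient_small:
  fixes A :: "nat \<Rightarrow> real"
  assumes zero: "(\<Sum>d\<le>n. r ^ d * z ^ (n - d) * A d) = 0" and low: "\<And>d. d < k \<Longrightarrow> A d = 0"
    and M: "\<And>d. d \<le> n \<Longrightarrow> \<bar>A d\<bar> \<le> M" and k: "k \<le> n" and r: "r \<noteq> 0" "\<bar>r\<bar> \<le> 1" and z: "1 / 2 \<le> z" "z \<le> 1"
  shows "\<bar>A k\<bar> \<le> \<bar>r\<bar> * (2 ^ n * (real n * M))"
proof -
  have M0: "M \<ge> 0" using M[OF k] by linarith
  have "(\<Sum>d\<le>n. r ^ d * z ^ (n - d) * A d) = r ^ k * z ^ (n - k) * A k + (\<Sum>d\<in>{k<..n}. r ^ d * z ^ (n - d) * A d)"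
  proof -
    have "(\<Sum>d\<le>n. r ^ d * z ^ (n - d) * A d) = (\<Sum>d\<in>insert k {k<..n}. r ^ d * z ^ (n - d) * A d)"
      using k low by (intro sum.mono_neutral_right) auto
    then show ?thesis by simp
  qed
  also have "(\<Sum>d\<in>{k<..n}. r ^ d * z ^ (n - d) * A d) = r ^ k * (r * (\<Sum>d\<in>{k<..n}. r ^ (d - Suc k) * z ^ (n - d) * A d))"
  proof -
    have "r ^ d = r ^ k * (r * r ^ (d - Suc k))" if "d \<in> {k<..n}" for d
    proof -
      have "d = k + Suc (d - Suc k)" using that by auto
      then show ?thesis by (metis power_add power_Suc)
    qed
    then show ?thesis by (simp add: sum_distrib_left mult.assoc)
  qed
  finally have "r ^ k * (z ^ (n - k) * A k + r * (\<Sum>d\<in>{k<..n}. r ^ (d - Suc k) * z ^ (n - d) * A d)) = 0"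
    using zero by (simp add: algebra_simps)
  then have "z ^ (n - k) * A k = - (r * (\<Sum>d\<in>{k<..n}. r ^ (d - Suc k) * z ^ (n - d) * A d))"
    using r by simp
  then have "\<bar>z ^ (n - k) * A k\<bar> = \<bar>r * (\<Sum>d\<in>{k<..n}. r ^ (d - Suc k) * z ^ (n - d) * A d)\<bar>"
    by (simp only: abs_minus_cancel)
  then have eq: "z ^ (n - k) * \<bar>A k\<bar> = \<bar>r\<bar> * \<bar>\<Sum>d\<in>{k<..n}. r ^ (d - Suc k) * z ^ (n - d) * A d\<bar>"
    using z by (simp add: abs_mult)
  have "\<bar>\<Sum>d\<in>{k<..n}. r ^ (d - Suc k) * z ^ (n - d) * A d\<bar> \<le> (\<Sum>d\<in>{k<..n}. M)"
  proof (rule order_trans[OF sum_abs], rule sum_mono)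
    fix d assume d: "d \<in> {k<..n}"
    have "\<bar>r\<bar> ^ (d - Suc k) * z ^ (n - d) * \<bar>A d\<bar> \<le> 1 * 1 * M"
      using r z M[of d] d M0 by (intro mult_mono power_le_one) auto
    then show "\<bar>r ^ (d - Suc k) * z ^ (n - d) * A d\<bar> \<le> M" using z by (simp add: abs_mult power_abs)
  qed
  also have "\<dots> \<le> real n * M" using M0 k by (auto intro!: mult_right_mono)
  finally have "\<bar>r\<bar> * \<bar>\<Sum>d\<in>{k<..n}. r ^ (d - Suc k) * z ^ (n - d) * A d\<bar> \<le> \<bar>r\<bar> * (real n * M)"
    by (rule mult_left_mono) simp
  then have "z ^ (n - k) * \<bar>A k\<bar> \<le> \<bar>r\<bar> * (real n * M)" using eq by simp
  moreover have "(1 / 2) ^ n \<le> z ^ (n - k)"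
  proof -
    have "(1 / 2 :: real) ^ n \<le> (1 / 2) ^ (n - k)" by (rule power_decreasing) auto
    also have "\<dots> \<le> z ^ (n - k)" using z by (intro power_mono) auto
    finally show ?thesis .
  qed
  ultimately have "(1 / 2) ^ n * \<bar>A k\<bar> \<le> \<bar>r\<bar> * (real n * M)"
    by (meson abs_ge_zero mult_right_mono order_trans)
  then show ?thesis by (simp add: power_divide field_simps)
qed

definition singular_set :: "(real ^ 3 \<Rightarrow> real) \<Rightarrow> (real ^ 3) set" where
  "singular_set U = {x \<in> sphere 0 1. U x = 0 \<and> gradient U x = 0}"

text \<open>The lowest nonvanishing angular part \<open>T k\<close> at a zero satisfies \<open>T k'' + k^2 T k = 0\<close>, so
  \<open>T k\<close> and \<open>T k'\<close> have no common zero.\<close>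

lemma singular_point_isolated:
  assumes U: "harmonic_poly n U" and nz: "U x0 \<noteq> 0" and p: "p \<in> singular_set U"
  shows "\<exists>\<epsilon>>0. \<forall>q\<in>singular_set U. q \<noteq> p \<longrightarrow> norm (q - p) \<ge> \<epsilon>"
proof -
  have p1: "norm p = 1" "U p = 0" using p by (auto simp: singular_set_def)
  obtain E where E: "frame E" "E 3 = p" using frame_exists[OF p1(1)] by blast
  obtain T T1 T2 where cyl: "cylindrical n U E T T1 T2" using cylindrical_exists[OF U E(1)] by blast
  have pU: "real_polynomial_function U" using U by (auto simp: harmonic_poly_def intro: hompoly_polynomial)
  have S: "U (frame_point E (r * cos \<phi>) (r * sin \<phi>) z) = (\<Sum>d\<le>n. r ^ d * z ^ (n - d) * T d \<phi>)" for r \<phi> z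
    using cyl unfolding cylindrical_def by blast
  have dT: "(T d has_real_derivative T1 d \<phi>) (at \<phi>)" "(T1 d has_real_derivative T2 d \<phi>) (at \<phi>)" for d \<phi>
    using cyl unfolding cylindrical_def by blast+
  have ode: "(real d)\<^sup>2 * T d \<phi> + T2 d \<phi> +
      (if 2 \<le> d then real (n - (d - 2)) * (real (n - (d - 2)) - 1) * T (d - 2) \<phi> else 0) = 0" if "d \<le> n" for d \<phi>
    using cyl that unfolding cylindrical_def by blast
  have polar: "\<exists>r \<phi>. x = frame_point E (r * cos \<phi>) (r * sin \<phi>) (x \<bullet> p)" for x
  proof -
    obtain r \<phi> where "x \<bullet> E 1 = r * cos \<phi>" "x \<bullet> E 2 = r * sin \<phi>" using polar_Ex by metis
    then show ?thesis using frame_expand[OF E(1), of x] E(2) by metis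
  qed
  have ex: "\<exists>d. d \<le> n \<and> (\<exists>\<phi>. T d \<phi> \<noteq> 0)"
  proof (rule ccontr)
    assume no: "\<not> ?thesis"
    obtain r \<phi> where "x0 = frame_point E (r * cos \<phi>) (r * sin \<phi>) (x0 \<bullet> p)" using polar by blast
    then have "U x0 = (\<Sum>d\<le>n. r ^ d * (x0 \<bullet> p) ^ (n - d) * T d \<phi>)" using S by metis
    also have "\<dots> = 0" using no by (intro sum.neutral) auto
    finally show False using nz by simp
  qed
  define k where "k = (LEAST d. d \<le> n \<and> (\<exists>\<phi>. T d \<phi> \<noteq> 0))"
  have k: "k \<le> n" "\<exists>\<phi>. T k \<phi> \<noteq> 0" using LeastI_ex[OF ex] by (auto simp: k_def)
  have low: "T d \<phi> = 0" if "d < k" for d \<phi>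
    using not_less_Least[of d "\<lambda>d. d \<le> n \<and> (\<exists>\<phi>. T d \<phi> \<noteq> 0)"] that k(1) by (auto simp: k_def)
  have low1: "T1 d \<phi> = 0" if "d < k" for d \<phi>
  proof -
    have "T d = (\<lambda>_. 0)" using low[OF that] by auto
    then show ?thesis using dT(1)[of d \<phi>] DERIV_unique[OF _ DERIV_const] by metis
  qed
  obtain \<phi>0 where \<phi>0: "T k \<phi>0 \<noteq> 0" using k(2) by blast
  have k1: "k \<ge> 1"
  proof (rule ccontr)
    assume "\<not> k \<ge> 1"
    then have k0: "k = 0" by simp
    have "U p = (\<Sum>d\<le>n. 0 ^ d * 1 ^ (n - d) * T d \<phi>0)" using S[of 0 \<phi>0 1] E(2) by (simp add: frame_point_def)
    also have "\<dots> = (\<Sum>d\<in>{0}. 0 ^ d * 1 ^ (n - d) * T d \<phi>0)"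
      by (intro sum.mono_neutral_right) auto
    finally show False using \<phi>0 p1 k0 by simp
  qed
  have T2k: "T2 k \<phi> = - ((real k)\<^sup>2 * T k \<phi>)" for \<phi>
    using ode[OF k(1), of \<phi>] low[of "k - 2" \<phi>] k1 by (cases "2 \<le> k") auto
  \<comment> \<open>The energy of the oscillator T_k'' = - k^2 T_k: constant in \<phi> and positive,
    hence a uniform lower bound for the pair T_k, T_k'.\<close>
  define e where "e = (\<lambda>\<phi>. (real k)\<^sup>2 * (T k \<phi>)\<^sup>2 + (T1 k \<phi>)\<^sup>2)"
  have "(e has_real_derivative 0) (at \<phi>)" for \<phi>
  proof -
    have "(e has_real_derivative (real k)\<^sup>2 * (2 * T k \<phi> * T1 k \<phi>) + 2 * T1 k \<phi> * T2 k \<phi>) (at \<phi>)"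
      unfolding e_def
      by (rule DERIV_cong[OF DERIV_add[OF DERIV_cmult[OF DERIV_power[OF dT(1)]] DERIV_power[OF dT(2)]]]) simp
    then show ?thesis by (simp add: T2k)
  qed
  then have econst: "e \<phi> = e \<phi>0" for \<phi> using DERIV_isconst_all by blast
  have epos: "e \<phi>0 > 0"
  proof -
    have "(real k)\<^sup>2 * (T k \<phi>0)\<^sup>2 > 0" using k1 \<phi>0 by simp
    then show ?thesis unfolding e_def by (simp add: add_pos_nonneg)
  qed
  obtain M where M: "\<And>d \<phi>. d \<le> n \<Longrightarrow> \<bar>T d \<phi>\<bar> \<le> M" "\<And>d \<phi>. d \<le> n \<Longrightarrow> \<bar>T1 d \<phi>\<bar> \<le> M"
  proof -
    have "\<forall>d. \<exists>m. \<forall>\<phi>. \<bar>T d \<phi>\<bar> \<le> m \<and> \<bar>T1 d \<phi>\<bar> \<le> m"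
    proof
      fix d
      obtain D D' where "T d = trig_form d D" "T1 d = trig_form d D'" using cyl unfolding cylindrical_def by blast
      then show "\<exists>m. \<forall>\<phi>. \<bar>T d \<phi>\<bar> \<le> m \<and> \<bar>T1 d \<phi>\<bar> \<le> m"
        using trig_form_bound by (intro exI[of _ "max (\<Sum>i\<le>d. \<bar>D i\<bar>) (\<Sum>i\<le>d. \<bar>D' i\<bar>)"]) (simp add: le_max_iff_disj)
    qed
    then obtain m where m: "\<And>d \<phi>. \<bar>T d \<phi>\<bar> \<le> m d" "\<And>d \<phi>. \<bar>T1 d \<phi>\<bar> \<le> m d" by metis
    have m0: "m d \<ge> 0" for d using m(1)[of d 0] by linarith
    have "m d \<le> (\<Sum>i\<le>n. m i)" if "d \<le> n" for d
      using m0 that by (intro member_le_sum) auto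
    then show ?thesis using that[of "\<Sum>i\<le>n. m i"] m by (meson order_trans)
  qed
  define K where "K = 2 ^ n * (real n * M)"
  \<comment> \<open>At another singular point with horizontal radius r, both T_k and T_k' will be at
    most |r| K, so the energy is at most (n^2 + 1) K^2 r^2. This choice keeps that below
    \<open>e \<phi>0\<close>; the cap 1 forces z \<ge> 1/2.\<close>
  define \<epsilon> where "\<epsilon> = min 1 (sqrt (e \<phi>0 / (((real n)\<^sup>2 + 1) * K\<^sup>2 + 1)))"
  have den: "((real n)\<^sup>2 + 1) * K\<^sup>2 + 1 > 0" by (simp add: add_nonneg_pos)
  have \<epsilon>: "\<epsilon> > 0" "\<epsilon> \<le> 1" using epos den by (auto simp: \<epsilon>_def)
  have \<epsilon>2: "\<epsilon>\<^sup>2 * (((real n)\<^sup>2 + 1) * K\<^sup>2 + 1) \<le> e \<phi>0"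
  proof -
    have "\<epsilon>\<^sup>2 \<le> (sqrt (e \<phi>0 / (((real n)\<^sup>2 + 1) * K\<^sup>2 + 1)))\<^sup>2"
      using \<epsilon> by (intro power_mono) (auto simp: \<epsilon>_def)
    also have "\<dots> = e \<phi>0 / (((real n)\<^sup>2 + 1) * K\<^sup>2 + 1)" using epos den by simp
    finally show ?thesis using den by (simp add: le_divide_eq)
  qed
  have "norm (q - p) \<ge> \<epsilon>" if q: "q \<in> singular_set U" "q \<noteq> p" for q
  proof (rule ccontr)
    assume "\<not> norm (q - p) \<ge> \<epsilon>"
    then have near: "norm (q - p) < \<epsilon>" by simp
    have q1: "norm q = 1" "U q = 0" "gradient U q = 0" using q by (auto simp: singular_set_def)
    define z where "z = q \<bullet> p"
    obtain r \<phi> where rq: "q = frame_point E (r * cos \<phi>) (r * sin \<phi>) z" using polar z_def by blast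
    have cs: "(r * cos \<phi>)\<^sup>2 + (r * sin \<phi>)\<^sup>2 = r\<^sup>2"
    proof -
      have "(r * cos \<phi>)\<^sup>2 + (r * sin \<phi>)\<^sup>2 = r\<^sup>2 * ((cos \<phi>)\<^sup>2 + (sin \<phi>)\<^sup>2)"
        by (simp only: power_mult_distrib distrib_left)
      then show ?thesis by simp
    qed
    have rz: "r\<^sup>2 + z\<^sup>2 = 1"
      using frame_norm[OF E(1), of "r * cos \<phi>" "r * sin \<phi>" z] cs q1(1) rq by simp
    have dist: "(norm (q - p))\<^sup>2 = r\<^sup>2 + (z - 1)\<^sup>2"
    proof -
      have "q - p = frame_point E (r * cos \<phi>) (r * sin \<phi>) (z - 1)"
        using rq E(2) by (simp add: frame_point_def algebra_simps)
      then show ?thesis using frame_norm[OF E(1)] cs by simp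
    qed
    have d2: "(norm (q - p))\<^sup>2 < \<epsilon>\<^sup>2" using near by (intro power_strict_mono) auto
    have "\<epsilon>\<^sup>2 \<le> 1" using \<epsilon> by (simp add: power_le_one)
    moreover have "r\<^sup>2 + (z - 1)\<^sup>2 = 2 - 2 * z" using rz by (simp add: power2_eq_square algebra_simps)
    ultimately have z1: "1 / 2 \<le> z" using d2 dist by linarith
    have z2: "z \<le> 1"
      using rz abs_square_le_1[of z] zero_le_power2[of r] by linarith
    have r1: "\<bar>r\<bar> \<le> 1" using rz abs_square_le_1[of r] zero_le_power2[of z] by linarith
    have r0: "r \<noteq> 0"
    proof
      assume "r = 0"
      then have "z = 1" using rz z1 by (simp add: power2_eq_1_iff)
      then show False using rq \<open>r = 0\<close> q(2) E(2) by (simp add: frame_point_def)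
    qed
    have r\<epsilon>: "r\<^sup>2 < \<epsilon>\<^sup>2" using d2 dist zero_le_power2[of "z - 1"] by linarith
    have A: "\<bar>T k \<phi>\<bar> \<le> \<bar>r\<bar> * K" unfolding K_def
    proof (rule leading_coefficient_small[where z = z])
      show "(\<Sum>d\<le>n. r ^ d * z ^ (n - d) * T d \<phi>) = 0" using S[of r \<phi> z] rq q1 by simp
    qed (use low M k r0 r1 z1 z2 in auto)
    \<comment> \<open>The angular derivative of U is a directional derivative and vanishes at q with
      the gradient, so the same estimate applies to the sum of the T_d'.\<close>
    have B: "\<bar>T1 k \<phi>\<bar> \<le> \<bar>r\<bar> * K" unfolding K_def
    proof (rule leading_coefficient_small[where z = z])
      define \<gamma> where "\<gamma> = (\<lambda>\<phi>. frame_point E (r * cos \<phi>) (r * sin \<phi>) z)"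
      have d\<gamma>: "(\<gamma> has_vector_derivative frame_point E (- r * sin \<phi>) (r * cos \<phi>) 0) (at \<phi>)"
        unfolding \<gamma>_def frame_point_def by (auto intro!: derivative_eq_intros simp: mult.commute)
      have "(\<Sum>d\<le>n. r ^ d * z ^ (n - d) * T1 d \<phi>) = gradient U (\<gamma> \<phi>) \<bullet> frame_point E (- r * sin \<phi>) (r * cos \<phi>) 0"
      proof (rule DERIV_unique[OF _ DERIV_along_path[OF pU d\<gamma>]])
        show "((\<lambda>t. U (\<gamma> t)) has_real_derivative (\<Sum>d\<le>n. r ^ d * z ^ (n - d) * T1 d \<phi>)) (at \<phi>)"
          unfolding \<gamma>_def S by (intro DERIV_sum DERIV_cmult dT)
      qed
      then show "(\<Sum>d\<le>n. r ^ d * z ^ (n - d) * T1 d \<phi>) = 0" using rq q1 by (simp add: \<gamma>_def)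
    qed (use low1 M k r0 r1 z1 z2 in auto)
    have "(T k \<phi>)\<^sup>2 \<le> r\<^sup>2 * K\<^sup>2" "(T1 k \<phi>)\<^sup>2 \<le> r\<^sup>2 * K\<^sup>2"
      using power_mono[OF A, of 2] power_mono[OF B, of 2] by (simp_all add: power_mult_distrib)
    moreover have "(real k)\<^sup>2 * (T k \<phi>)\<^sup>2 \<le> (real n)\<^sup>2 * (r\<^sup>2 * K\<^sup>2)"
      using k(1) calculation by (intro mult_mono power_mono) auto
    ultimately have "e \<phi> \<le> ((real n)\<^sup>2 + 1) * K\<^sup>2 * r\<^sup>2" unfolding e_def by (simp add: algebra_simps)
    also have "\<dots> \<le> ((real n)\<^sup>2 + 1) * K\<^sup>2 * \<epsilon>\<^sup>2"
      using r\<epsilon> by (intro mult_left_mono) auto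
    also have "\<dots> < \<epsilon>\<^sup>2 * (((real n)\<^sup>2 + 1) * K\<^sup>2 + 1)" using \<epsilon> by (simp add: algebra_simps)
    finally show False using \<epsilon>2 econst[of \<phi>] by simp
  qed
  then show ?thesis using \<epsilon> by blast
qed

lemma continuous_on_hompoly: "hompoly n U \<Longrightarrow> continuous_on S U"
  using hompoly_polynomial continuous_on_polymonial_function real_polynomial_function_eq by blast

lemma continuous_on_gradient_hompoly: "hompoly n U \<Longrightarrow> continuous_on S (gradient U)"
  using hompoly_polynomial polynomial_function_gradient continuous_on_polymonial_function by blast

lemma finite_singular_set:
  assumes U: "harmonic_poly n U" and nz: "U x0 \<noteq> 0"
  shows "finite (singular_set U)"
proof -
  let ?Z = "singular_set U"
  have h: "hompoly n U" using U by (simp add: harmonic_poly_def)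
  have "?Z = {x \<in> sphere 0 1. U x = 0} \<inter> {x \<in> sphere 0 1. gradient U x = 0}"
    by (auto simp: singular_set_def)
  then have "closed ?Z"
    by (simp only:) (intro closed_Int continuous_closed_preimage_constant continuous_on_hompoly[OF h]
        continuous_on_gradient_hompoly[OF h] closed_sphere)
  moreover have "bounded ?Z" by (rule bounded_subset[of "sphere 0 1"]) (auto simp: singular_set_def)
  ultimately have "compact ?Z" by (simp add: compact_eq_bounded_closed)
  moreover have "\<not> p islimpt ?Z" if p: "p \<in> ?Z" for p
  proof
    assume lim: "p islimpt ?Z"
    obtain \<epsilon> where "\<epsilon> > 0" "\<forall>q\<in>?Z. q \<noteq> p \<longrightarrow> norm (q - p) \<ge> \<epsilon>"
      using singular_point_isolated[OF U nz p] by blast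
    then show False using lim unfolding islimpt_approachable dist_norm by force
  qed
  ultimately have "finite (?Z \<inter> ?Z)" by (rule finite_not_islimpt_in_compact)
  then show ?thesis by simp
qed

section \<open>Volumes in orthonormal frames\<close>

lemma continuous_on_frame_point [continuous_intros]:
  assumes "continuous_on S f" "continuous_on S g" "continuous_on S h"
  shows "continuous_on S (\<lambda>x. frame_point E (f x) (g x) (h x))"
  unfolding frame_point_def by (intro continuous_intros assms)

text \<open>Cartesian coordinates as a nested pair, the shape in which Fubini's theorem
  applies.\<close>

lemma lborel_distr_axis:
  "lborel = distr lborel borel (\<lambda>q :: (real \<times> real) \<times> real. frame_point (\<lambda>i. axis i 1) (fst (fst q)) (snd (fst q)) (snd q))"
    (is "_ = distr _ _ ?F")
proof (rule lborel_eqI)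
  fix l u :: "real ^ 3" assume le: "\<And>b. b \<in> Basis \<Longrightarrow> l \<bullet> b \<le> u \<bullet> b"
  have c: "frame_point (\<lambda>i. axis i 1) x y z $ 1 = x" "frame_point (\<lambda>i. axis i 1) x y z $ 2 = y"
    "frame_point (\<lambda>i. axis i 1) x y z $ 3 = z" for x y z
    by (simp_all add: frame_point_def axis_def)
  have leI: "l $ i \<le> u $ i" for i using le[of "axis i 1"] by (simp add: inner_axis)
  have m: "?F \<in> borel_measurable borel"
    by (intro borel_measurable_continuous_onI continuous_intros)
  have "?F -` box l u = ({l $ 1<..<u $ 1} \<times> {l $ 2<..<u $ 2}) \<times> {l $ 3<..<u $ 3}"
    by (auto simp: mem_box_cart forall_3 c)
  then have "emeasure (distr lborel borel ?F) (box l u) = emeasure lborel (({l $ 1<..<u $ 1} \<times> {l $ 2<..<u $ 2}) \<times> {l $ 3<..<u $ 3})"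
    using m by (simp add: emeasure_distr)
  also have "\<dots> = emeasure lborel ({l $ 1<..<u $ 1} \<times> {l $ 2<..<u $ 2}) * emeasure lborel {l $ 3<..<u $ 3}"
    unfolding lborel_prod[symmetric, where 'a = "real \<times> real"]
    by (rule lborel.emeasure_pair_measure_Times) (auto intro!: borel_open open_Times)
  also have "emeasure lborel ({l $ 1<..<u $ 1} \<times> {l $ 2<..<u $ 2}) = emeasure lborel {l $ 1<..<u $ 1} * emeasure lborel {l $ 2<..<u $ 2}"
    unfolding lborel_prod[symmetric]
    by (rule lborel.emeasure_pair_measure_Times) auto
  also have "emeasure lborel {l $ 1<..<u $ 1} * emeasure lborel {l $ 2<..<u $ 2} * emeasure lborel {l $ 3<..<u $ 3}
     = ennreal ((u $ 1 - l $ 1) * (u $ 2 - l $ 2) * (u $ 3 - l $ 3))"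
    using leI by (simp add: ennreal_mult)
  also have "(u $ 1 - l $ 1) * (u $ 2 - l $ 2) * (u $ 3 - l $ 3) = (\<Prod>b\<in>Basis. (u - l) \<bullet> b)"
  proof -
    have B: "(Basis :: (real ^ 3) set) = (\<lambda>i. axis i 1) ` UNIV" by (auto simp: Basis_vec_def)
    have "inj (\<lambda>i :: 3. axis i (1 :: real))" by (auto simp: inj_on_def axis_eq_axis)
    then have "(\<Prod>b\<in>Basis. (u - l) \<bullet> b) = (\<Prod>i\<in>UNIV. (u - l) $ i)"
      unfolding B by (simp add: prod.reindex inner_axis)
    then show ?thesis unfolding UNIV_3 by (simp add: mult.assoc)
  qed
  finally show "emeasure (distr lborel borel ?F) (box l u) = ennreal (prod ((\<bullet>) (u - l)) Basis)" .
qed simp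

lemma lborel_distr_orthogonal:
  fixes L :: "real ^ 3 \<Rightarrow> real ^ 3"
  assumes "orthogonal_transformation L"
  shows "lborel = distr lborel borel L"
proof (rule lborel_eqI)
  fix l u :: "real ^ 3" assume le: "\<And>b. b \<in> Basis \<Longrightarrow> l \<bullet> b \<le> u \<bullet> b"
  have lin: "linear L" using assms by (rule orthogonal_transformation_linear)
  have m: "L \<in> borel_measurable borel"
    using lin by (intro borel_measurable_continuous_onI linear_continuous_on) (simp add: linear_conv_bounded_linear)
  have bij: "bij L" using assms by (rule orthogonal_transformation_bij)
  have eq: "L -` box l u = inv L ` box l u" using bij by (rule bij_vimage_eq_inv_image)
  have oi: "orthogonal_transformation (inv L)" using assms by (rule orthogonal_transformation_inv)
  have "linear (inv L)" using oi by (rule orthogonal_transformation_linear)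
  then have "bounded (L -` box l u)" unfolding eq
    by (intro bounded_linear_image bounded_box) (simp add: linear_conv_bounded_linear)
  then have fin: "emeasure lborel (L -` box l u) < \<infinity>" by (rule emeasure_bounded_finite)
  have sets: "L -` box l u \<in> sets lborel" using measurable_sets[OF m, of "box l u"] by simp
  have "emeasure (distr lborel borel L) (box l u) = emeasure lborel (L -` box l u)"
    using m by (simp add: emeasure_distr)
  also have "\<dots> = ennreal (measure lborel (L -` box l u))"
    using fin by (intro emeasure_eq_ennreal_measure) auto
  also have "measure lborel (L -` box l u) = measure lebesgue (inv L ` box l u)"
    using sets unfolding eq by simp
  also have "\<dots> = measure lebesgue (box l u)" using oi by (rule measure_orthogonal_image) simp
  also have "\<dots> = measure lborel (box l u)" by simp
  also have "ennreal \<dots> = emeasure lborel (box l u)"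
    by (intro emeasure_eq_ennreal_measure[symmetric]) (use emeasure_lborel_box_finite[of l u] in auto)
  finally show "emeasure (distr lborel borel L) (box l u) = ennreal (prod ((\<bullet>) (u - l)) Basis)"
    using le by simp
qed simp

text \<open>Rotation invariance and Fubini along the lines parallel to \<open>E 3\<close>. With
  \<open>E 3\<close> taken at or near the set to be met by the circles, the admissible centres on
  each line are controlled by a short interval.\<close>

lemma emeasure_frame:
  assumes E: "frame E" and S: "S \<in> sets borel"
  shows "emeasure lborel S = (\<integral>\<^sup>+p. emeasure lborel {h. frame_point E (fst p) (snd p) h \<in> S} \<partial>lborel)"
proof -
  define F where "F = (\<lambda>q :: (real \<times> real) \<times> real. frame_point (\<lambda>i. axis i 1) (fst (fst q)) (snd (fst q)) (snd q))"
  define L where "L = (\<lambda>x :: real ^ 3. frame_point E (x $ 1) (x $ 2) (x $ 3))"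
  have "orthogonal_transformation L"
    unfolding orthogonal_transformation_def
  proof (intro conjI allI)
    show "linear L" unfolding L_def frame_point_def by (rule linearI) (simp_all add: algebra_simps)
    show "L v \<bullet> L w = v \<bullet> w" for v w
      unfolding L_def frame_inner[OF E] by (simp add: inner_vec_def sum_3)
  qed
  then have dL: "lborel = distr lborel borel L" by (rule lborel_distr_orthogonal)
  have dF: "lborel = distr lborel borel F" unfolding F_def by (rule lborel_distr_axis)
  have mL: "L \<in> borel_measurable borel" unfolding L_def
    by (intro borel_measurable_continuous_onI continuous_intros)
  have mF: "F \<in> borel_measurable borel" unfolding F_def
    by (intro borel_measurable_continuous_onI continuous_intros)
  have LF: "L (F q) = frame_point E (fst (fst q)) (snd (fst q)) (snd q)" for q
    by (simp add: L_def F_def frame_point_def axis_def)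
  have "emeasure lborel S = emeasure lborel (L -` S)"
    using mL S by (subst dL) (simp add: emeasure_distr)
  also have "L -` S \<in> sets borel" using measurable_sets[OF mL S] by simp
  then have "emeasure lborel (L -` S) = emeasure lborel (F -` (L -` S))"
    using mF by (subst dF) (simp add: emeasure_distr)
  also have "\<dots> = emeasure (lborel \<Otimes>\<^sub>M lborel) (F -` (L -` S))" by (simp add: lborel_prod)
  also have "\<dots> = (\<integral>\<^sup>+p. emeasure lborel (Pair p -` (F -` (L -` S))) \<partial>lborel)"
  proof (rule lborel.emeasure_pair_measure_alt)
    have "F -` (L -` S) \<in> sets lborel" using measurable_sets[OF mF \<open>L -` S \<in> sets borel\<close>] by simp
    then show "F -` (L -` S) \<in> sets (lborel \<Otimes>\<^sub>M lborel)" unfolding lborel_prod .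
  qed
  also have "\<dots> = (\<integral>\<^sup>+p. emeasure lborel {h. frame_point E (fst p) (snd p) h \<in> S} \<partial>lborel)"
    by (intro nn_integral_cong arg_cong[of _ _ "emeasure lborel"]) (auto simp: LF)
  finally show ?thesis .
qed

section \<open>Moments of discs\<close>

definition disc :: "real \<Rightarrow> (real \<times> real) set" where
  "disc R = {p. (fst p)\<^sup>2 + (snd p)\<^sup>2 \<le> R\<^sup>2}"

lemma closed_disc: "closed (disc R)"
  unfolding disc_def by (intro closed_Collect_le continuous_intros)

lemma disc_borel [measurable]: "disc R \<in> sets borel"
  by (rule borel_closed[OF closed_disc])

lemma nn_integral_disc:
  assumes R: "R \<ge> 0" and f: "f \<in> borel_measurable borel" "\<And>y. f y \<ge> 0"
  shows "(\<integral>\<^sup>+p. ennreal (f (fst p)) * indicator (disc R) p \<partial>lborel) =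
    (\<integral>\<^sup>+y. ennreal (f y * (2 * sqrt (R\<^sup>2 - y\<^sup>2))) * indicator {-R..R} y \<partial>lborel)"
proof -
  have "(\<integral>\<^sup>+p. ennreal (f (fst p)) * indicator (disc R) p \<partial>(lborel \<Otimes>\<^sub>M lborel)) =
    (\<integral>\<^sup>+y. \<integral>\<^sup>+z. ennreal (f y) * indicator (disc R) (y, z) \<partial>lborel \<partial>lborel)"
  proof (subst lborel.nn_integral_fst[symmetric])
    have [measurable]: "f \<in> borel_measurable borel" by fact
    have [measurable]: "disc R \<in> sets (lborel \<Otimes>\<^sub>M lborel)" unfolding lborel_prod by simp
    show "(\<lambda>p. ennreal (f (fst p)) * indicator (disc R) p) \<in> borel_measurable (lborel \<Otimes>\<^sub>M lborel)"
      by measurable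
  qed simp
  also have "\<dots> = (\<integral>\<^sup>+y. ennreal (f y * (2 * sqrt (R\<^sup>2 - y\<^sup>2))) * indicator {-R..R} y \<partial>lborel)"
  proof (intro nn_integral_cong)
    fix y
    have "(\<integral>\<^sup>+z. ennreal (f y) * indicator (disc R) (y, z) \<partial>lborel) =
       (\<integral>\<^sup>+z. ennreal (f y) * indicator {z. (y, z) \<in> disc R} z \<partial>lborel)"
      by (intro nn_integral_cong) (auto simp: indicator_def)
    also have "\<dots> = ennreal (f y) * emeasure lborel {z. (y, z) \<in> disc R}"
    proof (rule nn_integral_cmult_indicator)
      have "closed {z. (y, z) \<in> disc R}" unfolding disc_def by (auto intro!: closed_Collect_le continuous_intros)
      then show "{z. (y, z) \<in> disc R} \<in> sets lborel" by simp
    qed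
    also have "\<dots> = ennreal (f y * (2 * sqrt (R\<^sup>2 - y\<^sup>2))) * indicator {-R..R} y"
    proof (cases "\<bar>y\<bar> \<le> R")
      case True
      then have sq: "y\<^sup>2 \<le> R\<^sup>2" using abs_le_square_iff[of y R] R by simp
      have "{z. (y, z) \<in> disc R} = {- sqrt (R\<^sup>2 - y\<^sup>2)..sqrt (R\<^sup>2 - y\<^sup>2)}"
      proof -
        have iff: "(y, z) \<in> disc R \<longleftrightarrow> \<bar>z\<bar> \<le> sqrt (R\<^sup>2 - y\<^sup>2)" for z
        proof -
          have "(y, z) \<in> disc R \<longleftrightarrow> z\<^sup>2 \<le> R\<^sup>2 - y\<^sup>2" by (auto simp: disc_def)
          also have "\<dots> \<longleftrightarrow> sqrt (z\<^sup>2) \<le> sqrt (R\<^sup>2 - y\<^sup>2)" by (rule real_sqrt_le_iff[symmetric])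
          finally show ?thesis by simp
        qed
        show ?thesis
        proof (rule set_eqI)
          fix z
          show "z \<in> {z. (y, z) \<in> disc R} \<longleftrightarrow> z \<in> {- sqrt (R\<^sup>2 - y\<^sup>2)..sqrt (R\<^sup>2 - y\<^sup>2)}"
            unfolding mem_Collect_eq atLeastAtMost_iff iff abs_le_iff by linarith
        qed
      qed
      then have "emeasure lborel {z. (y, z) \<in> disc R} = ennreal (2 * sqrt (R\<^sup>2 - y\<^sup>2))"
        using sq by simp
      then show ?thesis using True f(2)[of y] sq by (simp add: ennreal_mult abs_le_iff indicator_def)
    next
      case False
      then have "y\<^sup>2 > R\<^sup>2" using abs_le_square_iff[of y R] R by auto
      then have "{z. (y, z) \<in> disc R} = {}" by (auto simp: disc_def) (smt (verit) zero_le_power2)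
      moreover have "y \<notin> {-R..R}" using False by auto
      ultimately show ?thesis by simp
    qed
    finally show "(\<integral>\<^sup>+z. ennreal (f y) * indicator (disc R) (y, z) \<partial>lborel) =
       ennreal (f y * (2 * sqrt (R\<^sup>2 - y\<^sup>2))) * indicator {-R..R} y" .
  qed
  finally show ?thesis by (simp add: lborel_prod)
qed

text \<open>Up to sign, 2/3 (R^2 - y^2)^(3/2) is an antiderivative. The square root in it is not
  differentiable at the end points, hence the fundamental theorem with derivatives in the interior
  only.\<close>

lemma has_integral_circle_moment:
  assumes R: "R \<ge> 0"
  shows "((\<lambda>y. y * (2 * sqrt (R\<^sup>2 - y\<^sup>2))) has_integral (2 / 3 * R ^ 3)) {0..R}"
    and "((\<lambda>y. - y * (2 * sqrt (R\<^sup>2 - y\<^sup>2))) has_integral (2 / 3 * R ^ 3)) {-R..0}"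
proof -
  define G where "G = (\<lambda>y. (2 / 3) * ((R\<^sup>2 - y\<^sup>2) * sqrt (R\<^sup>2 - y\<^sup>2)))"
  have dG: "(G has_vector_derivative - y * (2 * sqrt (R\<^sup>2 - y\<^sup>2))) (at y)" if "y \<in> {-R<..<R}" for y
  proof -
    have "\<bar>y\<bar> < \<bar>R\<bar>" using that by auto
    then have pos: "R\<^sup>2 - y\<^sup>2 > 0" using abs_le_square_iff[of R y] by (simp add: not_le[symmetric])
    have w: "((\<lambda>y. R\<^sup>2 - y\<^sup>2) has_real_derivative - 2 * y) (at y)"
      by (auto intro!: derivative_eq_intros)
    have s: "((\<lambda>y. sqrt (R\<^sup>2 - y\<^sup>2)) has_real_derivative inverse (sqrt (R\<^sup>2 - y\<^sup>2)) / 2 * (- 2 * y)) (at y)"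
      by (rule DERIV_chain2[where f = sqrt and g = "\<lambda>y. R\<^sup>2 - y\<^sup>2", OF DERIV_real_sqrt[OF pos] w])
    have "(G has_real_derivative (2 / 3) * (- 2 * y * sqrt (R\<^sup>2 - y\<^sup>2) + inverse (sqrt (R\<^sup>2 - y\<^sup>2)) / 2 * (- 2 * y) * (R\<^sup>2 - y\<^sup>2))) (at y)"
      unfolding G_def by (rule DERIV_cmult[OF DERIV_mult[OF w s]])
    moreover have "(2 / 3) * (- 2 * y * sqrt (R\<^sup>2 - y\<^sup>2) + inverse (sqrt (R\<^sup>2 - y\<^sup>2)) / 2 * (- 2 * y) * (R\<^sup>2 - y\<^sup>2)) = - y * (2 * sqrt (R\<^sup>2 - y\<^sup>2))"
    proof -
      define q where "q = sqrt (R\<^sup>2 - y\<^sup>2)"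
      have "q > 0" "R\<^sup>2 - y\<^sup>2 = q * q" using pos by (auto simp: q_def)
      then show ?thesis unfolding q_def[symmetric] by (simp add: field_simps)
    qed
    ultimately show ?thesis by (simp only: has_real_derivative_iff_has_vector_derivative)
  qed
  have cG: "continuous_on S G" for S unfolding G_def by (intro continuous_intros)
  have G0: "G R = 0" "G (-R) = 0" "G 0 = 2 / 3 * R ^ 3"
    using R by (simp_all add: G_def power2_eq_square power3_eq_cube)
  have "((\<lambda>y. - y * (2 * sqrt (R\<^sup>2 - y\<^sup>2))) has_integral (G R - G 0)) {0..R}"
    using R by (intro fundamental_theorem_of_calculus_interior cG dG) auto
  from has_integral_neg[OF this]
  show "((\<lambda>y. y * (2 * sqrt (R\<^sup>2 - y\<^sup>2))) has_integral (2 / 3 * R ^ 3)) {0..R}" by (simp add: G0)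
  have "((\<lambda>y. - y * (2 * sqrt (R\<^sup>2 - y\<^sup>2))) has_integral (G 0 - G (-R))) {-R..0}"
    using R by (intro fundamental_theorem_of_calculus_interior cG dG) auto
  then show "((\<lambda>y. - y * (2 * sqrt (R\<^sup>2 - y\<^sup>2))) has_integral (2 / 3 * R ^ 3)) {-R..0}" by (simp only: G0 diff_0_right)
qed

text \<open>This moment produces the constants of the kinematic formula. Over the point (y, z) the
  centres of great circles meeting a short segment along the first axis fill a slice of length
  proportional to |y|. For R = 1 the quotient of 4/3 by the volume 4/3 pi of the ball is Crofton's 1
  / pi, the average number of intersections per unit length.\<close>

lemma nn_integral_abs_disc:
  assumes R: "R \<ge> 0"
  shows "(\<integral>\<^sup>+p. ennreal \<bar>fst p\<bar> * indicator (disc R) p \<partial>lborel) = ennreal (4 / 3 * R ^ 3)"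
proof -
  have "((\<lambda>y. \<bar>y\<bar> * (2 * sqrt (R\<^sup>2 - y\<^sup>2))) has_integral (2 / 3 * R ^ 3)) {0..R}"
    by (rule has_integral_eq[OF _ has_integral_circle_moment(1)[OF R]]) auto
  moreover have "((\<lambda>y. \<bar>y\<bar> * (2 * sqrt (R\<^sup>2 - y\<^sup>2))) has_integral (2 / 3 * R ^ 3)) {-R..0}"
    by (rule has_integral_eq[OF _ has_integral_circle_moment(2)[OF R]]) auto
  ultimately have "((\<lambda>y. \<bar>y\<bar> * (2 * sqrt (R\<^sup>2 - y\<^sup>2))) has_integral (2 / 3 * R ^ 3 + 2 / 3 * R ^ 3)) {-R..R}"
    using R by (intro has_integral_combine[of "-R" 0 R]) auto
  then have "(\<integral>\<^sup>+y. ennreal (\<bar>y\<bar> * (2 * sqrt (R\<^sup>2 - y\<^sup>2))) * indicator {-R..R} y \<partial>lborel) = ennreal (2 / 3 * R ^ 3 + 2 / 3 * R ^ 3)"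
  proof (rule nn_integral_has_integral_lebesgue'[rotated])
    fix y assume "y \<in> {-R..R}"
    then have "y\<^sup>2 \<le> R\<^sup>2" using abs_le_square_iff[of y R] R by auto
    then show "0 \<le> \<bar>y\<bar> * (2 * sqrt (R\<^sup>2 - y\<^sup>2))" by simp
  qed
  then show ?thesis using nn_integral_disc[OF R, of abs] by simp
qed

text \<open>A crude bound suffices, since the area of the disc is multiplied by the flatness error
  \<open>\<epsilon>\<close>, which tends to 0.\<close>

lemma emeasure_disc_le:
  assumes "R \<ge> 0"
  shows "emeasure lborel (disc R) \<le> ennreal (4 * R\<^sup>2)"
proof -
  have "emeasure lborel (disc R) \<le> emeasure lborel ({-R..R} \<times> {-R..R})"
  proof (rule emeasure_mono)
    show "disc R \<subseteq> {-R..R} \<times> {-R..R}"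
    proof
      fix p assume "p \<in> disc R"
      then have "(fst p)\<^sup>2 \<le> R\<^sup>2" "(snd p)\<^sup>2 \<le> R\<^sup>2"
        unfolding disc_def using zero_le_power2[of "fst p"] zero_le_power2[of "snd p"] by (auto intro: order_trans[rotated])
      then have "\<bar>fst p\<bar> \<le> R" "\<bar>snd p\<bar> \<le> R" using abs_le_square_iff[of _ R] assms by auto
      then show "p \<in> {-R..R} \<times> {-R..R}" by (cases p) (auto simp: abs_le_iff)
    qed
  qed (auto intro!: borel_closed closed_Times)
  also have "\<dots> = emeasure lborel {-R..R} * emeasure lborel {-R..R}"
    unfolding lborel_prod[symmetric] by (rule lborel.emeasure_pair_measure_Times) auto
  also have "\<dots> = ennreal (4 * R\<^sup>2)" using assms by (simp add: ennreal_mult[symmetric] power2_eq_square)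
  finally show ?thesis .
qed

section \<open>Volume of the centres whose circles meet a short set\<close>

lemma emeasure_small_gaps:
  fixes X :: "real set"
  assumes gap: "\<And>x y. x \<in> X \<Longrightarrow> y \<in> X \<Longrightarrow> x < y \<Longrightarrow> y - x \<le> l" and l: "l \<ge> 0"
  shows "emeasure lborel X \<le> ennreal l"
proof (cases "X = {}")
  case False
  then obtain x0 where x0: "x0 \<in> X" by blast
  have gap': "y \<le> x + l" if "x \<in> X" "y \<in> X" for x y
    using gap[OF that] l by (cases "x < y") auto
  have bdd: "bdd_above X" "bdd_below X"
    using gap'[OF x0] gap'[OF _ x0] by (auto intro!: bdd_aboveI[of _ "x0 + l"] bdd_belowI[of _ "x0 - l"] simp: algebra_simps)
  have "X \<subseteq> {Inf X..Sup X}" using bdd by (auto intro: cInf_lower cSup_upper)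
  then have "emeasure lborel X \<le> emeasure lborel {Inf X..Sup X}" by (intro emeasure_mono) auto
  also have "\<dots> = ennreal (Sup X - Inf X)"
    using cInf_lower[OF x0 bdd(2)] cSup_upper[OF x0 bdd(1)] by simp
  also have "\<dots> \<le> ennreal l"
  proof (rule ennreal_leI)
    have "Sup X \<le> x + l" if "x \<in> X" for x using False gap'[OF that] by (intro cSup_least) auto
    then have "Sup X - l \<le> Inf X" using False by (intro cInf_greatest) (auto simp: algebra_simps)
    then show "Sup X - Inf X \<le> l" by simp
  qed
  finally show ?thesis .
qed (use l in simp)

text \<open>Circles of fixed radius hitting a short, almost straight set \<open>A\<close>: the centres are weighted by
  Lebesgue measure on the unit ball, \<open>a\<close> standing for the centre \<open>a / norm a\<close>.\<close>

definition circle_hits :: "real \<Rightarrow> (real ^ 3) set \<Rightarrow> (real ^ 3) set" where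
  "circle_hits c A = {a \<in> ball 0 1. \<exists>x\<in>A. a \<bullet> x = c * norm a}"

text \<open>A closed set projected along a compact factor is closed; this makes the set of centres
  measurable. Members of a cover are arbitrary sets and will be replaced by compact ones for this
  reason.\<close>

lemma circle_hits_borel:
  assumes "compact A"
  shows "circle_hits c A \<in> sets borel"
proof -
  have "closed {z :: (real ^ 3) \<times> (real ^ 3). snd z \<bullet> fst z = c * norm (snd z)}"
    by (intro closed_Collect_eq continuous_intros)
  from closed_compact_projection[OF assms this]
  have "closed {a. \<exists>x. x \<in> A \<and> a \<bullet> x = c * norm a}" by simp
  moreover have "circle_hits c A = ball 0 1 \<inter> {a. \<exists>x. x \<in> A \<and> a \<bullet> x = c * norm a}"
    by (auto simp: circle_hits_def)
  ultimately show ?thesis by auto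
qed

text \<open>Two centres on one line parallel to \<open>E 3\<close>, whose circles pass through x1
  and x2. Subtracting the equations a_i x_i = c |a_i| leaves on one side the tangential displacement
  times y plus residuals, at most d |y| + 2 \<epsilon> d. On the other side |a_2| - |a_1| = (h2 -
  h1) (h1 + h2) / (|a_1| + |a_2|), and the last quotient is c up to an error d, so that side is
  about (1 - c^2) (h2 - h1).\<close>

lemma flat_section_gap:
  fixes c d \<delta> \<epsilon> :: real
  assumes E: "frame E" and c: "\<bar>c\<bar> \<le> 1" and \<delta>: "d \<le> \<delta>" "0 \<le> d" "\<delta> < 1 - c\<^sup>2" and \<epsilon>: "\<epsilon> \<ge> 0"
    and x1: "norm (x1 - E 3) \<le> d" "norm ((x1 - E 3) - ((x1 - E 3) \<bullet> E 1) *\<^sub>R E 1) \<le> \<epsilon> * d"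
    and x2: "norm (x2 - E 3) \<le> d" "norm ((x2 - E 3) - ((x2 - E 3) \<bullet> E 1) *\<^sub>R E 1) \<le> \<epsilon> * d"
    and x12: "norm (x1 - x2) \<le> d"
    and a1: "a1 = frame_point E y z h1" "norm a1 < 1" "a1 \<bullet> x1 = c * norm a1"
    and a2: "a2 = frame_point E y z h2" "norm a2 < 1" "a2 \<bullet> x2 = c * norm a2" and h: "h1 < h2"
  shows "h2 - h1 \<le> (d * \<bar>y\<bar> + 2 * \<epsilon> * d) / (1 - c\<^sup>2 - \<delta>)"
proof -
  have nE: "norm (E i) = 1" for i using E by (auto simp: frame_def norm_eq_1)
  have residual: "a \<bullet> x = h + ((x - E 3) \<bullet> E 1) * y + a \<bullet> ((x - E 3) - ((x - E 3) \<bullet> E 1) *\<^sub>R E 1)"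
    if "a = frame_point E y z h" for a x h
    using frame_coordinates[OF E, of y z h] that
    by (simp add: inner_diff_right algebra_simps)
  have res_bound: "\<bar>a \<bullet> ((x - E 3) - ((x - E 3) \<bullet> E 1) *\<^sub>R E 1)\<bar> \<le> \<epsilon> * d"
    if "norm a < 1" "norm ((x - E 3) - ((x - E 3) \<bullet> E 1) *\<^sub>R E 1) \<le> \<epsilon> * d" for a x
  proof -
    have "\<bar>a \<bullet> ((x - E 3) - ((x - E 3) \<bullet> E 1) *\<^sub>R E 1)\<bar> \<le> norm a * norm ((x - E 3) - ((x - E 3) \<bullet> E 1) *\<^sub>R E 1)"
      by (rule Cauchy_Schwarz_ineq2)
    also have "\<dots> \<le> 1 * (\<epsilon> * d)" using that by (intro mult_mono) auto
    finally show ?thesis by simp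
  qed
  have hn: "\<bar>h - c * norm a\<bar> \<le> d * norm a" if "a = frame_point E y z h" "a \<bullet> x = c * norm a" "norm (x - E 3) \<le> d" for a x h
  proof -
    have "a \<bullet> E 3 = h" using frame_coordinates[OF E, of y z h] that by simp
    then have "h - c * norm a = - (a \<bullet> (x - E 3))" using that by (simp add: inner_diff_right)
    then have "\<bar>h - c * norm a\<bar> \<le> norm a * norm (x - E 3)" using Cauchy_Schwarz_ineq2[of a "x - E 3"] by simp
    also have "\<dots> \<le> norm a * d" using that by (intro mult_left_mono) auto
    finally show ?thesis by (simp add: mult.commute)
  qed
  define N where "N = norm a1 + norm a2"
  have sq: "(norm a1)\<^sup>2 = y\<^sup>2 + z\<^sup>2 + h1\<^sup>2" "(norm a2)\<^sup>2 = y\<^sup>2 + z\<^sup>2 + h2\<^sup>2"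
    using frame_norm[OF E] a1 a2 by auto
  have N: "N > 0"
  proof -
    have "h1 \<noteq> 0 \<or> h2 \<noteq> 0" using h by auto
    then have "(norm a1)\<^sup>2 > 0 \<or> (norm a2)\<^sup>2 > 0" unfolding sq by (auto simp: add_nonneg_pos)
    then show ?thesis unfolding N_def by (auto simp: add_pos_nonneg add_nonneg_pos)
  qed
  have diff: "(norm a2 - norm a1) * N = (h2 - h1) * (h1 + h2)"
    using sq unfolding N_def by (simp add: power2_eq_square algebra_simps)
  have med: "\<bar>h1 + h2 - c * N\<bar> \<le> d * N"
    using hn[OF a1(1,3) x1(1)] hn[OF a2(1,3) x2(1)] unfolding N_def by (simp add: algebra_simps abs_le_iff)
  have num: "(h2 - h1) - c * (norm a2 - norm a1) \<le> d * \<bar>y\<bar> + 2 * \<epsilon> * d"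
  proof -
    have "(h2 - h1) - c * (norm a2 - norm a1) =
       ((x1 - x2) \<bullet> E 1) * y + a1 \<bullet> ((x1 - E 3) - ((x1 - E 3) \<bullet> E 1) *\<^sub>R E 1) - a2 \<bullet> ((x2 - E 3) - ((x2 - E 3) \<bullet> E 1) *\<^sub>R E 1)"
      using residual[OF a1(1), of x1] residual[OF a2(1), of x2] a1(3) a2(3)
      by (simp add: inner_diff_left algebra_simps)
    also have "((x1 - x2) \<bullet> E 1) * y \<le> d * \<bar>y\<bar>"
    proof -
      have "\<bar>(x1 - x2) \<bullet> E 1\<bar> \<le> d" using Cauchy_Schwarz_ineq2[of "x1 - x2" "E 1"] x12 nE by simp
      then have "\<bar>(x1 - x2) \<bullet> E 1\<bar> * \<bar>y\<bar> \<le> d * \<bar>y\<bar>" by (rule mult_right_mono) simp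
      then show ?thesis unfolding abs_mult[symmetric] by linarith
    qed
    finally show ?thesis using res_bound[OF a1(2) x1(2)] res_bound[OF a2(2) x2(2)] by (simp add: abs_le_iff)
  qed
  have "(h2 - h1) * (1 - c\<^sup>2 - \<delta>) * N \<le> ((h2 - h1) - c * (norm a2 - norm a1)) * N"
  proof -
    have "((h2 - h1) - c * (norm a2 - norm a1)) * N = (h2 - h1) * N - c * ((norm a2 - norm a1) * N)"
      by (simp add: algebra_simps)
    also have "\<dots> = (h2 - h1) * (N - c * (h1 + h2))"
      unfolding diff by (simp add: algebra_simps)
    finally have "((h2 - h1) - c * (norm a2 - norm a1)) * N = (h2 - h1) * (N - c * (h1 + h2))" .
    moreover have "c * (h1 + h2) \<le> (c\<^sup>2 + \<delta>) * N"
    proof -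
      have "c * (h1 + h2 - c * N) \<le> \<bar>c\<bar> * \<bar>h1 + h2 - c * N\<bar>" by (metis abs_ge_self abs_mult)
      also have "\<dots> \<le> 1 * (\<delta> * N)"
        using c med \<delta> N by (intro mult_mono order_trans[OF med] mult_right_mono) auto
      finally show ?thesis by (simp add: power2_eq_square algebra_simps)
    qed
    moreover have "(1 - c\<^sup>2 - \<delta>) * N \<le> N - c * (h1 + h2)"
      using calculation(2) by (simp add: algebra_simps)
    then have "(h2 - h1) * ((1 - c\<^sup>2 - \<delta>) * N) \<le> (h2 - h1) * (N - c * (h1 + h2))"
      using h by (intro mult_left_mono) auto
    ultimately show ?thesis by (simp only: mult.assoc)
  qed
  then have "(h2 - h1) * (1 - c\<^sup>2 - \<delta>) \<le> (h2 - h1) - c * (norm a2 - norm a1)"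
    using N by (simp only: mult_le_cancel_right)
  then show ?thesis using num \<delta> by (simp add: le_divide_eq)
qed

text \<open>The height of a is c |a| up to d |a|, so its horizontal part is at most about sqrt (1 -
  c^2) |a|; outside this disc the slices are empty.\<close>

lemma flat_section_disc:
  fixes c d \<delta> :: real
  assumes E: "frame E" and c: "\<bar>c\<bar> \<le> 1" and \<delta>: "d \<le> \<delta>" "0 \<le> d"
    and x: "norm (x - E 3) \<le> d" and a: "a = frame_point E y z h" "norm a < 1" "a \<bullet> x = c * norm a"
  shows "(y, z) \<in> disc (sqrt (1 - c\<^sup>2 + 2 * \<delta>))"
proof -
  have c2: "c\<^sup>2 \<le> 1" using c by (simp add: abs_square_le_1)
  have "a \<bullet> E 3 = h" using frame_coordinates[OF E, of y z h] a by simp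
  then have "h - c * norm a = - (a \<bullet> (x - E 3))" using a by (simp add: inner_diff_right)
  then have "\<bar>h - c * norm a\<bar> \<le> norm a * norm (x - E 3)" using Cauchy_Schwarz_ineq2[of a "x - E 3"] by simp
  also have "\<dots> \<le> norm a * \<delta>" using x \<delta> by (intro mult_left_mono) auto
  finally have e: "\<bar>h - c * norm a\<bar> \<le> norm a * \<delta>" .
  have "c * norm a * (h - c * norm a) \<ge> - (norm a * (norm a * \<delta>))"
  proof -
    have "\<bar>c * norm a * (h - c * norm a)\<bar> \<le> (1 * norm a) * (norm a * \<delta>)"
      unfolding abs_mult[of "c * norm a"] using mult_right_mono[OF c norm_ge_zero[of a]] e
      by (intro mult_mono) (auto simp: abs_mult)
    then show ?thesis by (simp add: abs_le_iff)
  qed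
  then have "h\<^sup>2 \<ge> (c * norm a)\<^sup>2 - 2 * (norm a * (norm a * \<delta>))"
  proof -
    assume "c * norm a * (h - c * norm a) \<ge> - (norm a * (norm a * \<delta>))"
    moreover have "h\<^sup>2 = (c * norm a)\<^sup>2 + 2 * (c * norm a * (h - c * norm a)) + (h - c * norm a)\<^sup>2"
      by (simp add: power2_eq_square algebra_simps)
    ultimately show ?thesis using zero_le_power2[of "h - c * norm a"] by linarith
  qed
  moreover have "(norm a)\<^sup>2 = y\<^sup>2 + z\<^sup>2 + h\<^sup>2" using frame_norm[OF E] a by simp
  moreover have "(c * norm a)\<^sup>2 = c\<^sup>2 * (norm a)\<^sup>2" "norm a * (norm a * \<delta>) = (norm a)\<^sup>2 * \<delta>"
    by (simp_all add: power2_eq_square)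
  ultimately have "y\<^sup>2 + z\<^sup>2 \<le> (norm a)\<^sup>2 - c\<^sup>2 * (norm a)\<^sup>2 + 2 * ((norm a)\<^sup>2 * \<delta>)" by linarith
  also have "\<dots> = (norm a)\<^sup>2 * (1 - c\<^sup>2 + 2 * \<delta>)" by (simp add: algebra_simps)
  also have "\<dots> \<le> 1 * (1 - c\<^sup>2 + 2 * \<delta>)"
    using a(2) \<delta> c2 by (intro mult_right_mono) (auto simp: power_le_one)
  finally show ?thesis using \<delta> c2 by (simp add: disc_def)
qed

text \<open>The factor of d tends to 4/3 sqrt (1 - c^2) as \<delta> and \<epsilon> tend to 0, the
  sharp constant for circles of radius arccos c. \<open>\<delta>\<close> is kept apart from
  \<open>d\<close> so that the factor is the same for all members of a cover.\<close>

lemma emeasure_circle_hits_flat: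
  assumes A: "compact A" "x0 \<in> A" and sph: "norm x0 = 1" and v: "norm v = 1" "x0 \<bullet> v = 0"
    and c: "\<bar>c\<bar> \<le> 1" and \<delta>: "d \<le> \<delta>" "0 \<le> d" "\<delta> < 1 - c\<^sup>2" and \<epsilon>: "\<epsilon> \<ge> 0"
    and diam: "\<And>x y. x \<in> A \<Longrightarrow> y \<in> A \<Longrightarrow> norm (x - y) \<le> d"
    and flat: "\<And>x. x \<in> A \<Longrightarrow> norm ((x - x0) - ((x - x0) \<bullet> v) *\<^sub>R v) \<le> \<epsilon> * norm (x - x0)"
  shows "emeasure lborel (circle_hits c A) \<le>
    ennreal (d * ((4 / 3 * sqrt (1 - c\<^sup>2 + 2 * \<delta>) ^ 3 + 8 * \<epsilon> * (1 - c\<^sup>2 + 2 * \<delta>)) / (1 - c\<^sup>2 - \<delta>)))"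
proof -
  obtain E where E: "frame E" "E 3 = x0" "E 1 = v" using frame_exists2[OF sph v] by blast
  define R where "R = sqrt (1 - c\<^sup>2 + 2 * \<delta>)"
  define q where "q = 1 - c\<^sup>2 - \<delta>"
  have q: "q > 0" using \<delta> by (simp add: q_def)
  have c2: "c\<^sup>2 \<le> 1" using c by (simp add: abs_square_le_1)
  have R: "R \<ge> 0" "R\<^sup>2 = 1 - c\<^sup>2 + 2 * \<delta>" using c2 \<delta> by (auto simp: R_def)
  have flat': "norm ((x - E 3) - ((x - E 3) \<bullet> E 1) *\<^sub>R E 1) \<le> \<epsilon> * d" if "x \<in> A" for x
    using flat[OF that] mult_left_mono[OF diam[OF that A(2)] \<epsilon>] by (simp add: E)
  have near: "norm (x - E 3) \<le> d" if "x \<in> A" for x using diam[OF that A(2)] E by simp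
  have sec: "emeasure lborel {h. frame_point E (fst p) (snd p) h \<in> circle_hits c A} \<le>
      ennreal (d / q) * (ennreal \<bar>fst p\<bar> * indicator (disc R) p) + ennreal (2 * \<epsilon> * d / q) * indicator (disc R) p" for p
  proof -
    obtain y z where p: "p = (y, z)" by (cases p)
    show ?thesis
    proof (cases "p \<in> disc R")
      case False
      have "{h. frame_point E (fst p) (snd p) h \<in> circle_hits c A} = {}"
      proof (rule ccontr)
        assume "\<not> ?thesis"
        then obtain h x where "x \<in> A" "norm (frame_point E y z h) < 1" "frame_point E y z h \<bullet> x = c * norm (frame_point E y z h)"
          by (auto simp: circle_hits_def p)
        then have "(y, z) \<in> disc R" unfolding R_def
          using flat_section_disc[OF E(1) c \<delta>(1,2) near refl] by blast
        then show False using False p by simp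
      qed
      then show ?thesis by simp
    next
      case True
      have "emeasure lborel {h. frame_point E (fst p) (snd p) h \<in> circle_hits c A} \<le> ennreal ((d * \<bar>y\<bar> + 2 * \<epsilon> * d) / q)"
      proof (rule emeasure_small_gaps)
        fix h1 h2 assume h: "h1 \<in> {h. frame_point E (fst p) (snd p) h \<in> circle_hits c A}"
          "h2 \<in> {h. frame_point E (fst p) (snd p) h \<in> circle_hits c A}" "h1 < h2"
        obtain x1 where x1: "x1 \<in> A" "norm (frame_point E y z h1) < 1" "frame_point E y z h1 \<bullet> x1 = c * norm (frame_point E y z h1)"
          using h by (auto simp: circle_hits_def p)
        obtain x2 where x2: "x2 \<in> A" "norm (frame_point E y z h2) < 1" "frame_point E y z h2 \<bullet> x2 = c * norm (frame_point E y z h2)"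
          using h by (auto simp: circle_hits_def p)
        show "h2 - h1 \<le> (d * \<bar>y\<bar> + 2 * \<epsilon> * d) / q" unfolding q_def
          by (rule flat_section_gap[OF E(1) c \<delta> \<epsilon> near[OF x1(1)] flat'[OF x1(1)] near[OF x2(1)] flat'[OF x2(1)]
                diam[OF x1(1) x2(1)] refl x1(2,3) refl x2(2,3) h(3)])
      next
        show "0 \<le> (d * \<bar>y\<bar> + 2 * \<epsilon> * d) / q" using \<delta> \<epsilon> q by simp
      qed
      also have "(d * \<bar>y\<bar> + 2 * \<epsilon> * d) / q = d / q * \<bar>y\<bar> + 2 * \<epsilon> * d / q"
        by (simp add: add_divide_distrib)
      also have "ennreal \<dots> = ennreal (d / q) * ennreal \<bar>y\<bar> + ennreal (2 * \<epsilon> * d / q)"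
        using \<delta> \<epsilon> q by (simp add: ennreal_mult[symmetric] ennreal_plus[symmetric] del: ennreal_plus)
      finally show ?thesis using True by (simp add: p)
    qed
  qed
  have m1: "(\<lambda>p. ennreal \<bar>fst p\<bar> * indicator (disc R) p) \<in> borel_measurable lborel"
  proof -
    have [measurable]: "(\<lambda>p :: real \<times> real. \<bar>fst p\<bar>) \<in> borel_measurable borel"
      by (intro borel_measurable_continuous_onI continuous_intros)
    show ?thesis by measurable
  qed
  have "emeasure lborel (circle_hits c A) = (\<integral>\<^sup>+p. emeasure lborel {h. frame_point E (fst p) (snd p) h \<in> circle_hits c A} \<partial>lborel)"
    by (rule emeasure_frame[OF E(1) circle_hits_borel[OF A(1)]])
  also have "\<dots> \<le> (\<integral>\<^sup>+p. ennreal (d / q) * (ennreal \<bar>fst p\<bar> * indicator (disc R) p) + ennreal (2 * \<epsilon> * d / q) * indicator (disc R) p \<partial>lborel)"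
    by (intro nn_integral_mono sec)
  also have "\<dots> = ennreal (d / q) * (\<integral>\<^sup>+p. ennreal \<bar>fst p\<bar> * indicator (disc R) p \<partial>lborel) +
      ennreal (2 * \<epsilon> * d / q) * emeasure lborel (disc R)"
    using m1 by (simp add: nn_integral_add nn_integral_cmult nn_integral_cmult_indicator)
  also have "\<dots> \<le> ennreal (d / q) * ennreal (4 / 3 * R ^ 3) + ennreal (2 * \<epsilon> * d / q) * ennreal (4 * R\<^sup>2)"
    unfolding nn_integral_abs_disc[OF R(1)]
    by (intro add_left_mono mult_left_mono emeasure_disc_le R(1)) simp
  also have "\<dots> = ennreal (d / q * (4 / 3 * R ^ 3) + 2 * \<epsilon> * d / q * (4 * R\<^sup>2))"
    using \<delta> \<epsilon> q R(1) by (simp add: ennreal_mult[symmetric] ennreal_plus[symmetric] del: ennreal_plus)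
  also have "d / q * (4 / 3 * R ^ 3) + 2 * \<epsilon> * d / q * (4 * R\<^sup>2) = d * ((4 / 3 * R ^ 3 + 8 * \<epsilon> * R\<^sup>2) / q)"
    using q by (simp add: field_simps)
  finally show ?thesis unfolding R(2) unfolding R_def q_def .
qed

section \<open>Great circles separating two points\<close>

definition separating :: "real ^ 3 \<Rightarrow> real ^ 3 \<Rightarrow> (real ^ 3) set" where
  "separating p q = {a \<in> ball 0 1. (a \<bullet> p) * (a \<bullet> q) < 0}"

lemma separating_borel [measurable]: "separating p q \<in> sets borel"
proof -
  have "open {a :: real ^ 3. (a \<bullet> p) * (a \<bullet> q) < 0}" by (intro open_Collect_less continuous_intros)
  moreover have "separating p q = ball 0 1 \<inter> {a. (a \<bullet> p) * (a \<bullet> q) < 0}" by (auto simp: separating_def)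
  ultimately show ?thesis by auto
qed

text \<open>In the frame of the normalised p + q and p - q one has p = \<kappa> m + \<sigma> v and q
  = \<kappa> m - \<sigma> v, so a separates p and q if and only if \<kappa> |h| < \<sigma> |y|. Over
  the disc of radius \<kappa> these heights stay in the ball, which gives 2 \<sigma> / \<kappa>
  times the moment 4/3 \<kappa>^3. To first order in norm (p - q) nothing is lost.\<close>

lemma emeasure_separating_ge:
  assumes p: "norm p = 1" and q: "norm q = 1" and pq: "p \<noteq> q" "norm (p - q) < 2"
  shows "emeasure lborel (separating p q) \<ge> ennreal (4 / 3 * norm (p - q) * (1 - (norm (p - q))\<^sup>2 / 4))"
proof -
  define \<sigma> \<kappa> where "\<sigma> = norm (p - q) / 2" and "\<kappa> = sqrt (1 - \<sigma>\<^sup>2)"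
  have \<sigma>: "\<sigma> > 0" "\<sigma> < 1" using pq by (auto simp: \<sigma>_def)
  have "\<sigma>\<^sup>2 < 1\<^sup>2" using \<sigma> by (intro power_strict_mono) auto
  then have \<kappa>: "\<kappa> > 0" "\<kappa>\<^sup>2 = 1 - \<sigma>\<^sup>2" by (auto simp: \<kappa>_def)
  have pp: "p \<bullet> p = 1" "q \<bullet> q = 1" using p q by (simp_all add: dot_square_norm)
  have "(norm (p - q))\<^sup>2 = 2 - 2 * (p \<bullet> q)" "(norm (p + q))\<^sup>2 = 2 + 2 * (p \<bullet> q)"
    using pp by (simp_all add: power2_norm_eq_inner inner_diff_left inner_diff_right inner_add_left inner_add_right inner_commute)
  moreover have "(2 * \<sigma>)\<^sup>2 = (norm (p - q))\<^sup>2" by (simp add: \<sigma>_def)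
  moreover have "(2 * \<kappa>)\<^sup>2 = 4 * \<kappa>\<^sup>2" "(2 * \<sigma>)\<^sup>2 = 4 * \<sigma>\<^sup>2" by (simp_all add: power_mult_distrib)
  ultimately have "(norm (p + q))\<^sup>2 = (2 * \<kappa>)\<^sup>2" using \<kappa>(2) by linarith
  then have npq: "norm (p + q) = 2 * \<kappa>" by (rule power2_eq_imp_eq) (use \<kappa>(1) in simp_all)
  define m v where "m = (p + q) /\<^sub>R (2 * \<kappa>)" and "v = (p - q) /\<^sub>R (2 * \<sigma>)"
  have "norm m = 1" using npq \<kappa>(1) by (simp add: m_def)
  moreover have "norm v = 1" using \<sigma>(1) by (simp add: v_def \<sigma>_def)
  moreover have "m \<bullet> v = 0"
  proof -
    have "(p + q) \<bullet> (p - q) = 0" using pp by (simp add: inner_add_left inner_diff_right inner_commute[of q p])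
    then show ?thesis by (simp add: m_def v_def)
  qed
  ultimately obtain E where E: "frame E" "E 3 = m" "E 1 = v" using frame_exists2 by blast
  have "p + q = (2 * \<kappa>) *\<^sub>R m" "p - q = (2 * \<sigma>) *\<^sub>R v" using \<kappa>(1) \<sigma>(1) by (simp_all add: m_def v_def)
  then have "(p + q) + (p - q) = (2 * \<kappa>) *\<^sub>R m + (2 * \<sigma>) *\<^sub>R v"
    "(p + q) - (p - q) = (2 * \<kappa>) *\<^sub>R m - (2 * \<sigma>) *\<^sub>R v" by (simp_all only:)
  then have "2 *\<^sub>R p = 2 *\<^sub>R (\<kappa> *\<^sub>R m + \<sigma> *\<^sub>R v)" "2 *\<^sub>R q = 2 *\<^sub>R (\<kappa> *\<^sub>R m - \<sigma> *\<^sub>R v)"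
    by (simp_all add: scaleR_right_distrib scaleR_right_diff_distrib scaleR_2)
  then have p_eq: "p = \<kappa> *\<^sub>R m + \<sigma> *\<^sub>R v" and q_eq: "q = \<kappa> *\<^sub>R m - \<sigma> *\<^sub>R v" by simp_all
  have sec: "ennreal (2 * \<sigma> / \<kappa>) * (ennreal \<bar>fst w\<bar> * indicator (disc \<kappa>) w) \<le>
      emeasure lborel {h. frame_point E (fst w) (snd w) h \<in> separating p q}" for w
  proof -
    obtain y z where w: "w = (y, z)" by (cases w)
    show ?thesis
    proof (cases "w \<in> disc \<kappa>")
      case True
      then have yz: "y\<^sup>2 + z\<^sup>2 \<le> \<kappa>\<^sup>2" by (simp add: disc_def w)
      have "{- (\<sigma> * \<bar>y\<bar> / \<kappa>)<..<\<sigma> * \<bar>y\<bar> / \<kappa>} \<subseteq> {h. frame_point E (fst w) (snd w) h \<in> separating p q}"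
      proof
        fix h assume "h \<in> {- (\<sigma> * \<bar>y\<bar> / \<kappa>)<..<\<sigma> * \<bar>y\<bar> / \<kappa>}"
        then have "\<bar>h\<bar> < \<sigma> * \<bar>y\<bar> / \<kappa>" by auto
        then have "\<kappa> * \<bar>h\<bar> < \<sigma> * \<bar>y\<bar>" using \<kappa> by (simp add: less_divide_eq mult.commute)
        then have "(\<kappa> * \<bar>h\<bar>)\<^sup>2 < (\<sigma> * \<bar>y\<bar>)\<^sup>2" using \<kappa> by (intro power_strict_mono) auto
        then have lt: "\<kappa>\<^sup>2 * h\<^sup>2 < \<sigma>\<^sup>2 * y\<^sup>2" by (simp add: power_mult_distrib)
        let ?a = "frame_point E y z h"
        have am: "?a \<bullet> m = h" "?a \<bullet> v = y" using frame_coordinates[OF E(1), of y z h] E by auto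
        have "(?a \<bullet> p) * (?a \<bullet> q) = \<kappa>\<^sup>2 * h\<^sup>2 - \<sigma>\<^sup>2 * y\<^sup>2"
          unfolding p_eq q_eq by (simp add: inner_add_right inner_diff_right am power2_eq_square algebra_simps)
        moreover have "norm ?a < 1"
        proof -
          have "y\<^sup>2 \<le> \<kappa>\<^sup>2" using yz zero_le_power2[of z] by linarith
          then have "\<sigma>\<^sup>2 * y\<^sup>2 \<le> \<sigma>\<^sup>2 * \<kappa>\<^sup>2" by (rule mult_left_mono) simp
          then have "\<kappa>\<^sup>2 * h\<^sup>2 < \<kappa>\<^sup>2 * \<sigma>\<^sup>2" using lt by (simp add: mult.commute)
          then have "h\<^sup>2 < \<sigma>\<^sup>2" using \<kappa>(1) by simp
          then have "(norm ?a)\<^sup>2 < 1\<^sup>2" unfolding frame_norm[OF E(1)] using yz \<kappa>(2) by simp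
          then show ?thesis by (rule power2_less_imp_less) simp
        qed
        ultimately show "h \<in> {h. frame_point E (fst w) (snd w) h \<in> separating p q}"
          using lt by (simp add: separating_def w)
      qed
      moreover have "{h. frame_point E (fst w) (snd w) h \<in> separating p q} \<in> sets borel"
      proof -
        have "(\<lambda>h. frame_point E (fst w) (snd w) h) \<in> borel_measurable borel"
          by (intro borel_measurable_continuous_onI continuous_intros)
        from measurable_sets[OF this separating_borel[of p q]] show ?thesis by (simp add: vimage_def)
      qed
      ultimately have "emeasure lborel {- (\<sigma> * \<bar>y\<bar> / \<kappa>)<..<\<sigma> * \<bar>y\<bar> / \<kappa>} \<le>
         emeasure lborel {h. frame_point E (fst w) (snd w) h \<in> separating p q}"
        by (intro emeasure_mono) auto
      moreover have "emeasure lborel {- (\<sigma> * \<bar>y\<bar> / \<kappa>)<..<\<sigma> * \<bar>y\<bar> / \<kappa>} = ennreal (2 * \<sigma> / \<kappa> * \<bar>y\<bar>)"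
        using \<sigma>(1) \<kappa>(1) by simp
      ultimately show ?thesis using True \<sigma>(1) \<kappa>(1) by (simp add: w ennreal_mult[symmetric])
    qed simp
  qed
  have m1: "(\<lambda>p. ennreal \<bar>fst p\<bar> * indicator (disc \<kappa>) p) \<in> borel_measurable lborel"
  proof -
    have [measurable]: "(\<lambda>p :: real \<times> real. \<bar>fst p\<bar>) \<in> borel_measurable borel"
      by (intro borel_measurable_continuous_onI continuous_intros)
    show ?thesis by measurable
  qed
  have "4 / 3 * norm (p - q) * (1 - (norm (p - q))\<^sup>2 / 4) = 2 * \<sigma> / \<kappa> * (4 / 3 * \<kappa> ^ 3)"
  proof -
    have "1 - (norm (p - q))\<^sup>2 / 4 = \<kappa>\<^sup>2" using \<kappa>(2) by (simp add: \<sigma>_def power_divide)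
    then show ?thesis using \<kappa>(1) by (simp add: \<sigma>_def power2_eq_square power3_eq_cube)
  qed
  then have "ennreal (4 / 3 * norm (p - q) * (1 - (norm (p - q))\<^sup>2 / 4)) = ennreal (2 * \<sigma> / \<kappa>) * ennreal (4 / 3 * \<kappa> ^ 3)"
    by (simp only:) (rule ennreal_mult, use \<sigma>(1) \<kappa>(1) in simp_all)
  also have "\<dots> = (\<integral>\<^sup>+w. ennreal (2 * \<sigma> / \<kappa>) * (ennreal \<bar>fst w\<bar> * indicator (disc \<kappa>) w) \<partial>lborel)"
    using m1 nn_integral_abs_disc[of \<kappa>] \<kappa>(1) by (simp add: nn_integral_cmult)
  also have "\<dots> \<le> (\<integral>\<^sup>+w. emeasure lborel {h. frame_point E (fst w) (snd w) h \<in> separating p q} \<partial>lborel)"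
    by (intro nn_integral_mono sec)
  also have "\<dots> = emeasure lborel (separating p q)"
    by (rule emeasure_frame[OF E(1) separating_borel, symmetric])
  finally show ?thesis .
qed

lemma emeasure_unit_ball_3: "emeasure lborel (ball (0 :: real ^ 3) 1) = ennreal (4 / 3 * pi)"
  by (simp add: emeasure_ball unit_ball_vol_3)

section \<open>Hausdorff measure\<close>

lemma hausdorff1_pre_le:
  assumes "A \<subseteq> (\<Union>k. E k)" "\<And>k. bounded (E k)" "\<And>k. diameter (E k) \<le> \<delta>"
  shows "hausdorff1_pre \<delta> A \<le> (\<Sum>k. ennreal (diameter (E k)))"
  unfolding hausdorff1_pre_def using assms by (intro INF_lower) auto

lemma hausdorff1_pre_cover:
  assumes "hausdorff1_pre \<delta> A < b"
  shows "\<exists>E :: nat \<Rightarrow> 'a::metric_space set. A \<subseteq> (\<Union>k. E k) \<and> (\<forall>k. bounded (E k) \<and> diameter (E k) \<le> \<delta>) \<and>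
    (\<Sum>k. ennreal (diameter (E k))) < b"
  using assms unfolding hausdorff1_pre_def INF_less_iff by blast

lemma hausdorff1_pre_le_hausdorff1: "\<delta> > 0 \<Longrightarrow> hausdorff1_pre \<delta> A \<le> hausdorff1 A"
  unfolding hausdorff1_def by (intro SUP_upper) auto

lemma hausdorff1_mono:
  fixes A B :: "'a::metric_space set"
  assumes "A \<subseteq> B"
  shows "hausdorff1 A \<le> hausdorff1 B"
proof -
  have "hausdorff1_pre \<delta> A \<le> hausdorff1_pre \<delta> B" for \<delta>
    unfolding hausdorff1_pre_def using assms by (intro INF_superset_mono) auto
  then show ?thesis unfolding hausdorff1_def by (intro SUP_mono) blast
qed

lemma hausdorff1_pre_UN:
  fixes A :: "nat \<Rightarrow> 'a::metric_space set"
  shows "hausdorff1_pre \<delta> (\<Union>i. A i) \<le> (\<Sum>i. hausdorff1_pre \<delta> (A i))"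
proof (rule ennreal_le_epsilon)
  fix e :: real assume fin: "(\<Sum>i. hausdorff1_pre \<delta> (A i)) < top" and e: "0 < e"
  have "\<exists>E. A i \<subseteq> (\<Union>k. E k) \<and> (\<forall>k. bounded (E k) \<and> diameter (E k) \<le> \<delta>) \<and>
    (\<Sum>k. ennreal (diameter (E k))) < hausdorff1_pre \<delta> (A i) + ennreal (e * (1 / 2) ^ Suc i)" for i
  proof (rule hausdorff1_pre_cover)
    have "hausdorff1_pre \<delta> (A i) = sum (\<lambda>i. hausdorff1_pre \<delta> (A i)) {i}" by simp
    also have "\<dots> \<le> (\<Sum>i. hausdorff1_pre \<delta> (A i))" by (intro sum_le_suminf) auto
    finally have "hausdorff1_pre \<delta> (A i) < top" using fin by (rule le_less_trans)
    moreover have "ennreal (e * (1 / 2) ^ Suc i) > 0"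
      using e by simp
    ultimately show "hausdorff1_pre \<delta> (A i) < hausdorff1_pre \<delta> (A i) + ennreal (e * (1 / 2) ^ Suc i)"
      by (cases "hausdorff1_pre \<delta> (A i)") (auto simp: ennreal_plus[symmetric] ennreal_less_iff simp del: ennreal_plus)
  qed
  then obtain E where E: "\<And>i. A i \<subseteq> (\<Union>k. E i k)" "\<And>i k. bounded (E i k) \<and> diameter (E i k) \<le> \<delta>"
    "\<And>i. (\<Sum>k. ennreal (diameter (E i k))) < hausdorff1_pre \<delta> (A i) + ennreal (e * (1 / 2) ^ Suc i)" by metis
  define F where "F = (\<lambda>k. E (fst (prod_decode k)) (snd (prod_decode k)))"
  have "hausdorff1_pre \<delta> (\<Union>i. A i) \<le> (\<Sum>k. ennreal (diameter (F k)))"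
  proof (rule hausdorff1_pre_le)
    show "(\<Union>i. A i) \<subseteq> (\<Union>k. F k)"
    proof
      fix x assume "x \<in> (\<Union>i. A i)"
      then obtain i k where "x \<in> E i k" using E(1) by blast
      then have "x \<in> F (prod_encode (i, k))" by (simp add: F_def)
      then show "x \<in> (\<Union>k. F k)" by blast
    qed
  qed (use E(2) in \<open>auto simp: F_def\<close>)
  also have "(\<Sum>k. ennreal (diameter (F k))) = (\<Sum>i. \<Sum>k. ennreal (diameter (E i k)))"
    unfolding F_def
    using suminf_ennreal_2dimen[of "\<lambda>i. \<Sum>k. ennreal (diameter (E i k))" "\<lambda>(i, k). ennreal (diameter (E i k))"]
    by (simp add: case_prod_beta)
  also have "\<dots> \<le> (\<Sum>i. hausdorff1_pre \<delta> (A i) + ennreal (e * (1 / 2) ^ Suc i))"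
    by (intro suminf_le less_imp_le E(3)) auto
  also have "\<dots> = (\<Sum>i. hausdorff1_pre \<delta> (A i)) + (\<Sum>i. ennreal (e * (1 / 2) ^ Suc i))"
    by (intro suminf_add[symmetric]) auto
  also have "(\<Sum>i. ennreal (e * (1 / 2) ^ Suc i)) = ennreal e"
  proof (rule suminf_ennreal_eq)
    show "(\<lambda>i. e * (1 / 2) ^ Suc i) sums e" using sums_mult[OF power_half_series, of e] by simp
  qed (use e in simp)
  finally show "hausdorff1_pre \<delta> (\<Union>i. A i) \<le> (\<Sum>i. hausdorff1_pre \<delta> (A i)) + ennreal e" .
qed

lemma hausdorff1_UN:
  fixes A :: "nat \<Rightarrow> 'a::metric_space set"
  shows "hausdorff1 (\<Union>i. A i) \<le> (\<Sum>i. hausdorff1 (A i))"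
  unfolding hausdorff1_def[of "\<Union>i. A i"]
proof (rule SUP_least)
  fix \<delta> :: real assume "\<delta> \<in> {0<..}"
  then have "(\<Sum>i. hausdorff1_pre \<delta> (A i)) \<le> (\<Sum>i. hausdorff1 (A i))"
    by (intro suminf_le hausdorff1_pre_le_hausdorff1) auto
  then show "hausdorff1_pre \<delta> (\<Union>i. A i) \<le> (\<Sum>i. hausdorff1 (A i))"
    using hausdorff1_pre_UN order_trans by blast
qed

lemma hausdorff1_empty: "hausdorff1 ({} :: 'a::metric_space set) = 0"
proof -
  have "hausdorff1_pre \<delta> ({} :: 'a set) \<le> 0" if "\<delta> > 0" for \<delta>
    using hausdorff1_pre_le[of "{}" "\<lambda>_. {} :: 'a set" \<delta>] that by simp
  then have "hausdorff1 ({} :: 'a set) \<le> 0" unfolding hausdorff1_def by (intro SUP_least) auto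
  then show ?thesis by simp
qed

text \<open>The form in which the lengths of infinitely many arcs are added: arcs will be indexed by
  pairs of a chart and a component, and only finite sums of the bounds have to be controlled. Each
  \<open>J k\<close> holds at most one index.\<close>

lemma hausdorff1_countable_UN_le:
  fixes A :: "'i \<Rightarrow> 'a::metric_space set" and f :: "'i \<Rightarrow> ennreal"
  assumes I: "countable I" and f: "\<And>i. i \<in> I \<Longrightarrow> hausdorff1 (A i) \<le> f i"
    and C: "\<And>F. finite F \<Longrightarrow> F \<subseteq> I \<Longrightarrow> (\<Sum>i\<in>F. f i) \<le> C"
  shows "hausdorff1 (\<Union>i\<in>I. A i) \<le> C"
proof -
  define J where "J = (\<lambda>k. {i \<in> I. to_nat_on I i = k})"
  define B where "B = (\<lambda>k. \<Union>i\<in>J k. A i)"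
  have inj: "inj_on (to_nat_on I) I" using I by (rule inj_on_to_nat_on)
  have J: "J k = {} \<or> (\<exists>i\<in>I. J k = {i})" for k
  proof (cases "J k = {}")
    case False
    then obtain i where "i \<in> I" "to_nat_on I i = k" by (auto simp: J_def)
    then have "J k = {i}" using inj by (auto simp: J_def inj_on_def)
    then show ?thesis using \<open>i \<in> I\<close> by blast
  qed simp
  have finJ: "finite (J k)" for k using J[of k] by auto
  have "hausdorff1 (\<Union>i\<in>I. A i) = hausdorff1 (\<Union>k. B k)"
    by (rule arg_cong[of _ _ hausdorff1]) (auto simp: B_def J_def)
  also have "\<dots> \<le> (\<Sum>k. hausdorff1 (B k))" by (rule hausdorff1_UN)
  also have "\<dots> = (SUP m. \<Sum>k<m. hausdorff1 (B k))" by (rule suminf_eq_SUP)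
  also have "\<dots> \<le> C"
  proof (rule SUP_least)
    fix m
    have "(\<Sum>k<m. hausdorff1 (B k)) \<le> (\<Sum>k<m. \<Sum>i\<in>J k. f i)"
    proof (rule sum_mono)
      fix k
      show "hausdorff1 (B k) \<le> (\<Sum>i\<in>J k. f i)"
        using J[of k] f by (auto simp: B_def hausdorff1_empty)
    qed
    also have "\<dots> = (\<Sum>i\<in>(\<Union>k<m. J k). f i)"
      by (rule sum.UNION_disjoint[symmetric]) (auto simp: finJ, auto simp: J_def)
    also have "\<dots> \<le> C" by (rule C) (auto simp: finJ, auto simp: J_def)
    finally show "(\<Sum>k<m. hausdorff1 (B k)) \<le> C" .
  qed
  finally show ?thesis .
qed

lemma hausdorff1_countable:
  fixes A :: "'a::metric_space set"
  assumes "countable A"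
  shows "hausdorff1 A = 0"
proof -
  have "hausdorff1 {x :: 'a} \<le> 0" for x
    unfolding hausdorff1_def
  proof (rule SUP_least)
    fix \<delta> :: real assume "\<delta> \<in> {0<..}"
    then show "hausdorff1_pre \<delta> {x} \<le> 0"
      using hausdorff1_pre_le[of "{x}" "\<lambda>_. {x}" \<delta>] by simp
  qed
  then have "hausdorff1 (\<Union>x\<in>A. {x}) \<le> 0"
    by (rule hausdorff1_countable_UN_le[OF assms]) simp
  then show ?thesis by simp
qed

lemma hausdorff1_lipschitz_arc:
  fixes \<gamma> :: "real \<Rightarrow> 'a::metric_space"
  assumes lr: "l \<le> r" and L: "L \<ge> 0"
    and lip: "\<And>s t. s \<in> {l..r} \<Longrightarrow> t \<in> {l..r} \<Longrightarrow> dist (\<gamma> s) (\<gamma> t) \<le> L * \<bar>s - t\<bar>"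
  shows "hausdorff1 (\<gamma> ` {l..r}) \<le> ennreal (L * (r - l))"
  unfolding hausdorff1_def
proof (rule SUP_least)
  fix \<delta> :: real assume "\<delta> \<in> {0<..}"
  then have \<delta>: "\<delta> > 0" by simp
  obtain m :: nat where m: "m > 0" "L * (r - l) / real m \<le> \<delta>"
  proof -
    obtain m :: nat where "L * (r - l) / \<delta> < real m" using reals_Archimedean2 by blast
    then have "L * (r - l) < \<delta> * real m" using \<delta> by (simp add: divide_less_eq mult.commute)
    then have "L * (r - l) \<le> \<delta> * real (Suc m)" using \<delta> by (simp add: algebra_simps)
    then have "L * (r - l) / real (Suc m) \<le> \<delta>" by (simp add: divide_le_eq mult.commute)
    then show ?thesis using that[of "Suc m"] by simp
  qed
  define h where "h = (r - l) / real m"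
  have h: "h \<ge> 0" "real m * h = r - l" using lr m by (auto simp: h_def)
  define E where "E = (\<lambda>k. if k < m then \<gamma> ` {l + real k * h..l + real (Suc k) * h} else {})"
  have sub: "{l + real k * h..l + real (Suc k) * h} \<subseteq> {l..r}" if "k < m" for k
  proof -
    have "real (Suc k) * h \<le> real m * h" using that h by (intro mult_right_mono) auto
    moreover have "0 \<le> real k * h" using h by simp
    ultimately show ?thesis using h by auto
  qed
  have dE: "dist x y \<le> L * h" if xy: "x \<in> E k" "y \<in> E k" for x y k
  proof -
    have k: "k < m" using xy by (auto simp: E_def split: if_splits)
    obtain s t where st: "s \<in> {l + real k * h..l + real (Suc k) * h}" "x = \<gamma> s"
      "t \<in> {l + real k * h..l + real (Suc k) * h}" "y = \<gamma> t" using xy k by (auto simp: E_def)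
    have "dist x y \<le> L * \<bar>s - t\<bar>" using lip st sub[OF k] by blast
    also have "\<dots> \<le> L * h" using st L by (intro mult_left_mono) (auto simp: algebra_simps abs_le_iff)
    finally show ?thesis .
  qed
  have Lh: "L * h \<ge> 0" using L h by simp
  have diam: "diameter (E k) \<le> (if k < m then L * h else 0)" for k
  proof (cases "k < m")
    case True
    have "dist x y \<le> L * h" if "x \<in> E k" "y \<in> E k" for x y using dE that .
    then have "diameter (E k) \<le> L * h"
      unfolding diameter_def using Lh by (auto intro!: cSUP_least)
    then show ?thesis using True by simp
  qed (simp add: E_def)
  have "hausdorff1_pre \<delta> (\<gamma> ` {l..r}) \<le> (\<Sum>k. ennreal (diameter (E k)))"
  proof (rule hausdorff1_pre_le)
    show "\<gamma> ` {l..r} \<subseteq> (\<Union>k. E k)"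
    proof
      fix x assume "x \<in> \<gamma> ` {l..r}"
      then obtain s where s: "s \<in> {l..r}" "x = \<gamma> s" by auto
      have "\<exists>k<m. s \<in> {l + real k * h..l + real (Suc k) * h}"
      proof (rule ccontr)
        assume no: "\<not> ?thesis"
        have "j \<le> m \<Longrightarrow> l + real j * h \<le> s" for j
        proof (induction j)
          case (Suc j)
          then have "l + real j * h \<le> s" "j < m" by auto
          then show ?case using no by force
        qed (use s in simp)
        from this[of m] have "s = r" using h s by auto
        moreover obtain k where "m = Suc k" using m(1) not0_implies_Suc by blast
        ultimately have "k < m" "s \<in> {l + real k * h..l + real (Suc k) * h}"
          using h by (auto simp: algebra_simps)
        then show False using no by blast
      qed
      then show "x \<in> (\<Union>k. E k)" using s by (force simp: E_def)
    qed
    show "bounded (E k)" for k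
      using dE by (auto simp: bounded_two_points)
    show "diameter (E k) \<le> \<delta>" for k
    proof -
      have "L * h \<le> \<delta>" using m(2) by (simp add: h_def)
      then show ?thesis using diam[of k] \<delta> by (auto split: if_splits)
    qed
  qed
  also have "\<dots> \<le> (\<Sum>k. ennreal (if k < m then L * h else 0))"
    by (intro suminf_le ennreal_leI diam) auto
  also have "\<dots> = (\<Sum>k<m. ennreal (if k < m then L * h else 0))"
    by (rule suminf_finite) auto
  also have "\<dots> = ennreal (L * (r - l))"
    using Lh h(2) by (simp add: ennreal_of_nat_eq_real_of_nat ennreal_mult[symmetric] mult.left_commute)
  finally show "hausdorff1_pre \<delta> (\<gamma> ` {l..r}) \<le> ennreal (L * (r - l))" .
qed

section \<open>Lower bound for the nodal length\<close>

definition nodal :: "(real ^ 3 \<Rightarrow> real) \<Rightarrow> (real ^ 3) set" where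
  "nodal U = {x \<in> sphere 0 1. U x = 0}"

text \<open>By homogeneity \<open>U\<close> vanishes on the whole line through a zero and the
  origin, so at a zero on the sphere the gradient is tangent to the sphere.\<close>

lemma gradient_radial:
  assumes U: "hompoly n U" and z: "U x = 0"
  shows "gradient U x \<bullet> x = 0"
proof -
  have "U (x + t *\<^sub>R x) = 0" for t
  proof -
    have "x + t *\<^sub>R x = (1 + t) *\<^sub>R x" by (simp add: algebra_simps)
    then show ?thesis using hompoly_homogeneous[OF U] z by simp
  qed
  then have "((\<lambda>t. 0) has_real_derivative gradient U (x + 0 *\<^sub>R x) \<bullet> x) (at 0)"
    using DERIV_line(1)[OF hompoly_polynomial[OF U], of x x 0] by simp
  then have "gradient U (x + 0 *\<^sub>R x) \<bullet> x = 0" using DERIV_unique[OF _ DERIV_const] by blast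
  then show ?thesis by simp
qed

text \<open>The radial component of a chord of the sphere is of second order in its length.\<close>

lemma sphere_diff_inner:
  fixes x y :: "'a::real_inner"
  assumes "norm x = 1" "norm y = 1"
  shows "(x - y) \<bullet> y = - ((norm (x - y))\<^sup>2 / 2)"
proof -
  have "x \<bullet> x = 1" "y \<bullet> y = 1" using assms by (simp_all add: dot_square_norm)
  then have "(norm (x - y))\<^sup>2 = 2 - 2 * (x \<bullet> y)" "(x - y) \<bullet> y = x \<bullet> y - 1"
    by (simp_all add: power2_norm_eq_inner inner_diff_left inner_diff_right inner_commute)
  then show ?thesis by linarith
qed

text \<open>For zeros x and x0 Hadamard's factor is orthogonal to x - x0. On the compact set it is
  uniformly close to the gradient at x0, whose norm is bounded below, so the component of x - x0
  along the gradient is small; the radial component is quadratic. What remains is the direction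
  \<open>v\<close>, orthogonal to both.\<close>

lemma nodal_flat:
  assumes U: "hompoly n U" and K: "compact K" "K \<subseteq> nodal U" and reg: "\<And>x. x \<in> K \<Longrightarrow> gradient U x \<noteq> 0"
    and \<epsilon>: "\<epsilon> > 0"
  shows "\<exists>\<delta>>0. \<forall>x0\<in>K. \<exists>v. norm v = 1 \<and> x0 \<bullet> v = 0 \<and>
    (\<forall>x\<in>K. norm (x - x0) \<le> \<delta> \<longrightarrow> norm ((x - x0) - ((x - x0) \<bullet> v) *\<^sub>R v) \<le> \<epsilon> * norm (x - x0))"
proof (cases "K = {}")
  case False
  obtain \<Phi> :: "(real ^ 3) \<times> (real ^ 3) \<Rightarrow> real ^ 3" where \<Phi>: "polynomial_function \<Phi>"
    "\<forall>x y. U x - U y = \<Phi> (x, y) \<bullet> (x - y)" "\<forall>x. \<Phi> (x, x) = gradient U x"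
    using polynomial_difference_gradient[OF hompoly_polynomial[OF U]] by blast
  have "continuous_on K (\<lambda>x. norm (gradient U x))"
    by (intro continuous_intros continuous_on_gradient_hompoly[OF U])
  then obtain xm where xm: "xm \<in> K" "\<And>x. x \<in> K \<Longrightarrow> norm (gradient U xm) \<le> norm (gradient U x)"
    using continuous_attains_inf[OF K(1) False] by metis
  define \<mu> where "\<mu> = norm (gradient U xm)"
  have \<mu>: "\<mu> > 0" "\<And>x. x \<in> K \<Longrightarrow> \<mu> \<le> norm (gradient U x)" using xm reg by (auto simp: \<mu>_def)
  have "uniformly_continuous_on (K \<times> K) \<Phi>"
    using K(1) continuous_on_polymonial_function[OF \<Phi>(1)] by (intro compact_uniformly_continuous compact_Times)
  moreover have "\<mu> * (\<epsilon> / 2) > 0" using \<mu> \<epsilon> by simp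
  ultimately obtain \<delta>1 where \<delta>1: "\<delta>1 > 0"
    "\<And>w w'. w \<in> K \<times> K \<Longrightarrow> w' \<in> K \<times> K \<Longrightarrow> dist w' w < \<delta>1 \<Longrightarrow> dist (\<Phi> w') (\<Phi> w) < \<mu> * (\<epsilon> / 2)"
    unfolding uniformly_continuous_on_def by metis
  define \<delta> where "\<delta> = min (\<delta>1 / 2) \<epsilon>"
  have "\<exists>v. norm v = 1 \<and> x0 \<bullet> v = 0 \<and>
    (\<forall>x\<in>K. norm (x - x0) \<le> \<delta> \<longrightarrow> norm ((x - x0) - ((x - x0) \<bullet> v) *\<^sub>R v) \<le> \<epsilon> * norm (x - x0))"
    if x0: "x0 \<in> K" for x0
  proof -
    define g where "g = gradient U x0"
    have g: "norm g \<ge> \<mu>" "g \<noteq> 0" using \<mu>(2)[OF x0] reg[OF x0] by (auto simp: g_def)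
    have x0n: "norm x0 = 1" "U x0 = 0" using K(2) x0 by (auto simp: nodal_def)
    have "norm (g /\<^sub>R norm g) = 1" using g by simp
    moreover have "x0 \<bullet> (g /\<^sub>R norm g) = 0"
      using gradient_radial[OF U x0n(2)] by (simp add: g_def inner_commute)
    ultimately obtain E where E: "frame E" "E 3 = x0" "E 1 = g /\<^sub>R norm g" using frame_exists2[OF x0n(1)] by blast
    have EE: "E i \<bullet> E j = (if i = j then 1 else 0)" for i j using E(1) by (simp add: frame_def)
    have "norm ((x - x0) - ((x - x0) \<bullet> E 2) *\<^sub>R E 2) \<le> \<epsilon> * norm (x - x0)" if x: "x \<in> K" "norm (x - x0) \<le> \<delta>" for x
    proof -
      define d where "d = x - x0"
      have xn: "norm x = 1" "U x = 0" using K(2) x(1) by (auto simp: nodal_def)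
      have "dist (x, x0) (x0, x0) < \<delta>1" using x(2) \<delta>1(1) by (simp add: dist_Pair_Pair dist_norm \<delta>_def)
      then have "dist (\<Phi> (x, x0)) (\<Phi> (x0, x0)) < \<mu> * (\<epsilon> / 2)" using \<delta>1(2)[of "(x0, x0)" "(x, x0)"] x x0 by auto
      then have \<Phi>d: "norm (\<Phi> (x, x0) - g) \<le> \<mu> * (\<epsilon> / 2)" using \<Phi>(3) by (simp add: dist_norm g_def)
      have "\<Phi> (x, x0) \<bullet> d = 0" using \<Phi>(2) xn x0n by (metis d_def right_minus_eq)
      then have "g \<bullet> d = - ((\<Phi> (x, x0) - g) \<bullet> d)" by (simp add: inner_diff_left)
      then have "\<bar>g \<bullet> d\<bar> \<le> norm (\<Phi> (x, x0) - g) * norm d" using Cauchy_Schwarz_ineq2[of "\<Phi> (x, x0) - g" d] by simp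
      also have "\<dots> \<le> \<mu> * (\<epsilon> / 2) * norm d" using \<Phi>d by (rule mult_right_mono) simp
      also have "\<dots> \<le> norm g * (\<epsilon> / 2) * norm d" using g \<epsilon> by (intro mult_right_mono) auto
      finally have "\<bar>g \<bullet> d\<bar> / norm g \<le> \<epsilon> / 2 * norm d" using g by (simp add: divide_le_eq mult_ac)
      moreover have "\<bar>d \<bullet> E 1\<bar> = \<bar>g \<bullet> d\<bar> / norm g" by (simp add: E(3) abs_mult inner_commute divide_inverse mult.commute)
      ultimately have d1: "\<bar>d \<bullet> E 1\<bar> \<le> \<epsilon> / 2 * norm d" by simp
      have "d \<bullet> E 3 = - ((norm d)\<^sup>2 / 2)" using sphere_diff_inner[OF xn(1) x0n(1)] E(2) by (simp add: d_def)
      then have "\<bar>d \<bullet> E 3\<bar> = norm d * norm d / 2" by (simp add: power2_eq_square)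
      also have "\<dots> \<le> \<epsilon> * norm d / 2"
        using x(2) by (intro divide_right_mono mult_right_mono) (auto simp: d_def \<delta>_def)
      finally have d3: "\<bar>d \<bullet> E 3\<bar> \<le> \<epsilon> / 2 * norm d" by simp
      have res: "d - (d \<bullet> E 2) *\<^sub>R E 2 = frame_point E (d \<bullet> E 1) 0 (d \<bullet> E 3)"
      proof -
        have "d = frame_point E (d \<bullet> E 1) (d \<bullet> E 2) (d \<bullet> E 3)" by (rule frame_expand[OF E(1)])
        moreover have "frame_point E (d \<bullet> E 1) (d \<bullet> E 2) (d \<bullet> E 3) - (d \<bullet> E 2) *\<^sub>R E 2 = frame_point E (d \<bullet> E 1) 0 (d \<bullet> E 3)"
          by (simp add: frame_point_def)
        ultimately show ?thesis by metis
      qed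
      have "(norm (d - (d \<bullet> E 2) *\<^sub>R E 2))\<^sup>2 = \<bar>d \<bullet> E 1\<bar>\<^sup>2 + \<bar>d \<bullet> E 3\<bar>\<^sup>2"
        unfolding res frame_norm[OF E(1)] by simp
      also have "\<dots> \<le> (\<epsilon> / 2 * norm d)\<^sup>2 + (\<epsilon> / 2 * norm d)\<^sup>2"
        using d1 d3 by (intro add_mono power_mono) auto
      also have "\<dots> \<le> (\<epsilon> * norm d)\<^sup>2" by (simp add: power_mult_distrib power_divide)
      finally show ?thesis unfolding d_def by (rule power2_le_imp_le) (use \<epsilon> in simp)
    qed
    moreover have "norm (E 2) = 1" "x0 \<bullet> E 2 = 0" using EE[of 2 2] EE[of 3 2] E(2) by (auto simp: norm_eq_1)
    ultimately show ?thesis by blast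
  qed
  moreover have "\<delta> > 0" using \<delta>1 \<epsilon> by (simp add: \<delta>_def)
  ultimately show ?thesis by blast
qed (auto intro: exI[of _ 1])

text \<open>The flat estimate with d = 0. It removes the circles through the singular points, which
  belong to no regular part on which flatness is known.\<close>

lemma circle_hits_singleton_null:
  assumes "norm z = 1" "\<bar>c\<bar> < 1"
  shows "circle_hits c {z} \<in> null_sets lborel"
proof -
  obtain E where E: "frame E" "E 3 = z" using frame_exists[OF assms(1)] by blast
  have EE: "E i \<bullet> E j = (if i = j then 1 else 0)" for i j using E(1) by (simp add: frame_def)
  have "c\<^sup>2 < 1" using assms(2) by (simp add: abs_square_less_1)
  then have "emeasure lborel (circle_hits c {z}) \<le> ennreal (0 * ((4 / 3 * sqrt (1 - c\<^sup>2 + 2 * 0) ^ 3 + 8 * 0 * (1 - c\<^sup>2 + 2 * 0)) / (1 - c\<^sup>2 - 0)))"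
    using assms EE[of 1 1] EE[of 3 1] E(2)
    by (intro emeasure_circle_hits_flat[where v = "E 1" and ?x0.0 = z]) (auto simp: norm_eq_1)
  then show ?thesis using circle_hits_borel[of "{z}" c] by (auto simp: null_sets_def)
qed

text \<open>An Eilenberg-type inequality with the sharp constant of the kinematic formula. Covers of the nodal
  set need not be nice, but their traces on the regular part of the nodal set are almost straight.\<close>

lemma hausdorff1_nodal_ge:
  assumes U: "harmonic_poly n U" and nz: "U x0 \<noteq> 0" and c: "\<bar>c\<bar> < 1"
    and hits: "AE a in lborel. a \<in> ball 0 1 \<longrightarrow>
      (\<exists>X. finite X \<and> card X = k \<and> (\<forall>x\<in>X. norm x = 1 \<and> U x = 0 \<and> a \<bullet> x = c * norm a))"
  shows "ennreal (real k * pi / sqrt (1 - c\<^sup>2)) \<le> hausdorff1 (nodal U)"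
proof (cases "hausdorff1 (nodal U)")
  case (real C)
  define N Z where "N = nodal U" and "Z = singular_set U"
  have hU: "hompoly n U" using U by (simp add: harmonic_poly_def)
  have c2: "c\<^sup>2 < 1" using c by (simp add: abs_square_less_1)
  define s where "s = sqrt (1 - c\<^sup>2)"
  have s: "s > 0" "s\<^sup>2 = 1 - c\<^sup>2" using c2 by (auto simp: s_def)
  have C: "C \<ge> 0" "hausdorff1 N = ennreal C" using real by (auto simp: N_def)
  have finZ: "finite Z" unfolding Z_def by (rule finite_singular_set[OF U nz])
  have Z1: "norm z = 1" if "z \<in> Z" for z using that by (auto simp: Z_def singular_set_def)
  define e where "e = (\<lambda>m. inverse (real (Suc m)))"
  have e: "e m > 0" for m by (simp add: e_def)
  have elim: "e \<longlonglongrightarrow> 0" unfolding e_def by (rule LIMSEQ_inverse_real_of_nat)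
  \<comment> \<open>The nodal set without the open \<open>e m\<close>-neighbourhood of the singular
    points: compact and regular, so flatness is uniform on it. As m grows it exhausts the regular
    part.\<close>
  define Nr where "Nr = (\<lambda>m. {x \<in> N. \<forall>z\<in>Z. e m \<le> norm (x - z)})"
  have clN: "closed N"
  proof -
    have "closed {x \<in> sphere 0 1. U x = 0}"
      by (intro continuous_closed_preimage_constant continuous_on_hompoly[OF hU] closed_sphere)
    then show ?thesis by (simp add: N_def nodal_def)
  qed
  have boundedN: "bounded N" by (rule bounded_subset[of "sphere 0 1"]) (auto simp: N_def nodal_def)
  have cNr: "compact (Nr m)" for m
  proof -
    have "Nr m = N \<inter> (\<Inter>z\<in>Z. {x. e m \<le> norm (x - z)})" by (auto simp: Nr_def)
    moreover have "closed (\<Inter>z\<in>Z. {x. e m \<le> norm (x - z)})"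
      by (intro closed_INT ballI closed_Collect_le continuous_intros)
    ultimately have "closed (Nr m)" using clN by (simp add: closed_Int)
    moreover have "bounded (Nr m)" using boundedN by (rule bounded_subset) (auto simp: Nr_def)
    ultimately show ?thesis by (simp add: compact_eq_bounded_closed)
  qed
  have subNr: "Nr m \<subseteq> nodal U" for m by (auto simp: Nr_def N_def)
  have regNr: "gradient U x \<noteq> 0" if "x \<in> Nr m" for x m
  proof
    assume "gradient U x = 0"
    then have "x \<in> Z" using that by (auto simp: Nr_def N_def nodal_def Z_def singular_set_def)
    then have "e m \<le> norm (x - x)" using that unfolding Nr_def by blast
    then show False using e[of m] by simp
  qed
  have "\<forall>m. \<exists>\<delta>>0. \<forall>x0\<in>Nr m. \<exists>v. norm v = 1 \<and> x0 \<bullet> v = 0 \<and>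
    (\<forall>x\<in>Nr m. norm (x - x0) \<le> \<delta> \<longrightarrow> norm ((x - x0) - ((x - x0) \<bullet> v) *\<^sub>R v) \<le> e m * norm (x - x0))"
    by (rule allI, rule nodal_flat[OF hU cNr subNr _ e], erule regNr)
  then obtain \<delta> where \<delta>: "\<And>m. \<delta> m > 0"
    "\<And>m. \<forall>x0\<in>Nr m. \<exists>v. norm v = 1 \<and> x0 \<bullet> v = 0 \<and>
    (\<forall>x\<in>Nr m. norm (x - x0) \<le> \<delta> m \<longrightarrow> norm ((x - x0) - ((x - x0) \<bullet> v) *\<^sub>R v) \<le> e m * norm (x - x0))"
    by metis
  define D where "D = (\<lambda>m. min (\<delta> m) (e m))"
  have D: "D m > 0" "D m \<le> \<delta> m" "D m \<le> e m" for m using \<delta>(1)[of m] e[of m] by (auto simp: D_def)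
  have "\<exists>E :: nat \<Rightarrow> (real ^ 3) set. N \<subseteq> (\<Union>k. E k) \<and> (\<forall>k. bounded (E k) \<and> diameter (E k) \<le> D m) \<and>
      (\<Sum>k. ennreal (diameter (E k))) < ennreal (C + e m)" for m
  proof (rule hausdorff1_pre_cover)
    have "hausdorff1_pre (D m) N \<le> ennreal C" using hausdorff1_pre_le_hausdorff1[OF D(1), of m N] C by simp
    also have "\<dots> < ennreal (C + e m)" using C(1) e[of m] by (simp add: ennreal_less_iff)
    finally show "hausdorff1_pre (D m) N < ennreal (C + e m)" .
  qed
  then obtain E :: "nat \<Rightarrow> nat \<Rightarrow> (real ^ 3) set" where E: "\<And>m. N \<subseteq> (\<Union>k. E m k)"
    "\<And>m k. bounded (E m k)" "\<And>m k. diameter (E m k) \<le> D m"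
    "\<And>m. (\<Sum>k. ennreal (diameter (E m k))) < ennreal (C + e m)" by metis
  \<comment> \<open>Closure keeps the diameter, and the intersection is compact, so the centres of
    the circles that hit it form a measurable set.\<close>
  define A where "A = (\<lambda>m j. closure (E m j) \<inter> Nr m)"
  define H where "H = (\<lambda>m j. circle_hits c (A m j))"
  define K where "K = (\<lambda>m. (4 / 3 * sqrt (1 - c\<^sup>2 + 2 * e m) ^ 3 + 8 * e m * (1 - c\<^sup>2 + 2 * e m)) / (1 - c\<^sup>2 - e m))"
  have cA: "compact (A m j)" for m j unfolding A_def by (intro closed_Int_compact closed_closure cNr)
  have [measurable]: "H m j \<in> sets borel" for m j unfolding H_def by (rule circle_hits_borel[OF cA])
  have HK: "emeasure lborel (H m j) \<le> ennreal (diameter (E m j)) * ennreal (K m)" if m: "e m < 1 - c\<^sup>2" for m j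
  proof (cases "A m j = {}")
    case True
    then show ?thesis by (simp add: H_def circle_hits_def)
  next
    case False
    then obtain y where y: "y \<in> A m j" by blast
    then have yN: "y \<in> Nr m" by (simp add: A_def)
    have diam: "norm (x - x') \<le> diameter (E m j)" if "x \<in> A m j" "x' \<in> A m j" for x x'
    proof -
      have "dist x x' \<le> diameter (closure (E m j))"
        using that E(2)[of m j] by (intro diameter_bounded_bound bounded_closure) (auto simp: A_def)
      then show ?thesis using E(2)[of m j] by (simp add: diameter_closure dist_norm)
    qed
    obtain v where v: "norm v = 1" "y \<bullet> v = 0"
      "\<And>x. x \<in> Nr m \<Longrightarrow> norm (x - y) \<le> \<delta> m \<Longrightarrow> norm ((x - y) - ((x - y) \<bullet> v) *\<^sub>R v) \<le> e m * norm (x - y)"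
      using \<delta>(2)[of m] yN by blast
    have "emeasure lborel (H m j) \<le> ennreal (diameter (E m j) * K m)"
      unfolding H_def K_def
    proof (rule emeasure_circle_hits_flat[OF cA y _ v(1,2)])
      show "norm y = 1" using yN by (simp add: Nr_def N_def nodal_def)
      show "norm ((x - y) - ((x - y) \<bullet> v) *\<^sub>R v) \<le> e m * norm (x - y)" if x: "x \<in> A m j" for x
      proof (rule v(3))
        show "x \<in> Nr m" using x by (simp add: A_def)
        show "norm (x - y) \<le> \<delta> m" using diam[OF x y] E(3)[of m j] D(2)[of m] by linarith
      qed
      show "diameter (E m j) \<le> e m" using E(3)[of m j] D(3)[of m] by linarith
      show "0 \<le> diameter (E m j)" using E(2) by (rule diameter_ge_0)
    qed (use c m e[of m] diam in auto)
    also have "\<dots> = ennreal (diameter (E m j)) * ennreal (K m)"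
    proof (rule ennreal_mult)
      show "0 \<le> diameter (E m j)" using E(2) by (rule diameter_ge_0)
      show "0 \<le> K m" unfolding K_def using m c2 e[of m]
        by (intro divide_nonneg_nonneg add_nonneg_nonneg mult_nonneg_nonneg) auto
    qed
    finally show ?thesis .
  qed
  \<comment> \<open>The number of members of the cover whose trace on \<open>Nr m\<close> meets the
    circle with centre a. Its integral is bounded by the cover, and for almost all a in the ball it
    is eventually at least k; Fatou's lemma combines the two.\<close>
  define f where "f = (\<lambda>m a. \<Sum>j. indicator (H m j) a :: ennreal)"
  have [measurable]: "f m \<in> borel_measurable borel" for m
    unfolding f_def by measurable
  have intf: "integral\<^sup>N lborel (f m) \<le> ennreal (C + e m) * ennreal (K m)" if m: "e m < 1 - c\<^sup>2" for m
  proof -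
    have "integral\<^sup>N lborel (f m) = (\<Sum>j. emeasure lborel (H m j))"
      unfolding f_def by (subst nn_integral_suminf) (auto simp: nn_integral_indicator)
    also have "\<dots> \<le> (\<Sum>j. ennreal (diameter (E m j)) * ennreal (K m))"
      by (intro suminf_le HK[OF m]) auto
    also have "\<dots> = (\<Sum>j. ennreal (diameter (E m j))) * ennreal (K m)" by (rule ennreal_suminf_multc)
    also have "\<dots> \<le> ennreal (C + e m) * ennreal (K m)"
      by (rule mult_right_mono[OF less_imp_le[OF E(4)]]) simp
    finally show ?thesis .
  qed
  have "AE a in lborel. \<forall>z\<in>Z. a \<notin> circle_hits c {z}"
    by (intro AE_finite_allI[OF finZ] AE_not_in circle_hits_singleton_null Z1 c)
  with hits have "AE a in lborel. of_nat k * indicator (ball 0 1) a \<le> liminf (\<lambda>m. f m a)"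
  proof eventually_elim
    case (elim a)
    show ?case
    proof (cases "a \<in> ball 0 1")
      case True
      with elim(1) obtain X where X: "finite X" "card X = k"
        "\<And>x. x \<in> X \<Longrightarrow> norm x = 1 \<and> U x = 0 \<and> a \<bullet> x = c * norm a" by blast
      have XN: "x \<in> N" if "x \<in> X" for x using X(3)[OF that] by (simp add: N_def nodal_def)
      have XZ: "x \<noteq> z" if "x \<in> X" "z \<in> Z" for x z
        using X(3)[OF that(1)] elim(2) that(2) True by (auto simp: circle_hits_def)
      \<comment> \<open>The distances among the k points and from them to the singular points; the
        element 1 makes the minimum meaningful if there are none. Once \<open>e m\<close> is below
        the minimum, the points lie in \<open>Nr m\<close> and in k different members of the
        cover.\<close>
      define W where "W = insert 1 ((\<lambda>(x, z). norm (x - z)) ` (X \<times> (X \<union> Z) - Id))"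
      have "finite W" using X(1) finZ by (auto simp: W_def)
      moreover have "\<forall>w\<in>W. w > 0" by (auto simp: W_def)
      ultimately have "Min W > 0" by (auto simp: W_def)
      have "\<forall>\<^sub>F m in sequentially. e m < Min W" using elim \<open>Min W > 0\<close> by (simp add: order_tendstoD(2)[OF \<open>e \<longlonglongrightarrow> 0\<close>])
      then have "\<forall>\<^sub>F m in sequentially. of_nat k \<le> f m a"
      proof eventually_elim
        case (elim m)
        have far: "e m < norm (x - z)" if "x \<in> X" "z \<in> X \<union> Z" "x \<noteq> z" for x z
        proof -
          have "norm (x - z) \<in> W" using that by (force simp: W_def)
          then have "Min W \<le> norm (x - z)" using \<open>finite W\<close> by simp
          then show ?thesis using elim by simp
        qed
        have "\<forall>x\<in>X. \<exists>j. x \<in> E m j" using E(1)[of m] XN by blast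
        then obtain j where j: "\<And>x. x \<in> X \<Longrightarrow> x \<in> E m (j x)" by metis
        have inj: "inj_on j X"
        proof (rule inj_onI, rule ccontr)
          fix x y assume xy: "x \<in> X" "y \<in> X" "j x = j y" "x \<noteq> y"
          have "dist x y \<le> diameter (E m (j x))"
            using j[OF xy(1)] j[OF xy(2)] xy(3) E(2) by (intro diameter_bounded_bound) auto
          also have "\<dots> \<le> e m" using E(3)[of m "j x"] D(3)[of m] by linarith
          finally show False using far[of x y] xy by (simp add: dist_norm)
        qed
        have hit: "a \<in> H m (j x)" if x: "x \<in> X" for x
        proof -
          have "x \<in> Nr m" using XN[OF x] far[OF x] XZ[OF x] by (auto simp: Nr_def intro: less_imp_le)
          moreover have "x \<in> closure (E m (j x))" using j[OF x] closure_subset by blast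
          ultimately show ?thesis using True X(3)[OF x] by (auto simp: H_def circle_hits_def A_def)
        qed
        have "of_nat k = (\<Sum>i\<in>j ` X. indicator (H m i) a :: ennreal)"
          using inj X(1,2) hit by (simp add: sum.reindex)
        also have "\<dots> \<le> f m a" unfolding f_def using X(1) by (intro sum_le_suminf) auto
        finally show ?case .
      qed
      then show ?thesis using True by (simp add: Liminf_bounded)
    qed simp
  qed
  then have "(\<integral>\<^sup>+a. of_nat k * indicator (ball 0 1) a \<partial>(lborel :: (real ^ 3) measure)) \<le> (\<integral>\<^sup>+a. liminf (\<lambda>m. f m a) \<partial>(lborel :: (real ^ 3) measure))"
    by (rule nn_integral_mono_AE)
  also have "\<dots> \<le> liminf (\<lambda>m. integral\<^sup>N lborel (f m))"
    by (rule nn_integral_liminf) simp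
  also have "\<dots> \<le> liminf (\<lambda>m. ennreal ((C + e m) * K m))"
  proof (rule Liminf_mono)
    have "\<forall>\<^sub>F m in sequentially. e m < 1 - c\<^sup>2" using order_tendstoD(2)[OF elim] c2 by simp
    then show "\<forall>\<^sub>F m in sequentially. integral\<^sup>N lborel (f m) \<le> ennreal ((C + e m) * K m)"
    proof eventually_elim
      case (elim m)
      have "K m \<ge> 0" unfolding K_def using elim c2 e[of m]
        by (intro divide_nonneg_nonneg add_nonneg_nonneg mult_nonneg_nonneg) auto
      then show ?case using intf[OF elim] C(1) e[of m] by (simp add: ennreal_mult)
    qed
  qed
  also have "liminf (\<lambda>m. ennreal ((C + e m) * K m)) = ennreal (C * (4 / 3 * s))"
  proof (rule lim_imp_Liminf)
    have "K \<longlonglongrightarrow> (4 / 3 * sqrt (1 - c\<^sup>2 + 2 * 0) ^ 3 + 8 * 0 * (1 - c\<^sup>2 + 2 * 0)) / (1 - c\<^sup>2 - 0)"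
      unfolding K_def using c2 by (intro tendsto_intros elim) auto
    also have "(4 / 3 * sqrt (1 - c\<^sup>2 + 2 * 0) ^ 3 + 8 * 0 * (1 - c\<^sup>2 + 2 * 0)) / (1 - c\<^sup>2 - 0) = 4 / 3 * s"
    proof -
      have q: "1 - c\<^sup>2 = s\<^sup>2" using s(2) by simp
      show ?thesis unfolding q using s(1) by (simp add: power2_eq_square power3_eq_cube)
    qed
    finally have K: "K \<longlonglongrightarrow> 4 / 3 * s" .
    have "(\<lambda>m. (C + e m) * K m) \<longlonglongrightarrow> (C + 0) * (4 / 3 * s)" by (intro tendsto_intros K elim)
    then show "(\<lambda>m. ennreal ((C + e m) * K m)) \<longlonglongrightarrow> ennreal (C * (4 / 3 * s))" by (simp add: tendsto_ennrealI)
  qed simp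
  finally have "of_nat k * emeasure lborel (ball (0 :: real ^ 3) 1) \<le> ennreal (C * (4 / 3 * s))"
    by (simp add: nn_integral_cmult_indicator del: emeasure_lborel_box)
  then have "ennreal (real k) * ennreal (4 / 3 * pi) \<le> ennreal (C * (4 / 3 * s))"
    unfolding emeasure_unit_ball_3 ennreal_of_nat_eq_real_of_nat .
  also have "ennreal (real k) * ennreal (4 / 3 * pi) = ennreal (real k * (4 / 3 * pi))"
    by (rule ennreal_mult[symmetric]) simp_all
  finally have "ennreal (real k * (4 / 3 * pi)) \<le> ennreal (C * (4 / 3 * s))" .
  then have "real k * (4 / 3 * pi) \<le> C * (4 / 3 * s)" using C(1) s(1) by (subst (asm) ennreal_le_iff) auto
  then have "real k * pi / s \<le> C" using s(1) by (simp add: divide_le_eq mult.commute)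
  then show ?thesis using C unfolding s_def N_def by (simp add: ennreal_leI)
qed simp

section \<open>Upper bound for the nodal length\<close>

text \<open>Near a regular point the differences of points of the nodal set lie in a narrow cone around the
  tangent, so the tangential coordinate parametrises the nodal set almost isometrically.\<close>

lemma nodal_cone:
  assumes U: "hompoly n U" and p: "p \<in> nodal U" and g: "gradient U p \<noteq> 0" and \<epsilon>: "0 < \<epsilon>" "\<epsilon> \<le> 1"
  shows "\<exists>E r. frame E \<and> E 3 = p \<and> 0 < r \<and>
    (\<forall>x\<in>nodal U \<inter> ball p r. \<forall>y\<in>nodal U \<inter> ball p r. norm (x - y) \<le> (1 + \<epsilon>) * \<bar>(x - y) \<bullet> E 2\<bar>) \<and>
    (\<forall>x\<in>sphere 0 1 \<inter> ball p r. \<bar>U x - norm (gradient U p) * (x \<bullet> E 1)\<bar> \<le> norm (gradient U p) * (norm (x - p) / 2)) \<and> 2 * r \<le> sqrt \<epsilon>"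
proof -
  define g where "g = gradient U p"
  have g: "g \<noteq> 0" using assms(3) by (simp add: g_def)
  have p1: "norm p = 1" "U p = 0" using p by (auto simp: nodal_def)
  obtain \<Phi> :: "(real ^ 3) \<times> (real ^ 3) \<Rightarrow> real ^ 3" where \<Phi>: "polynomial_function \<Phi>"
    "\<forall>x y. U x - U y = \<Phi> (x, y) \<bullet> (x - y)" "\<forall>x. \<Phi> (x, x) = gradient U x"
    using polynomial_difference_gradient[OF hompoly_polynomial[OF U]] by blast
  have gn: "norm (g /\<^sub>R norm g) = 1" using g by simp
  have gp: "p \<bullet> (g /\<^sub>R norm g) = 0"
    using gradient_radial[OF U p1(2)] by (simp add: g_def inner_commute)
  obtain E where E: "frame E" "E 3 = p" "E 1 = g /\<^sub>R norm g" using frame_exists2[OF p1(1) gn gp] by blast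
  \<comment> \<open>Each of the two transversal components of a chord will be at most e times its
    length. With 2 e^2 = \<epsilon> / 2 the estimate closes because (1 + \<epsilon>)^2 (1 -
    \<epsilon> / 2) \<ge> 1 for \<epsilon> \<le> 1.\<close>
  define e where "e = sqrt \<epsilon> / 2"
  have e: "e > 0" "e \<le> 1 / 2" "e\<^sup>2 = \<epsilon> / 4" using \<epsilon> by (auto simp: e_def power_divide)
  have "isCont \<Phi> (p, p)" using \<Phi>(1) by (rule continuous_polymonial_function)
  moreover have "e * norm g > 0" using e(1) g by simp
  ultimately obtain r1 where r1: "r1 > 0" "\<forall>w. dist w (p, p) < r1 \<longrightarrow> dist (\<Phi> w) (\<Phi> (p, p)) < e * norm g"
    unfolding continuous_at_eps_delta by blast
  define r where "r = min (r1 / 2) e"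
  have r: "r > 0" "r \<le> e" using r1(1) e(1) by (auto simp: r_def)
  have \<Phi>g: "norm (\<Phi> (x, y) - g) \<le> e * norm g" if "x \<in> ball p r" "y \<in> ball p r" for x y
  proof -
    have "dist (x, y) (p, p) \<le> dist x p + dist y p"
      unfolding dist_Pair_Pair by (rule sqrt_sum_squares_le_sum) simp_all
    also have "\<dots> < r1" using that by (simp add: dist_commute r_def)
    finally have "dist (\<Phi> (x, y)) (\<Phi> (p, p)) < e * norm g" using r1(2) by blast
    then show ?thesis using \<Phi>(3) by (simp add: dist_norm g_def)
  qed
  have gE: "g \<bullet> d = norm g * (d \<bullet> E 1)" for d using g by (simp add: E(3) inner_commute)
  have cone: "norm (x - y) \<le> (1 + \<epsilon>) * \<bar>(x - y) \<bullet> E 2\<bar>" if x: "x \<in> nodal U \<inter> ball p r" and y: "y \<in> nodal U \<inter> ball p r" for x y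
  proof -
    define d where "d = x - y"
    have xy: "norm x = 1" "norm y = 1" "U x = 0" "U y = 0" using x y by (auto simp: nodal_def)
    have "\<Phi> (x, y) \<bullet> d = 0" using \<Phi>(2) xy by (metis d_def right_minus_eq)
    then have "g \<bullet> d = - ((\<Phi> (x, y) - g) \<bullet> d)" by (simp add: inner_diff_left)
    then have "\<bar>g \<bullet> d\<bar> \<le> norm (\<Phi> (x, y) - g) * norm d" using Cauchy_Schwarz_ineq2[of "\<Phi> (x, y) - g" d] by simp
    also have "\<dots> \<le> e * norm g * norm d" using \<Phi>g x y by (intro mult_right_mono) auto
    finally have "norm g * \<bar>d \<bullet> E 1\<bar> \<le> norm g * (e * norm d)" by (simp add: gE abs_mult mult_ac)
    then have d1: "\<bar>d \<bullet> E 1\<bar> \<le> e * norm d" using g by simp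
    \<comment> \<open>Both ends lie on the sphere, so the chord is orthogonal to x + y. Its
      component along p is its product with the difference of p and the midpoint, which is
      small.\<close>
    have "x \<bullet> x = 1" "y \<bullet> y = 1" using xy by (simp_all add: dot_square_norm)
    then have "d \<bullet> x + d \<bullet> y = 0"
      unfolding d_def by (simp add: inner_diff_left inner_commute[of y x])
    moreover have "d \<bullet> ((p - x) /\<^sub>R 2 + (p - y) /\<^sub>R 2) = (d \<bullet> p - d \<bullet> x) / 2 + (d \<bullet> p - d \<bullet> y) / 2"
      by (simp add: inner_add_right inner_diff_right)
    moreover have "u + v = 0 \<Longrightarrow> c = (q - u) / 2 + (q - v) / 2 \<Longrightarrow> q = c" for u v q c :: real by (simp add: field_simps)
    ultimately have "d \<bullet> p = d \<bullet> ((p - x) /\<^sub>R 2 + (p - y) /\<^sub>R 2)" by blast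
    then have "\<bar>d \<bullet> p\<bar> \<le> norm d * norm ((p - x) /\<^sub>R 2 + (p - y) /\<^sub>R 2)"
      using Cauchy_Schwarz_ineq2[of d "(p - x) /\<^sub>R 2 + (p - y) /\<^sub>R 2"] by simp
    also have "\<dots> \<le> norm d * e"
    proof (rule mult_left_mono)
      show "norm ((p - x) /\<^sub>R 2 + (p - y) /\<^sub>R 2) \<le> e"
    proof -
      have "norm ((p - x) /\<^sub>R 2 + (p - y) /\<^sub>R 2) \<le> norm (p - x) / 2 + norm (p - y) / 2"
        by (rule order_trans[OF norm_triangle_ineq]) simp
      then show ?thesis using x y r by (simp add: dist_norm)
    qed
    qed simp
    finally have d3: "\<bar>d \<bullet> E 3\<bar> \<le> e * norm d" by (simp add: E(2) mult.commute)
    have "(norm d)\<^sup>2 = \<bar>d \<bullet> E 1\<bar>\<^sup>2 + \<bar>d \<bullet> E 2\<bar>\<^sup>2 + \<bar>d \<bullet> E 3\<bar>\<^sup>2"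
      using frame_norm[OF E(1), of "d \<bullet> E 1" "d \<bullet> E 2" "d \<bullet> E 3"] frame_expand[OF E(1), of d] by simp
    also have "\<dots> \<le> (e * norm d)\<^sup>2 + \<bar>d \<bullet> E 2\<bar>\<^sup>2 + (e * norm d)\<^sup>2"
      using d1 d3 by (intro add_mono power_mono) auto
    finally have "(norm d)\<^sup>2 * (1 - \<epsilon> / 2) \<le> \<bar>d \<bullet> E 2\<bar>\<^sup>2"
      by (simp add: power_mult_distrib e(3) algebra_simps)
    then have "(1 + \<epsilon>)\<^sup>2 * ((norm d)\<^sup>2 * (1 - \<epsilon> / 2)) \<le> ((1 + \<epsilon>) * \<bar>d \<bullet> E 2\<bar>)\<^sup>2"
      unfolding power_mult_distrib by (intro mult_left_mono) auto
    moreover have "(norm d)\<^sup>2 * 1 \<le> (norm d)\<^sup>2 * ((1 + \<epsilon>)\<^sup>2 * (1 - \<epsilon> / 2))"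
    proof (rule mult_left_mono)
      have "\<epsilon> * (\<epsilon> * \<epsilon>) \<le> 1 * \<epsilon>" using \<epsilon> by (intro mult_mono mult_le_one) (auto simp: mult_le_one intro: mult_le_cancel_left1[THEN iffD2])
      then show "1 \<le> (1 + \<epsilon>)\<^sup>2 * (1 - \<epsilon> / 2)" using \<epsilon> by (simp add: power2_eq_square algebra_simps)
    qed simp
    ultimately have "(norm d)\<^sup>2 \<le> ((1 + \<epsilon>) * \<bar>d \<bullet> E 2\<bar>)\<^sup>2" by (simp add: mult_ac)
    then show ?thesis unfolding d_def by (rule power2_le_imp_le) (use \<epsilon> in simp)
  qed
  have lin: "\<bar>U x - norm g * (x \<bullet> E 1)\<bar> \<le> norm g * (norm (x - p) / 2)" if x: "x \<in> sphere 0 1 \<inter> ball p r" for x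
  proof -
    have "E 3 \<bullet> E 1 = 0" using E(1)[unfolded frame_def, rule_format, of 3 1] by simp
    then have "g \<bullet> (x - p) = norm g * (x \<bullet> E 1)" using gE[of "x - p"] E(2) by (simp add: inner_diff_left)
    moreover have "U x = \<Phi> (x, p) \<bullet> (x - p)" using \<Phi>(2) p1 by (metis diff_zero)
    ultimately have "U x - norm g * (x \<bullet> E 1) = (\<Phi> (x, p) - g) \<bullet> (x - p)" by (simp add: inner_diff_left)
    then have "\<bar>U x - norm g * (x \<bullet> E 1)\<bar> \<le> norm (\<Phi> (x, p) - g) * norm (x - p)"
      using Cauchy_Schwarz_ineq2[of "\<Phi> (x, p) - g" "x - p"] by simp
    also have "\<dots> \<le> (1 / 2 * norm g) * norm (x - p)"
    proof (rule mult_right_mono)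
      have "norm (\<Phi> (x, p) - g) \<le> e * norm g" using \<Phi>g[of x p] x r by simp
      also have "\<dots> \<le> 1 / 2 * norm g" using e by (intro mult_right_mono) auto
      finally show "norm (\<Phi> (x, p) - g) \<le> 1 / 2 * norm g" .
    qed simp
    finally show ?thesis by simp
  qed
  have "2 * r \<le> sqrt \<epsilon>" using r(2) by (simp add: e_def)
  then show ?thesis using E r cone lin unfolding g_def by blast
qed

text \<open>The lower bound makes \<gamma> injective and chords at least as long as parameter
  intervals; the upper bound gives the Hausdorff measure of the arc. The bound by sqrt \<epsilon>
  controls the factor 1 - norm (p - q)^2 / 4 in the volume of separating great circles.\<close>

definition nodal_arc :: "(real ^ 3 \<Rightarrow> real) \<Rightarrow> real \<Rightarrow> real \<Rightarrow> (real \<Rightarrow> real ^ 3) \<Rightarrow> bool" where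
  "nodal_arc U \<epsilon> \<eta> \<gamma> \<longleftrightarrow> 0 < \<eta> \<and> (\<forall>s\<in>{-\<eta>..\<eta>}. \<gamma> s \<in> nodal U) \<and>
     (\<forall>s\<in>{-\<eta>..\<eta>}. \<forall>t\<in>{-\<eta>..\<eta>}. \<bar>s - t\<bar> \<le> norm (\<gamma> s - \<gamma> t) \<and> norm (\<gamma> s - \<gamma> t) \<le> (1 + \<epsilon>) * \<bar>s - t\<bar> \<and>
       norm (\<gamma> s - \<gamma> t) \<le> sqrt \<epsilon>)"

text \<open>For fixed tangential coordinate s, U changes sign along the curve t \<mapsto> X s t in
  the normal direction, so there is a zero on it. By the cone condition it is the only nearby zero
  with this s and depends on s in a Lipschitz way, so every nodal point close to p is on the
  arc.\<close>

lemma local_nodal_arc: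
  assumes U: "hompoly n U" and p: "p \<in> nodal U" and g: "gradient U p \<noteq> 0" and \<epsilon>: "0 < \<epsilon>" "\<epsilon> \<le> 1"
  shows "\<exists>\<eta> \<gamma> W. nodal_arc U \<epsilon> \<eta> \<gamma> \<and> open W \<and> p \<in> W \<and> nodal U \<inter> W \<subseteq> \<gamma> ` {-\<eta><..<\<eta>}"
proof -
  obtain E r where E: "frame E" "E 3 = p" and r: "0 < r" "2 * r \<le> sqrt \<epsilon>"
    and cone: "\<And>x y. x \<in> nodal U \<inter> ball p r \<Longrightarrow> y \<in> nodal U \<inter> ball p r \<Longrightarrow> norm (x - y) \<le> (1 + \<epsilon>) * \<bar>(x - y) \<bullet> E 2\<bar>"
    and lin: "\<And>x. x \<in> sphere 0 1 \<inter> ball p r \<Longrightarrow> \<bar>U x - norm (gradient U p) * (x \<bullet> E 1)\<bar> \<le> norm (gradient U p) * (norm (x - p) / 2)"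
    using nodal_cone[OF assms] by blast
  have EE: "E i \<bullet> E j = (if i = j then 1 else 0)" for i j using E(1) by (simp add: frame_def)
  have E2: "norm (E 2) = 1" "p \<bullet> E 2 = 0" using EE[of 2 2] EE[of 3 2] E(2) by (auto simp: norm_eq_1)
  define X where "X = (\<lambda>s t. frame_point E t s (sqrt (1 - (s\<^sup>2 + t\<^sup>2))))"
  define \<tau> where "\<tau> = min (r / 3) (1 / 2)"
  have \<tau>: "\<tau> > 0" "2 * \<tau> < r" "\<tau> \<le> 1 / 2" using r by (auto simp: \<tau>_def)
  have sq: "s\<^sup>2 \<le> \<tau>\<^sup>2" if "\<bar>s\<bar> \<le> \<tau>" for s using that \<tau> by (simp add: abs_le_square_iff[symmetric])
  have \<tau>2: "\<tau>\<^sup>2 \<le> 1 / 4" using power_mono[of \<tau> "1 / 2" 2] \<tau> by (simp add: power_divide)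
  have st: "s\<^sup>2 + t\<^sup>2 \<le> 1 / 2" if "\<bar>s\<bar> \<le> \<tau>" "\<bar>t\<bar> \<le> \<tau>" for s t using sq[OF that(1)] sq[OF that(2)] \<tau>2 by linarith
  have Xn: "norm (X s t) = 1" if "\<bar>s\<bar> \<le> \<tau>" "\<bar>t\<bar> \<le> \<tau>" for s t
  proof -
    have "(norm (X s t))\<^sup>2 = 1\<^sup>2" unfolding X_def frame_norm[OF E(1)] using st[OF that] by simp
    then show ?thesis by (rule power2_eq_imp_eq) simp_all
  qed
  have XE: "X s t \<bullet> E 1 = t" "X s t \<bullet> E 2 = s" for s t
    using frame_coordinates[OF E(1)] by (simp_all add: X_def)
  have Xp: "(norm (X s t - p))\<^sup>2 \<le> 2 * (s\<^sup>2 + t\<^sup>2)" if "\<bar>s\<bar> \<le> \<tau>" "\<bar>t\<bar> \<le> \<tau>" for s t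
  proof -
    define w where "w = s\<^sup>2 + t\<^sup>2"
    have w: "0 \<le> w" "w \<le> 1 / 2" using st[OF that] by (auto simp: w_def)
    have "X s t - p = frame_point E t s (sqrt (1 - w) - 1)"
      using E(2) by (simp add: X_def frame_point_def w_def algebra_simps)
    then have "(norm (X s t - p))\<^sup>2 = t\<^sup>2 + s\<^sup>2 + (sqrt (1 - w) - 1)\<^sup>2" using frame_norm[OF E(1)] by simp
    also have "\<dots> = 2 - 2 * sqrt (1 - w)" using w by (simp add: power2_diff) (simp add: w_def)
    also have "\<dots> \<le> 2 * w"
    proof -
      have "(1 - w) * (1 - w) \<le> 1 * (1 - w)" using w by (intro mult_right_mono) auto
      then have "1 - w \<le> sqrt (1 - w)" by (intro real_le_rsqrt) (simp add: power2_eq_square)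
      then show ?thesis by simp
    qed
    finally show ?thesis by (simp add: w_def)
  qed
  have Xball: "X s t \<in> ball p r" if "\<bar>s\<bar> \<le> \<tau>" "\<bar>t\<bar> \<le> \<tau>" for s t
  proof -
    have "(norm (X s t - p))\<^sup>2 \<le> (2 * \<tau>)\<^sup>2"
      using Xp[OF that] sq[OF that(1)] sq[OF that(2)] by (simp add: power_mult_distrib)
    then have "norm (X s t - p) \<le> 2 * \<tau>" by (rule power2_le_imp_le) (use \<tau> in simp)
    then show ?thesis using \<tau> by (simp add: dist_norm norm_minus_commute)
  qed
  define G where "G = norm (gradient U p)"
  have G: "G > 0" using g by (simp add: G_def)
  \<comment> \<open>The chord from p to X 0 t is at most 3/2 |t|, and the error in
    \<open>lin\<close> is half of it: 3/4 |t| leaves the sign of the linear term intact.\<close>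
  have sign: "\<bar>U (X 0 t) - G * t\<bar> \<le> G * (3 / 4 * \<bar>t\<bar>)" if t: "\<bar>t\<bar> \<le> \<tau>" for t
  proof -
    have 0: "\<bar>0\<bar> \<le> \<tau>" using \<tau> by simp
    have "(norm (X 0 t - p))\<^sup>2 \<le> 2 * t\<^sup>2" using Xp[OF 0 t] by simp
    also have "\<dots> \<le> 9 / 4 * t\<^sup>2" by (rule mult_right_mono) simp_all
    also have "\<dots> = (3 / 2 * \<bar>t\<bar>)\<^sup>2" by (simp add: power_mult_distrib power_divide)
    finally have "(norm (X 0 t - p))\<^sup>2 \<le> (3 / 2 * \<bar>t\<bar>)\<^sup>2" .
    then have "norm (X 0 t - p) \<le> 3 / 2 * \<bar>t\<bar>" by (rule power2_le_imp_le) simp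
    then have "G * (norm (X 0 t - p) / 2) \<le> G * (3 / 4 * \<bar>t\<bar>)" using G by (intro mult_left_mono) auto
    moreover have "\<bar>U (X 0 t) - G * t\<bar> \<le> G * (norm (X 0 t - p) / 2)"
      using lin[of "X 0 t"] Xball[OF 0 t] Xn[OF 0 t] XE by (simp add: G_def)
    ultimately show ?thesis by linarith
  qed
  have pos: "U (X 0 \<tau>) > 0" "U (X 0 (- \<tau>)) < 0"
  proof -
    have "G * \<tau> > 0" using G \<tau> by simp
    moreover have "\<bar>U (X 0 \<tau>) - G * \<tau>\<bar> \<le> 3 / 4 * (G * \<tau>)" "\<bar>U (X 0 (- \<tau>)) + G * \<tau>\<bar> \<le> 3 / 4 * (G * \<tau>)"
      using sign[of \<tau>] sign[of "- \<tau>"] \<tau> by (simp_all add: mult_ac)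
    ultimately show "U (X 0 \<tau>) > 0" "U (X 0 (- \<tau>)) < 0" by linarith+
  qed
  have cX: "continuous_on S (\<lambda>s. U (X s t))" "continuous_on S (\<lambda>t. U (X s t))" for S s t
    unfolding X_def
    by (rule continuous_on_compose2[OF continuous_on_hompoly[OF U, of UNIV]]; auto intro!: continuous_intros)+
  have "open {s. U (X s (- \<tau>)) < 0 \<and> 0 < U (X s \<tau>)}"
    by (intro open_Collect_conj open_Collect_less cX continuous_on_const)
  moreover have "0 \<in> {s. U (X s (- \<tau>)) < 0 \<and> 0 < U (X s \<tau>)}" using pos by simp
  ultimately obtain \<eta>0 where \<eta>0: "\<eta>0 > 0" "cball 0 \<eta>0 \<subseteq> {s. U (X s (- \<tau>)) < 0 \<and> 0 < U (X s \<tau>)}"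
    by (meson open_contains_cball)
  define \<eta> where "\<eta> = min \<eta>0 \<tau>"
  have \<eta>: "\<eta> > 0" "\<eta> \<le> \<tau>" using \<eta>0 \<tau> by (auto simp: \<eta>_def)
  have ex: "\<exists>x. x \<in> nodal U \<inter> ball p r \<and> x \<bullet> E 2 = s" if s: "s \<in> {-\<eta>..\<eta>}" for s
  proof -
    have "s \<in> cball 0 \<eta>0" using s by (auto simp: \<eta>_def)
    then have "U (X s (- \<tau>)) < 0" "0 < U (X s \<tau>)" using \<eta>0(2) by auto
    then obtain t where t: "- \<tau> \<le> t" "t \<le> \<tau>" "U (X s t) = 0"
      using IVT'[OF _ _ _ cX(2), of s "- \<tau>" 0 \<tau>] \<tau> by auto
    have b: "\<bar>s\<bar> \<le> \<tau>" "\<bar>t\<bar> \<le> \<tau>" using s \<eta> t by auto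
    show ?thesis using Xn[OF b] Xball[OF b] t XE by (intro exI[of _ "X s t"]) (auto simp: nodal_def)
  qed
  define \<gamma> where "\<gamma> = (\<lambda>s. SOME x. x \<in> nodal U \<inter> ball p r \<and> x \<bullet> E 2 = s)"
  have \<gamma>: "\<gamma> s \<in> nodal U \<inter> ball p r" "\<gamma> s \<bullet> E 2 = s" if "s \<in> {-\<eta>..\<eta>}" for s
    using someI_ex[OF ex[OF that]] by (simp_all add: \<gamma>_def)
  have arc: "\<bar>s - t\<bar> \<le> norm (\<gamma> s - \<gamma> t) \<and> norm (\<gamma> s - \<gamma> t) \<le> (1 + \<epsilon>) * \<bar>s - t\<bar> \<and> norm (\<gamma> s - \<gamma> t) \<le> sqrt \<epsilon>"
    if s: "s \<in> {-\<eta>..\<eta>}" and t: "t \<in> {-\<eta>..\<eta>}" for s t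
  proof (intro conjI)
    have st: "(\<gamma> s - \<gamma> t) \<bullet> E 2 = s - t" using \<gamma>[OF s] \<gamma>[OF t] by (simp add: inner_diff_left)
    show "\<bar>s - t\<bar> \<le> norm (\<gamma> s - \<gamma> t)"
      using Cauchy_Schwarz_ineq2[of "\<gamma> s - \<gamma> t" "E 2"] E2 st by simp
    show "norm (\<gamma> s - \<gamma> t) \<le> (1 + \<epsilon>) * \<bar>s - t\<bar>" using cone[OF \<gamma>(1)[OF s] \<gamma>(1)[OF t]] st by simp
    have "dist (\<gamma> s) (\<gamma> t) \<le> dist p (\<gamma> s) + dist p (\<gamma> t)" by (rule dist_triangle3)
    also have "\<dots> \<le> 2 * r" using \<gamma>(1)[OF s] \<gamma>(1)[OF t] by simp
    finally show "norm (\<gamma> s - \<gamma> t) \<le> sqrt \<epsilon>" using r(2) by (simp add: dist_norm)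
  qed
  have "nodal U \<inter> ball p (min r \<eta>) \<subseteq> \<gamma> ` {-\<eta><..<\<eta>}"
  proof
    fix x assume x: "x \<in> nodal U \<inter> ball p (min r \<eta>)"
    define s where "s = x \<bullet> E 2"
    have "\<bar>s\<bar> = \<bar>(x - p) \<bullet> E 2\<bar>" using E2 by (simp add: s_def inner_diff_left)
    also have "\<dots> \<le> norm (x - p)" using Cauchy_Schwarz_ineq2[of "x - p" "E 2"] E2 by simp
    also have "\<dots> < \<eta>" using x by (simp add: dist_norm norm_minus_commute)
    finally have s: "s \<in> {-\<eta><..<\<eta>}" by auto
    then have s': "s \<in> {-\<eta>..\<eta>}" by auto
    have "norm (x - \<gamma> s) \<le> (1 + \<epsilon>) * \<bar>(x - \<gamma> s) \<bullet> E 2\<bar>"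
      using x \<gamma>(1)[OF s'] by (intro cone) auto
    also have "(x - \<gamma> s) \<bullet> E 2 = 0" using \<gamma>(2)[OF s'] by (simp add: inner_diff_left s_def)
    finally have "x = \<gamma> s" by simp
    then show "x \<in> \<gamma> ` {-\<eta><..<\<eta>}" using s by blast
  qed
  moreover have "nodal_arc U \<epsilon> \<eta> \<gamma>" using \<eta> \<gamma> arc by (auto simp: nodal_arc_def)
  moreover have "p \<in> ball p (min r \<eta>)" using r \<eta> by simp
  ultimately show ?thesis using open_ball by blast
qed

section \<open>Intersections of the nodal set with great circles\<close>

lemma great_circle_form:
  assumes U: "hompoly n U"
  shows "\<exists>D. \<forall>\<phi>. U (frame_point E (cos \<phi>) (sin \<phi>) 0) = trig_form n D \<phi>"
proof -
  obtain C where C: "\<forall>r \<phi> z. U (frame_point E (r * cos \<phi>) (r * sin \<phi>) z) =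
    (\<Sum>d\<le>n. r ^ d * z ^ (n - d) * trig_form d (C d) \<phi>)" using hompoly_cylindrical[OF U] by blast
  have "U (frame_point E (cos \<phi>) (sin \<phi>) 0) = trig_form n (C n) \<phi>" for \<phi>
  proof -
    have "U (frame_point E (cos \<phi>) (sin \<phi>) 0) = (\<Sum>d\<le>n. 1 ^ d * 0 ^ (n - d) * trig_form d (C d) \<phi>)"
      using C[rule_format, of 1 \<phi> 0] by simp
    also have "\<dots> = (\<Sum>d\<in>{n}. 1 ^ d * 0 ^ (n - d) * trig_form d (C d) \<phi>)"
      by (intro sum.mono_neutral_right) auto
    finally show ?thesis by simp
  qed
  then show ?thesis by blast
qed

text \<open>The half periods [0, pi) and [pi, 2 pi) contribute at most n zeros each. The point y
  excludes great circles contained in the nodal set.\<close>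

lemma great_circle_card:
  assumes U: "hompoly n U" and a: "a \<noteq> 0" and y: "norm y = 1" "a \<bullet> y = 0" "U y \<noteq> 0"
  shows "finite {x \<in> nodal U. a \<bullet> x = 0}" "card {x \<in> nodal U. a \<bullet> x = 0} \<le> 2 * n"
proof -
  have "norm (a /\<^sub>R norm a) = 1" using a by simp
  then obtain E where E: "frame E" "E 3 = a /\<^sub>R norm a" using frame_exists by blast
  obtain C where UC: "\<And>\<phi>. U (frame_point E (cos \<phi>) (sin \<phi>) 0) = trig_form n C \<phi>"
    using great_circle_form[OF U] by blast
  have circ: "\<exists>\<phi>\<in>{0..<2 * pi}. x = frame_point E (cos \<phi>) (sin \<phi>) 0" if x: "norm x = 1" "a \<bullet> x = 0" for x
  proof -
    have "x \<bullet> E 3 = 0" using x(2) by (simp add: E(2) inner_commute)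
    then have xe: "x = frame_point E (x \<bullet> E 1) (x \<bullet> E 2) 0" using frame_expand[OF E(1), of x] by simp
    then have "(norm x)\<^sup>2 = (x \<bullet> E 1)\<^sup>2 + (x \<bullet> E 2)\<^sup>2" using frame_norm[OF E(1), of "x \<bullet> E 1" "x \<bullet> E 2" 0] by simp
    then have "(x \<bullet> E 1)\<^sup>2 + (x \<bullet> E 2)\<^sup>2 = 1" using x(1) by simp
    then obtain t where "0 \<le> t" "t < 2 * pi" "x \<bullet> E 1 = cos t" "x \<bullet> E 2 = sin t" by (rule sincos_total_2pi)
    then show ?thesis using xe by (intro bexI[of _ t]) auto
  qed
  obtain \<phi>0 where "y = frame_point E (cos \<phi>0) (sin \<phi>0) 0" using circ[OF y(1,2)] by blast
  then have nz: "trig_form n C \<phi>0 \<noteq> 0" using UC y(3) by metis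
  define Z where "Z = (\<lambda>\<alpha>. {t \<in> {\<alpha>..<\<alpha> + pi}. trig_form n C t = 0})"
  have Z: "finite (Z \<alpha>)" "card (Z \<alpha>) \<le> n" for \<alpha>
    unfolding Z_def by (rule trig_form_zeros[OF nz])+
  have sub: "{x \<in> nodal U. a \<bullet> x = 0} \<subseteq> (\<lambda>\<phi>. frame_point E (cos \<phi>) (sin \<phi>) 0) ` (Z 0 \<union> Z pi)"
  proof
    fix x assume "x \<in> {x \<in> nodal U. a \<bullet> x = 0}"
    then have x: "norm x = 1" "U x = 0" "a \<bullet> x = 0" by (auto simp: nodal_def)
    obtain \<phi> where \<phi>: "\<phi> \<in> {0..<2 * pi}" "x = frame_point E (cos \<phi>) (sin \<phi>) 0" using circ[OF x(1,3)] by blast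
    then have "trig_form n C \<phi> = 0" using UC x by metis
    then have "\<phi> \<in> Z 0 \<union> Z pi" using \<phi>(1) by (auto simp: Z_def)
    then show "x \<in> (\<lambda>\<phi>. frame_point E (cos \<phi>) (sin \<phi>) 0) ` (Z 0 \<union> Z pi)" using \<phi> by blast
  qed
  show "finite {x \<in> nodal U. a \<bullet> x = 0}" using Z(1) by (intro finite_subset[OF sub]) auto
  have "card {x \<in> nodal U. a \<bullet> x = 0} \<le> card (Z 0 \<union> Z pi)"
    using Z(1) by (intro surj_card_le[OF _ sub]) auto
  also have "\<dots> \<le> card (Z 0) + card (Z pi)" by (rule card_Un_le)
  finally show "card {x \<in> nodal U. a \<bullet> x = 0} \<le> 2 * n" using Z(2)[of 0] Z(2)[of pi] by linarith
qed

lemma hyperplane_null: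
  fixes p :: "real ^ 3"
  assumes "p \<noteq> 0"
  shows "{a. a \<bullet> p = 0} \<in> null_sets lborel"
proof -
  have "closed {a. a \<bullet> p = 0}" by (intro closed_Collect_eq continuous_intros)
  moreover have "negligible {a. a \<bullet> p = 0}" using negligible_hyperplane[of p 0] assms by (simp add: inner_commute)
  ultimately show ?thesis by (simp add: negligible_iff_null_sets null_sets_completion_iff)
qed

text \<open>A fixed great circle, orthogonal to \<open>b\<close>, passes through a point where U is
  not zero and so meets the nodal set in a finite set \<open>P\<close>. Any other great circle meets
  the fixed one; if it were contained in the nodal set, its centre would be orthogonal to a point of
  \<open>P\<close>, and such centres fill finitely many planes only.\<close>

lemma AE_great_circle_card:
  assumes U: "hompoly n U" and nz: "U x0 \<noteq> 0" and n: "n \<ge> 1"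
  shows "AE a in lborel. finite {x \<in> nodal U. a \<bullet> x = 0} \<and> card {x \<in> nodal U. a \<bullet> x = 0} \<le> 2 * n"
proof -
  have x0: "x0 \<noteq> 0" using hompoly_homogeneous[OF U, of 0 x0] nz n by (auto simp: power_0_left)
  define y1 where "y1 = x0 /\<^sub>R norm x0"
  have y1: "norm y1 = 1" "U y1 \<noteq> 0" using x0 nz hompoly_homogeneous[OF U, of "inverse (norm x0)" x0] by (auto simp: y1_def)
  obtain F where F: "frame F" "F 3 = y1" using frame_exists[OF y1(1)] by blast
  define b where "b = F 1"
  have b: "b \<bullet> y1 = 0" "b \<noteq> 0"
  proof -
    have FF: "F i \<bullet> F j = (if i = j then 1 else 0)" for i j using F(1) by (simp add: frame_def)
    show "b \<bullet> y1 = 0" using FF[of 1 3] F(2) by (simp add: b_def)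
    show "b \<noteq> 0" using FF[of 1 1] by (auto simp: b_def)
  qed
  define P where "P = {x \<in> nodal U. b \<bullet> x = 0}"
  have finP: "finite P" unfolding P_def by (rule great_circle_card(1)[OF U b(2) y1(1) b(1) y1(2)])
  have "AE a in lborel. \<forall>q\<in>P. a \<notin> {a. a \<bullet> q = 0}"
    by (intro AE_finite_allI[OF finP] AE_not_in hyperplane_null) (auto simp: P_def nodal_def)
  moreover have "AE a in lborel. a \<notin> {0 :: real ^ 3}"
    by (intro AE_not_in) (simp add: null_sets_def)
  ultimately show ?thesis
  proof eventually_elim
    case (elim a)
    then have a: "a \<noteq> 0" by simp
    have "\<exists>y. norm y = 1 \<and> a \<bullet> y = 0 \<and> U y \<noteq> 0"
    proof (cases "cross3 a b = 0")
      case True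
      have "cross3 y1 (cross3 a b) = (y1 \<bullet> b) *\<^sub>R a - (y1 \<bullet> a) *\<^sub>R b" by (rule Lagrange)
      then have "(y1 \<bullet> a) *\<^sub>R b = 0" using True b(1) by (simp add: inner_commute cross_zero_right)
      then have "a \<bullet> y1 = 0" using b(2) by (simp add: inner_commute)
      then show ?thesis using y1 by blast
    next
      case False
      define w where "w = cross3 a b /\<^sub>R norm (cross3 a b)"
      have w: "norm w = 1" "a \<bullet> w = 0" "b \<bullet> w = 0" using False by (auto simp: w_def dot_cross_self)
      have "U w \<noteq> 0"
      proof
        assume "U w = 0"
        then have "w \<in> P" using w by (simp add: P_def nodal_def)
        then show False using elim(1) w(2) by blast
      qed
      then show ?thesis using w by blast
    qed
    then show ?case using great_circle_card[OF U a] by blast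
  qed
qed

lemma hausdorff1_Un_countable:
  fixes A B :: "'a::metric_space set"
  assumes "countable A"
  shows "hausdorff1 (A \<union> B) \<le> hausdorff1 B"
proof -
  have "hausdorff1 (\<Union>i\<in>(UNIV :: bool set). if i then A else B) \<le> hausdorff1 B"
  proof (rule hausdorff1_countable_UN_le)
    show "hausdorff1 (if i then A else B) \<le> (if i then 0 else hausdorff1 B)" for i
      using hausdorff1_countable[OF assms] by simp
    fix F :: "bool set"
    have "(\<Sum>i\<in>F. if i then 0 else hausdorff1 B) \<le> (\<Sum>i\<in>UNIV. if i then 0 else hausdorff1 B)"
      by (intro sum_mono2) auto
    then show "(\<Sum>i\<in>F. if i then 0 else hausdorff1 B) \<le> hausdorff1 B" by (simp add: UNIV_bool)
  qed simp
  then show ?thesis by (simp add: UNIV_bool Un_commute)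
qed

section \<open>Decomposition of the nodal set into disjoint arcs\<close>

lemma open_component_interval:
  fixes V :: "real set"
  assumes V: "open V" "V \<subseteq> {-\<eta><..<\<eta>}" and c: "c \<in> components V"
  shows "\<exists>l r. l < r \<and> -\<eta> \<le> l \<and> r \<le> \<eta> \<and> {l<..<r} \<subseteq> c \<and> c \<subseteq> {l..r}"
proof -
  have c': "open c" "connected c" "c \<noteq> {}" "c \<subseteq> {-\<eta><..<\<eta>}"
    using open_components[OF V(1) c] in_components_connected[OF c] in_components_nonempty[OF c]
      in_components_subset[OF c] V(2) by auto
  have bd: "bdd_above c" "bdd_below c" using c'(4) by (auto intro!: bdd_aboveI[of _ \<eta>] bdd_belowI[of _ "-\<eta>"])
  have sub: "c \<subseteq> {Inf c..Sup c}" using bd by (auto intro: cInf_lower cSup_upper)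
  have inside: "{Inf c<..<Sup c} \<subseteq> c"
  proof
    fix x assume x: "x \<in> {Inf c<..<Sup c}"
    obtain y where y: "y \<in> c" "y < x" using cInf_lessD[OF c'(3)] x by force
    obtain z where z: "z \<in> c" "x < z" using less_cSupD[OF c'(3)] x by force
    have "{y..z} \<subseteq> c" using c'(2) y z by (intro connected_contains_Icc) auto
    then show "x \<in> c" using y z by auto
  qed
  have "Inf c < Sup c"
  proof (rule ccontr)
    assume "\<not> Inf c < Sup c"
    then have "c \<subseteq> {Sup c}" using sub by auto
    then have "finite c" by (rule finite_subset) simp
    then show False using c'(1,3) finite_imp_not_open by blast
  qed
  moreover have "-\<eta> \<le> Inf c" using c'(3,4) by (intro cInf_greatest) auto
  moreover have "Sup c \<le> \<eta>" using c'(3,4) by (intro cSup_least) auto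
  ultimately show ?thesis using sub inside by blast
qed

text \<open>Countably many local arcs cover the regular part. As they overlap, the earlier ones are
  removed from each and the rest is split into components, which yields pairwise disjoint arcs. A
  great circle meeting several of them has as many nodal points, at most 2 n for almost every
  circle; integrating over the circles that separate end points bounds the sum of the parameter
  lengths.\<close>

lemma hausdorff1_nodal_le_aux:
  assumes U: "harmonic_poly n U" and nz: "U x0 \<noteq> 0" and n: "n \<ge> 1" and \<epsilon>: "0 < \<epsilon>" "\<epsilon> < 1"
  shows "hausdorff1 (nodal U) \<le> ennreal ((1 + \<epsilon>) / (1 - \<epsilon>) * (2 * pi * real n))"
proof -
  have hU: "hompoly n U" using U by (simp add: harmonic_poly_def)
  define Z R where "Z = singular_set U" and "R = nodal U - singular_set U"
  have finZ: "finite Z" unfolding Z_def by (rule finite_singular_set[OF U nz])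
  have "\<forall>p\<in>R. \<exists>\<eta> \<gamma> W. nodal_arc U \<epsilon> \<eta> \<gamma> \<and> open W \<and> p \<in> W \<and> nodal U \<inter> W \<subseteq> \<gamma> ` {-\<eta><..<\<eta>}"
  proof
    fix p assume "p \<in> R"
    then have "p \<in> nodal U" "gradient U p \<noteq> 0" by (auto simp: R_def nodal_def singular_set_def)
    then show "\<exists>\<eta> \<gamma> W. nodal_arc U \<epsilon> \<eta> \<gamma> \<and> open W \<and> p \<in> W \<and> nodal U \<inter> W \<subseteq> \<gamma> ` {-\<eta><..<\<eta>}"
      using \<epsilon> by (intro local_nodal_arc[OF hU]) auto
  qed
  then obtain \<eta> \<gamma> W where loc: "\<And>p. p \<in> R \<Longrightarrow> nodal_arc U \<epsilon> (\<eta> p) (\<gamma> p)"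
    "\<And>p. p \<in> R \<Longrightarrow> open (W p)" "\<And>p. p \<in> R \<Longrightarrow> p \<in> W p"
    "\<And>p. p \<in> R \<Longrightarrow> nodal U \<inter> W p \<subseteq> \<gamma> p ` {-\<eta> p<..<\<eta> p}" by metis
  obtain F' where F': "F' \<subseteq> W ` R" "countable F'" "\<Union>F' = \<Union>(W ` R)"
    using Lindelof[of "W ` R"] loc(2) by (metis (no_types, lifting) imageE)
  obtain P where P: "countable P" "P \<subseteq> R" "F' = W ` P"
    using countable_subset_image[of F' W R] F' by auto
  define idx where "idx = to_nat_on P"
  have idx: "inj_on idx P" unfolding idx_def using P(1) by (rule inj_on_to_nat_on)
  have \<gamma>N: "\<gamma> p s \<in> nodal U" if "p \<in> P" "s \<in> {-\<eta> p..\<eta> p}" for p s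
    using loc(1)[of p] that P(2) by (auto simp: nodal_arc_def)
  have \<gamma>d: "\<bar>s - t\<bar> \<le> norm (\<gamma> p s - \<gamma> p t)" "norm (\<gamma> p s - \<gamma> p t) \<le> (1 + \<epsilon>) * \<bar>s - t\<bar>" "norm (\<gamma> p s - \<gamma> p t) \<le> sqrt \<epsilon>"
    if "p \<in> P" "s \<in> {-\<eta> p..\<eta> p}" "t \<in> {-\<eta> p..\<eta> p}" for p s t
    using loc(1)[of p] that P(2) unfolding nodal_arc_def by blast+
  have \<gamma>c: "continuous_on {-\<eta> p..\<eta> p} (\<gamma> p)" if "p \<in> P" for p
  proof (rule continuous_on_iff[THEN iffD2], intro ballI allI impI)
    fix s and e :: real assume s: "s \<in> {-\<eta> p..\<eta> p}" and e: "0 < e"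
    show "\<exists>d>0. \<forall>t\<in>{-\<eta> p..\<eta> p}. dist t s < d \<longrightarrow> dist (\<gamma> p t) (\<gamma> p s) < e"
    proof (intro exI[of _ "e / (1 + \<epsilon>)"] conjI ballI impI)
      show "0 < e / (1 + \<epsilon>)" using e \<epsilon> by simp
      fix t assume t: "t \<in> {-\<eta> p..\<eta> p}" "dist t s < e / (1 + \<epsilon>)"
      then have "(1 + \<epsilon>) * \<bar>t - s\<bar> < e" using \<epsilon> by (simp add: dist_real_def less_divide_eq mult.commute)
      then show "dist (\<gamma> p t) (\<gamma> p s) < e" using \<gamma>d(2)[OF that t(1) s] by (simp add: dist_norm)
    qed
  qed
  define \<Gamma> where "\<Gamma> = (\<lambda>p. \<gamma> p ` {-\<eta> p..\<eta> p})"
  have \<Gamma>: "compact (\<Gamma> p)" if "p \<in> P" for p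
    unfolding \<Gamma>_def using \<gamma>c[OF that] by (intro compact_continuous_image) auto
  define prev where "prev = (\<lambda>p. {q \<in> P. idx q < idx p})"
  have finprev: "finite (prev p)" for p
  proof -
    have "inj_on idx (prev p)" using idx by (rule inj_on_subset) (auto simp: prev_def)
    moreover have "idx ` prev p \<subseteq> {..<idx p}" by (auto simp: prev_def)
    ultimately show ?thesis by (meson finite_lessThan inj_on_finite)
  qed
  \<comment> \<open>Only finitely many arcs are earlier, and each is taken with its end points,
    hence compact: what is left is open, and its components are intervals.\<close>
  define V where "V = (\<lambda>p. {-\<eta> p<..<\<eta> p} \<inter> \<gamma> p -` (- (\<Union>q\<in>prev p. \<Gamma> q)))"
  have V: "open (V p)" "V p \<subseteq> {-\<eta> p<..<\<eta> p}" if "p \<in> P" for p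
  proof -
    have c1: "closed (\<Union>q\<in>prev p. \<Gamma> q)"
      using finprev by (intro closed_UN) (auto simp: prev_def intro: compact_imp_closed \<Gamma>)
    have c2: "continuous_on {-\<eta> p<..<\<eta> p} (\<gamma> p)" using \<gamma>c[OF that] by (rule continuous_on_subset) auto
    show "open (V p)" unfolding V_def
      by (rule continuous_open_preimage[OF c2 open_greaterThanLessThan open_Compl[OF c1]])
  qed (auto simp: V_def)
  define I where "I = (SIGMA p:P. components (V p))"
  have cI: "countable I" unfolding I_def
  proof (rule countable_SIGMA[OF P(1)])
    fix p assume p: "p \<in> P"
    show "countable (components (V p))"
    proof (rule countable_disjoint_open_subsets)
      show "open S" if "S \<in> components (V p)" for S using open_components[OF V(1)[OF p] that] .
      show "pairwise disjnt (components (V p))" unfolding disjnt_def by (rule pairwise_disjoint_components)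
    qed
  qed
  have "\<forall>i\<in>I. \<exists>l r. l < r \<and> -\<eta> (fst i) \<le> l \<and> r \<le> \<eta> (fst i) \<and> {l<..<r} \<subseteq> snd i \<and> snd i \<subseteq> {l..r}"
    using open_component_interval[OF V] by (auto simp: I_def)
  then obtain l r where lr: "\<And>i. i \<in> I \<Longrightarrow> l i < r i" "\<And>i. i \<in> I \<Longrightarrow> -\<eta> (fst i) \<le> l i"
    "\<And>i. i \<in> I \<Longrightarrow> r i \<le> \<eta> (fst i)" "\<And>i. i \<in> I \<Longrightarrow> {l i<..<r i} \<subseteq> snd i" "\<And>i. i \<in> I \<Longrightarrow> snd i \<subseteq> {l i..r i}"
    by metis
  have IP: "fst i \<in> P" "snd i \<in> components (V (fst i))" if "i \<in> I" for i using that by (auto simp: I_def)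
  have lrI: "s \<in> {-\<eta> (fst i)..\<eta> (fst i)}" if "i \<in> I" "s \<in> {l i..r i}" for i s
    using lr(2,3)[OF that(1)] that(2) by auto
  define arc where "arc = (\<lambda>i. \<gamma> (fst i) ` snd i)"
  have arcV: "snd i \<subseteq> V (fst i)" if "i \<in> I" for i using IP[OF that] in_components_subset by blast
  have arcN: "arc i \<subseteq> nodal U" if "i \<in> I" for i
    using arcV[OF that] V(2)[OF IP(1)[OF that]] \<gamma>N[OF IP(1)[OF that]] by (force simp: arc_def)
  have arc_lt: "arc i \<inter> arc j = {}" if "i \<in> I" "j \<in> I" "idx (fst i) < idx (fst j)" for i j
  proof -
    have "fst i \<in> prev (fst j)" using that IP by (auto simp: prev_def)
    moreover have "arc i \<subseteq> \<Gamma> (fst i)"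
      using arcV[OF that(1)] V(2)[OF IP(1)[OF that(1)]] by (force simp: arc_def \<Gamma>_def)
    moreover have "arc j \<inter> (\<Union>q\<in>prev (fst j). \<Gamma> q) = {}"
      using arcV[OF that(2)] by (auto simp: arc_def V_def)
    ultimately show ?thesis by blast
  qed
  have disj: "arc i \<inter> arc j = {}" if ij: "i \<in> I" "j \<in> I" "i \<noteq> j" for i j
  proof (cases "fst i = fst j")
    case True
    then have ne: "snd i \<noteq> snd j" using ij(3) by (simp add: prod_eq_iff)
    have dd: "snd i \<inter> snd j = {}"
      using components_nonoverlap[OF IP(2)[OF ij(1)], of "snd j"] IP(2)[OF ij(2)] True ne by simp
    show ?thesis
    proof (rule ccontr)
      assume "arc i \<inter> arc j \<noteq> {}"
      then obtain s t where st: "s \<in> snd i" "t \<in> snd j" "\<gamma> (fst i) s = \<gamma> (fst i) t" using True by (auto simp: arc_def)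
      have "\<bar>s - t\<bar> \<le> norm (\<gamma> (fst i) s - \<gamma> (fst i) t)"
      proof (rule \<gamma>d(1)[OF IP(1)[OF ij(1)]])
        show "s \<in> {-\<eta> (fst i)..\<eta> (fst i)}" using lrI[OF ij(1)] lr(5)[OF ij(1)] st by blast
        show "t \<in> {-\<eta> (fst i)..\<eta> (fst i)}" using lrI[OF ij(2)] lr(5)[OF ij(2)] st True by auto
      qed
      then have "s = t" using st by simp
      then show False using dd st by blast
    qed
  next
    case False
    then have "idx (fst i) \<noteq> idx (fst j)" using inj_onD[OF idx] IP(1) ij by blast
    then show ?thesis using arc_lt ij by (metis Int_commute linorder_neqE_nat)
  qed
  \<comment> \<open>Components lie in the open parameter intervals; the end points of the charts are
    covered separately by a countable set, which has measure zero.\<close>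
  define D where "D = (\<Union>p\<in>P. {\<gamma> p (\<eta> p), \<gamma> p (-\<eta> p)})"
  have cD: "countable D" unfolding D_def using P(1) by (intro countable_UN) auto
  have cover: "nodal U \<subseteq> (Z \<union> D) \<union> (\<Union>i\<in>I. arc i)"
  proof
    fix x assume x: "x \<in> nodal U"
    show "x \<in> (Z \<union> D) \<union> (\<Union>i\<in>I. arc i)"
    proof (cases "x \<in> Z")
      case False
      then have xR: "x \<in> R" using x by (simp add: R_def Z_def)
      then have "x \<in> \<Union>F'" using F'(3) loc(3)[OF xR] xR by blast
      then obtain p0 where p0: "p0 \<in> P" "x \<in> W p0" using P(3) by auto
      have "p0 \<in> P \<and> x \<in> \<Gamma> p0"
        using loc(4)[of p0] p0 P(2) x by (force simp: \<Gamma>_def)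
      \<comment> \<open>The chart of least index containing x: no earlier arc contains x, so its
        parameter has not been removed.\<close>
      then obtain p where p: "p \<in> P" "x \<in> \<Gamma> p" "\<And>q. q \<in> P \<and> x \<in> \<Gamma> q \<Longrightarrow> idx p \<le> idx q"
        using ex_has_least_nat[of "\<lambda>p. p \<in> P \<and> x \<in> \<Gamma> p" p0 idx] by blast
      obtain s where s: "s \<in> {-\<eta> p..\<eta> p}" "x = \<gamma> p s" using p(2) by (auto simp: \<Gamma>_def)
      show ?thesis
      proof (cases "s = \<eta> p \<or> s = -\<eta> p")
        case True
        then show ?thesis using p(1) s(2) by (auto simp: D_def)
      next
        case False
        then have "s \<in> V p" using s p(3) by (force simp: V_def prev_def)
        then have "connected_component_set (V p) s \<in> components (V p)" "s \<in> connected_component_set (V p) s"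
          by (auto simp: components_def)
        then have "(p, connected_component_set (V p) s) \<in> I" "x \<in> arc (p, connected_component_set (V p) s)"
          using p(1) s(2) by (auto simp: I_def arc_def)
        then show ?thesis by blast
      qed
    qed simp
  qed
  define sep where "sep = (\<lambda>i. separating (\<gamma> (fst i) (l i)) (\<gamma> (fst i) (r i)))"
  have [measurable]: "sep i \<in> sets borel" for i by (simp add: sep_def)
  have sep_hit: "\<exists>x\<in>arc i. a \<bullet> x = 0" if i: "i \<in> I" and a: "a \<in> sep i" for i a
  proof -
    define h where "h = (\<lambda>s. (a \<bullet> \<gamma> (fst i) (l i)) * (a \<bullet> \<gamma> (fst i) s))"
    have neg: "(a \<bullet> \<gamma> (fst i) (l i)) * (a \<bullet> \<gamma> (fst i) (r i)) < 0" using a by (simp add: sep_def separating_def)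
    then have "h (l i) > 0" "h (r i) < 0" by (auto simp: h_def zero_less_mult_iff mult_less_0_iff)
    moreover have "continuous_on {l i..r i} h" unfolding h_def
      using continuous_on_subset[OF \<gamma>c[OF IP(1)[OF i]], of "{l i..r i}"] lrI[OF i] by (intro continuous_intros) auto
    ultimately obtain s where s: "l i \<le> s" "s \<le> r i" "h s = 0"
      using IVT2'[of h "r i" 0 "l i"] lr(1)[OF i] by auto
    \<comment> \<open>The zero is strictly inside: the open interval belongs to the component,
      whereas its end points need not.\<close>
    then have "s \<noteq> l i" "s \<noteq> r i" using \<open>h (l i) > 0\<close> \<open>h (r i) < 0\<close> by auto
    then have "s \<in> snd i" using lr(4)[OF i] s by auto
    moreover have "a \<bullet> \<gamma> (fst i) s = 0" using s(3) neg by (auto simp: h_def)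
    ultimately show ?thesis by (auto simp: arc_def)
  qed
  have sep_vol: "ennreal (4 / 3 * (1 - \<epsilon>) * (r i - l i)) \<le> emeasure lborel (sep i)" if i: "i \<in> I" for i
  proof -
    define p q where "p = \<gamma> (fst i) (l i)" and "q = \<gamma> (fst i) (r i)"
    have m: "l i \<in> {-\<eta> (fst i)..\<eta> (fst i)}" "r i \<in> {-\<eta> (fst i)..\<eta> (fst i)}" using lrI[OF i] lr(1)[OF i] by auto
    have pq: "norm p = 1" "norm q = 1" using \<gamma>N[OF IP(1)[OF i]] m by (auto simp: nodal_def p_def q_def)
    have d: "r i - l i \<le> norm (p - q)" "norm (p - q) \<le> sqrt \<epsilon>"
      using \<gamma>d(1,3)[OF IP(1)[OF i] m] lr(1)[OF i] by (auto simp: p_def q_def)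
    have "(norm (p - q))\<^sup>2 \<le> (sqrt \<epsilon>)\<^sup>2" using d(2) by (intro power_mono) auto
    then have d2: "(norm (p - q))\<^sup>2 \<le> \<epsilon>" using \<epsilon> by simp
    have "sqrt \<epsilon> < 2" using \<epsilon> by (intro real_less_lsqrt) auto
    then have lt: "p \<noteq> q" "norm (p - q) < 2" using d lr(1)[OF i] by auto
    have "4 / 3 * (1 - \<epsilon>) * (r i - l i) \<le> 4 / 3 * norm (p - q) * (1 - (norm (p - q))\<^sup>2 / 4)"
    proof -
      have "(1 - \<epsilon>) * (r i - l i) \<le> (1 - (norm (p - q))\<^sup>2 / 4) * norm (p - q)"
        using d d2 \<epsilon> lr(1)[OF i] by (intro mult_mono) auto
      then have "4 / 3 * ((1 - \<epsilon>) * (r i - l i)) \<le> 4 / 3 * ((1 - (norm (p - q))\<^sup>2 / 4) * norm (p - q))" by simp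
      then show ?thesis by (simp only: mult_ac)
    qed
    then have "ennreal (4 / 3 * (1 - \<epsilon>) * (r i - l i)) \<le> ennreal (4 / 3 * norm (p - q) * (1 - (norm (p - q))\<^sup>2 / 4))"
      by (rule ennreal_leI)
    also have "\<dots> \<le> emeasure lborel (sep i)"
      unfolding sep_def p_def[symmetric] q_def[symmetric] by (rule emeasure_separating_ge[OF pq lt])
    finally show ?thesis .
  qed
  have length: "(\<Sum>i\<in>F. r i - l i) \<le> 2 * real n * pi / (1 - \<epsilon>)" if F: "finite F" "F \<subseteq> I" for F
  proof -
    have "(\<Sum>i\<in>F. ennreal (4 / 3 * (1 - \<epsilon>) * (r i - l i))) \<le> (\<Sum>i\<in>F. emeasure lborel (sep i))"
      using F by (intro sum_mono sep_vol) auto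
    also have "\<dots> = (\<integral>\<^sup>+a. (\<Sum>i\<in>F. indicator (sep i) a) \<partial>lborel)"
      by (subst nn_integral_sum) auto
    also have "\<dots> \<le> (\<integral>\<^sup>+a. ennreal (2 * real n) * indicator (ball 0 1) a \<partial>(lborel :: (real ^ 3) measure))"
    proof (rule nn_integral_mono_AE)
      show "AE a in lborel. (\<Sum>i\<in>F. indicator (sep i) a) \<le> ennreal (2 * real n) * indicator (ball 0 1) a"
        using AE_great_circle_card[OF hU nz n]
      proof eventually_elim
        case (elim a)
        show ?case
        proof (cases "a \<in> ball 0 1")
          case False
          then have "a \<notin> sep i" for i by (simp add: sep_def separating_def)
          then show ?thesis by simp
        next
          case True
          define S where "S = {i \<in> F. a \<in> sep i}"
          have "\<forall>i\<in>S. \<exists>x. x \<in> arc i \<and> a \<bullet> x = 0" using sep_hit F(2) unfolding S_def by blast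
          then obtain x where x: "\<And>i. i \<in> S \<Longrightarrow> x i \<in> arc i \<and> a \<bullet> x i = 0" by metis
          have "inj_on x S"
          proof (rule inj_onI, rule ccontr)
            fix i j assume ij: "i \<in> S" "j \<in> S" "x i = x j" "i \<noteq> j"
            have "x i \<in> arc i \<inter> arc j" using x[OF ij(1)] x[OF ij(2)] ij(3) by simp
            then show False using disj[of i j] ij F(2) by (auto simp: S_def)
          qed
          moreover have "x ` S \<subseteq> {x \<in> nodal U. a \<bullet> x = 0}"
            using x arcN F(2) by (fastforce simp: S_def)
          ultimately have "card S \<le> card {x \<in> nodal U. a \<bullet> x = 0}" using elim by (intro card_inj_on_le) auto
          then have "card S \<le> 2 * n" using elim by linarith
          moreover have "(\<Sum>i\<in>F. indicator (sep i) a :: ennreal) = of_nat (card S)"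
          proof -
            have "(\<Sum>i\<in>F. indicator (sep i) a :: ennreal) = (\<Sum>i\<in>S. 1)"
              using F(1) by (intro sum.mono_neutral_cong_right) (auto simp: S_def)
            then show ?thesis by simp
          qed
          ultimately show ?thesis using True by (simp add: ennreal_of_nat_eq_real_of_nat ennreal_leI)
        qed
      qed
    qed
    also have "\<dots> = ennreal (2 * real n) * emeasure lborel (ball (0 :: real ^ 3) 1)"
      by (rule nn_integral_cmult_indicator) simp
    also have "\<dots> = ennreal (2 * real n * (4 / 3 * pi))"
      unfolding emeasure_unit_ball_3 by (rule ennreal_mult[symmetric]) auto
    also have "(\<Sum>i\<in>F. ennreal (4 / 3 * (1 - \<epsilon>) * (r i - l i))) = ennreal (\<Sum>i\<in>F. 4 / 3 * (1 - \<epsilon>) * (r i - l i))"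
    proof (rule sum_ennreal)
      fix i assume "i \<in> F"
      then have "l i < r i" using F(2) lr(1) by blast
      then show "0 \<le> 4 / 3 * (1 - \<epsilon>) * (r i - l i)" using \<epsilon> by simp
    qed
    finally have "(\<Sum>i\<in>F. 4 / 3 * (1 - \<epsilon>) * (r i - l i)) \<le> 2 * real n * (4 / 3 * pi)"
      by (subst (asm) ennreal_le_iff) auto
    then have "(4 / 3 * (1 - \<epsilon>)) * (\<Sum>i\<in>F. r i - l i) \<le> 2 * real n * (4 / 3 * pi)"
      by (simp only: sum_distrib_left)
    then have "4 / 3 * ((1 - \<epsilon>) * (\<Sum>i\<in>F. r i - l i)) \<le> 4 / 3 * (2 * real n * pi)" by (simp only: mult_ac)
    then have "(1 - \<epsilon>) * (\<Sum>i\<in>F. r i - l i) \<le> 2 * real n * pi" by (rule mult_left_le_imp_le) simp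
    then show ?thesis using \<epsilon> by (simp add: le_divide_eq mult.commute)
  qed
  have "hausdorff1 (\<Union>i\<in>I. arc i) \<le> ennreal ((1 + \<epsilon>) / (1 - \<epsilon>) * (2 * pi * real n))"
  proof (rule hausdorff1_countable_UN_le[OF cI])
    fix i assume i: "i \<in> I"
    have "hausdorff1 (arc i) \<le> hausdorff1 (\<gamma> (fst i) ` {l i..r i})"
      unfolding arc_def by (intro hausdorff1_mono image_mono lr(5)[OF i])
    also have "\<dots> \<le> ennreal ((1 + \<epsilon>) * (r i - l i))"
    proof (rule hausdorff1_lipschitz_arc)
      show "dist (\<gamma> (fst i) s) (\<gamma> (fst i) t) \<le> (1 + \<epsilon>) * \<bar>s - t\<bar>" if "s \<in> {l i..r i}" "t \<in> {l i..r i}" for s t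
        using \<gamma>d(2)[OF IP(1)[OF i] lrI[OF i that(1)] lrI[OF i that(2)]] by (simp add: dist_norm)
    qed (use lr(1)[OF i] \<epsilon> in auto)
    finally show "hausdorff1 (arc i) \<le> ennreal ((1 + \<epsilon>) * (r i - l i))" .
  next
    fix F assume F: "finite F" "F \<subseteq> I"
    have "(\<Sum>i\<in>F. ennreal ((1 + \<epsilon>) * (r i - l i))) = ennreal (\<Sum>i\<in>F. (1 + \<epsilon>) * (r i - l i))"
    proof (rule sum_ennreal)
      fix i assume "i \<in> F"
      then have "l i < r i" using F(2) lr(1) by blast
      then show "0 \<le> (1 + \<epsilon>) * (r i - l i)" using \<epsilon> by simp
    qed
    also have "\<dots> = ennreal ((1 + \<epsilon>) * (\<Sum>i\<in>F. r i - l i))" by (simp only: sum_distrib_left)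
    also have "\<dots> \<le> ennreal ((1 + \<epsilon>) * (2 * real n * pi / (1 - \<epsilon>)))"
      using length[OF F] \<epsilon> by (intro ennreal_leI mult_left_mono) auto
    also have "(1 + \<epsilon>) * (2 * real n * pi / (1 - \<epsilon>)) = (1 + \<epsilon>) / (1 - \<epsilon>) * (2 * pi * real n)" by (simp add: mult_ac)
    finally show "(\<Sum>i\<in>F. ennreal ((1 + \<epsilon>) * (r i - l i))) \<le> ennreal ((1 + \<epsilon>) / (1 - \<epsilon>) * (2 * pi * real n))" .
  qed
  moreover have "hausdorff1 (nodal U) \<le> hausdorff1 ((Z \<union> D) \<union> (\<Union>i\<in>I. arc i))"
    using cover by (rule hausdorff1_mono)
  moreover have "hausdorff1 ((Z \<union> D) \<union> (\<Union>i\<in>I. arc i)) \<le> hausdorff1 (\<Union>i\<in>I. arc i)"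
    using finZ cD by (intro hausdorff1_Un_countable) (auto simp: countable_finite)
  ultimately show ?thesis by (meson order_trans)
qed

lemma hausdorff1_nodal_le:
  assumes U: "harmonic_poly n U" and nz: "U x0 \<noteq> 0" and n: "n \<ge> 1"
  shows "hausdorff1 (nodal U) \<le> ennreal (2 * pi * real n)"
proof (rule tendsto_lowerbound)
  have "((\<lambda>\<epsilon>. (1 + \<epsilon>) / (1 - \<epsilon>) * (2 * pi * real n)) \<longlongrightarrow> (1 + 0) / (1 - 0) * (2 * pi * real n)) (at_right 0)"
    by (intro tendsto_intros) auto
  then show "((\<lambda>\<epsilon>. ennreal ((1 + \<epsilon>) / (1 - \<epsilon>) * (2 * pi * real n))) \<longlongrightarrow> ennreal (2 * pi * real n)) (at_right 0)"
    by (intro tendsto_ennrealI) simp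
  show "\<forall>\<^sub>F \<epsilon> in at_right 0. hausdorff1 (nodal U) \<le> ennreal ((1 + \<epsilon>) / (1 - \<epsilon>) * (2 * pi * real n))"
    unfolding eventually_at_right_field
    by (intro exI[of _ 1] conjI allI impI hausdorff1_nodal_le_aux[OF U nz n]) simp_all
qed simp

section \<open>Inner radius\<close>

lemma sphere_inner_bounds:
  assumes "norm x = 1" "norm y = 1"
  shows "-1 \<le> x \<bullet> y" "x \<bullet> y \<le> 1"
  using Cauchy_Schwarz_ineq2[of x y] assms by auto

lemma sphere_dist_bounds:
  assumes "norm x = 1" "norm y = 1"
  shows "0 \<le> sphere_dist x y" "sphere_dist x y \<le> pi"
  using arccos_bounded[OF sphere_inner_bounds[OF assms]] by (simp_all add: sphere_dist_def)

lemma inner_radius_le: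
  assumes N: "N \<subseteq> sphere 0 1" and near: "\<And>x. norm x = 1 \<Longrightarrow> \<exists>y\<in>N. sphere_dist x y \<le> b"
  shows "inner_radius N \<le> b"
  unfolding inner_radius_def
proof (rule cSUP_least)
  show "sphere 0 1 \<noteq> ({} :: (real ^ 3) set)" using norm_axis_1[of 1] by (metis empty_iff mem_sphere_0)
  fix x :: "real ^ 3" assume "x \<in> sphere 0 1"
  then have x: "norm x = 1" by simp
  then obtain y where y: "y \<in> N" "sphere_dist x y \<le> b" using near by blast
  have "bdd_below (sphere_dist x ` N)"
    using sphere_dist_bounds(1)[OF x] N by (intro bdd_belowI2[of _ 0]) auto
  then show "(INF y\<in>N. sphere_dist x y) \<le> b" using y by (rule cINF_lower2)
qed

lemma inner_radius_ge:
  assumes N: "N \<subseteq> sphere 0 1" "N \<noteq> {}" and x: "norm x = 1" and far: "\<And>y. y \<in> N \<Longrightarrow> b \<le> sphere_dist x y"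
  shows "b \<le> inner_radius N"
  unfolding inner_radius_def
proof (rule cSUP_upper2)
  show "b \<le> (INF y\<in>N. sphere_dist x y)" using N(2) far by (rule cINF_greatest)
  show "x \<in> sphere 0 1" using x by simp
  obtain y0 where y0: "y0 \<in> N" using N(2) by blast
  show "bdd_above ((\<lambda>x. INF y\<in>N. sphere_dist x y) ` sphere 0 1)"
  proof (rule bdd_aboveI2)
    fix z :: "real ^ 3" assume "z \<in> sphere 0 1"
    then have z: "norm z = 1" by simp
    have "bdd_below (sphere_dist z ` N)"
      using sphere_dist_bounds(1)[OF z] N by (intro bdd_belowI2[of _ 0]) auto
    moreover have "sphere_dist z y0 \<le> pi" using sphere_dist_bounds(2)[OF z] y0 N by auto
    ultimately show "(INF y\<in>N. sphere_dist z y) \<le> pi" using y0 by (intro cINF_lower2)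
  qed
qed

lemma nodal_sphere: "nodal U \<subseteq> sphere 0 1"
  by (auto simp: nodal_def)

text \<open>U divided by U x, restricted to the great circle through x and y, is a form with value 1
  at x and modulus at most 1, so it has no zero within pi / (2 n) of x. A nodal point closer than
  that has positive cos \<tau> and differs from x, so x and y are independent and span a great
  circle.\<close>

lemma nodal_distance_from_maximum:
  assumes U: "hompoly n U" and n: "n \<ge> 1" and x: "norm x = 1" "U x \<noteq> 0"
    and max: "\<And>y. norm y = 1 \<Longrightarrow> \<bar>U y\<bar> \<le> \<bar>U x\<bar>" and y: "y \<in> nodal U"
  shows "pi / (2 * real n) \<le> sphere_dist x y"
proof (rule ccontr)
  assume less: "\<not> ?thesis"
  define \<tau> where "\<tau> = sphere_dist x y"
  have y1: "norm y = 1" "U y = 0" using y by (auto simp: nodal_def)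
  have \<tau>: "\<tau> < pi / (2 * real n)" "0 \<le> \<tau>" using less sphere_dist_bounds[OF x(1) y1(1)] by (auto simp: \<tau>_def)
  have c: "cos \<tau> = x \<bullet> y" using sphere_inner_bounds[OF x(1) y1(1)] by (simp add: \<tau>_def sphere_dist_def)
  have "pi / (2 * real n) \<le> pi / 2" using n by (intro divide_left_mono) auto
  then have "cos \<tau> > 0" using \<tau> by (intro cos_gt_zero_pi) auto
  have ne: "cross3 x y \<noteq> 0"
  proof
    assume "cross3 x y = 0"
    then have "(x \<bullet> y)\<^sup>2 = 1" using norm_cross_dot[of x y] x(1) y1(1) by simp
    then have "x \<bullet> y = 1" using \<open>cos \<tau> > 0\<close> c by (auto simp: power2_eq_1_iff)
    then have "(x - y) \<bullet> y = 0" using y1(1) by (simp add: inner_diff_left dot_square_norm)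
    then have "norm (x - y) = 0" using sphere_diff_inner[OF x(1) y1(1)] by simp
    then show False using x(2) y1(2) by simp
  qed
  define a where "a = cross3 x y /\<^sub>R norm (cross3 x y)"
  have a: "norm a = 1" "a \<bullet> x = 0" "a \<bullet> y = 0" using ne by (auto simp: a_def dot_cross_self)
  obtain E where E: "frame E" "E 3 = a" "E 1 = x" using frame_exists2[OF a(1) x(1) a(2)] by blast
  have "y \<bullet> E 1 = cos \<tau>" "y \<bullet> E 3 = 0" using c a(3) E by (simp_all add: inner_commute)
  then have ye: "y = frame_point E (cos \<tau>) (y \<bullet> E 2) 0" using frame_expand[OF E(1), of y] by simp
  then have "(norm y)\<^sup>2 = (cos \<tau>)\<^sup>2 + (y \<bullet> E 2)\<^sup>2" using frame_norm[OF E(1), of "cos \<tau>" "y \<bullet> E 2" 0] by simp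
  then have "(y \<bullet> E 2)\<^sup>2 = (sin \<tau>)\<^sup>2" using y1(1) sin_cos_squared_add[of \<tau>] by (simp del: sin_cos_squared_add)
  then have "y \<bullet> E 2 = sin \<tau> \<or> y \<bullet> E 2 = sin (- \<tau>)" by (simp add: power2_eq_iff)
  then obtain \<tau>' where \<tau>': "\<bar>\<tau>'\<bar> = \<tau>" "y \<bullet> E 2 = sin \<tau>'" using \<tau>(2) by (metis abs_minus_cancel abs_of_nonneg)
  have cos\<tau>': "cos \<tau>' = cos \<tau>" using \<tau>'(1) by (metis cos_abs_real)
  obtain D where D: "\<And>\<phi>. U (frame_point E (cos \<phi>) (sin \<phi>) 0) = trig_form n D \<phi>"
    using great_circle_form[OF U] by blast
  define D' where "D' = (\<lambda>i. D i / U x)"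
  have D': "trig_form n D' \<phi> = U (frame_point E (cos \<phi>) (sin \<phi>) 0) / U x" for \<phi>
    unfolding D unfolding trig_form_def D'_def by (simp add: sum_divide_distrib)
  have "trig_form n D' \<tau>' > 0"
  proof (rule trig_form_pos[OF n])
    show "trig_form n D' 0 = 1" unfolding D' using x(2) E(3) by (simp add: frame_point_def)
    show "\<bar>trig_form n D' t\<bar> \<le> 1" for t
    proof -
      have "(norm (frame_point E (cos t) (sin t) 0))\<^sup>2 = 1\<^sup>2" unfolding frame_norm[OF E(1)] by simp
      then have "norm (frame_point E (cos t) (sin t) 0) = 1" by (rule power2_eq_imp_eq) simp_all
      then show ?thesis unfolding D' using max x(2) by (simp add: abs_divide divide_le_eq)
    qed
    show "\<bar>\<tau>'\<bar> < pi / (2 * real n)" using \<tau>'(1) \<tau>(1) by simp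
  qed
  then show False unfolding D' using ye \<tau>'(2) cos\<tau>' y1(2) by simp
qed

lemma inner_radius_nodal_bounds:
  assumes U: "harmonic_poly n U" and nz: "U x0 \<noteq> 0" and n: "n \<ge> 1"
  shows "arcsin (1 / real n) \<le> inner_radius (nodal U)" "inner_radius (nodal U) \<le> theta n"
proof -
  have hU: "hompoly n U" using U by (simp add: harmonic_poly_def)
  note \<theta> = theta_properties[OF n]
  have s: "sin (theta n) > 0" using \<theta>(1,3) by (rule sin_gt_zero)
  have near: "\<exists>y\<in>nodal U. sphere_dist x y = theta n" if x: "norm x = 1" for x
  proof -
    obtain y where "norm y = 1" "U y = 0" "x \<bullet> y = cos (theta n)"
      using circle_two_zeros[OF U x s _ \<theta>(4)] by auto
    then show ?thesis using \<theta>(1,3) by (intro bexI[of _ y]) (auto simp: nodal_def sphere_dist_def arccos_cos)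
  qed
  then show "inner_radius (nodal U) \<le> theta n"
    by (intro inner_radius_le nodal_sphere) (metis order_refl)
  have x0: "x0 \<noteq> 0" using hompoly_homogeneous[OF hU, of 0 x0] nz n by (auto simp: power_0_left)
  define y1 where "y1 = x0 /\<^sub>R norm x0"
  have y1: "norm y1 = 1" "U y1 \<noteq> 0"
    using x0 nz hompoly_homogeneous[OF hU, of "inverse (norm x0)" x0] by (auto simp: y1_def)
  have "continuous_on (sphere 0 1) (\<lambda>x. \<bar>U x\<bar>)" by (intro continuous_intros continuous_on_hompoly[OF hU])
  moreover have "sphere 0 1 \<noteq> ({} :: (real ^ 3) set)" using y1(1) by auto
  ultimately obtain x where x: "x \<in> sphere 0 1" "\<forall>y\<in>sphere 0 1. \<bar>U y\<bar> \<le> \<bar>U x\<bar>"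
    using continuous_attains_sup[of "sphere 0 1" "\<lambda>x. \<bar>U x\<bar>"] by auto
  have "U x \<noteq> 0" using x(2) y1 by force
  have "nodal U \<noteq> {}" using near[OF y1(1)] by auto
  have "arcsin (1 / real n) \<le> pi / (2 * real n)" by (rule arcsin_inverse_le[OF n])
  also have "\<dots> \<le> inner_radius (nodal U)"
    using x \<open>U x \<noteq> 0\<close> \<open>nodal U \<noteq> {}\<close>
    by (intro inner_radius_ge[OF nodal_sphere, of _ x] nodal_distance_from_maximum[OF hU n]) auto
  finally show "arcsin (1 / real n) \<le> inner_radius (nodal U)" .
qed

section \<open>Nodal length\<close>

text \<open>Circles of radius \<open>theta n\<close> with two hits give 2 pi / sin (theta n). The
  strictness is that of the Sturm comparison, after sin (theta n) \<le> theta n.\<close>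

lemma hausdorff1_nodal_gt:
  assumes U: "harmonic_poly n U" and nz: "U x0 \<noteq> 0" and n: "n \<ge> 1"
  shows "ennreal (2 * pi / j0 * (real n + 1 / 2)) < hausdorff1 (nodal U)"
proof -
  note \<theta> = theta_properties[OF n]
  have s: "sin (theta n) > 0" using \<theta>(1,3) by (rule sin_gt_zero)
  define c where "c = cos (theta n)"
  have cs: "1 - c\<^sup>2 = (sin (theta n))\<^sup>2" by (simp add: c_def sin_squared_eq)
  have "c\<^sup>2 < 1"
  proof -
    have "(sin (theta n))\<^sup>2 > 0" using s by simp
    then show ?thesis using cs by linarith
  qed
  then have c1: "\<bar>c\<bar> < 1" by (simp add: abs_square_less_1)
  have "ennreal (real 2 * pi / sqrt (1 - c\<^sup>2)) \<le> hausdorff1 (nodal U)"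
  proof (rule hausdorff1_nodal_ge[OF U nz c1])
    have "AE a in lborel. a \<notin> {0 :: real ^ 3}" by (intro AE_not_in) (simp add: null_sets_def)
    then show "AE a in lborel. a \<in> ball 0 1 \<longrightarrow>
      (\<exists>X. finite X \<and> card X = 2 \<and> (\<forall>x\<in>X. norm x = 1 \<and> U x = 0 \<and> a \<bullet> x = c * norm a))"
    proof eventually_elim
      case (elim a)
      then have a: "a \<noteq> 0" "norm (a /\<^sub>R norm a) = 1" by auto
      have "c\<^sup>2 + (sin (theta n))\<^sup>2 = 1" using cs by simp
      then obtain x y where xy: "x \<noteq> y" "norm x = 1" "norm y = 1" "U x = 0" "U y = 0"
        "(a /\<^sub>R norm a) \<bullet> x = c" "(a /\<^sub>R norm a) \<bullet> y = c"
        using circle_two_zeros[OF U a(2) s] \<theta>(4) unfolding c_def by blast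
      then have "a \<bullet> x = c * norm a" "a \<bullet> y = c * norm a" using a(1) by (auto simp: divide_inverse[symmetric] field_simps)
      then show ?case using xy by (intro impI exI[of _ "{x, y}"]) auto
    qed
  qed
  also have "sqrt (1 - c\<^sup>2) = sin (theta n)" unfolding cs using s by simp
  finally have ge: "ennreal (2 * pi / sin (theta n)) \<le> hausdorff1 (nodal U)" by simp
  have "sin (theta n) \<le> theta n" using \<theta>(1) by (intro sin_x_le_x) simp
  then have lt: "sin (theta n) < j0 / (real n + 1 / 2)" using \<theta>(2) by linarith
  have "2 * pi / j0 * (real n + 1 / 2) = 2 * pi / (j0 / (real n + 1 / 2))" by simp
  also have "\<dots> < 2 * pi / sin (theta n)"
    using s less_trans[OF s lt] by (intro divide_strict_left_mono lt mult_pos_pos) simp_all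
  finally have "ennreal (2 * pi / j0 * (real n + 1 / 2)) < ennreal (2 * pi / sin (theta n))"
    using s by (intro ennreal_lessI) auto
  then show ?thesis using ge by (rule less_le_trans)
qed

section \<open>The sectorial harmonic\<close>

text \<open>\<open>\<omega> i\<close> is the derivative of the complex coordinate
  \<open>Complex (x $ 1) (x $ 2)\<close> along axis \<open>i\<close>. The factor
  \<open>\<kappa>\<close> allows a second application to the derivative that the first one
  yields.\<close>

lemma DERIV_Re_power:
  fixes x :: "real ^ 3" and \<kappa> :: complex
  defines "\<omega> \<equiv> (\<lambda>i :: 3. Complex (axis i 1 $ (1 :: 3)) (axis i 1 $ (2 :: 3)))"
  shows "((\<lambda>t. Re (\<kappa> * Complex ((x + t *\<^sub>R axis i 1) $ 1) ((x + t *\<^sub>R axis i 1) $ 2) ^ m)) has_real_derivative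
    Re (\<kappa> * \<omega> i * of_nat m * Complex (x $ 1) (x $ 2) ^ (m - 1))) (at 0)"
proof -
  define z where "z = Complex (x $ 1) (x $ 2)"
  have eq: "Complex ((x + t *\<^sub>R axis i 1) $ 1) ((x + t *\<^sub>R axis i 1) $ 2) = z + of_real t * \<omega> i" for t
    by (simp add: z_def \<omega>_def complex_eq_iff)
  have "((\<lambda>w. \<kappa> * (z + w * \<omega> i) ^ m) has_field_derivative \<kappa> * \<omega> i * of_nat m * z ^ (m - 1)) (at (of_real 0))"
    by (auto intro!: derivative_eq_intros)
  from has_vector_derivative_real_field[OF this]
  have "((\<lambda>t. \<kappa> * (z + of_real t * \<omega> i) ^ m) has_vector_derivative \<kappa> * \<omega> i * of_nat m * z ^ (m - 1)) (at 0)" .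
  from bounded_linear.has_vector_derivative[OF bounded_linear_Re this]
  show ?thesis unfolding eq z_def by (simp add: has_real_derivative_iff_has_vector_derivative)
qed

lemma hompoly_Re_Im_power:
  "hompoly n (\<lambda>x. Re (Complex (x $ 1) (x $ 2) ^ n)) \<and> hompoly n (\<lambda>x. Im (Complex (x $ 1) (x $ 2) ^ n))"
proof (induction n)
  case 0
  then show ?case using hompoly_1 hompoly_zero by simp
next
  case (Suc n)
  have c: "hompoly (Suc n) (\<lambda>x. x $ i * V x)" if "hompoly n V" for V and i :: 3
    using hompoly_inner_mult[OF that, of "axis i 1"] by (simp add: inner_axis')
  have m: "hompoly (Suc n) (\<lambda>x. x $ 1 * V x + (- 1) * (x $ 2 * V' x))" if "hompoly n V" "hompoly n V'" for V V'
    by (intro hompoly_add hompoly_cmul c that)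
  show ?case using m[of "\<lambda>x. Re (Complex (x $ 1) (x $ 2) ^ n)" "\<lambda>x. Im (Complex (x $ 1) (x $ 2) ^ n)"]
      hompoly_add[OF c c, of "\<lambda>x. Im (Complex (x $ 1) (x $ 2) ^ n)" "\<lambda>x. Re (Complex (x $ 1) (x $ 2) ^ n)" 1 2] Suc
    by simp
qed

lemma psi_harmonic: "psi n \<in> harmonic_space n"
proof -
  define \<omega> where "\<omega> = (\<lambda>i :: 3. Complex (axis i 1 $ (1 :: 3)) (axis i 1 $ (2 :: 3)))"
  define D where "D = (\<lambda>i (x :: real ^ 3). Re (\<omega> i * of_nat n * Complex (x $ 1) (x $ 2) ^ (n - 1)))"
  define D2 where "D2 = (\<lambda>i (x :: real ^ 3). Re (\<omega> i * of_nat n * \<omega> i * of_nat (n - 1) * Complex (x $ 1) (x $ 2) ^ (n - 1 - 1)))"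
  have psi: "psi n = (\<lambda>x. of_real (Re (Complex (x $ 1) (x $ 2) ^ n)))" by (rule ext) (simp add: psi_def)
  have "laplacian (psi n) x = of_real (\<Sum>i\<in>UNIV. D2 i x)" for x
    unfolding psi
  proof (rule laplacian_of_real[where D = D])
    show "((\<lambda>t. Re (Complex ((x + t *\<^sub>R axis i 1) $ 1) ((x + t *\<^sub>R axis i 1) $ 2) ^ n)) has_real_derivative D i x) (at 0)" for i x
      using DERIV_Re_power[of 1 x i n] by (simp add: D_def \<omega>_def)
    show "((\<lambda>t. D i (x + t *\<^sub>R axis i 1)) has_real_derivative D2 i x) (at 0)" for i x
      unfolding D_def D2_def \<omega>_def by (rule DERIV_Re_power)
  qed
  moreover have "(\<Sum>i\<in>UNIV. D2 i x) = 0" for x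
  proof -
    \<comment> \<open>The squares add up to 1 - 1 + 0: real parts of holomorphic functions are
      harmonic.\<close>
    have "\<omega> 1 = 1" "\<omega> 2 = \<i>" "\<omega> 3 = 0" by (simp_all add: \<omega>_def axis_def complex_eq_iff)
    then show ?thesis by (simp add: sum_3 D2_def)
  qed
  moreover have "homogeneous_polynomial n (psi n)"
    unfolding psi using hompoly_Re_Im_power by (intro hompoly_imp_homogeneous_polynomial) blast
  ultimately show ?thesis by (simp add: harmonic_space_def)
qed

lemma psi_real: "real_valued (psi n)"
  by (simp add: real_valued_def psi_def)

lemma psi_nonzero: "psi n (axis 1 1) = 1"
proof -
  have "Complex 1 0 = 1" by (simp add: complex_eq_iff)
  then show ?thesis by (simp add: psi_def axis_def)
qed

text \<open>\<open>psi\<close> vanishes on 2 n half meridians, at the angles \<open>\<phi> k\<close>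
  where cos (n \<phi>) = 0. A great circle that avoids the poles, as expressed by
  \<open>a $ 3 \<noteq> 0\<close>, meets each of them; \<open>v k\<close> is the vector over the
  angle \<open>\<phi> k\<close> that is orthogonal to a, before normalisation.\<close>

lemma psi_great_circle_zeros:
  fixes a :: "real ^ 3"
  assumes n: "n \<ge> 1" and a: "a $ 3 \<noteq> 0"
  shows "\<exists>X. finite X \<and> card X = 2 * n \<and> (\<forall>x\<in>X. norm x = 1 \<and> psi n x = 0 \<and> a \<bullet> x = 0)"
proof -
  define \<phi> where "\<phi> = (\<lambda>k. (2 * real k + 1) * pi / (2 * real n))"
  define v where "v = (\<lambda>k. vector [cos (\<phi> k), sin (\<phi> k), - (a $ 1 * cos (\<phi> k) + a $ 2 * sin (\<phi> k)) / a $ 3] :: real ^ 3)"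
  define g where "g = (\<lambda>k. v k /\<^sub>R norm (v k))"
  have v3: "v k $ 1 = cos (\<phi> k)" "v k $ 2 = sin (\<phi> k)" "v k $ 3 = - (a $ 1 * cos (\<phi> k) + a $ 2 * sin (\<phi> k)) / a $ 3" for k
    by (simp_all add: v_def)
  have v0: "v k \<noteq> 0" for k
  proof
    assume "v k = 0"
    then have "cos (\<phi> k) = 0" "sin (\<phi> k) = 0" using v3[of k] by auto
    then show False using sin_cos_squared_add[of "\<phi> k"] by simp
  qed
  have av: "a \<bullet> v k = 0" for k using a by (simp add: inner_vec_def sum_3 v3)
  have psig: "psi n (g k) = 0" for k
  proof -
    define r where "r = inverse (norm (v k))"
    have "Complex (g k $ 1) (g k $ 2) = of_real r * cis (\<phi> k)"
      by (simp add: g_def v3 complex_eq_iff r_def[symmetric])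
    then have "Re (Complex (g k $ 1) (g k $ 2) ^ n) = r ^ n * cos (real n * \<phi> k)"
      by (simp add: power_mult_distrib Complex.DeMoivre flip: of_real_power)
    also have "real n * \<phi> k = real k * pi + pi / 2" using n by (simp add: \<phi>_def field_simps)
    also have "cos (real k * pi + pi / 2) = 0" by (simp add: cos_add)
    finally show ?thesis by (simp add: psi_def)
  qed
  have inj: "inj_on g {..<2 * n}"
  proof (rule inj_onI)
    fix j k assume jk: "j \<in> {..<2 * n}" "k \<in> {..<2 * n}" "g j = g k"
    have sq: "(g k $ 1)\<^sup>2 + (g k $ 2)\<^sup>2 = (inverse (norm (v k)))\<^sup>2" for k
    proof -
      have "(g k $ 1)\<^sup>2 + (g k $ 2)\<^sup>2 = (inverse (norm (v k)))\<^sup>2 * ((cos (\<phi> k))\<^sup>2 + (sin (\<phi> k))\<^sup>2)"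
        by (simp only: g_def vector_scaleR_component v3 real_scaleR_def power_mult_distrib distrib_left)
      then show ?thesis by simp
    qed
    have "(inverse (norm (v j)))\<^sup>2 = (inverse (norm (v k)))\<^sup>2" using sq[of j] sq[of k] jk(3) by simp
    then have "inverse (norm (v j)) = inverse (norm (v k))" by (rule power2_eq_imp_eq) simp_all
    moreover have "inverse (norm (v k)) \<noteq> 0" using v0 by simp
    moreover have "g j $ 1 = g k $ 1" "g j $ 2 = g k $ 2" using jk(3) by simp_all
    ultimately have "cos (\<phi> j) = cos (\<phi> k)" "sin (\<phi> j) = sin (\<phi> k)" by (simp_all add: g_def v3)
    then have "cis (2 * (\<phi> j / 2)) = cis (2 * (\<phi> k / 2))" by (simp add: complex_eq_iff)
    moreover have "\<bar>\<phi> j / 2 - \<phi> k / 2\<bar> < pi"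
    proof -
      have "\<phi> j / 2 - \<phi> k / 2 = (real j - real k) * (pi / (2 * real n))" using n by (simp add: \<phi>_def field_simps)
      moreover have "\<bar>real j - real k\<bar> < 2 * real n" using jk by auto
      then have "\<bar>real j - real k\<bar> * (pi / (2 * real n)) < 2 * real n * (pi / (2 * real n))"
        using n by (intro mult_strict_right_mono) auto
      ultimately show ?thesis using n by (simp add: abs_mult)
    qed
    ultimately have "\<phi> j / 2 = \<phi> k / 2" by (rule cis_double_eq_imp_eq)
    then show "j = k" using n by (simp add: \<phi>_def)
  qed
  have "norm (g k) = 1" "a \<bullet> g k = 0" for k using v0[of k] av[of k] by (simp_all add: g_def)
  then show ?thesis using inj psig by (intro exI[of _ "g ` {..<2 * n}"]) (auto simp: card_image)
qed

section \<open>Zonal harmonics\<close>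

text \<open>The coefficients c_k for which the sum of c_k \<rho>^k z^(n - 2 k) is harmonic, with
  value 1 at the pole.\<close>

fun zonal_coeff :: "nat \<Rightarrow> nat \<Rightarrow> real" where
  "zonal_coeff n 0 = 1"
| "zonal_coeff n (Suc k) = - (real (n - 2 * k) * (real (n - 2 * k) - 1) * zonal_coeff n k) / (4 * (real k + 1)\<^sup>2)"

lemma zonal_coeff_rec:
  "4 * (real k + 1)\<^sup>2 * zonal_coeff n (Suc k) = - (real (n - 2 * k) * (real (n - 2 * k) - 1) * zonal_coeff n k)"
proof -
  have "4 * (real k + 1)\<^sup>2 \<noteq> 0" by (simp add: add_eq_0_iff)
  then show ?thesis by simp
qed

definition zonal_poly :: "nat \<Rightarrow> real ^ 3 \<Rightarrow> real" where
  "zonal_poly n x = (\<Sum>k\<le>n div 2. zonal_coeff n k * (((x $ 1)\<^sup>2 + (x $ 2)\<^sup>2) ^ k * x $ 3 ^ (n - 2 * k)))"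

lemma hompoly_zonal_poly: "hompoly n (zonal_poly n)"
proof -
  have c: "hompoly (Suc n) (\<lambda>x. x $ i * V x)" if "hompoly n V" for V n and i :: 3
    using hompoly_inner_mult[OF that, of "axis i 1"] by (simp add: inner_axis')
  have "hompoly (2 * k + m) (\<lambda>x. ((x $ 1)\<^sup>2 + (x $ 2)\<^sup>2) ^ k * x $ 3 ^ m)" for k m
  proof (induction k)
    case 0
    show ?case using hompoly_monomial[of 0 0 m m] by simp
  next
    case (Suc k)
    have "hompoly (Suc (Suc (2 * k + m))) (\<lambda>x. x $ 1 * (x $ 1 * (((x $ 1)\<^sup>2 + (x $ 2)\<^sup>2) ^ k * x $ 3 ^ m)) +
        x $ 2 * (x $ 2 * (((x $ 1)\<^sup>2 + (x $ 2)\<^sup>2) ^ k * x $ 3 ^ m)))"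
      by (intro hompoly_add c Suc)
    then show ?case by (simp add: power2_eq_square algebra_simps)
  qed
  note h = this
  have "hompoly n (\<lambda>x. ((x $ 1)\<^sup>2 + (x $ 2)\<^sup>2) ^ k * x $ 3 ^ (n - 2 * k))" if "k \<le> n div 2" for k
  proof -
    have "2 * k + (n - 2 * k) = n" using that by linarith
    then show ?thesis using h[of k "n - 2 * k"] by simp
  qed
  then show ?thesis unfolding zonal_poly_def[abs_def] by (intro hompoly_sum hompoly_cmul) auto
qed

text \<open>The telescoping used for Legendre's equation, now with the Laplacian of \<rho>^k z^m on
  all of space. Axes 1 and 2 share one formula for the derivatives; the combination x_1^2 + x_2^2 =
  \<rho> appears only in their sum.\<close>

lemma zonal_poly_harmonic: "(\<lambda>x. of_real (zonal_poly n x)) \<in> harmonic_space n"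
proof -
  define \<rho> where "\<rho> = (\<lambda>x :: real ^ 3. (x $ 1)\<^sup>2 + (x $ 2)\<^sup>2)"
  have zp: "zonal_poly n x = (\<Sum>k\<le>n div 2. zonal_coeff n k * (\<rho> x ^ k * x $ 3 ^ (n - 2 * k)))" for x
    by (simp add: zonal_poly_def \<rho>_def)
  define D where "D = (\<lambda>(i :: 3) x. if i = 3 then \<Sum>k\<le>n div 2. zonal_coeff n k * (\<rho> x ^ k * (real (n - 2 * k) * x $ 3 ^ (n - 2 * k - 1)))
      else \<Sum>k\<le>n div 2. zonal_coeff n k * ((real k * \<rho> x ^ (k - 1) * (2 * x $ i)) * x $ 3 ^ (n - 2 * k)))"
  define D2 where "D2 = (\<lambda>(i :: 3) x. if i = 3 then \<Sum>k\<le>n div 2. zonal_coeff n k * (\<rho> x ^ k * (real (n - 2 * k) * (real (n - 2 * k - 1) * x $ 3 ^ (n - 2 * k - 1 - 1))))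
      else \<Sum>k\<le>n div 2. zonal_coeff n k * ((real k * (real (k - 1) * \<rho> x ^ (k - 1 - 1) * (2 * x $ i)) * (2 * x $ i) + real k * \<rho> x ^ (k - 1) * 2) * x $ 3 ^ (n - 2 * k)))"
  have xi: "((\<lambda>t. (x + t *\<^sub>R axis i 1) $ j) has_real_derivative (if i = j then 1 else 0)) (at 0)" for x :: "real ^ 3" and i j
    by (auto simp: axis_def intro!: derivative_eq_intros)
  have d\<rho>: "((\<lambda>t. \<rho> (x + t *\<^sub>R axis i 1)) has_real_derivative (if i = 3 then 0 else 2 * x $ i)) (at 0)" for x i
  proof -
    have "((\<lambda>t. \<rho> (x + t *\<^sub>R axis i 1)) has_real_derivative
        real 2 * ((x + 0 *\<^sub>R axis i 1) $ 1) ^ (2 - 1) * (if i = 1 then 1 else 0) + real 2 * ((x + 0 *\<^sub>R axis i 1) $ 2) ^ (2 - 1) * (if i = 2 then 1 else 0)) (at 0)"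
      unfolding \<rho>_def by (rule DERIV_cong[OF DERIV_add[OF DERIV_power[OF xi] DERIV_power[OF xi]]]) simp
    then show ?thesis using exhaust_3[of i] by (auto elim!: DERIV_cong)
  qed
  have dpow: "((\<lambda>t. \<rho> (x + t *\<^sub>R axis i 1) ^ k) has_real_derivative real k * \<rho> x ^ (k - 1) * (if i = 3 then 0 else 2 * x $ i)) (at 0)" for x i k
    by (rule DERIV_cong[OF DERIV_power[OF d\<rho>]]) simp
  have d3: "((\<lambda>t. (x + t *\<^sub>R axis i 1) $ 3 ^ m) has_real_derivative real m * x $ 3 ^ (m - 1) * (if i = 3 then 1 else 0)) (at 0)" for x :: "real ^ 3" and i m
    by (rule DERIV_cong[OF DERIV_power[OF xi]]) simp
  have "laplacian (\<lambda>x. of_real (zonal_poly n x)) x = of_real (\<Sum>i\<in>UNIV. D2 i x)" for x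
  proof (rule laplacian_of_real[where D = D])
    fix i :: 3 and x :: "real ^ 3"
    have "((\<lambda>t. zonal_poly n (x + t *\<^sub>R axis i 1)) has_real_derivative
      (\<Sum>k\<le>n div 2. zonal_coeff n k * (real k * \<rho> x ^ (k - 1) * (if i = 3 then 0 else 2 * x $ i) * (x + 0 *\<^sub>R axis i 1) $ 3 ^ (n - 2 * k) +
        real (n - 2 * k) * x $ 3 ^ (n - 2 * k - 1) * (if i = 3 then 1 else 0) * \<rho> (x + 0 *\<^sub>R axis i 1) ^ k))) (at 0)"
      unfolding zp
      by (intro DERIV_sum DERIV_cmult DERIV_mult dpow d3)
    then show "((\<lambda>t. zonal_poly n (x + t *\<^sub>R axis i 1)) has_real_derivative D i x) (at 0)"
      by (rule DERIV_cong) (auto simp: D_def mult_ac)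
    show "((\<lambda>t. D i (x + t *\<^sub>R axis i 1)) has_real_derivative D2 i x) (at 0)"
    proof (cases "i = 3")
      case True
      have "((\<lambda>t. \<Sum>k\<le>n div 2. zonal_coeff n k * (\<rho> (x + t *\<^sub>R axis i 1) ^ k * (real (n - 2 * k) * (x + t *\<^sub>R axis i 1) $ 3 ^ (n - 2 * k - 1)))) has_real_derivative
        (\<Sum>k\<le>n div 2. zonal_coeff n k * (real k * \<rho> x ^ (k - 1) * (if i = 3 then 0 else 2 * x $ i) * (real (n - 2 * k) * (x + 0 *\<^sub>R axis i 1) $ 3 ^ (n - 2 * k - 1)) +
          real (n - 2 * k) * (real (n - 2 * k - 1) * x $ 3 ^ (n - 2 * k - 1 - 1) * (if i = 3 then 1 else 0)) * \<rho> (x + 0 *\<^sub>R axis i 1) ^ k))) (at 0)"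
        by (intro DERIV_sum DERIV_cmult DERIV_mult dpow d3)
      then have "((\<lambda>t. D i (x + t *\<^sub>R axis i 1)) has_real_derivative (\<Sum>k\<le>n div 2. zonal_coeff n k * (real k * \<rho> x ^ (k - 1) * (if i = 3 then 0 else 2 * x $ i) * (real (n - 2 * k) * (x + 0 *\<^sub>R axis i 1) $ 3 ^ (n - 2 * k - 1)) +
          real (n - 2 * k) * (real (n - 2 * k - 1) * x $ 3 ^ (n - 2 * k - 1 - 1) * (if i = 3 then 1 else 0)) * \<rho> (x + 0 *\<^sub>R axis i 1) ^ k))) (at 0)"
        using True by (simp only: D_def if_True simp_thms)
      then show ?thesis by (rule DERIV_cong) (simp add: True D2_def mult_ac)
    next
      case False
      have "((\<lambda>t. \<Sum>k\<le>n div 2. zonal_coeff n k * ((real k * \<rho> (x + t *\<^sub>R axis i 1) ^ (k - 1) * (2 * (x + t *\<^sub>R axis i 1) $ i)) * (x + t *\<^sub>R axis i 1) $ 3 ^ (n - 2 * k))) has_real_derivative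
        (\<Sum>k\<le>n div 2. zonal_coeff n k * ((real k * (real (k - 1) * \<rho> x ^ (k - 1 - 1) * (if i = 3 then 0 else 2 * x $ i)) * (2 * (x + 0 *\<^sub>R axis i 1) $ i) +
            2 * (if i = i then 1 else 0) * (real k * \<rho> (x + 0 *\<^sub>R axis i 1) ^ (k - 1))) * (x + 0 *\<^sub>R axis i 1) $ 3 ^ (n - 2 * k) +
          real (n - 2 * k) * x $ 3 ^ (n - 2 * k - 1) * (if i = 3 then 1 else 0) * (real k * \<rho> (x + 0 *\<^sub>R axis i 1) ^ (k - 1) * (2 * (x + 0 *\<^sub>R axis i 1) $ i))))) (at 0)"
        by (intro DERIV_sum DERIV_cmult DERIV_mult dpow d3 xi)
      then have "((\<lambda>t. D i (x + t *\<^sub>R axis i 1)) has_real_derivative (\<Sum>k\<le>n div 2. zonal_coeff n k * ((real k * (real (k - 1) * \<rho> x ^ (k - 1 - 1) * (if i = 3 then 0 else 2 * x $ i)) * (2 * (x + 0 *\<^sub>R axis i 1) $ i) +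
            2 * (if i = i then 1 else 0) * (real k * \<rho> (x + 0 *\<^sub>R axis i 1) ^ (k - 1))) * (x + 0 *\<^sub>R axis i 1) $ 3 ^ (n - 2 * k) +
          real (n - 2 * k) * x $ 3 ^ (n - 2 * k - 1) * (if i = 3 then 1 else 0) * (real k * \<rho> (x + 0 *\<^sub>R axis i 1) ^ (k - 1) * (2 * (x + 0 *\<^sub>R axis i 1) $ i))))) (at 0)"
        using False by (simp only: D_def if_False)
      then show ?thesis by (rule DERIV_cong) (simp add: False D2_def mult_ac)
    qed
  qed
  moreover have "(\<Sum>i\<in>UNIV. D2 i x) = 0" for x
  proof -
    define g where "g = (\<lambda>k m. \<rho> x ^ k * x $ 3 ^ m)"
    have "(\<Sum>i\<in>UNIV. D2 i x) = (\<Sum>k\<le>n div 2. zonal_coeff n k *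
       (4 * (real k)\<^sup>2 * g (k - 1) (n - 2 * k) + real (n - 2 * k) * (real (n - 2 * k) - 1) * g k (n - 2 * k - 2)))"
    proof -
      have step: "zonal_coeff n k * ((real k * (real (k - 1) * \<rho> x ^ (k - 1 - 1) * (2 * x $ 1)) * (2 * x $ 1) + real k * \<rho> x ^ (k - 1) * 2) * x $ 3 ^ (n - 2 * k)) +
         zonal_coeff n k * ((real k * (real (k - 1) * \<rho> x ^ (k - 1 - 1) * (2 * x $ 2)) * (2 * x $ 2) + real k * \<rho> x ^ (k - 1) * 2) * x $ 3 ^ (n - 2 * k)) +
         zonal_coeff n k * (\<rho> x ^ k * (real (n - 2 * k) * (real (n - 2 * k - 1) * x $ 3 ^ (n - 2 * k - 1 - 1)))) =
         zonal_coeff n k * (4 * (real k)\<^sup>2 * g (k - 1) (n - 2 * k) + real (n - 2 * k) * (real (n - 2 * k) - 1) * g k (n - 2 * k - 2))" for k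
      proof -
        have a: "real k * (real (k - 1) * \<rho> x ^ (k - 1 - 1) * (2 * x $ 1)) * (2 * x $ 1) + real k * \<rho> x ^ (k - 1) * 2 +
          (real k * (real (k - 1) * \<rho> x ^ (k - 1 - 1) * (2 * x $ 2)) * (2 * x $ 2) + real k * \<rho> x ^ (k - 1) * 2) = 4 * (real k)\<^sup>2 * \<rho> x ^ (k - 1)"
        proof (cases k)
          case (Suc j)
          have "real j * \<rho> x ^ (j - 1) * ((x $ 1)\<^sup>2 + (x $ 2)\<^sup>2) = real j * \<rho> x ^ j"
            by (cases j) (simp_all add: \<rho>_def)
          then have "real j * \<rho> x ^ (j - 1) * (x $ 1)\<^sup>2 + real j * \<rho> x ^ (j - 1) * (x $ 2)\<^sup>2 = real j * \<rho> x ^ j"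
            by (simp only: distrib_left)
          then have "4 * real (Suc j) * (real j * \<rho> x ^ (j - 1) * (x $ 1)\<^sup>2 + real j * \<rho> x ^ (j - 1) * (x $ 2)\<^sup>2) + 4 * real (Suc j) * \<rho> x ^ j =
             4 * real (Suc j) * (real j * \<rho> x ^ j) + 4 * real (Suc j) * \<rho> x ^ j" by simp
          then show ?thesis unfolding Suc by (simp add: power2_eq_square algebra_simps)
        qed simp
        have b: "real (n - 2 * k) * (real (n - 2 * k - 1) * x $ 3 ^ (n - 2 * k - 1 - 1)) = real (n - 2 * k) * (real (n - 2 * k) - 1) * x $ 3 ^ (n - 2 * k - 2)"
          by (cases "n - 2 * k") auto
        show ?thesis unfolding b using arg_cong[OF a, of "\<lambda>u. zonal_coeff n k * (u * x $ 3 ^ (n - 2 * k))"]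
          by (simp add: g_def algebra_simps)
      qed
      have neq: "((1 :: 3) = 3) = False" "((2 :: 3) = 3) = False" by simp_all
      show ?thesis unfolding sum_3 D2_def neq if_False simp_thms if_True sum.distrib[symmetric]
        by (intro sum.cong refl step)
    qed
    also have "\<dots> = 0" by (rule zonal_telescope) (rule zonal_coeff_rec)
    finally show ?thesis .
  qed
  ultimately show ?thesis using hompoly_imp_homogeneous_polynomial[OF hompoly_zonal_poly]
    by (simp add: harmonic_space_def)
qed

text \<open>Zonal harmonics are described by their values on the sphere; existence ensures that the
  statement about them is not void.\<close>

lemma zonal_harmonic_exists: "\<exists>\<phi>. zonal_harmonic n \<phi>"
proof -
  have "zonal_poly n x = 1 * poly (legendre n) (axis 3 1 \<bullet> x)" if x: "x \<in> sphere 0 1" for x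
  proof -
    have "(x $ 1)\<^sup>2 + (x $ 2)\<^sup>2 + (x $ 3)\<^sup>2 = (norm x)\<^sup>2"
      unfolding power2_norm_eq_inner by (simp add: inner_vec_def sum_3 power2_eq_square)
    then have "(x $ 1)\<^sup>2 + (x $ 2)\<^sup>2 = 1 - (x $ 3)\<^sup>2" using x by simp
    then have "zonal_poly n x = (\<Sum>k\<le>n div 2. zonal_coeff n k * (1 - (x $ 3)\<^sup>2) ^ k * x $ 3 ^ (n - 2 * k))"
      by (simp add: zonal_poly_def mult.assoc)
    also have "\<dots> = zonal_coeff n 0 * poly (legendre n) (x $ 3)"
      by (rule zonal_sum_eq_legendre) (rule zonal_coeff_rec)
    finally show ?thesis by (simp add: inner_axis')
  qed
  then have "zonal_harmonic n (\<lambda>x. of_real (zonal_poly n x))"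
    unfolding zonal_harmonic_def using zonal_poly_harmonic
    by (intro conjI bexI[of _ "axis 3 1"] exI[of _ 1]) auto
  then show ?thesis by blast
qed

lemma homogeneous_polynomial_homogeneous:
  assumes "homogeneous_polynomial n u"
  shows "u (t *\<^sub>R x) = of_real (t ^ n) * u x"
proof -
  obtain c where c: "\<forall>x. u x = (\<Sum>i\<le>n. \<Sum>j\<le>n - i. c i j * of_real (x $ 1 ^ i * x $ 2 ^ j * x $ 3 ^ (n - i - j)))"
    using assms unfolding homogeneous_polynomial_def by blast
  have "c i j * of_real ((t *\<^sub>R x) $ 1 ^ i * (t *\<^sub>R x) $ 2 ^ j * (t *\<^sub>R x) $ 3 ^ (n - i - j)) =
     of_real (t ^ n) * (c i j * of_real (x $ 1 ^ i * x $ 2 ^ j * x $ 3 ^ (n - i - j)))" if "i \<le> n" "j \<le> n - i" for i j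
  proof -
    have "t ^ n = t ^ i * t ^ j * t ^ (n - i - j)" using that by (simp flip: power_add)
    then have "(t *\<^sub>R x) $ 1 ^ i * (t *\<^sub>R x) $ 2 ^ j * (t *\<^sub>R x) $ 3 ^ (n - i - j) = t ^ n * (x $ 1 ^ i * x $ 2 ^ j * x $ 3 ^ (n - i - j))"
      by (simp add: power_mult_distrib)
    then show ?thesis by (simp only: of_real_mult) (simp only: mult_ac)
  qed
  then show ?thesis unfolding c[rule_format] sum_distrib_left by (intro sum.cong refl) auto
qed

text \<open>The values are given on the sphere, and homogeneity carries them to other points; at the
  origin n \<ge> 1 gives the value 0. At the pole a the value is c, because P_n(1) = 1.\<close>

lemma zonal_harmonic_real:
  assumes z: "zonal_harmonic n \<phi>" and n: "n \<ge> 1"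
  shows "real_valued \<phi>" "\<phi> \<noteq> (\<lambda>_. 0)"
proof -
  obtain a c where a: "a \<in> sphere 0 1" "c \<noteq> 0"
    "\<forall>x\<in>sphere 0 1. \<phi> x = of_real (c * poly (legendre n) (a \<bullet> x))"
    using z unfolding zonal_harmonic_def by blast
  have h: "homogeneous_polynomial n \<phi>" using z by (simp add: zonal_harmonic_def harmonic_space_def)
  show "real_valued \<phi>" unfolding real_valued_def
  proof
    fix x
    show "\<phi> x \<in> \<real>"
    proof (cases "x = 0")
      case True
      then show ?thesis using homogeneous_polynomial_homogeneous[OF h, of 0 0] n by (simp add: power_0_left)
    next
      case False
      then have "\<phi> x = of_real (norm x ^ n) * \<phi> (x /\<^sub>R norm x)"
        using homogeneous_polynomial_homogeneous[OF h, of "norm x" "x /\<^sub>R norm x"] by simp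
      moreover have "x /\<^sub>R norm x \<in> sphere 0 1" using False by simp
      ultimately show ?thesis using a(3) by (metis Reals_mult Reals_of_real)
    qed
  qed
  have "\<phi> a = of_real c" using a by (simp add: dot_square_norm legendre_1)
  then show "\<phi> \<noteq> (\<lambda>_. 0)" using a(2) by auto
qed

lemma nodal_set_of_real: "nodal_set (\<lambda>x. of_real (U x)) = nodal U"
  by (simp add: nodal_set_def nodal_def)

lemma harmonic_space_nonzero:
  assumes "u \<in> harmonic_space n" "real_valued u" "u \<noteq> (\<lambda>_. 0)"
  obtains U x0 where "harmonic_poly n U" "u = (\<lambda>x. of_real (U x))" "U x0 \<noteq> 0"
proof -
  obtain U where U: "harmonic_poly n U" "u = (\<lambda>x. of_real (U x))" using harmonic_space_real[OF assms(1,2)] by blast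
  have "\<exists>x0. U x0 \<noteq> 0"
  proof (rule ccontr)
    assume "\<nexists>x0. U x0 \<noteq> 0"
    then have "u = (\<lambda>_. 0)" using U(2) by simp
    then show False using assms(3) by simp
  qed
  then show ?thesis using that[OF U] by blast
qed

theorem theorem5:
  fixes n :: nat
  assumes "n \<ge> 1"
  shows "(\<forall>u \<in> harmonic_space n. real_valued u \<and> u \<noteq> (\<lambda>_. 0) \<longrightarrow>
            ennreal (2 * pi / j0 * (real n + 1 / 2)) < hausdorff1 (nodal_set u) \<and>
            hausdorff1 (nodal_set u) \<le> ennreal (2 * pi * real n) \<and>
            arcsin (1 / real n) \<le> inner_radius (nodal_set u) \<and>
            inner_radius (nodal_set u) \<le> theta n)
       \<and> theta n < j0 / (real n + 1 / 2)
       \<and> (psi n \<in> harmonic_space n \<and> real_valued (psi n) \<and> psi n \<noteq> (\<lambda>_. 0) \<and>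
            hausdorff1 (nodal_set (psi n)) = ennreal (2 * pi * real n))
       \<and> (\<exists>\<phi>. zonal_harmonic n \<phi>)
       \<and> (\<forall>\<phi>. zonal_harmonic n \<phi> \<longrightarrow>
            real_valued \<phi> \<and> \<phi> \<noteq> (\<lambda>_. 0) \<and> inner_radius (nodal_set \<phi>) = theta n)"
proof -
  have bounds: "ennreal (2 * pi / j0 * (real n + 1 / 2)) < hausdorff1 (nodal_set u) \<and>
            hausdorff1 (nodal_set u) \<le> ennreal (2 * pi * real n) \<and>
            arcsin (1 / real n) \<le> inner_radius (nodal_set u) \<and>
            inner_radius (nodal_set u) \<le> theta n"
    if u: "u \<in> harmonic_space n" "real_valued u" "u \<noteq> (\<lambda>_. 0)" for u
  proof -
    obtain U x0 where U: "harmonic_poly n U" "u = (\<lambda>x. of_real (U x))" "U x0 \<noteq> 0"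
      using harmonic_space_nonzero[OF u] by blast
    show ?thesis unfolding U(2) nodal_set_of_real
      using hausdorff1_nodal_gt[OF U(1,3) assms] hausdorff1_nodal_le[OF U(1,3) assms]
        inner_radius_nodal_bounds[OF U(1,3) assms] by blast
  qed
  have psi0: "psi n \<noteq> (\<lambda>_. 0)"
  proof
    assume "psi n = (\<lambda>_. 0)"
    then show False using psi_nonzero[of n] by simp
  qed
  have psi_length: "hausdorff1 (nodal_set (psi n)) = ennreal (2 * pi * real n)"
  proof (rule antisym)
    show "hausdorff1 (nodal_set (psi n)) \<le> ennreal (2 * pi * real n)"
      using bounds[OF psi_harmonic psi_real psi0] by blast
    obtain U x0 where U: "harmonic_poly n U" "psi n = (\<lambda>x. of_real (U x))" "U x0 \<noteq> 0"
      using harmonic_space_nonzero[OF psi_harmonic psi_real psi0] by blast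
    \<comment> \<open>Great circles, c = 0, with 2 n intersections for almost every centre: the
      lower estimate 2 n pi meets the upper bound.\<close>
    have "ennreal (real (2 * n) * pi / sqrt (1 - 0\<^sup>2)) \<le> hausdorff1 (nodal U)"
    proof (rule hausdorff1_nodal_ge[OF U(1,3)])
      have "AE a in lborel. a \<notin> {a :: real ^ 3. a \<bullet> axis 3 1 = 0}"
        by (intro AE_not_in hyperplane_null) (simp add: axis_eq_0_iff)
      then show "AE a in lborel. a \<in> ball 0 1 \<longrightarrow>
        (\<exists>X. finite X \<and> card X = 2 * n \<and> (\<forall>x\<in>X. norm x = 1 \<and> U x = 0 \<and> a \<bullet> x = 0 * norm a))"
      proof eventually_elim
        case (elim a)
        then have "a $ 3 \<noteq> 0" by (simp add: inner_axis)
        from psi_great_circle_zeros[OF assms this] show ?case unfolding U(2) by simp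
      qed
    qed simp
    then show "ennreal (2 * pi * real n) \<le> hausdorff1 (nodal_set (psi n))"
      unfolding U(2) nodal_set_of_real by (simp add: mult_ac)
  qed
  have zonal: "real_valued \<phi> \<and> \<phi> \<noteq> (\<lambda>_. 0) \<and> inner_radius (nodal_set \<phi>) = theta n" if z: "zonal_harmonic n \<phi>" for \<phi>
  proof (intro conjI antisym)
    show rv: "real_valued \<phi>" and nz: "\<phi> \<noteq> (\<lambda>_. 0)" using zonal_harmonic_real[OF z assms] .
    have h: "\<phi> \<in> harmonic_space n" using z by (simp add: zonal_harmonic_def)
    show "inner_radius (nodal_set \<phi>) \<le> theta n" using bounds[OF h rv nz] by blast
    obtain a c where a: "a \<in> sphere 0 1" "c \<noteq> 0"
      "\<forall>x\<in>sphere 0 1. \<phi> x = of_real (c * poly (legendre n) (a \<bullet> x))"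
      using z unfolding zonal_harmonic_def by blast
    note \<theta> = theta_properties[OF assms]
    \<comment> \<open>The infimum over the nodal set is meaningful only if the set is nonempty; its
      length is positive by the lower bound.\<close>
    have ne: "nodal_set \<phi> \<noteq> {}"
    proof
      assume "nodal_set \<phi> = {}"
      then have "hausdorff1 (nodal_set \<phi>) = 0" by (simp add: hausdorff1_empty)
      then show False using bounds[OF h rv nz] by simp
    qed
    \<comment> \<open>Tested at the pole a: no zero of P_n exceeds cos (theta n), so no nodal point
      is closer to a than \<open>theta n\<close>.\<close>
    show "theta n \<le> inner_radius (nodal_set \<phi>)"
    proof (rule inner_radius_ge[OF _ ne, of a])
      show "nodal_set \<phi> \<subseteq> sphere 0 1" by (auto simp: nodal_set_def)
      show "norm a = 1" using a(1) by simp
      fix y assume y: "y \<in> nodal_set \<phi>"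
      then have y1: "y \<in> sphere 0 1" "\<phi> y = 0" by (auto simp: nodal_set_def)
      then have "of_real (c * poly (legendre n) (a \<bullet> y)) = (0 :: complex)" using a(3) by metis
      then have "poly (legendre n) (a \<bullet> y) = 0" using a(2) by simp
      then have "a \<bullet> y \<le> cos (theta n)" by (rule \<theta>(5))
      moreover have "-1 \<le> a \<bullet> y" using sphere_inner_bounds(1)[of a y] a(1) y1(1) by simp
      ultimately have "arccos (cos (theta n)) \<le> arccos (a \<bullet> y)" by (intro arccos_le_arccos) auto
      then show "theta n \<le> sphere_dist a y" using \<theta>(1,3) by (simp add: sphere_dist_def arccos_cos)
    qed
  qed
  show ?thesis
    using bounds by (intro conjI ballI allI impI theta_properties(2)[OF assms] psi_harmonic psi_real psi0
        psi_length zonal_harmonic_exists zonal) blast+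
qed

end
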